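(* Let $0<\rho_1<\rho_2<\infty$, $\Omega=\{x\in\mathbb{R}^2:\rho_1<|x|<\rho_2\}$, and let $u_0(x)=\hat u_0(|x|)$ be radially symmetric boundary data with $m_i:=\hat u_0(\rho_i)\in\mathbb{R}$, $i=1,2$. Let $\mu\in(1,\infty)$ and let $g:[0,\infty)\to[0,\infty)$ be of class $C^2([0,\infty))$ such that: (1) there are constants $a,A>0$ and $b,B\in\mathbb{R}$ with $at-b\le g(t)\le At+B$ for all $t\ge 0$; (2) $g(0)=g'(0)=0$; (3) there are constants $\nu_1,\nu_2>0$ and an exponent $\overline{\mu}\in[1,\mu]$ with $$\nu_1(1+t)^{-\mu}\le g''(t)\le \nu_2(1+t)^{-\overline{\mu}}\quad\text{for all } t\ge 0;$$ (4) $\mu-\overline{\mu}<2$. Then the problem $K[w]\to\min$ in $\mathrm{BV}(\Omega)$ has a unique solution $u$, namely the minimizer of class $W^{1,1}(\Omega)\cap C^0(\overline{\Omega})\cap C^1(\Omega)\cap W^{2,2}_{\mathrm{loc}}(\Omega)$ of the form $u(x)=\hat u(|x|)$. Moreover: (i) The minimizer $u$ respects the boundary data for $|x|=\rho_2$ (that is, $u=m_2$ on $\{|x|=\rho_2\}$), hence it is the solution of the minimizing problem $$\int_\Omega g(|\nabla w|)\,dx+g'_\infty\int_{\{|x|=\rho_1\}}|w-m_1|\,d\mathcal{H}^1\to\min,\qquad w\in W^{1,1}(\Omega),\quad w=m_2\text{ on }\{|x|=\rho_2\}.$$ (ii) Fix $m_2$ and, for $m<m_2$, let $u_m(x)=\hat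 u_m(|x|)$ denote the unique solution of the minimizing problem in (i) with $m_1=m$. Then: (a) For any $m<m_2$ and any $\rho\in(\rho_1,\rho_2)$ it holds that $\hat u_m(\rho)\ge m$. (b) As a function of $m$, the quantity $\hat u_m(\rho_1)$ is non-decreasing, i.e. for $\zeta_1,\zeta_2<m_2$, $$\zeta_1<\zeta_2\ \Rightarrow\ \hat u_{\zeta_1}(\rho_1)\le\hat u_{\zeta_2}(\rho_1).$$
   Context: For $w\in\mathrm{BV}(\Omega)$, $\nabla^a w$ and $\nabla^s w$ denote the absolutely continuous and the singular part of the measure $\nabla w$ with respect to Lebesgue measure. Under the linear growth condition and convexity of $g$ the limit $g'_\infty:=\lim_{t\to\infty}g'(t)=\lim_{t\to\infty}g(t)/t$ exists in $(0,\infty)$. The relaxed functional is $$K[w]:=\int_\Omega g(|\nabla^a w|)\,dx+g'_\infty|\nabla^s w|(\Omega)+g'_\infty\int_{\partial\Omega}|u_0-w|\,d\mathcal{H}^1,\qquad w\in\mathrm{BV}(\Omega),$$ where $u_0=m_i$ on $\{|x|=\rho_i\}$ and $\mathcal{H}^1$ is one-dimensional Hausdorff measure. Boundary values and boundary integrals of $w$ are understood in the sense of traces. Since the solutions are continuous on $\overline{\Omega}$, the values $\hat u_m(\rho_1)$ and $\hat u_m(\rho_2)$ are well defined. *)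

theory Defs
  imports "HOL-Analysis.Analysis"
begin

section \<open>Classical regularity and test functions\<close>

definition partial_deriv :: "'n::finite \<Rightarrow> (real^'n \<Rightarrow> real) \<Rightarrow> real^'n \<Rightarrow> real" where
  "partial_deriv i f x = frechet_derivative f (at x) (axis i 1)"

text \<open>The class $C^1(S)$, meant for open \<open>S\<close>.\<close>

definition C1_on :: "(real^'n::finite) set \<Rightarrow> (real^'n \<Rightarrow> real) \<Rightarrow> bool" where
  "C1_on S f \<longleftrightarrow> (\<forall>x\<in>S. f differentiable (at x)) \<and> (\<forall>i. continuous_on S (partial_deriv i f))"

definition test_function :: "(real^'n::finite) set \<Rightarrow> (real^'n \<Rightarrow> real) \<Rightarrow> bool" where
  "test_function \<Omega> \<phi> \<longleftrightarrow>
     C1_on UNIV \<phi> \<and> (\<exists>C. compact C \<and> C \<subseteq> \<Omega> \<and> (\<forall>x. x \<notin> C \<longrightarrow> \<phi> x = 0))"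


section \<open>Sobolev spaces\<close>

definition L1_loc :: "(real^'n::finite) set \<Rightarrow> (real^'n \<Rightarrow> real) \<Rightarrow> bool" where
  "L1_loc \<Omega> f \<longleftrightarrow> (\<forall>C. compact C \<and> C \<subseteq> \<Omega> \<longrightarrow> f absolutely_integrable_on C)"

definition L2_loc :: "(real^'n::finite) set \<Rightarrow> (real^'n \<Rightarrow> real) \<Rightarrow> bool" where
  "L2_loc \<Omega> f \<longleftrightarrow> f \<in> borel_measurable (lebesgue_on \<Omega>) \<and>
     (\<forall>C. compact C \<and> C \<subseteq> \<Omega> \<longrightarrow> (\<lambda>x. (f x)\<^sup>2) absolutely_integrable_on C)"

definition weak_partial ::
  "(real^'n::finite) set \<Rightarrow> 'n \<Rightarrow> (real^'n \<Rightarrow> real) \<Rightarrow> (real^'n \<Rightarrow> real) \<Rightarrow> bool" where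
  "weak_partial \<Omega> i f h \<longleftrightarrow> L1_loc \<Omega> f \<and> L1_loc \<Omega> h \<and>
     (\<forall>\<phi>. test_function \<Omega> \<phi> \<longrightarrow>
        (LINT x:\<Omega>|lebesgue. f x * partial_deriv i \<phi> x) = - (LINT x:\<Omega>|lebesgue. h x * \<phi> x))"

definition has_weak_gradient ::
  "(real^'n::finite) set \<Rightarrow> (real^'n \<Rightarrow> real) \<Rightarrow> (real^'n \<Rightarrow> real^'n) \<Rightarrow> bool" where
  "has_weak_gradient \<Omega> w G \<longleftrightarrow> (\<forall>i. weak_partial \<Omega> i w (\<lambda>x. G x $ i))"

text \<open>The weak gradient is unique almost everywhere, so the choice is immaterial below an
  integral over \<open>\<Omega>\<close>.\<close>

definition weak_gradient ::
  "(real^'n::finite) set \<Rightarrow> (real^'n \<Rightarrow> real) \<Rightarrow> real^'n \<Rightarrow> real^'n" where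
  "weak_gradient \<Omega> w = (SOME G. has_weak_gradient \<Omega> w G)"

definition W11 :: "(real^'n::finite) set \<Rightarrow> (real^'n \<Rightarrow> real) set" where
  "W11 \<Omega> = {w. w absolutely_integrable_on \<Omega> \<and>
     (\<exists>G. has_weak_gradient \<Omega> w G \<and> G absolutely_integrable_on \<Omega>)}"

definition W22_loc :: "(real^'n::finite) set \<Rightarrow> (real^'n \<Rightarrow> real) set" where
  "W22_loc \<Omega> = {w. L2_loc \<Omega> w \<and>
     (\<exists>G H. (\<forall>i. L2_loc \<Omega> (G i) \<and> weak_partial \<Omega> i w (G i)) \<and>
            (\<forall>i j. L2_loc \<Omega> (H i j) \<and> weak_partial \<Omega> j (G i) (H i j)))}"


section \<open>Functions of bounded variation\<close>

text \<open>An $\mathbb{R}^n$-valued finite Borel measure on \<open>\<Omega>\<close> is encoded by its polar decomposition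
  $\sigma\,\nu$: the positive finite measure \<open>\<nu>\<close> is its total variation measure and
  \<open>\<sigma>\<close> is a unit vector field.\<close>

definition polar_measure ::
  "(real^'n::finite) set \<Rightarrow> (real^'n) measure \<Rightarrow> (real^'n \<Rightarrow> real^'n) \<Rightarrow> bool" where
  "polar_measure \<Omega> \<nu> \<sigma> \<longleftrightarrow> sets \<nu> = sets borel \<and> finite_measure \<nu> \<and> emeasure \<nu> (- \<Omega>) = 0 \<and>
     \<sigma> \<in> borel_measurable borel \<and> (AE x in \<nu>. norm (\<sigma> x) = 1)"

text \<open>$\nabla w = \sigma\,\nu$ in the sense of distributions on \<open>\<Omega>\<close>.\<close>

definition is_gradient_measure ::
  "(real^'n::finite) set \<Rightarrow> (real^'n \<Rightarrow> real) \<Rightarrow> (real^'n) measure \<Rightarrow> (real^'n \<Rightarrow> real^'n) \<Rightarrow> bool" where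
  "is_gradient_measure \<Omega> w \<nu> \<sigma> \<longleftrightarrow> polar_measure \<Omega> \<nu> \<sigma> \<and>
     (\<forall>i \<phi>. test_function \<Omega> \<phi> \<longrightarrow>
        (LINT x:\<Omega>|lebesgue. w x * partial_deriv i \<phi> x) = - (LINT x|\<nu>. \<phi> x * \<sigma> x $ i))"

definition BV :: "(real^'n::finite) set \<Rightarrow> (real^'n \<Rightarrow> real) set" where
  "BV \<Omega> = {w. w absolutely_integrable_on \<Omega> \<and> (\<exists>\<nu> \<sigma>. is_gradient_measure \<Omega> w \<nu> \<sigma>)}"

text \<open>Lebesgue decomposition of the measure $\nabla w$: the absolutely continuous part is
  $\nabla^a w = h\,\mathcal{L}^n$, the singular part is $\nabla^s w = \sigma\,\nu$ with \<open>\<nu>\<close>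
  concentrated on a Lebesgue null set, and $\nabla w = \nabla^a w + \nabla^s w$ (again as
  distributions on \<open>\<Omega>\<close>). This determines \<open>h\<close> almost everywhere in \<open>\<Omega>\<close> and the measure
  \<open>\<nu>\<close> $= |\nabla^s w|$ completely.\<close>

definition gradient_decomposition ::
  "(real^'n::finite) set \<Rightarrow> (real^'n \<Rightarrow> real) \<Rightarrow> (real^'n \<Rightarrow> real^'n) \<Rightarrow>
     (real^'n) measure \<Rightarrow> (real^'n \<Rightarrow> real^'n) \<Rightarrow> bool" where
  "gradient_decomposition \<Omega> w h \<nu> \<sigma> \<longleftrightarrow>
     h absolutely_integrable_on \<Omega> \<and> polar_measure \<Omega> \<nu> \<sigma> \<and>
     (\<exists>N \<in> null_sets lborel. emeasure \<nu> (- N) = 0) \<and>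
     (\<forall>i \<phi>. test_function \<Omega> \<phi> \<longrightarrow>
        (LINT x:\<Omega>|lebesgue. w x * partial_deriv i \<phi> x) =
          - ((LINT x:\<Omega>|lebesgue. \<phi> x * h x $ i) + (LINT x|\<nu>. \<phi> x * \<sigma> x $ i)))"

definition grad_ac :: "(real^'n::finite) set \<Rightarrow> (real^'n \<Rightarrow> real) \<Rightarrow> real^'n \<Rightarrow> real^'n" where
  "grad_ac \<Omega> w = (SOME h. \<exists>\<nu> \<sigma>. gradient_decomposition \<Omega> w h \<nu> \<sigma>)"

definition grad_sing_variation ::
  "(real^'n::finite) set \<Rightarrow> (real^'n \<Rightarrow> real) \<Rightarrow> (real^'n) measure" where
  "grad_sing_variation \<Omega> w = (SOME \<nu>. \<exists>h \<sigma>. gradient_decomposition \<Omega> w h \<nu> \<sigma>)"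


section \<open>One-dimensional Hausdorff measure\<close>

definition hausdorff1_pre :: "real \<Rightarrow> 'a::metric_space set \<Rightarrow> ennreal" where
  "hausdorff1_pre \<delta> A =
     (INF U \<in> {U :: nat \<Rightarrow> 'a set. A \<subseteq> (\<Union>k. U k) \<and> (\<forall>k. bounded (U k) \<and> diameter (U k) \<le> \<delta>)}.
        (\<Sum>k. ennreal (diameter (U k))))"

definition hausdorff1_outer :: "'a::metric_space set \<Rightarrow> ennreal" where
  "hausdorff1_outer A = (SUP \<delta> \<in> {0<..}. hausdorff1_pre \<delta> A)"

text \<open>The outer measure is a metric outer measure and hence countably additive on Borel sets, so
  \<^const>\<open>measure_of\<close> does not fall back to the zero measure here.\<close>

definition hausdorff1 :: "'a::metric_space measure" where
  "hausdorff1 = measure_of UNIV (sets borel) hausdorff1_outer"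


section \<open>Boundary traces\<close>

text \<open>The trace of $w \in BV(\Omega)$ is the $\mathcal{H}^1$-almost everywhere unique
  $T \in L^1(\partial\Omega;\mathcal{H}^1)$ satisfying the Gauss--Green formula
  $\int_\Omega w\,\partial_i\varphi\,dx = -\int_\Omega \varphi\,d\nabla_i w
     + \int_{\partial\Omega} \varphi\,T\,n_i\,d\mathcal{H}^1$
  for all $\varphi \in C^1(\mathbb{R}^2)$, where \<open>n\<close> is the outer unit normal. Since
  $W^{1,1}(\Omega) \subseteq BV(\Omega)$, the same notion serves Sobolev functions.\<close>

definition is_trace ::
  "(real^2) set \<Rightarrow> (real^2 \<Rightarrow> real^2) \<Rightarrow> (real^2 \<Rightarrow> real) \<Rightarrow> (real^2 \<Rightarrow> real) \<Rightarrow> bool" where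
  "is_trace \<Omega> n w T \<longleftrightarrow> set_integrable hausdorff1 (frontier \<Omega>) T \<and>
     (\<exists>\<nu> \<sigma>. is_gradient_measure \<Omega> w \<nu> \<sigma> \<and>
        (\<forall>i \<phi>. C1_on UNIV \<phi> \<longrightarrow>
           (LINT x:\<Omega>|lebesgue. w x * partial_deriv i \<phi> x) =
             - (LINT x|\<nu>. \<phi> x * \<sigma> x $ i)
             + (LINT x:frontier \<Omega>|hausdorff1. \<phi> x * T x * n x $ i)))"

definition trace_on ::
  "(real^2) set \<Rightarrow> (real^2 \<Rightarrow> real^2) \<Rightarrow> (real^2 \<Rightarrow> real) \<Rightarrow> real^2 \<Rightarrow> real" where
  "trace_on \<Omega> n w = (SOME T. is_trace \<Omega> n w T)"


section \<open>The variational problems on an annulus\<close>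

definition annulus :: "real \<Rightarrow> real \<Rightarrow> (real^2) set" where
  "annulus \<rho>\<^sub>1 \<rho>\<^sub>2 = {x. \<rho>\<^sub>1 < norm x \<and> norm x < \<rho>\<^sub>2}"

text \<open>The outer unit normal on the boundary of the annulus (only used there).\<close>

definition annulus_normal :: "real \<Rightarrow> real \<Rightarrow> real^2 \<Rightarrow> real^2" where
  "annulus_normal \<rho>\<^sub>1 \<rho>\<^sub>2 x = (if norm x = \<rho>\<^sub>2 then x /\<^sub>R \<rho>\<^sub>2 else - (x /\<^sub>R \<rho>\<^sub>1))"

abbreviation annulus_trace :: "real \<Rightarrow> real \<Rightarrow> (real^2 \<Rightarrow> real) \<Rightarrow> real^2 \<Rightarrow> real" where
  "annulus_trace \<rho>\<^sub>1 \<rho>\<^sub>2 \<equiv> trace_on (annulus \<rho>\<^sub>1 \<rho>\<^sub>2) (annulus_normal \<rho>\<^sub>1 \<rho>\<^sub>2)"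

text \<open>$g'_\infty$\<close>

definition recession_slope :: "(real \<Rightarrow> real) \<Rightarrow> real" where
  "recession_slope g = Lim at_top (\<lambda>t. g t / t)"

definition relaxed_functional ::
  "real \<Rightarrow> real \<Rightarrow> (real \<Rightarrow> real) \<Rightarrow> (real^2 \<Rightarrow> real) \<Rightarrow> (real^2 \<Rightarrow> real) \<Rightarrow> real" where
  "relaxed_functional \<rho>\<^sub>1 \<rho>\<^sub>2 g u\<^sub>0 w =
     (let \<Omega> = annulus \<rho>\<^sub>1 \<rho>\<^sub>2 in
       (LINT x:\<Omega>|lebesgue. g (norm (grad_ac \<Omega> w x)))
       + recession_slope g * measure (grad_sing_variation \<Omega> w) \<Omega>
       + recession_slope g *
           (LINT x:frontier \<Omega>|hausdorff1. \<bar>u\<^sub>0 x - annulus_trace \<rho>\<^sub>1 \<rho>\<^sub>2 w x\<bar>))"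

definition inner_relaxed_functional ::
  "real \<Rightarrow> real \<Rightarrow> (real \<Rightarrow> real) \<Rightarrow> real \<Rightarrow> (real^2 \<Rightarrow> real) \<Rightarrow> real" where
  "inner_relaxed_functional \<rho>\<^sub>1 \<rho>\<^sub>2 g m w =
     (LINT x:annulus \<rho>\<^sub>1 \<rho>\<^sub>2|lebesgue. g (norm (weak_gradient (annulus \<rho>\<^sub>1 \<rho>\<^sub>2) w x)))
     + recession_slope g *
         (LINT x:{x. norm x = \<rho>\<^sub>1}|hausdorff1. \<bar>annulus_trace \<rho>\<^sub>1 \<rho>\<^sub>2 w x - m\<bar>)"

definition outer_admissible :: "real \<Rightarrow> real \<Rightarrow> real \<Rightarrow> (real^2 \<Rightarrow> real) set" where
  "outer_admissible \<rho>\<^sub>1 \<rho>\<^sub>2 m = {w \<in> W11 (annulus \<rho>\<^sub>1 \<rho>\<^sub>2).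
     AE x in hausdorff1. norm x = \<rho>\<^sub>2 \<longrightarrow> annulus_trace \<rho>\<^sub>1 \<rho>\<^sub>2 w x = m}"

definition is_minimizer :: "('f \<Rightarrow> real) \<Rightarrow> 'f set \<Rightarrow> 'f \<Rightarrow> bool" where
  "is_minimizer F X u \<longleftrightarrow> u \<in> X \<and> (\<forall>w\<in>X. F u \<le> F w)"

text \<open>Uniqueness is that of equivalence classes modulo equality almost everywhere in \<open>\<Omega>\<close>.\<close>

definition is_unique_minimizer ::
  "(real^2) set \<Rightarrow> ((real^2 \<Rightarrow> real) \<Rightarrow> real) \<Rightarrow> (real^2 \<Rightarrow> real) set \<Rightarrow> (real^2 \<Rightarrow> real) \<Rightarrow> bool" where
  "is_unique_minimizer \<Omega> F X u \<longleftrightarrow> is_minimizer F X u \<and>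
     (\<forall>v. is_minimizer F X v \<longrightarrow> (AE x in lebesgue. x \<in> \<Omega> \<longrightarrow> v x = u x))"

end

theory Submission
  imports Defs
begin

text \<open>
  The proof is a calibration argument. For a radial function \<open>u(x) = U(|x|)\<close> the Euler-Lagrange
  equation says that the flux \<open>g'(|\<nabla>u|) \<nabla>u / |\<nabla>u|\<close> is the divergence free field
  \<open>Z(x) = c x / |x|\<^sup>2\<close> for some constant \<open>c\<close>. Let \<open>G\<close> be the odd extension of \<open>g'\<close>. It is
  strictly increasing with range \<open>{- ginf<..<ginf}\<close>, so \<open>U'(r)\<close> has to be the inverse function of
  \<open>G\<close> at \<open>c / r\<close>, called \<open>V c r\<close>. This is defined for all \<open>r > a\<close> exactly when
  \<open>|c| \<le> ginf * a\<close>, where \<open>a < b\<close> are the radii. The profile is normalized by \<open>U b = m\<^sub>2\<close>, and the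
  slope \<open>c\<close> is chosen such that \<open>U a = m\<^sub>1\<close>. If no admissible slope achieves this, then the total
  increase of \<open>U\<close> is too small even for the extreme slope \<open>\<plusminus> ginf * a\<close>, and this one is taken
  (\<open>exists_slope\<close>).

  As \<open>Z\<close> is divergence free, the Gauss-Green formula \<open>\<integral> Z \<bullet> d(\<nabla>w) = \<integral> w (Z \<bullet> n) dH\<^sup>1\<close> holds for
  every \<open>w\<close> of bounded variation, with the second integral over the boundary. Hence \<open>K[w]\<close> is the sum of the
  three integrals of \<open>g |\<nabla>\<^sup>a w| - Z \<bullet> \<nabla>\<^sup>a w\<close>, of \<open>ginf - Z \<bullet> \<sigma>\<close> against \<open>|\<nabla>\<^sup>s w|\<close> and of
  \<open>ginf |u\<^sub>0 - w| + w (Z \<bullet> n)\<close> over the boundary (\<open>energy_calibrated\<close>). Each integrand is minimal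
  at \<open>u\<close> pointwise: the first one because \<open>g\<close> is convex and \<open>Z\<close> is the flux of \<open>u\<close>
  (\<open>integrand_le\<close>), the second one because \<open>|Z| < ginf\<close> inside the annulus, and the third one
  because \<open>|Z| \<le> ginf\<close> on the boundary, where an unattained value \<open>U a \<noteq> m\<^sub>1\<close> occurs only for
  the extreme slope, so that \<open>Z \<bullet> n\<close> compensates the penalty exactly (\<open>boundary_le\<close>). On the outer
  circle \<open>|Z| < ginf\<close>, so there the datum is attained.

  If \<open>w\<close> has the same energy as \<open>u\<close>, then all three integrands agree almost everywhere, which
  means that \<open>\<nabla>w = \<nabla>u\<close>, without singular part, and that \<open>w = m\<^sub>2\<close> on the outer circle. A function
  with vanishing gradient and vanishing trace on the outer circle is zero
  (\<open>AE_zero_of_zero_gradient\<close>), which gives uniqueness. The problem in (i) is the restriction of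
  \<open>K\<close> to the Sobolev functions with value \<open>m\<^sub>2\<close> on the outer circle, and \<open>u\<close> is one of them. Part
  (ii) follows since \<open>V c r\<close> is increasing in \<open>c\<close>, and nonnegative for \<open>c \<ge> 0\<close>.

  Most of the text shows that the functional has the expected meaning. One-dimensional
  Hausdorff measure is arc length on circles (\<open>hausdorff1_circle\<close>). The Lebesgue decomposition of
  the gradient exists and is unique (\<open>gradient_decomposition_exists\<close>,
  \<open>gradient_decomposition_unique\<close>), and so is the trace (\<open>trace_exists\<close>, \<open>trace_unique\<close>). The
  trace is the limit in \<open>L\<^sup>1\<close> of averages over thin layers at the boundary, taken along rays. They form a
  Cauchy sequence because their differences are controlled by the gradient measure of shrinking
  layers, as one sees by testing with fields \<open>\<psi>(x / |x|) \<kappa>(|x|) x / |x|\<^sup>2\<close>, whose divergence is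
  \<open>\<psi>(x / |x|) \<kappa>'(|x|) / |x|\<close>.
\<close>

section \<open>Hausdorff measure on circles\<close>

lemma borel_measurable_vec_nth [measurable (raw)]:
  fixes f :: "'a \<Rightarrow> real^'n::finite"
  assumes "f \<in> borel_measurable M"
  shows "(\<lambda>x. f x $ i) \<in> borel_measurable M"
  by (rule measurable_compose[OF assms]) (intro borel_measurable_continuous_onI continuous_intros)

lemma metric_outer_measure_tail:
  fixes f :: "'a set \<Rightarrow> ennreal"
  assumes fin: "(\<Sum>k. f (D k)) < top" and e: "0 < (e::real)"
  shows "\<exists>n. (\<Sum>k. f (D (k + n))) \<le> ennreal e"
proof -
  let ?S = "\<Sum>k. f (D k)"
  obtain n where n: "?S \<le> (\<Sum>k<n. f (D k)) + ennreal e"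
  proof (cases "?S = 0")
    case True then show ?thesis using that[of 0] by simp
  next
    case False
    have "?S - ennreal e < ?S"
      using False fin e by (intro ennreal_between) (auto simp: zero_less_iff_neq_zero)
    then have "?S - ennreal e < (SUP n. \<Sum>k<n. f (D k))" by (simp add: suminf_eq_SUP)
    then obtain n where "?S - ennreal e < (\<Sum>k<n. f (D k))"
      by (auto simp: less_SUP_iff)
    then have "?S \<le> (\<Sum>k<n. f (D k)) + ennreal e"
      by (metis add.commute ennreal_minus_le_iff order_less_imp_le)
    then show ?thesis by (rule that)
  qed
  have "?S = (\<Sum>k. f (D (k + n))) + (\<Sum>k<n. f (D k))"
    by (rule suminf_offset) (rule summableI)
  with n have "(\<Sum>k<n. f (D k)) + (\<Sum>k. f (D (k + n))) \<le> (\<Sum>k<n. f (D k)) + ennreal e"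
    by (simp add: add.commute)
  moreover have "(\<Sum>k<n. f (D k)) < top"
    by (rule le_less_trans[OF sum_le_suminf[OF summableI] fin]) auto
  ultimately have "(\<Sum>k. f (D (k + n))) \<le> ennreal e"
    unfolding ennreal_add_left_cancel_le by (metis infinity_ennreal_def order_less_irrefl)
  then show ?thesis by blast
qed

text \<open>Caratheodory's criterion. Let \<open>E n\<close> be the part of \<open>A\<close> at distance at least \<open>1 / (n + 1)\<close> from a
  closed set \<open>C\<close>. Additivity on separated sets gives \<open>f (A \<inter> C) + f (E n) \<le> f A\<close>, and it remains to
  see that \<open>f (A - C)\<close> exceeds \<open>f (E n)\<close> by a small amount only. The shells \<open>E (n + 1) - E n\<close>
  are separated from each other if their indices differ by at least two. So the sums over the even and
  over the odd shells are bounded by \<open>f A\<close> each, and the tails of the series of all shells are small.\<close>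

theorem metric_outer_measure_borel:
  fixes f :: "'a::metric_space set \<Rightarrow> ennreal"
  assumes om: "outer_measure_space (Pow UNIV) f"
    and metric: "\<And>A B d. 0 < d \<Longrightarrow> (\<forall>a\<in>A. \<forall>b\<in>B. d \<le> dist a b) \<Longrightarrow> f A + f B \<le> f (A \<union> B)"
  shows "measure_space UNIV (sets borel) f"
proof -
  interpret S: sigma_algebra UNIV "Pow (UNIV::'a set)" by (rule sigma_algebra_Pow)
  have pos: "f {} = 0" and mono: "\<And>A B. A \<subseteq> B \<Longrightarrow> f A \<le> f B"
    and csub: "countably_subadditive (Pow UNIV) f"
    using om by (auto simp: outer_measure_space_def positive_def increasing_def)
  have sub2: "f (A \<union> B) \<le> f A + f B" for A B
    using S.countably_subadditive_subadditive[of f] om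
      S.countably_subadditive_subadditive[THEN subadditiveD, of f "A" "B - A"]
      mono[of "B - A" B]
    by (auto simp: outer_measure_space_def Un_Diff_cancel
        intro: order_trans add_left_mono)
  have csubD: "f (\<Union>i. A i) \<le> (\<Sum>i. f (A i))" if "disjoint_family A" for A :: "nat \<Rightarrow> 'a set"
    using csub that by (auto simp: countably_subadditive_def)
  let ?L = "lambda_system UNIV (Pow UNIV) f"
  have msL: "measure_space UNIV ?L f" by (rule S.caratheodory_lemma[OF om])
  have closed_L: "C \<in> ?L" if C: "closed C" for C :: "'a set"
  proof (cases "C = {}")
    case True then show ?thesis using pos by (auto simp: lambda_system_def)
  next
    case ne: False
    have key: "f (A \<inter> C) + f (A - C) \<le> f A" for A
    proof (cases "f A = top")
      case True then show ?thesis by simp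
    next
      case False
      then have fA: "f A < top" by (simp add: less_top)
      define E where "E n = {x \<in> A. 1 / (real n + 1) \<le> infdist x C}" for n
      define D where "D n = E (Suc n) - E n" for n
      have E_sub: "E n \<subseteq> A" for n by (auto simp: E_def)
      have incE: "incseq E"
      proof (rule incseq_SucI)
        fix n
        have "1 / (real (Suc n) + 1) \<le> 1 / (real n + 1)" by (simp add: divide_simps)
        then show "E n \<subseteq> E (Suc n)" by (auto simp: E_def)
      qed
      have cover: "A - C \<subseteq> E n \<union> (\<Union>k. D (k + n))" for n
      proof
        fix x assume x: "x \<in> A - C"
        then have "0 < infdist x C"
          using C ne by (metis Diff_iff in_closed_iff_infdist_zero infdist_nonneg less_eq_real_def)
        then obtain m where m: "1 / real (Suc m) < infdist x C" using nat_approx_posE by blast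
        then have "x \<in> E m" using x by (auto simp: E_def add.commute)
        then obtain m0 where m0: "x \<in> E m0" "\<And>j. j < m0 \<Longrightarrow> x \<notin> E j"
          using exists_least_iff[of "\<lambda>m. x \<in> E m"] by blast
        show "x \<in> E n \<union> (\<Union>k. D (k + n))"
        proof (cases "m0 \<le> n")
          case True then show ?thesis using m0(1) incE by (auto simp: incseq_def)
        next
          case False
          then have "x \<in> D (m0 - 1)" using m0 by (auto simp: D_def)
          moreover have "m0 - 1 = (m0 - 1 - n) + n" using False by auto
          ultimately show ?thesis by (metis UN_I UnI2 UNIV_I)
        qed
      qed
      have sep: "1 / (real m + 2) - 1 / (real m + 3) \<le> dist a b"
        if a: "a \<in> E (Suc m)" and b: "b \<in> D (Suc (Suc m) + j)" for a b m j
      proof -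
        have "1 / (real m + 2) \<le> infdist a C" using a by (auto simp: E_def add.commute)
        moreover have "infdist b C < 1 / (real m + 3)"
        proof -
          have "b \<in> A" "b \<notin> E (Suc (Suc m) + j)" using b by (auto simp: D_def E_def)
          then have "infdist b C < 1 / (real (Suc (Suc m) + j) + 1)" by (auto simp: E_def)
          also have "\<dots> \<le> 1 / (real m + 3)" by (intro divide_left_mono) auto
          finally show ?thesis .
        qed
        moreover have "infdist a C \<le> infdist b C + dist a b" by (rule infdist_triangle)
        ultimately show ?thesis by linarith
      qed
      have posgap: "0 < 1 / (real m + 2) - 1 / (real m + 3)" for m
        by (simp add: frac_less2)
      have alt: "(\<Sum>j<n. f (D (2 * j + i))) \<le> f (\<Union>j<n. D (2 * j + i))" for i n
      proof (induction n)
        case 0 then show ?case by simp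
      next
        case (Suc n)
        have "(\<Sum>j<Suc n. f (D (2 * j + i))) \<le> f (\<Union>j<n. D (2 * j + i)) + f (D (2 * n + i))"
          using Suc by (simp add: add_right_mono)
        also have "\<dots> \<le> f ((\<Union>j<n. D (2 * j + i)) \<union> D (2 * n + i))"
        proof (cases "n = 0")
          case True then show ?thesis using pos by simp
        next
          case n: False
          define m where "m = 2 * (n - 1) + i"
          have idx: "2 * n + i = Suc (Suc m) + 0" using n by (auto simp: m_def)
          show ?thesis
          proof (rule metric[OF posgap[of m]], intro ballI)
            fix a b assume a: "a \<in> (\<Union>j<n. D (2 * j + i))" and b: "b \<in> D (2 * n + i)"
            from a obtain j where j: "j < n" "a \<in> D (2 * j + i)" by auto
            then have "2 * j + i \<le> m" by (auto simp: m_def)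
            then have "E (Suc (2 * j + i)) \<subseteq> E (Suc m)" using incE by (auto simp: incseq_def)
            then have "a \<in> E (Suc m)" using j by (auto simp: D_def)
            then show "1 / (real m + 2) - 1 / (real m + 3) \<le> dist a b"
              using sep b unfolding idx by blast
          qed
        qed
        also have "(\<Union>j<n. D (2 * j + i)) \<union> D (2 * n + i) = (\<Union>j<Suc n. D (2 * j + i))"
          by (auto simp: lessThan_Suc)
        finally show ?case .
      qed
      have alt': "(\<Sum>j<n. f (D (2 * j + i))) \<le> f A" for i n
        by (rule order_trans[OF alt]) (rule mono, auto simp: D_def E_def)
      have "(\<Sum>k. f (D k)) \<le> f A + f A"
      proof (rule suminf_le_const[OF summableI])
        fix n
        have dbl: "(\<Sum>k<2 * n. f (D k)) = (\<Sum>j<n. f (D (2 * j + 0))) + (\<Sum>j<n. f (D (2 * j + 1)))"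
          by (induction n) (auto simp: algebra_simps)
        have "(\<Sum>k<n. f (D k)) \<le> (\<Sum>k<2 * n. f (D k))" by (intro sum_mono2) auto
        also have "\<dots> \<le> f A + f A" unfolding dbl by (intro add_mono alt')
        finally show "(\<Sum>k<n. f (D k)) \<le> f A + f A" .
      qed
      then have fin: "(\<Sum>k. f (D k)) < top" using fA
        by (meson ennreal_add_less_top le_less_trans)
      show ?thesis
      proof (rule ennreal_le_epsilon)
        fix e :: real assume e: "0 < e"
        obtain n where n: "(\<Sum>k. f (D (k + n))) \<le> ennreal e"
          using metric_outer_measure_tail[OF fin e] by blast
        have disj: "disjoint_family (\<lambda>k. D (k + n))"
        proof (unfold disjoint_family_on_def, intro ballI impI)
          have *: "D a \<inter> D b = {}" if "a < b" for a b
          proof -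
            have "E (Suc a) \<subseteq> E b" using incE that by (auto simp: incseq_def)
            then show ?thesis by (auto simp: D_def)
          qed
          fix k l :: nat assume "k \<noteq> l"
          then show "D (k + n) \<inter> D (l + n) = {}"
            using *[of "k + n" "l + n"] *[of "l + n" "k + n"] by (cases "k < l") auto
        qed
        have "f (A - C) \<le> f (E n \<union> (\<Union>k. D (k + n)))" by (rule mono[OF cover])
        also have "\<dots> \<le> f (E n) + f (\<Union>k. D (k + n))" by (rule sub2)
        also have "\<dots> \<le> f (E n) + ennreal e"
          using csubD[OF disj] n by (intro add_left_mono) auto
        finally have "f (A \<inter> C) + f (A - C) \<le> (f (A \<inter> C) + f (E n)) + ennreal e"
          by (simp add: add.assoc add_left_mono)
        also have "f (A \<inter> C) + f (E n) \<le> f ((A \<inter> C) \<union> E n)"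
        proof (rule metric[of "1 / (real n + 1)"], simp, intro ballI)
          fix a b assume "a \<in> A \<inter> C" "b \<in> E n"
          then show "1 / (real n + 1) \<le> dist a b"
            using infdist_le[of a C b] by (auto simp: E_def dist_commute)
        qed
        also have "\<dots> \<le> f A" by (rule mono) (auto simp: E_def)
        finally show "f (A \<inter> C) + f (A - C) \<le> f A + ennreal e"
          by (simp add: add_right_mono)
      qed
    qed
    have "f (A \<inter> C) + f (A - C) = f A" for A
    proof (rule antisym[OF key])
      show "f A \<le> f (A \<inter> C) + f (A - C)"
        using sub2[of "A \<inter> C" "A - C"] by (simp add: Un_Diff_Int Int_Diff_Un)
    qed
    then show ?thesis unfolding S.lambda_system_eq by blast
  qed
  interpret L: sigma_algebra UNIV ?L using msL by (simp add: measure_space_def)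
  have "sets borel = sigma_sets UNIV (Collect closed :: 'a set set)"
    by (simp add: borel_eq_closed)
  also have "\<dots> \<subseteq> ?L"
    by (rule L.sigma_sets_subset) (use closed_L in auto)
  finally have sub: "sets borel \<subseteq> ?L" .
  have ca: "countably_additive ?L f" using msL by (simp add: measure_space_def)
  have "countably_additive (sets borel) f"
    unfolding countably_additive_def
  proof (intro allI impI)
    fix A :: "nat \<Rightarrow> 'a set"
    assume "range A \<subseteq> sets borel" "disjoint_family A" "(\<Union>i. A i) \<in> sets borel"
    then show "(\<Sum>i. f (A i)) = f (\<Union>i. A i)"
      using ca[unfolded countably_additive_def, rule_format, of A] sub by (meson subsetD subset_trans)
  qed
  moreover have "positive (sets borel) f" using pos by (simp add: positive_def)
  ultimately show ?thesis
    using sets.sigma_algebra_axioms[of "borel :: 'a measure"] by (simp add: measure_space_def)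
qed

lemma hausdorff1_pre_le:
  assumes "A \<subseteq> (\<Union>k. U k)" "\<And>k::nat. bounded (U k)" "\<And>k. diameter (U k) \<le> \<delta>"
  shows "hausdorff1_pre \<delta> A \<le> (\<Sum>k. ennreal (diameter (U k)))"
  unfolding hausdorff1_pre_def by (rule INF_lower) (use assms in auto)

lemma hausdorff1_pre_cover:
  assumes "hausdorff1_pre \<delta> A < y"
  obtains U :: "nat \<Rightarrow> 'a::metric_space set"
  where "A \<subseteq> (\<Union>k. U k)" "\<And>k. bounded (U k)" "\<And>k. diameter (U k) \<le> \<delta>"
    "(\<Sum>k. ennreal (diameter (U k))) < y"
  using assms unfolding hausdorff1_pre_def INF_less_iff by auto

lemma hausdorff1_pre_antimono:
  assumes "\<delta> \<le> \<delta>'"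
  shows "hausdorff1_pre \<delta>' A \<le> hausdorff1_pre \<delta> A"
  unfolding hausdorff1_pre_def using assms by (intro INF_superset_mono) (auto intro: order_trans)

lemma hausdorff1_pre_mono:
  assumes "A \<subseteq> B"
  shows "hausdorff1_pre \<delta> A \<le> hausdorff1_pre \<delta> B"
  unfolding hausdorff1_pre_def using assms by (intro INF_superset_mono) auto

lemma hausdorff1_pre_le_outer: "0 < \<delta> \<Longrightarrow> hausdorff1_pre \<delta> A \<le> hausdorff1_outer A"
  unfolding hausdorff1_outer_def by (rule SUP_upper) auto

lemma hausdorff1_pre_subadditive:
  fixes A :: "nat \<Rightarrow> 'a::metric_space set"
  shows "hausdorff1_pre \<delta> (\<Union>n. A n) \<le> (\<Sum>n. hausdorff1_pre \<delta> (A n))"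
proof (rule ennreal_le_epsilon)
  fix e :: real assume fin: "(\<Sum>n. hausdorff1_pre \<delta> (A n)) < top" and e: "0 < e"
  have "\<exists>U. A n \<subseteq> (\<Union>k. U k) \<and> (\<forall>k. bounded (U k) \<and> diameter (U k) \<le> \<delta>) \<and>
     (\<Sum>k::nat. ennreal (diameter (U k))) \<le> hausdorff1_pre \<delta> (A n) + ennreal (e * (1/2) ^ Suc n)" for n
  proof -
    have "hausdorff1_pre \<delta> (A n) < top" using fin by (rule ennreal_suminf_lessD)
    then have "hausdorff1_pre \<delta> (A n) < hausdorff1_pre \<delta> (A n) + ennreal (e * (1/2) ^ Suc n)"
      using e by (auto simp: ennreal_add_left_cancel_less[of _ 0, simplified])
    then obtain U where "A n \<subseteq> (\<Union>k. U k)" "\<And>k. bounded (U k)" "\<And>k. diameter (U k) \<le> \<delta>"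
      "(\<Sum>k. ennreal (diameter (U k))) < hausdorff1_pre \<delta> (A n) + ennreal (e * (1/2) ^ Suc n)"
      by (rule hausdorff1_pre_cover) blast
    then show ?thesis by (intro exI[of _ U]) auto
  qed
  then obtain U where U: "\<And>n. A n \<subseteq> (\<Union>k. U n k)" "\<And>n k. bounded (U n k)"
      "\<And>n k. diameter (U n k) \<le> \<delta>"
      "\<And>n. (\<Sum>k::nat. ennreal (diameter (U n k))) \<le> hausdorff1_pre \<delta> (A n) + ennreal (e * (1/2) ^ Suc n)"
    by metis
  define V where "V i = (case prod_decode i of (n, k) \<Rightarrow> U n k)" for i
  have V: "V (prod_encode (n, k)) = U n k" for n k by (simp add: V_def)
  have "hausdorff1_pre \<delta> (\<Union>n. A n) \<le> (\<Sum>i. ennreal (diameter (V i)))"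
  proof (rule hausdorff1_pre_le)
    show "(\<Union>n. A n) \<subseteq> (\<Union>k. V k)"
    proof
      fix x assume "x \<in> (\<Union>n. A n)"
      then obtain n k where "x \<in> U n k" using U(1) by blast
      then show "x \<in> (\<Union>k. V k)" using V by blast
    qed
  qed (use U in \<open>auto simp: V_def split: prod.split\<close>)
  also have "\<dots> = (\<Sum>n. \<Sum>k. ennreal (diameter (U n k)))"
    unfolding V_def
    using suminf_ennreal_2dimen[of "\<lambda>n. \<Sum>k. ennreal (diameter (U n k))"
        "\<lambda>(n, k). ennreal (diameter (U n k))"]
    by (simp add: case_prod_unfold)
  also have "\<dots> \<le> (\<Sum>n. hausdorff1_pre \<delta> (A n) + ennreal (e * (1/2) ^ Suc n))"
    using U(4) by (intro suminf_le summableI) auto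
  also have "\<dots> = (\<Sum>n. hausdorff1_pre \<delta> (A n)) + (\<Sum>n. ennreal e * ennreal ((1/2) ^ Suc n))"
    using e by (subst suminf_add[symmetric])
      (auto simp del: ennreal_suminf_cmult simp add: ennreal_mult[symmetric])
  also have "\<dots> = (\<Sum>n. hausdorff1_pre \<delta> (A n)) + ennreal e"
    unfolding ennreal_suminf_cmult
    by (subst suminf_ennreal_eq[OF zero_le_power power_half_series]) auto
  finally show "hausdorff1_pre \<delta> (\<Union>n. A n) \<le> (\<Sum>n. hausdorff1_pre \<delta> (A n)) + ennreal e" .
qed

text \<open>A set of diameter less than \<open>d\<close> cannot meet both \<open>A\<close> and \<open>B\<close>, so a cover of the union splits
  into a cover of \<open>A\<close> and one of \<open>B\<close>.\<close>

lemma hausdorff1_pre_separated: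
  fixes A B :: "'a::metric_space set"
  assumes d: "\<delta> < d" "\<forall>a\<in>A. \<forall>b\<in>B. d \<le> dist a b"
  shows "hausdorff1_pre \<delta> A + hausdorff1_pre \<delta> B \<le> hausdorff1_pre \<delta> (A \<union> B)"
proof (rule ccontr)
  assume "\<not> ?thesis"
  then have "hausdorff1_pre \<delta> (A \<union> B) < hausdorff1_pre \<delta> A + hausdorff1_pre \<delta> B" by simp
  then obtain U where U: "A \<union> B \<subseteq> (\<Union>k. U k)" "\<And>k. bounded (U k)" "\<And>k. diameter (U k) \<le> \<delta>"
    "(\<Sum>k. ennreal (diameter (U k))) < hausdorff1_pre \<delta> A + hausdorff1_pre \<delta> B"
    using hausdorff1_pre_cover by blast
  define V where "V X k = (if U k \<inter> X = {} then {} else U k)" for X k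
  have \<delta>: "0 \<le> \<delta>" using U(2,3) diameter_ge_0 order_trans by blast
  have V: "hausdorff1_pre \<delta> X \<le> (\<Sum>k. ennreal (diameter (V X k)))" if "X \<subseteq> A \<union> B" for X
  proof (rule hausdorff1_pre_le)
    show "X \<subseteq> (\<Union>k. V X k)"
    proof
      fix x assume x: "x \<in> X"
      then have "x \<in> (\<Union>k. U k)" using U(1) that by blast
      then obtain k where "x \<in> U k" by blast
      then have "x \<in> V X k" using x by (auto simp: V_def)
      then show "x \<in> (\<Union>k. V X k)" by blast
    qed
  qed (use U \<delta> in \<open>auto simp: V_def\<close>)
  have excl: "U k \<inter> A = {} \<or> U k \<inter> B = {}" for k
  proof (rule ccontr)
    assume "\<not> ?thesis"
    then obtain a b where "a \<in> U k" "a \<in> A" "b \<in> U k" "b \<in> B" by blast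
    then show False
      using d U(2,3)[of k] diameter_bounded_bound[of "U k" a b] by (auto dest!: bspec)
  qed
  have "hausdorff1_pre \<delta> A + hausdorff1_pre \<delta> B
      \<le> (\<Sum>k. ennreal (diameter (V A k))) + (\<Sum>k. ennreal (diameter (V B k)))"
    by (intro add_mono V) auto
  also have "\<dots> = (\<Sum>k. ennreal (diameter (V A k)) + ennreal (diameter (V B k)))"
    by (intro suminf_add summableI)
  also have "\<dots> \<le> (\<Sum>k. ennreal (diameter (U k)))"
    using excl by (intro suminf_le summableI) (auto simp: V_def)
  finally show False using U(4) by (simp add: leD)
qed

lemma measure_space_hausdorff1_outer:
  "measure_space UNIV (sets borel) (hausdorff1_outer :: 'a::metric_space set \<Rightarrow> ennreal)"
proof (rule metric_outer_measure_borel)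
  have "hausdorff1_pre \<delta> ({} :: 'a set) = 0" if "0 < \<delta>" for \<delta>
    using hausdorff1_pre_le[of "{}" "\<lambda>_. {}" \<delta>] that by simp
  then have "hausdorff1_outer ({} :: 'a set) = 0" by (simp add: hausdorff1_outer_def)
  moreover have "hausdorff1_outer A \<le> hausdorff1_outer B" if "A \<subseteq> B" for A B :: "'a set"
    unfolding hausdorff1_outer_def by (intro SUP_mono') (rule hausdorff1_pre_mono[OF that])
  moreover have "hausdorff1_outer (\<Union>n. A n) \<le> (\<Sum>n. hausdorff1_outer (A n))" for A :: "nat \<Rightarrow> 'a set"
    unfolding hausdorff1_outer_def[of "\<Union>n. A n"]
  proof (rule SUP_least)
    fix \<delta> :: real assume "\<delta> \<in> {0<..}"
    then show "hausdorff1_pre \<delta> (\<Union>n. A n) \<le> (\<Sum>n. hausdorff1_outer (A n))"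
      by (intro order_trans[OF hausdorff1_pre_subadditive] suminf_le summableI hausdorff1_pre_le_outer) auto
  qed
  ultimately show "outer_measure_space (Pow UNIV) (hausdorff1_outer :: 'a set \<Rightarrow> ennreal)"
    by (auto simp: outer_measure_space_def positive_def increasing_def countably_subadditive_def)
next
  fix A B :: "'a set" and d :: real
  assume d: "0 < d" "\<forall>a\<in>A. \<forall>b\<in>B. d \<le> dist a b"
  have *: "hausdorff1_pre \<delta> A + hausdorff1_pre \<delta>' B \<le> hausdorff1_outer (A \<union> B)"
    if "0 < \<delta>" "0 < \<delta>'" for \<delta> \<delta>'
  proof -
    define m where "m = min (min \<delta> \<delta>') (d / 2)"
    have m: "0 < m" "m \<le> \<delta>" "m \<le> \<delta>'" "m < d" using that d by (auto simp: m_def)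
    have "hausdorff1_pre \<delta> A + hausdorff1_pre \<delta>' B \<le> hausdorff1_pre m A + hausdorff1_pre m B"
      by (intro add_mono hausdorff1_pre_antimono m)
    also have "\<dots> \<le> hausdorff1_pre m (A \<union> B)" using hausdorff1_pre_separated m d by blast
    also have "\<dots> \<le> hausdorff1_outer (A \<union> B)" by (rule hausdorff1_pre_le_outer[OF m(1)])
    finally show ?thesis .
  qed
  have ne: "{0<..} \<noteq> ({} :: real set)" using gt_ex by auto
  have "hausdorff1_pre \<delta> A + hausdorff1_outer B \<le> hausdorff1_outer (A \<union> B)" if "0 < \<delta>" for \<delta>
    unfolding hausdorff1_outer_def[of B] ennreal_SUP_add_right[OF ne]
    by (rule SUP_least) (use *[OF that] in auto)
  then show "hausdorff1_outer A + hausdorff1_outer B \<le> hausdorff1_outer (A \<union> B)"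
    unfolding hausdorff1_outer_def[of A] ennreal_SUP_add_left[OF ne, symmetric]
    by (intro SUP_least) auto
qed

lemma sets_hausdorff1 [measurable_cong, simp]: "sets hausdorff1 = sets borel"
  unfolding hausdorff1_def using sets.sigma_sets_eq[of borel] by (simp add: sets_measure_of)

lemma space_hausdorff1 [simp]: "space hausdorff1 = UNIV"
  unfolding hausdorff1_def by (simp add: space_measure_of)

lemma emeasure_hausdorff1:
  assumes "A \<in> sets borel"
  shows "emeasure hausdorff1 A = hausdorff1_outer A"
  unfolding hausdorff1_def
  using measure_space_hausdorff1_outer assms sets.sigma_algebra_axioms[of borel]
  by (intro emeasure_measure_of_sigma) (auto simp: measure_space_def)

text \<open>The preimage of a covering set lies in an interval whose length is the diameter divided by
  \<open>L\<close>.\<close>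

lemma hausdorff1_outer_ge_inverse_Lipschitz:
  fixes f :: "real \<Rightarrow> 'a::metric_space"
  assumes L: "0 < L" "\<And>x y. x \<in> B \<Longrightarrow> y \<in> B \<Longrightarrow> L * \<bar>x - y\<bar> \<le> dist (f x) (f y)"
    and B: "B \<in> sets borel"
  shows "ennreal L * emeasure lborel B \<le> hausdorff1_outer (f ` B)"
proof (rule order_trans[OF _ hausdorff1_pre_le_outer[of 1]])
  show "ennreal L * emeasure lborel B \<le> hausdorff1_pre 1 (f ` B)"
  proof (rule ccontr)
    assume "\<not> ?thesis"
    then have "hausdorff1_pre 1 (f ` B) < ennreal L * emeasure lborel B" by simp
    then obtain U where U: "f ` B \<subseteq> (\<Union>k. U k)" "\<And>k. bounded (U k)" "\<And>k. diameter (U k) \<le> 1"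
      "(\<Sum>k. ennreal (diameter (U k))) < ennreal L * emeasure lborel B"
      by (rule hausdorff1_pre_cover) blast
    define d where "d k = diameter (U k)" for k
    have d: "0 \<le> d k" for k using U(2) diameter_ge_0 by (auto simp: d_def)
    have "\<exists>a. {x \<in> B. f x \<in> U k} \<subseteq> {a .. a + d k / L}" for k
    proof (cases "{x \<in> B. f x \<in> U k} = {}")
      case True then show ?thesis by (metis empty_subsetI)
    next
      case False
      define V where "V = {x \<in> B. f x \<in> U k}"
      have near: "\<bar>x - y\<bar> \<le> d k / L" if "x \<in> V" "y \<in> V" for x y
      proof -
        have "L * \<bar>x - y\<bar> \<le> d k"
          using that L(2)[of x y] diameter_bounded_bound[OF U(2), of "f x" k "f y"]
          by (auto simp: V_def d_def)
        then show ?thesis using L(1) by (simp add: field_simps)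
      qed
      obtain x0 where x0: "x0 \<in> V" using False by (auto simp: V_def)
      have bdd: "bdd_below V"
      proof (rule bdd_belowI[of _ "x0 - d k / L"])
        fix x assume "x \<in> V"
        then show "x0 - d k / L \<le> x" using near[of x x0] x0 by linarith
      qed
      have "x \<in> {Inf V .. Inf V + d k / L}" if x: "x \<in> V" for x
      proof -
        have "x - d k / L \<le> Inf V"
        proof (rule cInf_greatest)
          show "V \<noteq> {}" using x0 by blast
          show "x - d k / L \<le> y" if "y \<in> V" for y using near[OF x that] by linarith
        qed
        then show ?thesis using cInf_lower[OF x bdd] by auto
      qed
      then show ?thesis unfolding V_def by blast
    qed
    then obtain a where a: "\<And>k. {x \<in> B. f x \<in> U k} \<subseteq> {a k .. a k + d k / L}" by metis
    have "B \<subseteq> (\<Union>k. {a k .. a k + d k / L})"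
    proof
      fix x assume x: "x \<in> B"
      then have "f x \<in> (\<Union>k. U k)" using U(1) by blast
      then obtain k where "f x \<in> U k" by blast
      then show "x \<in> (\<Union>k. {a k .. a k + d k / L})" using a[of k] x by blast
    qed
    then have "emeasure lborel B \<le> emeasure lborel (\<Union>k. {a k .. a k + d k / L})"
      by (intro emeasure_mono) auto
    also have "\<dots> \<le> (\<Sum>k. emeasure lborel {a k .. a k + d k / L})"
      by (intro emeasure_subadditive_countably) auto
    also have "\<dots> = (\<Sum>k. ennreal (d k / L))" using d L by simp
    finally have "ennreal L * emeasure lborel B \<le> ennreal L * (\<Sum>k. ennreal (d k / L))"
      by (rule mult_left_mono) auto
    also have "\<dots> = (\<Sum>k. ennreal (d k))"
      using d L by (simp flip: ennreal_suminf_cmult ennreal_mult)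
    finally show False using U(4) by (simp add: d_def leD)
  qed
qed simp

definition unit_vec :: "real \<Rightarrow> real^2" where
  "unit_vec \<theta> = (\<chi> i. if i = 1 then cos \<theta> else sin \<theta>)"

lemma unit_vec_nth [simp]: "unit_vec \<theta> $ 1 = cos \<theta>" "unit_vec \<theta> $ 2 = sin \<theta>"
  by (auto simp: unit_vec_def)

lemma continuous_on_unit_vec [continuous_intros]:
  fixes f :: "'a::t2_space \<Rightarrow> real"
  shows "continuous_on S f \<Longrightarrow> continuous_on S (\<lambda>x. unit_vec (f x))"
  unfolding unit_vec_def
  by (rule continuous_on_vec_lambda, case_tac "i = 1")
    (auto intro!: continuous_on_cos continuous_on_sin)

lemma borel_measurable_unit_vec [measurable]: "unit_vec \<in> borel_measurable borel"
  by (intro borel_measurable_continuous_onI continuous_intros)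

lemma norm_unit_vec [simp]: "norm (unit_vec \<theta>) = 1"
  by (simp add: norm_vec_def L2_set_def sum_2)

lemma dist_unit_vec:
  fixes a b :: real
  shows "dist (unit_vec a) (unit_vec b) = 2 * \<bar>sin ((a - b) / 2)\<bar>"
proof -
  have "(dist (unit_vec a) (unit_vec b))\<^sup>2 = (cos a - cos b)\<^sup>2 + (sin a - sin b)\<^sup>2"
    by (simp add: dist_vec_def L2_set_def sum_2 dist_real_def)
  also have "\<dots> = 2 - 2 * cos (a - b)"
    by (simp add: power2_diff cos_diff)
       (metis (no_types, opaque_lifting) add.commute add.left_commute distrib_left mult.left_commute mult_2 one_add_one sin_cos_squared_add3 power2_eq_square)
  also have "\<dots> = (2 * \<bar>sin ((a - b) / 2)\<bar>)\<^sup>2"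
  proof -
    have "2 * ((a - b) / 2) = a - b" for a b :: real by simp
    then have "cos (a - b) = cos (2 * ((a - b) / 2))" by metis
    also have "\<dots> = 1 - 2 * (sin ((a - b) / 2))\<^sup>2" by (rule cos_double_sin)
    finally show ?thesis by (simp add: power_mult_distrib)
  qed
  finally show ?thesis by (rule power2_eq_imp_eq) auto
qed

lemma unit_vec_surj:
  assumes "norm x = 1"
  obtains \<theta> where "0 \<le> \<theta>" "\<theta> < 2 * pi" "x = unit_vec \<theta>"
proof -
  have "(x $ 1)\<^sup>2 + (x $ 2)\<^sup>2 = 1"
    using assms by (simp add: norm_vec_def L2_set_def sum_2)
  then obtain \<theta> where "0 \<le> \<theta>" "\<theta> < 2 * pi" "x $ 1 = cos \<theta>" "x $ 2 = sin \<theta>"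
    by (rule sincos_total_2pi)
  then show ?thesis using that[of \<theta>] by (simp add: vec_eq_iff forall_2)
qed

lemma inj_on_unit_vec: "inj_on unit_vec {0..<2 * pi}"
proof (rule inj_onI)
  fix a b assume ab: "a \<in> {0..<2 * pi}" "b \<in> {0..<2 * pi}" "unit_vec a = unit_vec b"
  then have "sin ((a - b) / 2) = 0" using dist_unit_vec[of a b] by simp
  moreover have "-pi < (a - b) / 2" "(a - b) / 2 < pi" using ab by auto
  ultimately have "(a - b) / 2 = 0" by (metis sin_eq_0_pi)
  then show "a = b" by simp
qed

lemma unit_vec_image: "unit_vec ` {0..<2 * pi} = sphere 0 1"
proof
  show "sphere 0 1 \<subseteq> unit_vec ` {0..<2 * pi}"
  proof
    fix x :: "real^2" assume "x \<in> sphere 0 1"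
    then have "norm x = 1" by simp
    then obtain \<theta> where "0 \<le> \<theta>" "\<theta> < 2 * pi" "x = unit_vec \<theta>" by (rule unit_vec_surj)
    then show "x \<in> unit_vec ` {0..<2 * pi}" by auto
  qed
qed auto

definition circle_measure :: "(real^2) measure" where
  "circle_measure = distr (restrict_space lborel {0..<2 * pi}) borel unit_vec"

lemma sets_circle_measure [measurable_cong, simp]: "sets circle_measure = sets borel"
  by (simp add: circle_measure_def)

lemma space_circle_measure [simp]: "space circle_measure = UNIV"
  by (simp add: circle_measure_def)

lemma emeasure_circle_measure:
  assumes [measurable]: "A \<in> sets borel"
  shows "emeasure circle_measure A = emeasure lborel {\<theta> \<in> {0..<2 * pi}. unit_vec \<theta> \<in> A}"
proof -
  have "emeasure circle_measure A
      = emeasure (restrict_space lborel {0..<2 * pi}) (unit_vec -` A \<inter> {0..<2 * pi})"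
    unfolding circle_measure_def by (subst emeasure_distr) (auto simp: space_restrict_space intro!: measurable_restrict_space1)
  also have "\<dots> = emeasure lborel (unit_vec -` A \<inter> {0..<2 * pi})"
    by (subst emeasure_restrict_space) auto
  finally show ?thesis by (simp add: vimage_def Int_def conj_commute)
qed

lemma finite_measure_circle_measure: "finite_measure circle_measure"
proof (rule finite_measureI)
  have "{\<theta>. 0 \<le> \<theta> \<and> \<theta> < 2 * pi} = {0..<2 * pi}" by auto
  then show "emeasure circle_measure (space circle_measure) \<noteq> \<infinity>"
    by (simp add: emeasure_circle_measure)
qed

lemma AE_circle_measure: "AE x in circle_measure. norm x = 1"
  unfolding circle_measure_def
  by (subst AE_distr_iff) (auto intro!: measurable_restrict_space1)

lemma sin_ge_mult_cos:
  fixes y :: real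
  assumes "0 \<le> y" "y \<le> pi"
  shows "y * cos y \<le> sin y"
proof -
  have "(\<lambda>y. sin y - y * cos y) 0 \<le> (\<lambda>y. sin y - y * cos y) y"
  proof (rule DERIV_nonneg_imp_nondecreasing[OF assms(1)])
    fix t assume t: "0 \<le> t" "t \<le> y"
    have "((\<lambda>y. sin y - y * cos y) has_real_derivative t * sin t) (at t)"
      by (auto intro!: derivative_eq_intros)
    moreover have "0 \<le> t * sin t" using t assms by (intro mult_nonneg_nonneg sin_ge_zero) auto
    ultimately show "\<exists>d. ((\<lambda>y. sin y - y * cos y) has_real_derivative d) (at t) \<and> 0 \<le> d" by blast
  qed
  then show ?thesis by simp
qed

text \<open>On an arc of angle \<open>2 * pi / N\<close> the parametrization by the angle expands distances by
  \<open>R * cos (pi / N)\<close> at least, since chords there are almost as long as arcs. The bounds for the \<open>N\<close>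
  arcs add up, and \<open>N\<close> tends to infinity.\<close>

lemma hausdorff1_circle_ge:
  assumes R: "0 < R" and A [measurable]: "A \<in> sets borel"
  shows "ennreal R * emeasure lborel {\<theta> \<in> {0..<2 * pi}. R *\<^sub>R unit_vec \<theta> \<in> A}
    \<le> emeasure hausdorff1 (A \<inter> sphere 0 R)" (is "ennreal R * emeasure lborel ?T \<le> ?H")
proof -
  define f where "f \<theta> = R *\<^sub>R unit_vec \<theta>" for \<theta>
  have f_cont: "continuous_on S f" for S unfolding f_def by (intro continuous_intros)
  have f_inj: "inj_on f {0..<2 * pi}" using inj_on_unit_vec R by (auto simp: f_def inj_on_def)
  have f_im: "f ` {0..<2 * pi} = sphere 0 R"
  proof -
    have "f ` {0..<2 * pi} = (*\<^sub>R) R ` unit_vec ` {0..<2 * pi}" by (auto simp: f_def)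
    then show ?thesis using R by (simp add: unit_vec_image sphere_scale)
  qed
  have f_borel [measurable]: "f \<in> borel_measurable borel"
    unfolding f_def by measurable
  have bound: "ennreal (R * cos (pi / real N)) * emeasure lborel ?T \<le> ?H" if N: "3 \<le> N" for N
  proof -
    define h where "h = 2 * pi / real N"
    have h: "0 < h" "real N * h = 2 * pi" using N by (auto simp: h_def)
    define I where "I j = {real j * h ..< real (Suc j) * h}" for j
    define B where "B j = {\<theta> \<in> I j. f \<theta> \<in> A}" for j
    have I_sub: "I j \<subseteq> {0..<2 * pi}" if "j < N" for j
    proof -
      have "real (Suc j) * h \<le> real N * h" using that h by (intro mult_right_mono) auto
      then show ?thesis using h by (auto simp: I_def intro: order_trans[rotated])
    qed
    have I_Un: "(\<Union>j<N. I j) = {0..<2 * pi}"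
    proof
      show "{0..<2 * pi} \<subseteq> (\<Union>j<N. I j)"
      proof
        fix \<theta> assume \<theta>: "\<theta> \<in> {0..<2 * pi}"
        define j where "j = nat \<lfloor>\<theta> / h\<rfloor>"
        have j: "real j \<le> \<theta> / h" "\<theta> / h < real j + 1" using \<theta> h by (auto simp: j_def)
        then have "real j < real N"
          using \<theta> h by (metis atLeastLessThan_iff le_less_trans mult.commute pos_divide_less_eq)
        moreover have "\<theta> \<in> I j" using j h by (auto simp: I_def field_simps)
        ultimately show "\<theta> \<in> (\<Union>j<N. I j)" by auto
      qed
    qed (use I_sub in blast)
    have I_disj: "disjoint_family I"
    proof (unfold disjoint_family_on_def, intro ballI impI)
      have *: "I a \<inter> I b = {}" if "a < b" for a b
      proof -
        have "real (Suc a) * h \<le> real b * h" using that h by (intro mult_right_mono) auto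
        then show ?thesis by (auto simp: I_def)
      qed
      fix a b :: nat assume "a \<noteq> b"
      then show "I a \<inter> I b = {}" using *[of a b] *[of b a] by (cases "a < b") auto
    qed
    have fI: "f ` I j \<in> sets borel" for j
    proof -
      have "I j = (\<Union>n. {real j * h .. real (Suc j) * h - 1 / real (Suc n)})"
      proof
        show "I j \<subseteq> (\<Union>n. {real j * h .. real (Suc j) * h - 1 / real (Suc n)})"
        proof
          fix x assume x: "x \<in> I j"
          then obtain n where "1 / real (Suc n) < real (Suc j) * h - x"
            using nat_approx_posE[of "real (Suc j) * h - x"] by (auto simp: I_def)
          then show "x \<in> (\<Union>n. {real j * h .. real (Suc j) * h - 1 / real (Suc n)})"
            using x by (intro UN_I[of n]) (auto simp: I_def)
        qed
        show "(\<Union>n. {real j * h .. real (Suc j) * h - 1 / real (Suc n)}) \<subseteq> I j"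
        proof clarsimp
          fix x n assume "real j * h \<le> x" "x \<le> (1 + real j) * h - 1 / (1 + real n)"
          moreover have "0 < 1 / (1 + real n)" by simp
          ultimately have "x < (1 + real j) * h" by linarith
          then show "x \<in> I j" using \<open>real j * h \<le> x\<close> by (simp add: I_def)
        qed
      qed
      then have "f ` I j = (\<Union>n. f ` {real j * h .. real (Suc j) * h - 1 / real (Suc n)})"
        by blast
      moreover have "closed (f ` {a..b})" for a b
        by (intro compact_imp_closed compact_continuous_image f_cont compact_Icc)
      ultimately show ?thesis by (auto intro!: borel_closed)
    qed
    have fB: "f ` B j = A \<inter> f ` I j" for j by (auto simp: B_def)
    have [measurable]: "B j \<in> sets borel" for j unfolding B_def I_def by measurable
    have L: "0 < R * cos (pi / real N)"
    proof -
      have "pi / real N \<le> pi / 3" using N by (intro divide_left_mono) auto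
      moreover have "0 < pi / real N" using N by auto
      ultimately show ?thesis using R pi_gt_zero by (intro mult_pos_pos cos_gt_zero_pi) linarith+
    qed
    have le: "ennreal (R * cos (pi / real N)) * emeasure lborel (B j) \<le> emeasure hausdorff1 (A \<inter> f ` I j)"
      for j
    proof -
      have "R * cos (pi / real N) * \<bar>x - y\<bar> \<le> dist (f x) (f y)" if "x \<in> B j" "y \<in> B j" for x y
      proof -
        define z where "z = \<bar>x - y\<bar> / 2"
        have "\<bar>x - y\<bar> \<le> h" using that by (auto simp: B_def I_def algebra_simps abs_le_iff)
        then have z: "0 \<le> z" "z \<le> pi / real N" by (auto simp: z_def h_def mult.commute)
        have "pi / real N \<le> pi / 3" using N by (intro divide_left_mono) auto
        then have zpi: "z \<le> pi" "pi / real N \<le> pi" using z by linarith+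
        have "z * cos (pi / real N) \<le> z * cos z"
          using z zpi by (intro mult_left_mono cos_monotone_0_pi_le) auto
        also have "\<dots> \<le> sin z" using z zpi by (intro sin_ge_mult_cos) auto
        finally have "2 * R * (z * cos (pi / real N)) \<le> 2 * R * sin z" using R by simp
        also have "sin z = \<bar>sin ((x - y) / 2)\<bar>"
        proof -
          have "0 \<le> sin z" using z zpi by (intro sin_ge_zero) auto
          moreover have "\<bar>sin ((x - y) / 2)\<bar> = \<bar>sin z\<bar>"
          proof -
            have "(x - y) / 2 = z \<or> (x - y) / 2 = - z" unfolding z_def by linarith
            then show ?thesis by (metis abs_minus_cancel sin_minus)
          qed
          ultimately show ?thesis by simp
        qed
        also have "2 * R * \<dots> = dist (f x) (f y)"
          using R dist_unit_vec[of x y] by (simp add: f_def dist_norm flip: scaleR_diff_right)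
        finally show ?thesis by (simp add: z_def mult_ac)
      qed
      then show ?thesis
        using hausdorff1_outer_ge_inverse_Lipschitz[OF L, of "B j" f] fB[of j] fI[of j]
        by (simp add: emeasure_hausdorff1 sets.Int[OF A])
    qed
    have "?T = (\<Union>j<N. B j)" using I_Un by (auto simp: B_def f_def)
    moreover have "disjoint_family_on B {..<N}"
      using I_disj unfolding disjoint_family_on_def B_def by blast
    ultimately have "emeasure lborel ?T = (\<Sum>j<N. emeasure lborel (B j))"
      by (simp only:) (rule sum_emeasure[symmetric], auto)
    then have "ennreal (R * cos (pi / real N)) * emeasure lborel ?T
        = (\<Sum>j<N. ennreal (R * cos (pi / real N)) * emeasure lborel (B j))"
      by (simp add: sum_distrib_left)
    also have "\<dots> \<le> (\<Sum>j<N. emeasure hausdorff1 (A \<inter> f ` I j))" by (intro sum_mono le)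
    also have "\<dots> = emeasure hausdorff1 (\<Union>j<N. A \<inter> f ` I j)"
    proof (rule sum_emeasure)
      show "disjoint_family_on (\<lambda>j. A \<inter> f ` I j) {..<N}"
      proof (unfold disjoint_family_on_def, intro ballI impI)
        fix a b assume ab: "a \<in> {..<N}" "b \<in> {..<N}" "a \<noteq> b"
        then have "f ` I a \<inter> f ` I b = f ` (I a \<inter> I b)"
          using inj_on_image_Int[OF f_inj, of "I a" "I b"] I_sub by auto
        also have "\<dots> = {}" using I_disj ab by (auto simp: disjoint_family_on_def)
        finally show "(A \<inter> f ` I a) \<inter> (A \<inter> f ` I b) = {}" by blast
      qed
    qed (use fI A in auto)
    also have "(\<Union>j<N. A \<inter> f ` I j) = A \<inter> sphere 0 R"
      using I_Un f_im by (metis Int_UN_distrib image_UN)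
    finally show ?thesis .
  qed
  have "emeasure lborel ?T \<le> emeasure lborel {0..<2 * pi}"
    by (intro emeasure_mono) auto
  then have "emeasure lborel ?T < top" by (auto intro: le_less_trans simp: ennreal_less_top)
  then obtain m where m: "0 \<le> m" "emeasure lborel ?T = ennreal m" by (cases "emeasure lborel ?T") auto
  have lim: "(\<lambda>N. ennreal (R * cos (pi / real N) * m)) \<longlonglongrightarrow> ennreal (R * cos 0 * m)"
    by (intro tendsto_intros tendsto_ennrealI lim_const_over_n)
  have "ennreal (R * cos 0 * m) \<le> ?H"
  proof (rule LIMSEQ_le_const2[OF lim], intro exI allI impI)
    fix N :: nat assume N: "3 \<le> N"
    have "0 \<le> R * cos (pi / real N)"
    proof -
      have "pi / real N \<le> pi / 3" using N by (intro divide_left_mono) auto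
      moreover have "0 < pi / real N" using N by auto
      ultimately show ?thesis using R pi_gt_zero by (intro mult_nonneg_nonneg cos_ge_zero) linarith+
    qed
    then show "ennreal (R * cos (pi / real N) * m) \<le> ?H"
      using bound[OF N] m by (simp add: ennreal_mult)
  qed
  then show ?thesis using m R by (simp add: ennreal_mult)
qed

text \<open>Here the cover consists of \<open>N\<close> arcs, whose diameters are at most their lengths.\<close>

lemma hausdorff1_circle_le:
  assumes R: "0 < R"
  shows "emeasure hausdorff1 (sphere (0::real^2) R) \<le> ennreal (2 * pi * R)"
proof -
  define f where "f \<theta> = R *\<^sub>R unit_vec \<theta>" for \<theta>
  have f_im: "f ` {0..<2 * pi} = sphere 0 R"
  proof -
    have "f ` {0..<2 * pi} = (*\<^sub>R) R ` unit_vec ` {0..<2 * pi}" by (auto simp: f_def)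
    then show ?thesis using R by (simp add: unit_vec_image sphere_scale)
  qed
  have "hausdorff1_pre \<delta> (sphere (0::real^2) R) \<le> ennreal (2 * pi * R)" if \<delta>: "0 < \<delta>" for \<delta>
  proof -
    obtain N where N: "1 / real (Suc N) < \<delta> / (2 * pi * R)"
      using nat_approx_posE[of "\<delta> / (2 * pi * R)"] \<delta> R by auto
    define h where "h = 2 * pi / real (Suc N)"
    have h: "0 < h" "real (Suc N) * h = 2 * pi" by (auto simp: h_def)
    have hR: "R * h \<le> \<delta>" using N R \<delta> by (simp add: h_def field_simps)
    define U where "U j = (if j < Suc N then f ` {real j * h .. real (Suc j) * h} else {})" for j
    have dU: "diameter (U j) \<le> (if j < Suc N then R * h else 0)" for j
    proof (cases "j < Suc N")
      case True
      have "norm (f x - f y) \<le> R * h" if "x \<in> {real j * h .. real (Suc j) * h}"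
        "y \<in> {real j * h .. real (Suc j) * h}" for x y
      proof -
        have "norm (f x - f y) = R * (2 * \<bar>sin ((x - y) / 2)\<bar>)"
          using R dist_unit_vec[of x y] by (simp add: f_def dist_norm flip: scaleR_diff_right)
        also have "\<dots> \<le> R * (2 * \<bar>(x - y) / 2\<bar>)"
          using R by (intro mult_left_mono abs_sin_x_le_abs_x) auto
        also have "\<dots> \<le> R * h"
          using R that by (intro mult_left_mono) (auto simp: algebra_simps abs_le_iff)
        finally show ?thesis .
      qed
      then show ?thesis using True R h by (auto simp: U_def intro!: diameter_le)
    qed (auto simp: U_def)
    have "hausdorff1_pre \<delta> (sphere (0::real^2) R) \<le> (\<Sum>j. ennreal (diameter (U j)))"
    proof (rule hausdorff1_pre_le)
      show "sphere 0 R \<subseteq> (\<Union>j. U j)"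
      proof
        fix x :: "real^2" assume "x \<in> sphere 0 R"
        then have "x \<in> f ` {0..<2 * pi}" unfolding f_im .
        then obtain \<theta> where \<theta>: "0 \<le> \<theta>" "\<theta> < 2 * pi" "x = f \<theta>" by auto
        define j where "j = nat \<lfloor>\<theta> / h\<rfloor>"
        have j: "real j \<le> \<theta> / h" "\<theta> / h < real j + 1" using \<theta> h by (auto simp: j_def)
        then have "real j < real (Suc N)"
          using \<theta> h by (metis le_less_trans mult.commute pos_divide_less_eq)
        moreover have "\<theta> \<in> {real j * h .. real (Suc j) * h}" using j h by (auto simp: field_simps)
        ultimately have "x \<in> U j" using \<theta> by (auto simp: U_def)
        then show "x \<in> (\<Union>j. U j)" by blast
      qed
      show "bounded (U k)" for k
        unfolding U_def f_def by (auto intro!: compact_imp_bounded compact_continuous_image continuous_intros)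
      show "diameter (U k) \<le> \<delta>" for k
        using dU[of k] hR \<delta> by (auto split: if_splits)
    qed
    also have "\<dots> \<le> (\<Sum>j. ennreal (if j < Suc N then R * h else 0))"
      by (intro suminf_le summableI ennreal_leI dU)
    also have "\<dots> = (\<Sum>j<Suc N. ennreal (if j < Suc N then R * h else 0))"
      by (rule suminf_finite) auto
    also have "\<dots> = (\<Sum>j<Suc N. ennreal (R * h))" by (intro sum.cong) auto
    also have "\<dots> = ennreal (real (Suc N) * (R * h))"
      using R h by (subst sum_ennreal) auto
    also have "real (Suc N) * (R * h) = 2 * pi * R" using h(2) by (metis mult.assoc mult.commute)
    finally show ?thesis .
  qed
  then show ?thesis
    unfolding emeasure_hausdorff1[OF borel_closed[OF closed_sphere]] hausdorff1_outer_def
    by (intro SUP_least) auto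
qed

text \<open>The lower bound holds for \<open>A\<close> and for its complement. As the two lower bounds add up to the upper
  bound for the whole circle, both are equalities.\<close>

lemma hausdorff1_circle:
  assumes R: "0 < R" and A [measurable]: "A \<in> sets borel"
  shows "emeasure hausdorff1 (A \<inter> sphere 0 R) = ennreal R * emeasure circle_measure {x. R *\<^sub>R x \<in> A}"
proof -
  define T where "T A = emeasure lborel {\<theta> \<in> {0..<2 * pi}. R *\<^sub>R unit_vec \<theta> \<in> A}" for A
  have T_circle: "emeasure circle_measure {x. R *\<^sub>R x \<in> A} = T A"
    by (subst emeasure_circle_measure) (auto simp: T_def)
  have sum: "T A + T (- A) = ennreal (2 * pi)"
  proof -
    have "T A + T (- A) = emeasure lborel ({\<theta> \<in> {0..<2 * pi}. R *\<^sub>R unit_vec \<theta> \<in> A}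
        \<union> {\<theta> \<in> {0..<2 * pi}. R *\<^sub>R unit_vec \<theta> \<in> - A})"
      unfolding T_def by (rule plus_emeasure) auto
    also have "{\<theta> \<in> {0..<2 * pi}. R *\<^sub>R unit_vec \<theta> \<in> A}
        \<union> {\<theta> \<in> {0..<2 * pi}. R *\<^sub>R unit_vec \<theta> \<in> - A} = {0..<2 * pi}" by auto
    finally show ?thesis by simp
  qed
  then have fin: "T A < top" "T (- A) < top"
    by (auto simp: less_top[symmetric])
  have S [measurable]: "sphere (0::real^2) R \<in> sets borel" by (intro borel_closed closed_sphere)
  have ge: "ennreal R * T A \<le> emeasure hausdorff1 (A \<inter> sphere 0 R)"
    "ennreal R * T (- A) \<le> emeasure hausdorff1 (- A \<inter> sphere 0 R)"
    unfolding T_def by (intro hausdorff1_circle_ge R; measurable)+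
  have "emeasure hausdorff1 (A \<inter> sphere 0 R) + ennreal R * T (- A)
      \<le> emeasure hausdorff1 (A \<inter> sphere 0 R) + emeasure hausdorff1 (- A \<inter> sphere 0 R)"
    by (intro add_left_mono ge)
  also have "\<dots> = emeasure hausdorff1 ((A \<inter> sphere 0 R) \<union> (- A \<inter> sphere 0 R))"
    by (rule plus_emeasure) auto
  also have "(A \<inter> sphere 0 R) \<union> (- A \<inter> sphere 0 R) = sphere 0 R" by blast
  also have "emeasure hausdorff1 (sphere (0::real^2) R) \<le> ennreal (2 * pi * R)"
    by (rule hausdorff1_circle_le[OF R])
  also have "\<dots> = ennreal R * (T A + T (- A))" using R sum by (simp add: mult.commute flip: ennreal_mult)
  also have "\<dots> = ennreal R * T A + ennreal R * T (- A)" by (simp add: distrib_left)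
  finally have "emeasure hausdorff1 (A \<inter> sphere 0 R) \<le> ennreal R * T A"
    using fin unfolding add.commute[of _ "ennreal R * T (- A)"] ennreal_add_left_cancel_le
    by (auto simp: ennreal_mult_eq_top_iff)
  then show ?thesis using ge(1) T_circle by simp
qed

lemma density_hausdorff1_sphere:
  assumes R: "0 < R"
  shows "density hausdorff1 (indicator (sphere 0 R))
    = density (distr circle_measure borel ((*\<^sub>R) R)) (\<lambda>_. ennreal R)" (is "?M = ?N")
proof (rule measure_eqI)
  fix A assume "A \<in> sets ?M"
  then have [measurable]: "A \<in> sets borel" by simp
  have [measurable]: "sphere (0::real^2) R \<in> sets borel" by (intro borel_closed closed_sphere)
  have "emeasure ?M A = emeasure hausdorff1 (A \<inter> sphere 0 R)"
    by (subst emeasure_density) (auto simp: nn_integral_indicator Int_commute simp flip: indicator_inter_arith)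
  also have "\<dots> = ennreal R * emeasure (distr circle_measure borel ((*\<^sub>R) R)) A"
    by (subst hausdorff1_circle[OF R], simp) (subst emeasure_distr, auto simp: vimage_def)
  also have "\<dots> = emeasure ?N A"
    by (subst emeasure_density) (auto simp: nn_integral_cmult_indicator)
  finally show "emeasure ?M A = emeasure ?N A" .
qed simp

lemma
  fixes f :: "real^2 \<Rightarrow> real"
  assumes R: "0 < R" and f [measurable]: "f \<in> borel_measurable borel"
  shows set_integrable_hausdorff1_sphere:
      "set_integrable hausdorff1 (sphere 0 R) f \<longleftrightarrow> integrable circle_measure (\<lambda>x. f (R *\<^sub>R x))"
    and set_integral_hausdorff1_sphere:
      "(LINT x:sphere 0 R|hausdorff1. f x) = R * (LINT x|circle_measure. f (R *\<^sub>R x))"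
proof -
  have [measurable]: "sphere (0::real^2) R \<in> sets borel" by (intro borel_closed closed_sphere)
  have e: "ennreal (indicator (sphere 0 R) x) = indicator (sphere 0 R) x" for x :: "real^2"
    by (simp add: indicator_def)
  have "set_integrable hausdorff1 (sphere 0 R) f
      \<longleftrightarrow> integrable (density hausdorff1 (indicator (sphere 0 R))) f"
    unfolding set_integrable_def e[symmetric] by (subst integrable_density) (auto simp: mult.commute)
  also have "\<dots> \<longleftrightarrow> integrable circle_measure (\<lambda>x. f (R *\<^sub>R x))"
    unfolding density_hausdorff1_sphere[OF R] using R
    by (subst integrable_density) (auto simp: integrable_distr_eq)
  finally show "set_integrable hausdorff1 (sphere 0 R) f \<longleftrightarrow> integrable circle_measure (\<lambda>x. f (R *\<^sub>R x))" .
  have "(LINT x:sphere 0 R|hausdorff1. f x)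
      = (LINT x|density hausdorff1 (indicator (sphere 0 R)). f x)"
    unfolding set_lebesgue_integral_def e[symmetric] by (subst integral_density) (auto simp: mult.commute)
  also have "\<dots> = R * (LINT x|circle_measure. f (R *\<^sub>R x))"
    unfolding density_hausdorff1_sphere[OF R] using R
    by (subst integral_density) (auto simp: integral_distr)
  finally show "(LINT x:sphere 0 R|hausdorff1. f x) = R * (LINT x|circle_measure. f (R *\<^sub>R x))" .
qed

section \<open>Polar coordinates\<close>

lemma continuous_on_vector_2:
  fixes f g :: "'a::topological_space \<Rightarrow> real"
  assumes "continuous_on S f" "continuous_on S g"
  shows "continuous_on S (\<lambda>x. vector [f x, g x] :: real^2)"
proof -
  have "continuous_on S (\<lambda>x. \<chi> i::2. if i = 1 then f x else g x)"
    by (rule continuous_on_vec_lambda, case_tac "i = 1") (use assms in auto)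
  moreover have "(\<chi> i. if i = 1 then f x else g x) = (vector [f x, g x] :: real^2)" for x
    by (simp add: vec_eq_iff forall_2)
  ultimately show ?thesis by simp
qed

lemma distr_lborel_vector:
  "distr (lborel \<Otimes>\<^sub>M lborel) borel (\<lambda>(a, b). vector [a, b]) = (lborel :: (real^2) measure)"
proof (rule lborel_eqI[symmetric])
  have meas: "(\<lambda>(a, b). vector [a, b] :: real^2) \<in> borel_measurable (lborel \<Otimes>\<^sub>M lborel)"
  proof -
    have "continuous_on UNIV (\<lambda>p :: real \<times> real. vector [fst p, snd p] :: real^2)"
      by (intro continuous_on_vector_2 continuous_intros)
    then show ?thesis
      by (simp add: case_prod_unfold lborel_prod borel_measurable_continuous_onI)
  qed
  fix l u :: "real^2"
  assume lu: "\<And>b. b \<in> Basis \<Longrightarrow> l \<bullet> b \<le> u \<bullet> b"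
  have le: "l $ i \<le> u $ i" for i using lu[of "axis i 1"] by (simp add: inner_axis)
  have pre: "(\<lambda>(a, b). vector [a, b] :: real^2) -` box l u \<inter> space (lborel \<Otimes>\<^sub>M lborel)
      = {l $ 1 <..< u $ 1} \<times> {l $ 2 <..< u $ 2}"
    by (auto simp: mem_box_cart forall_2 space_pair_measure)
  have "emeasure (distr (lborel \<Otimes>\<^sub>M lborel) borel (\<lambda>(a, b). vector [a, b])) (box l u)
      = ennreal ((u $ 1 - l $ 1) * (u $ 2 - l $ 2))"
    using le by (subst emeasure_distr[OF meas])
      (auto simp: pre lborel.emeasure_pair_measure_Times ennreal_mult)
  also have "(u $ 1 - l $ 1) * (u $ 2 - l $ 2) = (\<Prod>i\<in>UNIV. u $ i - l $ i)"
    by (simp add: UNIV_2)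
  also have "\<dots> = measure lborel (cbox l u)"
    using le by (subst content_cbox_cart) (auto simp: interval_ne_empty_cart)
  also have "\<dots> = (\<Prod>b\<in>Basis. (u - l) \<bullet> b)"
    using lu by (simp add: content_cbox inner_diff_left)
  finally show "emeasure (distr (lborel \<Otimes>\<^sub>M lborel) borel (\<lambda>(a, b). vector [a, b])) (box l u)
      = ennreal (\<Prod>b\<in>Basis. (u - l) \<bullet> b)" .
qed simp

lemma nn_integral_lborel_vector:
  fixes f :: "real^2 \<Rightarrow> ennreal"
  assumes [measurable]: "f \<in> borel_measurable borel"
  shows "(\<integral>\<^sup>+x. f x \<partial>lborel) = (\<integral>\<^sup>+r. \<integral>\<^sup>+\<theta>. f (vector [r, \<theta>]) \<partial>lborel \<partial>lborel)"
proof -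
  have "continuous_on UNIV (\<lambda>p :: real \<times> real. vector [fst p, snd p] :: real^2)"
    by (intro continuous_on_vector_2 continuous_intros)
  then have [measurable]: "(\<lambda>(a, b). vector [a, b] :: real^2) \<in> borel_measurable (lborel \<Otimes>\<^sub>M lborel)"
    by (simp add: case_prod_unfold lborel_prod borel_measurable_continuous_onI)
  have [measurable]: "(\<lambda>p. f (vector [fst p, snd p])) \<in> borel_measurable (lborel \<Otimes>\<^sub>M lborel)"
    using measurable_compose[OF \<open>(\<lambda>(a, b). vector [a, b] :: real^2) \<in> _\<close> assms]
    by (simp add: case_prod_unfold)
  have "(\<integral>\<^sup>+x. f x \<partial>lborel) = (\<integral>\<^sup>+p. f (vector [fst p, snd p]) \<partial>(lborel \<Otimes>\<^sub>M lborel))"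
    by (subst distr_lborel_vector[symmetric], subst nn_integral_distr) (auto simp: case_prod_unfold)
  then show ?thesis by (subst (asm) lborel.nn_integral_fst[symmetric]) auto
qed

text \<open>Polar coordinates are a map on \<^typ>\<open>real^2\<close> because the change of variables formula concerns maps
  of a space to itself.\<close>

definition annulus_polar :: "real^2 \<Rightarrow> real^2" where
  "annulus_polar p = (p $ 1) *\<^sub>R unit_vec (p $ 2)"

lemma annulus_polar_nth [simp]:
  "annulus_polar p $ 1 = p $ 1 * cos (p $ 2)" "annulus_polar p $ 2 = p $ 1 * sin (p $ 2)"
  by (simp_all add: annulus_polar_def)

definition annulus_polar_deriv :: "real^2 \<Rightarrow> real^2 \<Rightarrow> real^2" where
  "annulus_polar_deriv p h = (\<chi> i. if i = 1 then h $ 1 * cos (p $ 2) - p $ 1 * sin (p $ 2) * h $ 2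
     else h $ 1 * sin (p $ 2) + p $ 1 * cos (p $ 2) * h $ 2)"

lemma annulus_polar_has_derivative:
  "(annulus_polar has_derivative annulus_polar_deriv p) (at p within S)"
proof -
  have nth: "((\<lambda>p::real^2. p $ i) has_derivative (\<lambda>h. h $ i)) (at p within S)" for i
    by (rule bounded_linear.has_derivative[OF bounded_linear_vec_nth has_derivative_ident])
  have "((\<lambda>p. (p $ 1 * cos (p $ 2)) *\<^sub>R axis 1 1 + (p $ 1 * sin (p $ 2)) *\<^sub>R (axis 2 1 :: real^2))
      has_derivative annulus_polar_deriv p) (at p within S)"
    by (rule derivative_eq_intros nth refl)+
      (auto simp: fun_eq_iff vec_eq_iff forall_2 annulus_polar_deriv_def axis_def algebra_simps)
  moreover have "annulus_polar = (\<lambda>p. (p $ 1 * cos (p $ 2)) *\<^sub>R axis 1 1 + (p $ 1 * sin (p $ 2)) *\<^sub>R (axis 2 1 :: real^2))"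
    by (auto simp: fun_eq_iff vec_eq_iff forall_2 axis_def)
  ultimately show ?thesis by simp
qed

lemma det_annulus_polar_deriv: "det (matrix (annulus_polar_deriv p)) = p $ 1"
proof -
  have "det (matrix (annulus_polar_deriv p))
      = p $ 1 * (cos (p $ 2) * cos (p $ 2) + sin (p $ 2) * sin (p $ 2))"
    unfolding distrib_left by (simp add: det_2 matrix_def annulus_polar_deriv_def axis_def)
  then show ?thesis by simp
qed

lemma emeasure_annulus_polar:
  assumes ab: "0 \<le> a" and A [measurable]: "A \<in> sets borel"
  shows "emeasure lborel (A \<inter> {x. a < norm x \<and> norm x < b})
    = (\<integral>\<^sup>+r. \<integral>\<^sup>+x. ennreal (r * indicator {a<..<b} r) * indicator A (r *\<^sub>R x) \<partial>circle_measure \<partial>lborel)"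
proof -
  define W where "W = A \<inter> {x::real^2. a < norm x \<and> norm x < b}"
  have [measurable]: "W \<in> sets borel"
    unfolding W_def by measurable
  define S where "S = {p :: real^2. a < p $ 1 \<and> p $ 1 < b \<and> 0 < p $ 2 \<and> p $ 2 < 2 * pi \<and> annulus_polar p \<in> A}"
  have [measurable]: "annulus_polar \<in> borel_measurable borel"
    by (intro borel_measurable_continuous_onI differentiable_imp_continuous_on)
      (auto simp: differentiable_on_def differentiable_def intro!: exI annulus_polar_has_derivative)
  have S [measurable]: "S \<in> sets borel"
    unfolding S_def by measurable
  have norm_polar: "norm (annulus_polar p) = \<bar>p $ 1\<bar>" for p
    by (simp add: annulus_polar_def)
  have inj: "inj_on annulus_polar S"
  proof (rule inj_onI)
    fix p q assume pq: "p \<in> S" "q \<in> S" "annulus_polar p = annulus_polar q"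
    then have 1: "p $ 1 = q $ 1" using norm_polar[of p] norm_polar[of q] ab by (auto simp: S_def)
    moreover have "p $ 1 \<noteq> 0" using pq ab by (auto simp: S_def)
    ultimately have "unit_vec (p $ 2) = unit_vec (q $ 2)"
      using pq(3) by (simp add: annulus_polar_def)
    then have "p $ 2 = q $ 2" using inj_on_unit_vec pq(1,2) by (auto simp: S_def inj_on_def)
    with 1 show "p = q" by (simp add: vec_eq_iff forall_2)
  qed
  have im: "annulus_polar ` S = W \<inter> {x. \<not> (x $ 2 = 0 \<and> 0 \<le> x $ 1)}"
  proof (rule set_eqI, rule iffI)
    fix x assume "x \<in> annulus_polar ` S"
    then obtain p where p: "p \<in> S" "x = annulus_polar p" by auto
    have pos: "0 < p $ 1" using p ab by (auto simp: S_def)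
    have "\<not> (x $ 2 = 0 \<and> 0 \<le> x $ 1)"
    proof
      assume "x $ 2 = 0 \<and> 0 \<le> x $ 1"
      then have sc: "sin (p $ 2) = 0" "0 \<le> cos (p $ 2)" using p pos by (auto simp: zero_le_mult_iff)
      then have "cos (p $ 2) = 1" using sin_cos_squared_add[of "p $ 2"]
        by (simp add: power2_eq_1_iff)
      then have "unit_vec (p $ 2) = unit_vec 0" using sc by (simp add: vec_eq_iff forall_2)
      then have "p $ 2 = 0"
        using p(1) by (intro inj_onD[OF inj_on_unit_vec]) (auto simp: S_def)
      then show False using p(1) by (simp add: S_def)
    qed
    then show "x \<in> W \<inter> {x. \<not> (x $ 2 = 0 \<and> 0 \<le> x $ 1)}"
      using p pos norm_polar[of p] by (auto simp: W_def S_def)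
  next
    fix x assume x: "x \<in> W \<inter> {x. \<not> (x $ 2 = 0 \<and> 0 \<le> x $ 1)}"
    define r where "r = norm x"
    have r: "0 < r" "a < r" "r < b" using x ab by (auto simp: r_def W_def)
    then have "norm (x /\<^sub>R r) = 1" by (simp add: r_def)
    then obtain \<theta> where \<theta>: "0 \<le> \<theta>" "\<theta> < 2 * pi" "x /\<^sub>R r = unit_vec \<theta>" by (rule unit_vec_surj)
    have xr: "x = r *\<^sub>R unit_vec \<theta>" using r by (simp flip: \<theta>(3))
    have "\<theta> \<noteq> 0" using x r by (auto simp: xr)
    then have "vector [r, \<theta>] \<in> S" "annulus_polar (vector [r, \<theta>]) = x"
      using \<theta> r x by (auto simp: S_def annulus_polar_def xr W_def)
    then show "x \<in> annulus_polar ` S" by blast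
  qed
  have null: "AE x in lborel. (x :: real^2) $ 2 \<noteq> 0"
  proof (rule AE_I')
    have "negligible {x :: real^2. x $ 2 = 0}" by (rule negligible_standard_hyperplane_cart)
    then have "{x :: real^2. x $ 2 = 0} \<in> null_sets lebesgue" by (simp add: negligible_iff_null_sets)
    moreover have "{x :: real^2. x $ 2 = 0} \<in> sets borel" by measurable
    ultimately show "{x :: real^2. x $ 2 = 0} \<in> null_sets lborel"
      by (simp add: null_sets_completion_iff)
  qed auto
  have imB: "annulus_polar ` S \<in> sets borel"
    unfolding im by measurable
  have eW: "emeasure lborel W = emeasure lborel (annulus_polar ` S)"
  proof (rule emeasure_eq_AE)
    show "AE x in lborel. x \<in> W \<longleftrightarrow> x \<in> annulus_polar ` S"
      using null by eventually_elim (auto simp: im)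
  qed (use imB in auto)
  have lm: "annulus_polar ` S \<in> lmeasurable"
  proof (rule bounded_set_imp_lmeasurable)
    show "bounded (annulus_polar ` S)"
      by (rule bounded_subset[of "ball 0 b"]) (auto simp: im W_def)
  qed (use imB in auto)
  have "((\<lambda>p. \<bar>det (matrix (annulus_polar_deriv p))\<bar>) has_integral measure lebesgue (annulus_polar ` S)) S"
    using lm S
    by (subst has_measure_differentiable_image[OF _ annulus_polar_has_derivative inj, symmetric]) auto
  then have "integral\<^sup>N lborel (\<lambda>p. ennreal \<bar>p $ 1\<bar> * indicator S p) = ennreal (measure lebesgue (annulus_polar ` S))"
    unfolding det_annulus_polar_deriv
    by (intro nn_integral_has_integral_lebesgue') auto
  also have "\<dots> = emeasure lebesgue (annulus_polar ` S)"
    by (rule emeasure_eq_measure2[OF lm, symmetric])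
  also have "\<dots> = emeasure lborel (annulus_polar ` S)"
    using imB by (subst emeasure_completion) simp_all
  also have "\<dots> = emeasure lborel W" by (rule eW[symmetric])
  finally have "emeasure lborel W = (\<integral>\<^sup>+r. \<integral>\<^sup>+\<theta>. ennreal \<bar>r\<bar> * indicator S (vector [r, \<theta>]) \<partial>lborel \<partial>lborel)"
    by (simp add: nn_integral_lborel_vector)
  also have "\<dots> = (\<integral>\<^sup>+r. \<integral>\<^sup>+x. ennreal (r * indicator {a<..<b} r) * indicator A (r *\<^sub>R x) \<partial>circle_measure \<partial>lborel)"
  proof (rule nn_integral_cong)
    fix r :: real
    have "(\<integral>\<^sup>+x. ennreal (r * indicator {a<..<b} r) * indicator A (r *\<^sub>R x) \<partial>circle_measure)
        = (\<integral>\<^sup>+\<theta>. ennreal (r * indicator {a<..<b} r) * indicator A (r *\<^sub>R unit_vec \<theta>) * indicator {0..<2 * pi} \<theta> \<partial>lborel)"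
      unfolding circle_measure_def
      by (subst nn_integral_distr) (auto simp: nn_integral_restrict_space intro!: measurable_restrict_space1)
    also have "\<dots> = (\<integral>\<^sup>+\<theta>. ennreal \<bar>r\<bar> * indicator S (vector [r, \<theta>]) \<partial>lborel)"
    proof (rule nn_integral_cong_AE)
      have "AE \<theta> in lborel. \<theta> \<noteq> (0::real)" by (rule AE_lborel_singleton)
      then show "AE \<theta> in lborel. ennreal (r * indicator {a<..<b} r) * indicator A (r *\<^sub>R unit_vec \<theta>)
          * indicator {0..<2 * pi} \<theta> = ennreal \<bar>r\<bar> * indicator S (vector [r, \<theta>])"
        by eventually_elim
          (use ab in \<open>auto simp: S_def annulus_polar_def indicator_def\<close>)
    qed
    finally show "(\<integral>\<^sup>+\<theta>. ennreal \<bar>r\<bar> * indicator S (vector [r, \<theta>]) \<partial>lborel)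
        = (\<integral>\<^sup>+x. ennreal (r * indicator {a<..<b} r) * indicator A (r *\<^sub>R x) \<partial>circle_measure)" by simp
  qed
  finally show ?thesis by (simp add: W_def)
qed

interpretation circle_measure: finite_measure circle_measure
  by (rule finite_measure_circle_measure)

interpretation polar: pair_sigma_finite lborel circle_measure
  by standard

lemma density_annulus_polar:
  assumes "0 \<le> a"
  shows "density lborel (indicator {x. a < norm x \<and> norm x < b})
    = distr (density (lborel \<Otimes>\<^sub>M circle_measure) (\<lambda>p. ennreal (fst p * indicator {a<..<b} (fst p))))
        borel (\<lambda>p. fst p *\<^sub>R snd p)" (is "?M = distr ?P borel ?f")
proof (rule measure_eqI)
  fix A assume "A \<in> sets ?M"
  then have A [measurable]: "A \<in> sets borel" by simp
  have [measurable]: "?f \<in> borel_measurable (lborel \<Otimes>\<^sub>M circle_measure)" by measurable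
  have "emeasure ?M A = emeasure lborel (A \<inter> {x. a < norm x \<and> norm x < b})"
    by (subst emeasure_density) (auto simp: Int_commute simp flip: indicator_inter_arith)
  also have "\<dots> = (\<integral>\<^sup>+p. ennreal (fst p * indicator {a<..<b} (fst p)) * indicator A (fst p *\<^sub>R snd p) \<partial>(lborel \<Otimes>\<^sub>M circle_measure))"
    by (subst emeasure_annulus_polar[OF assms A], subst circle_measure.nn_integral_fst[symmetric]) auto
  also have "\<dots> = emeasure (distr ?P borel ?f) A"
  proof -
    have [measurable]: "?f -` A \<in> sets (borel \<Otimes>\<^sub>M borel)"
      using measurable_sets[of ?f "lborel \<Otimes>\<^sub>M circle_measure" borel A]
      by (simp add: space_pair_measure cong: sets_pair_measure_cong)
    show ?thesis
      by (subst emeasure_distr, simp, simp, subst emeasure_density)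
        (auto intro!: nn_integral_cong simp: indicator_def space_pair_measure)
  qed
  finally show "emeasure ?M A = emeasure (distr ?P borel ?f) A" .
qed simp

lemma
  fixes f :: "real^2 \<Rightarrow> real"
  assumes a: "0 \<le> a" and f [measurable]: "f \<in> borel_measurable borel"
  shows integrable_annulus_polar:
      "set_integrable lborel {x. a < norm x \<and> norm x < b} f \<longleftrightarrow>
        integrable (lborel \<Otimes>\<^sub>M circle_measure) (\<lambda>(r, x). r * indicator {a<..<b} r * f (r *\<^sub>R x))"
    and integral_annulus_polar:
      "(LINT x:{x. a < norm x \<and> norm x < b}|lborel. f x)
        = integral\<^sup>L (lborel \<Otimes>\<^sub>M circle_measure) (\<lambda>(r, x). r * indicator {a<..<b} r * f (r *\<^sub>R x))"
proof -
  let ?W = "{x :: real^2. a < norm x \<and> norm x < b}"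
  have e: "(indicator ?W :: _ \<Rightarrow> ennreal) = (\<lambda>x. ennreal (indicator ?W x))"
    by (auto simp: indicator_def fun_eq_iff)
  have nn: "AE p in lborel \<Otimes>\<^sub>M circle_measure. 0 \<le> fst p * indicator {a<..<b} (fst p)"
    using a by (intro AE_I2) (auto simp: indicator_def)
  have "set_integrable lborel ?W f \<longleftrightarrow> integrable (density lborel (indicator ?W)) f"
    unfolding set_integrable_def e by (subst integrable_density) auto
  also have "\<dots> \<longleftrightarrow> integrable (lborel \<Otimes>\<^sub>M circle_measure) (\<lambda>(r, x). r * indicator {a<..<b} r * f (r *\<^sub>R x))"
    unfolding density_annulus_polar[OF a]
    by (subst integrable_distr_eq, simp, simp, subst integrable_density) (auto simp: nn case_prod_unfold)
  finally show "set_integrable lborel ?W f \<longleftrightarrow>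
        integrable (lborel \<Otimes>\<^sub>M circle_measure) (\<lambda>(r, x). r * indicator {a<..<b} r * f (r *\<^sub>R x))" .
  have "(LINT x:?W|lborel. f x) = (LINT x|density lborel (indicator ?W). f x)"
    unfolding set_lebesgue_integral_def e by (subst integral_density) auto
  also have "\<dots> = integral\<^sup>L (lborel \<Otimes>\<^sub>M circle_measure) (\<lambda>(r, x). r * indicator {a<..<b} r * f (r *\<^sub>R x))"
    unfolding density_annulus_polar[OF a]
    by (subst integral_distr, simp, simp, subst integral_density) (auto simp: nn case_prod_unfold)
  finally show "(LINT x:?W|lborel. f x)
        = integral\<^sup>L (lborel \<Otimes>\<^sub>M circle_measure) (\<lambda>(r, x). r * indicator {a<..<b} r * f (r *\<^sub>R x))" .
qed

section \<open>Differential calculus\<close>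

lemma partial_deriv_eq: "GDERIV f x :> d \<Longrightarrow> partial_deriv i f x = d $ i"
  unfolding gderiv_def partial_deriv_def
  by (drule frechet_derivative_at, drule sym) (simp add: inner_axis')

lemma differentiable_GDERIV:
  fixes f :: "real^'n::finite \<Rightarrow> real"
  assumes "f differentiable (at x)"
  shows "GDERIV f x :> (\<chi> i. partial_deriv i f x)"
proof -
  let ?F = "frechet_derivative f (at x)"
  have F: "(f has_derivative ?F) (at x)" using assms frechet_derivative_works by blast
  then have lin: "linear ?F" by (rule has_derivative_linear)
  have "?F h = h \<bullet> (\<chi> i. partial_deriv i f x)" for h
  proof -
    have "?F h = ?F (\<Sum>i\<in>UNIV. h $ i *\<^sub>R axis i 1)"
      using basis_expansion[of h] by (simp add: scalar_mult_eq_scaleR)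
    also have "\<dots> = (\<Sum>i\<in>UNIV. h $ i * ?F (axis i 1))"
      by (simp add: linear_sum[OF lin] linear_scale[OF lin])
    finally show ?thesis by (simp add: inner_vec_def partial_deriv_def)
  qed
  then have "?F = (\<lambda>h. h \<bullet> (\<chi> i. partial_deriv i f x))" by (rule ext)
  with F show ?thesis unfolding gderiv_def by simp
qed

lemma C1_onI:
  assumes "\<And>x. x \<in> S \<Longrightarrow> GDERIV f x :> D x" "continuous_on S D"
  shows "C1_on S f"
proof -
  have "continuous_on S (partial_deriv i f)" for i
  proof -
    have "continuous_on S (\<lambda>x. D x $ i)" by (intro continuous_intros assms)
    then show ?thesis by (rule continuous_on_eq) (simp add: partial_deriv_eq[OF assms(1)])
  qed
  then show ?thesis using assms(1) by (auto simp: C1_on_def gderiv_def differentiable_def)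
qed

lemma C1_onD:
  assumes "C1_on S f"
  shows "x \<in> S \<Longrightarrow> GDERIV f x :> (\<chi> i. partial_deriv i f x)"
    and "continuous_on S (\<lambda>x. \<chi> i. partial_deriv i f x)"
    and "continuous_on S f"
    and "continuous_on S (partial_deriv i f)"
proof -
  show "x \<in> S \<Longrightarrow> GDERIV f x :> (\<chi> i. partial_deriv i f x)"
    using assms by (auto simp: C1_on_def intro: differentiable_GDERIV)
  show "continuous_on S (\<lambda>x. \<chi> i. partial_deriv i f x)"
    using assms by (auto simp: C1_on_def intro!: continuous_on_vec_lambda)
  show "continuous_on S f"
    using assms by (auto simp: C1_on_def intro!: differentiable_imp_continuous_on differentiable_at_imp_differentiable_on)
  show "continuous_on S (partial_deriv i f)" using assms by (auto simp: C1_on_def)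
qed

lemma C1_on_measurable:
  fixes f :: "real^'n::finite \<Rightarrow> real"
  assumes "C1_on UNIV f"
  shows "f \<in> borel_measurable borel" and "partial_deriv i f \<in> borel_measurable borel"
  using C1_onD(3,4)[OF assms] by (auto intro: borel_measurable_continuous_onI)

lemma C1_on_subset: "C1_on S f \<Longrightarrow> T \<subseteq> S \<Longrightarrow> C1_on T f"
  by (auto simp: C1_on_def intro: continuous_on_subset)

lemma C1_on_const: "C1_on S (\<lambda>x. c)"
  by (rule C1_onI[where D = "\<lambda>_. 0"]) (auto simp: GDERIV_const)

lemma C1_on_add: "C1_on S f \<Longrightarrow> C1_on S g \<Longrightarrow> C1_on S (\<lambda>x. f x + g x)"
  by (rule C1_onI[OF GDERIV_add], erule (1) C1_onD(1), erule (1) C1_onD(1))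
    (intro continuous_intros C1_onD(2))

lemma C1_on_mult: "C1_on S f \<Longrightarrow> C1_on S g \<Longrightarrow> C1_on S (\<lambda>x. f x * g x)"
  by (rule C1_onI[OF GDERIV_mult], erule (1) C1_onD(1), erule (1) C1_onD(1))
    (intro continuous_intros C1_onD(2,3))

lemma partial_deriv_mult:
  assumes "C1_on S f" "C1_on S g" "x \<in> S"
  shows "partial_deriv i (\<lambda>x. f x * g x) x = f x * partial_deriv i g x + g x * partial_deriv i f x"
  using partial_deriv_eq[OF GDERIV_mult[OF C1_onD(1)[OF assms(1,3)] C1_onD(1)[OF assms(2,3)]]]
  by simp

lemma GDERIV_nth: "GDERIV (\<lambda>x::real^'n::finite. x $ i) x :> axis i 1"
  unfolding gderiv_def inner_axis
  using bounded_linear.has_derivative[OF bounded_linear_vec_nth has_derivative_ident] by simp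

lemma C1_on_nth: "C1_on S (\<lambda>x. x $ i)"
  by (rule C1_onI[where D = "\<lambda>_. axis i 1"]) (auto simp: GDERIV_nth)

lemma C1_on_real_polynomial_function:
  "real_polynomial_function p \<Longrightarrow> C1_on S (p :: real^'n::finite \<Rightarrow> real)"
proof (induction rule: real_polynomial_function.induct)
  case (linear f)
  have sum: "f x = (\<Sum>i\<in>UNIV. x $ i * f (axis i 1))" for x
  proof -
    interpret linear f using linear by (simp add: bounded_linear.linear)
    have "f x = f (\<Sum>i\<in>UNIV. x $ i *\<^sub>R axis i 1)"
      using basis_expansion[of x] by (simp add: scalar_mult_eq_scaleR)
    then show ?thesis by (simp add: sum scale)
  qed
  have "f x = x \<bullet> (\<chi> i. f (axis i 1))" for x
    unfolding inner_vec_def inner_real_def vec_lambda_beta by (rule sum)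
  then have eq: "f = (\<lambda>x. x \<bullet> (\<chi> i. f (axis i 1)))" by (rule ext)
  have G: "GDERIV (\<lambda>x. x \<bullet> v) x :> v" for x v :: "real^'n"
    unfolding gderiv_def by (rule bounded_linear.has_derivative[OF bounded_linear_inner_left has_derivative_ident])
  have "GDERIV f x :> (\<chi> i. f (axis i 1))" for x
    using G[of "\<chi> i. f (axis i 1)" x] unfolding eq[symmetric] .
  then show ?case by (rule C1_onI) auto
qed (auto intro: C1_on_const C1_on_add C1_on_mult)

lemma GDERIV_radial:
  assumes "(Y has_real_derivative Y') (at (norm x))" "x \<noteq> 0"
  shows "GDERIV (\<lambda>x. Y (norm x)) x :> Y' *\<^sub>R sgn x"
  by (rule GDERIV_DERIV_compose[OF GDERIV_norm]) (use assms in auto)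

lemma C1_on_radial:
  fixes S :: "(real^'n::finite) set"
  assumes "\<And>r. r \<in> T \<Longrightarrow> (Y has_real_derivative Y' r) (at r)" "continuous_on T Y'"
    and "\<And>x. x \<in> S \<Longrightarrow> norm x \<in> T" "0 \<notin> S"
  shows "C1_on S (\<lambda>x. Y (norm x))"
proof (rule C1_onI[where D = "\<lambda>x. Y' (norm x) *\<^sub>R sgn x"])
  show "continuous_on S (\<lambda>x. Y' (norm x) *\<^sub>R sgn x)"
    by (intro continuous_intros continuous_on_compose2[OF assms(2)]) (use assms in auto)
  show "GDERIV (\<lambda>x. Y (norm x)) x :> Y' (norm x) *\<^sub>R sgn x" if "x \<in> S" for x
    by (rule GDERIV_radial) (use assms that in auto)
qed

lemma C1_on_Un:
  assumes "open S" "open T" "C1_on S f" "C1_on T f"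
  shows "C1_on (S \<union> T) f"
  using assms by (auto simp: C1_on_def intro: continuous_on_open_Un)

lemma GDERIV_transform_open:
  assumes "GDERIV f x :> d" "open S" "x \<in> S" "\<And>y. y \<in> S \<Longrightarrow> g y = f y"
  shows "GDERIV g x :> d"
  using assms(1) unfolding gderiv_def
  by (rule has_derivative_transform_within_open[OF _ assms(2,3)]) (simp add: assms(4))

lemma C1_on_cong:
  assumes "open S" "C1_on S f" "\<And>x. x \<in> S \<Longrightarrow> g x = f x"
  shows "C1_on S g"
  by (rule C1_onI[OF GDERIV_transform_open[OF C1_onD(1)[OF assms(2)]] C1_onD(2)[OF assms(2)]])
    (use assms in auto)

lemma C1_on_zero:
  assumes "open S" "\<And>x. x \<in> S \<Longrightarrow> f x = 0"
  shows "C1_on S f"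
  by (rule C1_on_cong[OF assms(1) C1_on_const[of _ 0]]) (rule assms(2))

lemma partial_deriv_cong:
  assumes "GDERIV f x :> d" "open S" "x \<in> S" "\<And>y. y \<in> S \<Longrightarrow> g y = f y"
  shows "partial_deriv i g x = partial_deriv i f x"
  using partial_deriv_eq[OF assms(1)] partial_deriv_eq[OF GDERIV_transform_open[OF assms]] by simp

lemma partial_deriv_zero:
  assumes "open S" "x \<in> S" "\<And>y. y \<in> S \<Longrightarrow> f y = 0"
  shows "partial_deriv i f x = 0"
  using partial_deriv_eq[OF GDERIV_transform_open[OF GDERIV_const assms]] by simp

lemma C1_on_radial_mult:
  fixes f :: "real^'n::finite \<Rightarrow> real"
  assumes f: "C1_on UNIV f"
    and Y: "\<And>r. (Y has_real_derivative Y' r) (at r)" "continuous_on UNIV Y'"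
    and a: "0 < a" "\<And>r. r \<le> a \<Longrightarrow> Y r = 0"
  shows "C1_on UNIV (\<lambda>x. f x * Y (norm x))"
proof -
  have "C1_on (- {0}) (\<lambda>x. f x * Y (norm x))"
    by (intro C1_on_mult C1_on_subset[OF f] C1_on_radial[where T = UNIV, OF Y]) auto
  moreover have "C1_on (ball 0 a) (\<lambda>x. f x * Y (norm x))"
    by (rule C1_on_zero) (use a in auto)
  ultimately have "C1_on (- {0} \<union> ball 0 a) (\<lambda>x. f x * Y (norm x))"
    by (intro C1_on_Un) auto
  moreover have "- {0} \<union> ball 0 a = (UNIV :: (real^'n) set)" using a by auto
  ultimately show ?thesis by simp
qed

lemma partial_deriv_radial_mult:
  fixes f :: "real^'n::finite \<Rightarrow> real"
  assumes f: "C1_on UNIV f"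
    and Y: "\<And>r. (Y has_real_derivative Y' r) (at r)" and x: "x \<noteq> 0"
  shows "partial_deriv i (\<lambda>x. f x * Y (norm x)) x
    = f x * (Y' (norm x) * (x $ i / norm x)) + Y (norm x) * partial_deriv i f x"
  using partial_deriv_eq[OF GDERIV_mult[OF C1_onD(1)[OF f UNIV_I] GDERIV_radial[OF Y x]], of i]
  by (simp add: sgn_div_norm divide_inverse mult_ac)

section \<open>Cutoff functions\<close>

text \<open>A step from 0 to 1 on the unit interval whose derivative is a tent. It is only once continuously
  differentiable, which suffices for test functions.\<close>

definition ramp :: "real \<Rightarrow> real" where
  "ramp t = 2 * (max 0 t)\<^sup>2 - 4 * (max 0 (t - 1/2))\<^sup>2 + 2 * (max 0 (t - 1))\<^sup>2"

definition ramp' :: "real \<Rightarrow> real" where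
  "ramp' t = 4 * max 0 t - 8 * max 0 (t - 1/2) + 4 * max 0 (t - 1)"

lemma DERIV_max_square: "((\<lambda>t. (max 0 t)\<^sup>2) has_real_derivative 2 * max 0 t) (at (t::real))"
proof -
  consider "t < 0" | "t = 0" | "t > 0" by linarith
  then show ?thesis
  proof cases
    case 1
    have "((\<lambda>t. 0) has_real_derivative 0) (at t)" by simp
    then have "((\<lambda>t. (max 0 t)\<^sup>2) has_real_derivative 0) (at t)"
      by (rule has_field_derivative_transform_within_open[of _ _ _ "{..<0}"]) (use 1 in auto)
    then show ?thesis using 1 by simp
  next
    case 2
    have "((\<lambda>h. ((max 0 h)\<^sup>2 - 0) / h) \<longlongrightarrow> 0) (at (0::real))"
    proof (rule tendsto_0_le[where K = 1])
      show "((\<lambda>h. h) \<longlongrightarrow> 0) (at (0::real))" by (rule tendsto_ident_at)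
      show "\<forall>\<^sub>F h in at (0::real). norm (((max 0 h)\<^sup>2 - 0) / h) \<le> norm h * (1::real)"
      proof (intro always_eventually allI)
        fix h :: real
        show "norm (((max 0 h)\<^sup>2 - 0) / h) \<le> norm h * 1"
          by (cases "h \<le> 0") (auto simp: power2_eq_square)
      qed
    qed
    then show ?thesis using 2 by (simp add: DERIV_def)
  next
    case 3
    have "((\<lambda>t. t\<^sup>2) has_real_derivative 2 * t) (at t)" by (auto intro!: derivative_eq_intros)
    then have "((\<lambda>t. (max 0 t)\<^sup>2) has_real_derivative 2 * t) (at t)"
      by (rule has_field_derivative_transform_within_open[of _ _ _ "{0<..}"]) (use 3 in auto)
    then show ?thesis using 3 by simp
  qed
qed

lemma DERIV_ramp: "(ramp has_real_derivative ramp' t) (at t)"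
proof -
  have "((\<lambda>t. (max 0 (t - c))\<^sup>2) has_real_derivative 2 * max 0 (t - c)) (at t)" for c :: real
    by (rule DERIV_chain2[OF DERIV_max_square, THEN DERIV_cong]) (auto intro!: derivative_eq_intros)
  from DERIV_add[OF DERIV_diff[OF DERIV_cmult[OF this[of 0], of 2] DERIV_cmult[OF this[of "1/2"], of 4]]
      DERIV_cmult[OF this[of 1], of 2]]
  show ?thesis unfolding ramp_def[abs_def] ramp'_def by simp
qed

lemma continuous_on_ramp' [continuous_intros]:
  "continuous_on S f \<Longrightarrow> continuous_on S (\<lambda>x. ramp' (f x))"
  unfolding ramp'_def by (intro continuous_intros)

lemma continuous_on_ramp [continuous_intros]:
  "continuous_on S f \<Longrightarrow> continuous_on S (\<lambda>x. ramp (f x))"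
  unfolding ramp_def by (intro continuous_intros)

lemma ramp_le_0: "t \<le> 0 \<Longrightarrow> ramp t = 0"
  and ramp_ge_1: "1 \<le> t \<Longrightarrow> ramp t = 1"
  and ramp'_le_0: "t \<le> 0 \<Longrightarrow> ramp' t = 0"
  and ramp'_ge_1: "1 \<le> t \<Longrightarrow> ramp' t = 0"
  and ramp'_nonneg: "0 \<le> ramp' t"
  and ramp'_le: "ramp' t \<le> 2"
  by (auto simp: ramp_def ramp'_def max_def power2_eq_square algebra_simps)

lemma ramp_mono: "s \<le> t \<Longrightarrow> ramp s \<le> ramp t"
  by (rule DERIV_nonneg_imp_nondecreasing) (use DERIV_ramp ramp'_nonneg in blast)+

lemma ramp_nonneg: "0 \<le> ramp t" and ramp_le_1: "ramp t \<le> 1"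
  using ramp_mono[of 0 t] ramp_le_0[of t] ramp_le_0[of 0] ramp_mono[of t 1] ramp_ge_1[of t] ramp_ge_1[of 1]
  by (cases "0 \<le> t"; cases "t \<le> 1"; simp)+

text \<open>The cutoffs below vanish up to distance \<open>1 / cutoff_scale a b n\<close> from one boundary circle and
  are 1 from twice that distance on. The factor keeps the transition layers of the inner and of the
  outer cutoff apart. The kernels are the derivatives, up to sign, and have integral 1.\<close>

definition cutoff_scale :: "real \<Rightarrow> real \<Rightarrow> nat \<Rightarrow> real" where
  "cutoff_scale a b n = 4 * (real n + 1) / (b - a)"

definition inner_cutoff :: "real \<Rightarrow> real \<Rightarrow> nat \<Rightarrow> real \<Rightarrow> real" where
  "inner_cutoff a b n r = ramp (cutoff_scale a b n * (r - a) - 1)"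

definition inner_kernel :: "real \<Rightarrow> real \<Rightarrow> nat \<Rightarrow> real \<Rightarrow> real" where
  "inner_kernel a b n r = cutoff_scale a b n * ramp' (cutoff_scale a b n * (r - a) - 1)"

definition outer_cutoff :: "real \<Rightarrow> real \<Rightarrow> nat \<Rightarrow> real \<Rightarrow> real" where
  "outer_cutoff a b n r = ramp (cutoff_scale a b n * (b - r) - 1)"

definition outer_kernel :: "real \<Rightarrow> real \<Rightarrow> nat \<Rightarrow> real \<Rightarrow> real" where
  "outer_kernel a b n r = cutoff_scale a b n * ramp' (cutoff_scale a b n * (b - r) - 1)"

lemma DERIV_inner_cutoff: "(inner_cutoff a b n has_real_derivative inner_kernel a b n r) (at r)"
  unfolding inner_cutoff_def[abs_def] inner_kernel_def
  by (rule DERIV_chain2[OF DERIV_ramp, THEN DERIV_cong]) (auto intro!: derivative_eq_intros)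

lemma DERIV_outer_cutoff: "(outer_cutoff a b n has_real_derivative - outer_kernel a b n r) (at r)"
  unfolding outer_cutoff_def[abs_def] outer_kernel_def
  by (rule DERIV_chain2[OF DERIV_ramp, THEN DERIV_cong]) (auto intro!: derivative_eq_intros)

lemma continuous_on_cutoff [continuous_intros]:
  assumes "continuous_on S f"
  shows "continuous_on S (\<lambda>x. inner_cutoff a b n (f x))"
    and "continuous_on S (\<lambda>x. inner_kernel a b n (f x))"
    and "continuous_on S (\<lambda>x. outer_cutoff a b n (f x))"
    and "continuous_on S (\<lambda>x. outer_kernel a b n (f x))"
  unfolding inner_cutoff_def inner_kernel_def outer_cutoff_def outer_kernel_def
  by (intro continuous_intros assms)+

lemma cutoff_bounds:
  "0 \<le> inner_cutoff a b n r" "inner_cutoff a b n r \<le> 1"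
  "0 \<le> outer_cutoff a b n r" "outer_cutoff a b n r \<le> 1"
  by (auto simp: inner_cutoff_def outer_cutoff_def ramp_nonneg ramp_le_1)

lemma cutoff_scale_pos: "a < b \<Longrightarrow> 0 < cutoff_scale a b n"
  by (simp add: cutoff_scale_def)

lemma cutoff_measurable [measurable]:
  "inner_cutoff a b n \<in> borel_measurable borel" "inner_kernel a b n \<in> borel_measurable borel"
  "outer_cutoff a b n \<in> borel_measurable borel" "outer_kernel a b n \<in> borel_measurable borel"
  by (intro borel_measurable_continuous_onI continuous_on_cutoff continuous_on_id)+

lemma
  assumes "a < b"
  shows inner_cutoff_eq_0: "r \<le> a + 1 / cutoff_scale a b n \<Longrightarrow> inner_cutoff a b n r = 0"
    and inner_cutoff_eq_1: "a + 2 / cutoff_scale a b n \<le> r \<Longrightarrow> inner_cutoff a b n r = 1"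
    and outer_cutoff_eq_0: "b - 1 / cutoff_scale a b n \<le> r \<Longrightarrow> outer_cutoff a b n r = 0"
    and outer_cutoff_eq_1: "r \<le> b - 2 / cutoff_scale a b n \<Longrightarrow> outer_cutoff a b n r = 1"
    and inner_kernel_eq_0: "r \<le> a + 1 / cutoff_scale a b n \<or> a + 2 / cutoff_scale a b n \<le> r
      \<Longrightarrow> inner_kernel a b n r = 0"
    and outer_kernel_eq_0: "b - 1 / cutoff_scale a b n \<le> r \<or> r \<le> b - 2 / cutoff_scale a b n
      \<Longrightarrow> outer_kernel a b n r = 0"
    and kernel_bounds: "0 \<le> inner_kernel a b n r" "inner_kernel a b n r \<le> 2 * cutoff_scale a b n"
      "0 \<le> outer_kernel a b n r" "outer_kernel a b n r \<le> 2 * cutoff_scale a b n"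
    and cutoff_scale_ge: "2 / cutoff_scale a b n \<le> (b - a) / 2"
proof -
  define m where "m = cutoff_scale a b n"
  have m: "0 < m" using cutoff_scale_pos[OF assms] by (simp add: m_def)
  have "r \<le> a + c / m \<longleftrightarrow> m * (r - a) \<le> c" "a + c / m \<le> r \<longleftrightarrow> c \<le> m * (r - a)"
    "b - c / m \<le> r \<longleftrightarrow> m * (b - r) \<le> c" "r \<le> b - c / m \<longleftrightarrow> c \<le> m * (b - r)" for c
    using m by (auto simp: field_simps)
  note scale = this[folded m_def]
  show "r \<le> a + 1 / cutoff_scale a b n \<Longrightarrow> inner_cutoff a b n r = 0"
    and "a + 2 / cutoff_scale a b n \<le> r \<Longrightarrow> inner_cutoff a b n r = 1"
    and "b - 1 / cutoff_scale a b n \<le> r \<Longrightarrow> outer_cutoff a b n r = 0"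
    and "r \<le> b - 2 / cutoff_scale a b n \<Longrightarrow> outer_cutoff a b n r = 1"
    and "r \<le> a + 1 / cutoff_scale a b n \<or> a + 2 / cutoff_scale a b n \<le> r \<Longrightarrow> inner_kernel a b n r = 0"
    and "b - 1 / cutoff_scale a b n \<le> r \<or> r \<le> b - 2 / cutoff_scale a b n \<Longrightarrow> outer_kernel a b n r = 0"
    unfolding inner_cutoff_def outer_cutoff_def inner_kernel_def outer_kernel_def m_def[symmetric] scale
    by (auto intro: ramp_le_0 ramp_ge_1 ramp'_le_0 ramp'_ge_1)
  show "0 \<le> inner_kernel a b n r" "inner_kernel a b n r \<le> 2 * cutoff_scale a b n"
      "0 \<le> outer_kernel a b n r" "outer_kernel a b n r \<le> 2 * cutoff_scale a b n"
    unfolding inner_kernel_def outer_kernel_def m_def[symmetric]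
    using m ramp'_nonneg ramp'_le by (auto simp: mult.commute[of 2])
  have "2 * 2 \<le> m * (b - a)" using assms by (simp add: m_def cutoff_scale_def)
  then show "2 / cutoff_scale a b n \<le> (b - a) / 2"
    unfolding m_def[symmetric] using m by (simp add: field_simps)
qed

lemma cutoff_scale_at_top: "a < b \<Longrightarrow> (\<lambda>n. c / cutoff_scale a b n) \<longlonglongrightarrow> 0"
  unfolding cutoff_scale_def by real_asymp

lemma cutoff_tendsto_1:
  assumes "a < r" "r < b"
  shows "(\<lambda>n. inner_cutoff a b n r) \<longlonglongrightarrow> 1" "(\<lambda>n. outer_cutoff a b n r) \<longlonglongrightarrow> 1"
proof -
  have ab: "a < b" using assms by linarith
  have "\<forall>\<^sub>F n in sequentially. 2 / cutoff_scale a b n < min (r - a) (b - r)"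
    by (rule order_tendstoD[OF cutoff_scale_at_top[OF ab]]) (use assms in auto)
  then have "\<forall>\<^sub>F n in sequentially. inner_cutoff a b n r = 1"
    "\<forall>\<^sub>F n in sequentially. outer_cutoff a b n r = 1"
    by (eventually_elim; intro inner_cutoff_eq_1 outer_cutoff_eq_1 ab; simp)+
  then show "(\<lambda>n. inner_cutoff a b n r) \<longlonglongrightarrow> 1" "(\<lambda>n. outer_cutoff a b n r) \<longlonglongrightarrow> 1"
    by (auto intro: tendsto_eventually)
qed

definition annulus_cutoff :: "real \<Rightarrow> real \<Rightarrow> nat \<Rightarrow> real \<Rightarrow> real" where
  "annulus_cutoff a b n r = inner_cutoff a b n r * outer_cutoff a b n r"

lemma DERIV_annulus_cutoff:
  assumes "a < b"
  shows "(annulus_cutoff a b n has_real_derivative inner_kernel a b n r - outer_kernel a b n r) (at r)"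
proof -
  have 1: "inner_kernel a b n r * outer_cutoff a b n r = inner_kernel a b n r"
  proof (cases "r \<le> a + 2 / cutoff_scale a b n")
    case True
    then have "r \<le> b - 2 / cutoff_scale a b n" using cutoff_scale_ge[OF assms, of n] by argo
    then show ?thesis by (simp add: outer_cutoff_eq_1[OF assms])
  qed (simp add: inner_kernel_eq_0[OF assms])
  have 2: "outer_kernel a b n r * inner_cutoff a b n r = outer_kernel a b n r"
  proof (cases "b - 2 / cutoff_scale a b n \<le> r")
    case True
    then have "a + 2 / cutoff_scale a b n \<le> r" using cutoff_scale_ge[OF assms, of n] by argo
    then show ?thesis by (simp add: inner_cutoff_eq_1[OF assms])
  qed (simp add: outer_kernel_eq_0[OF assms])
  show ?thesis
    unfolding annulus_cutoff_def[abs_def]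
    using 1 2
    by (intro DERIV_mult[OF DERIV_inner_cutoff DERIV_outer_cutoff, THEN DERIV_cong]) auto
qed

lemma annulus_cutoff_bounds: "0 \<le> annulus_cutoff a b n r" "annulus_cutoff a b n r \<le> 1"
  by (auto simp: annulus_cutoff_def cutoff_bounds mult_le_one)

lemma annulus_cutoff_tendsto_1: "a < r \<Longrightarrow> r < b \<Longrightarrow> (\<lambda>n. annulus_cutoff a b n r) \<longlonglongrightarrow> 1"
  unfolding annulus_cutoff_def using tendsto_mult[OF cutoff_tendsto_1] by fastforce

lemma annulus_cutoff_measurable [measurable]: "annulus_cutoff a b n \<in> borel_measurable borel"
  unfolding annulus_cutoff_def[abs_def] by measurable

lemma test_function_radial_mult:
  assumes ab: "0 < a" "a < b" and f: "C1_on UNIV f"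
    and Y: "\<And>r. (Y has_real_derivative Y' r) (at r)" "continuous_on UNIV Y'"
    and supp: "0 < e" "\<And>r. r \<le> a + e \<or> b - e \<le> r \<Longrightarrow> Y r = 0"
  shows "test_function (annulus a b) (\<lambda>x. f x * Y (norm x))"
  unfolding test_function_def
proof (intro conjI exI[of _ "cball 0 (b - e) - ball 0 (a + e)"])
  show "C1_on UNIV (\<lambda>x. f x * Y (norm x))"
    by (rule C1_on_radial_mult[OF f Y, of a]) (use ab supp in auto)
  show "compact (cball 0 (b - e) - ball 0 (a + e) :: (real^2) set)"
    by (intro compact_diff) auto
  show "cball 0 (b - e) - ball 0 (a + e) \<subseteq> annulus a b"
    using supp by (auto simp: annulus_def)
  show "\<forall>x. x \<notin> cball 0 (b - e) - ball 0 (a + e) \<longrightarrow> f x * Y (norm x) = 0"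
    using supp(2) by (auto simp: not_le not_less)
qed

lemma test_function_annulus_cutoff:
  assumes ab: "0 < a" "a < b" and f: "C1_on UNIV f"
  shows "test_function (annulus a b) (\<lambda>x. f x * annulus_cutoff a b n (norm x))"
proof (rule test_function_radial_mult[OF ab f DERIV_annulus_cutoff[OF ab(2)]])
  show "continuous_on UNIV (\<lambda>r. inner_kernel a b n r - outer_kernel a b n r)"
    by (intro continuous_intros)
  show "0 < 1 / cutoff_scale a b n" using cutoff_scale_pos[OF ab(2)] by simp
  show "annulus_cutoff a b n r = 0" if "r \<le> a + 1 / cutoff_scale a b n \<or> b - 1 / cutoff_scale a b n \<le> r" for r
    using that inner_cutoff_eq_0[OF ab(2)] outer_cutoff_eq_0[OF ab(2)] by (auto simp: annulus_cutoff_def)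
qed

section \<open>Bounded Borel functions and duality\<close>

text \<open>Indicators of open sets are limits of continuous functions, Dynkin's theorem leads to all Borel
  sets, and nonnegative functions are limits of simple ones.\<close>

lemma bounded_borel_functional_zero:
  fixes L :: "('a::metric_space \<Rightarrow> real) \<Rightarrow> real"
  assumes add: "\<And>f g B. f \<in> borel_measurable borel \<Longrightarrow> g \<in> borel_measurable borel \<Longrightarrow>
      (\<And>x. \<bar>f x\<bar> \<le> B) \<Longrightarrow> (\<And>x. \<bar>g x\<bar> \<le> B) \<Longrightarrow> L (\<lambda>x. f x + g x) = L f + L g"
    and cmult: "\<And>f B c. f \<in> borel_measurable borel \<Longrightarrow> (\<And>x. \<bar>f x\<bar> \<le> B) \<Longrightarrow> L (\<lambda>x. c * f x) = c * L f"
    and lim: "\<And>F f B. (\<And>n. F n \<in> borel_measurable borel) \<Longrightarrow> (\<And>n x. \<bar>F n x\<bar> \<le> B) \<Longrightarrow>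
      (\<And>x. (\<lambda>n. F n x) \<longlonglongrightarrow> f x) \<Longrightarrow> (\<lambda>n. L (F n)) \<longlonglongrightarrow> L f"
    and cont: "\<And>f B. continuous_on UNIV f \<Longrightarrow> (\<And>x. \<bar>f x\<bar> \<le> B) \<Longrightarrow> L f = 0"
    and f: "f \<in> borel_measurable borel" "\<And>x. \<bar>f x\<bar> \<le> B"
  shows "L f = 0"
proof -
  have ind: "\<bar>indicat_real A x\<bar> \<le> 1" for A and x :: 'a by (simp add: indicator_def)
  have L0: "L (\<lambda>x. 0) = 0" using cmult[of "\<lambda>x. 0" 0 0] by simp
  have L1: "L (\<lambda>x. 1) = 0" by (rule cont[of _ 1]) auto
  have zero_lim: "L g = 0" if "\<And>n. F n \<in> borel_measurable borel" "\<And>n x. \<bar>F n x\<bar> \<le> C"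
      "\<And>x. (\<lambda>n. F n x) \<longlonglongrightarrow> g x" "\<And>n. L (F n) = 0" for F g C
    using lim[OF that(1-3)] that(4) by (simp add: LIMSEQ_const_iff)
  have opn: "L (indicator A) = 0" if A: "open A" for A
  proof (cases "A = UNIV")
    case True
    then have "indicator A = (\<lambda>x. 1 :: real)" by auto
    then show ?thesis using L1 by simp
  next
    case False
    define F where "F n x = min 1 (real n * infdist x (- A))" for n x
    have Fc: "continuous_on UNIV (F n)" for n
      unfolding F_def by (intro continuous_intros)
    have Fb: "\<bar>F n x\<bar> \<le> 1" for n x by (simp add: F_def infdist_nonneg)
    show ?thesis
    proof (rule zero_lim)
      show "F n \<in> borel_measurable borel" for n by (rule borel_measurable_continuous_onI[OF Fc])
      show "\<bar>F n x\<bar> \<le> 1" for n x by (rule Fb)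
      show "L (F n) = 0" for n by (rule cont[OF Fc Fb])
      show "(\<lambda>n. F n x) \<longlonglongrightarrow> indicator A x" for x
      proof (cases "x \<in> A")
        case True
        have "0 < infdist x (- A)"
          using A True False in_closed_iff_infdist_zero[of "- A" x] infdist_nonneg[of x "- A"]
          by (auto simp: closed_Compl less_le)
        then obtain N :: nat where N: "1 / infdist x (- A) \<le> N" using real_arch_simple by blast
        have "F n x = 1" if "N \<le> n" for n
        proof -
          have "1 / infdist x (- A) \<le> n" using N that by linarith
          then show ?thesis using \<open>0 < infdist x (- A)\<close> by (simp add: F_def field_simps)
        qed
        then have "\<forall>\<^sub>F n in sequentially. F n x = indicator A x"
          using True by (auto simp: eventually_sequentially intro!: exI[of _ N])
        then show ?thesis by (rule tendsto_eventually)
      next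
        case outside: False
        then have "F n x = 0" for n by (simp add: F_def)
        then show ?thesis using outside by simp
      qed
    qed
  qed
  have bor: "L (indicator A) = 0" if "A \<in> sets borel" for A
  proof -
    have "Int_stable {S :: 'a set. open S}" "{S :: 'a set. open S} \<subseteq> Pow UNIV"
      "A \<in> sigma_sets UNIV {S. open S}"
      using that by (auto simp: borel_def Int_stable_def)
    then show ?thesis
    proof (induction rule: sigma_sets_induct_disjoint)
      case (compl A)
      then have [measurable]: "A \<in> sets borel" by (simp add: borel_def)
      have "L (\<lambda>x. indicator A x + indicator (UNIV - A) x) = L (indicator A) + L (indicator (UNIV - A))"
        by (rule add[of _ _ 1]) (auto simp: ind)
      moreover have "(\<lambda>x. indicator A x + indicator (UNIV - A) x) = (\<lambda>x. 1 :: real)"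
        by (auto simp: indicator_def)
      ultimately show ?case using compl L1 by simp
    next
      case (union A)
      then have [measurable]: "\<And>i. A i \<in> sets borel" by (auto simp: borel_def)
      define F where "F n = (indicator (\<Union>i<n. A i) :: 'a \<Rightarrow> real)" for n
      have Fz: "L (F n) = 0" for n
      proof (induction n)
        case 0 then show ?case using L0 by (simp add: F_def)
      next
        case (Suc n)
        have "F (Suc n) = (\<lambda>x. F n x + indicator (A n) x)"
        proof
          fix x
          have "(\<Union>i<n. A i) \<inter> A n = {}"
            using union(1) by (auto simp: disjoint_family_on_def) (metis Int_iff empty_iff nless_le)
          then show "F (Suc n) x = F n x + indicator (A n) x"
            unfolding F_def lessThan_Suc by (auto simp: indicator_def)
        qed
        moreover have "L (\<lambda>x. F n x + indicator (A n) x) = L (F n) + L (indicator (A n))"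
          by (rule add[of _ _ 1]) (auto simp: ind F_def)
        ultimately show ?case using Suc union(3)[of n] by simp
      qed
      show ?case
      proof (rule zero_lim[of F 1])
        show "(\<lambda>n. F n x) \<longlonglongrightarrow> indicator (\<Union> (range A)) x" for x
          unfolding F_def by (rule LIMSEQ_indicator_UN)
      qed (auto simp: F_def ind Fz[unfolded F_def])
    qed (auto simp: opn L0)
  qed
  have nonneg: "(\<exists>C. \<forall>x. f x \<le> C) \<longrightarrow> L f = 0"
    if "f \<in> borel_measurable borel" "\<And>x. 0 \<le> f x" for f :: "'a \<Rightarrow> real"
    using that
  proof (induction rule: borel_measurable_induct_real)
    case (set A)
    then show ?case using bor by blast
  next
    case (mult u c)
    show ?case
    proof (cases "c = 0")
      case False
      show ?thesis
      proof
        assume "\<exists>C. \<forall>x. c * u x \<le> C"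
        then obtain C where "\<forall>x. c * u x \<le> C" ..
        then have C: "u x \<le> C / c" for x using False mult.hyps(1) by (simp add: pos_le_divide_eq mult.commute)
        then have "L u = 0" using mult.IH by blast
        then show "L (\<lambda>x. c * u x) = 0" using cmult[OF mult.hyps(2), of "C / c" c] C mult.hyps(3) by simp
      qed
    qed (simp add: L0)
  next
    case (add u v)
    show ?case
    proof
      assume "\<exists>C. \<forall>x. v x + u x \<le> C"
      then obtain C where "\<And>x. v x + u x \<le> C" by blast
      then have C: "u x \<le> C" "v x \<le> C" for x
      proof -
        have "v x + u x \<le> C" "0 \<le> u x" "0 \<le> v x" by fact+
        then show "u x \<le> C" "v x \<le> C" by linarith+
      qed
      then have "L u = 0" "L v = 0" using add.IH by blast+
      then show "L (\<lambda>x. v x + u x) = 0" using assms(1)[OF add.hyps(3,1), of C] C add.hyps(2,4) by simp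
    qed
  next
    case (seq U)
    show ?case
    proof
      assume "\<exists>C. \<forall>x. f x \<le> C"
      then obtain C where "\<forall>x. f x \<le> C" ..
      moreover have "U i x \<le> f x" for i x
        using seq.hyps(3,4) by (intro incseq_le) (auto simp: incseq_def le_fun_def)
      ultimately have C: "U i x \<le> C" for i x using order_trans by blast
      show "L f = 0"
      proof (rule zero_lim[of U C])
        show "U n \<in> borel_measurable borel" for n by (rule seq.hyps(1))
        show "\<bar>U n x\<bar> \<le> C" for n x using C[of n x] seq.hyps(2)[of n x] by simp
        show "(\<lambda>n. U n x) \<longlonglongrightarrow> f x" for x by (rule seq.hyps(4)) simp
        show "L (U n) = 0" for n using C[of n] seq.IH[of n] by blast
      qed
    qed
  qed
  have fB: "- B \<le> f x" "f x \<le> B" for x using f(2)[of x] by (auto simp: abs_le_iff)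
  have m: "(\<lambda>x. f x + B) \<in> borel_measurable borel" using f(1) by measurable
  have "L (\<lambda>x. f x + B) = 0"
  proof (rule mp[OF nonneg[OF m]])
    show "0 \<le> f x + B" for x using fB(1)[of x] by linarith
    show "\<exists>C. \<forall>x. f x + B \<le> C" using fB(2) by (intro exI[of _ "B + B"]) simp
  qed
  moreover have "L (\<lambda>x. B * 1) = 0" using cmult[of "\<lambda>_. 1" 1 B] L1 by simp
  moreover have "L (\<lambda>x. f x + B) = L f + L (\<lambda>x. B * 1)"
    using add[OF f(1), of "\<lambda>_. B" B] f(2) order_trans[OF abs_ge_zero f(2)] by simp
  ultimately show ?thesis by simp
qed

text \<open>A continuous function is approximated by polynomials. Multiplied with a cutoff, these are test
  functions.\<close>

lemma annulus_functional_zero: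
  fixes L :: "(real^2 \<Rightarrow> real) \<Rightarrow> real"
  assumes ab: "0 < a" "a < b"
    and add: "\<And>f g B. f \<in> borel_measurable borel \<Longrightarrow> g \<in> borel_measurable borel \<Longrightarrow>
      (\<And>x. x \<in> annulus a b \<Longrightarrow> \<bar>f x\<bar> \<le> B) \<Longrightarrow> (\<And>x. x \<in> annulus a b \<Longrightarrow> \<bar>g x\<bar> \<le> B)
        \<Longrightarrow> L (\<lambda>x. f x + g x) = L f + L g"
    and cmult: "\<And>f B c. f \<in> borel_measurable borel \<Longrightarrow> (\<And>x. x \<in> annulus a b \<Longrightarrow> \<bar>f x\<bar> \<le> B)
        \<Longrightarrow> L (\<lambda>x. c * f x) = c * L f"
    and lim: "\<And>F f B. (\<And>n. F n \<in> borel_measurable borel) \<Longrightarrow> (\<And>n x. x \<in> annulus a b \<Longrightarrow> \<bar>F n x\<bar> \<le> B) \<Longrightarrow>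
      (\<And>x. x \<in> annulus a b \<Longrightarrow> (\<lambda>n. F n x) \<longlonglongrightarrow> f x) \<Longrightarrow> f \<in> borel_measurable borel
        \<Longrightarrow> (\<lambda>n. L (F n)) \<longlonglongrightarrow> L f"
    and bound: "\<And>f B. f \<in> borel_measurable borel \<Longrightarrow> (\<And>x. x \<in> annulus a b \<Longrightarrow> \<bar>f x\<bar> \<le> B) \<Longrightarrow> \<bar>L f\<bar> \<le> C * B"
    and test: "\<And>\<phi>. test_function (annulus a b) \<phi> \<Longrightarrow> L \<phi> = 0"
    and f: "f \<in> borel_measurable borel" "\<And>x. \<bar>f x\<bar> \<le> B"
  shows "L f = 0"
proof (rule bounded_borel_functional_zero[of L, OF _ _ _ _ f])
  fix f :: "real^2 \<Rightarrow> real" and B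
  assume fc: "continuous_on UNIV f" and fB: "\<And>x. \<bar>f x\<bar> \<le> B"
  have [measurable]: "f \<in> borel_measurable borel" by (rule borel_measurable_continuous_onI[OF fc])
  define \<eta> where "\<eta> n x = annulus_cutoff a b n (norm x)" for n and x :: "real^2"
  have [measurable]: "\<eta> n \<in> borel_measurable borel" for n unfolding \<eta>_def by measurable
  have \<eta>: "\<bar>\<eta> n x\<bar> \<le> 1" for n x using annulus_cutoff_bounds by (simp add: \<eta>_def)
  have L\<eta>: "L (\<lambda>x. f x * \<eta> n x) = 0" for n
  proof -
    have small: "\<bar>L (\<lambda>x. f x * \<eta> n x)\<bar> \<le> C * e" if e: "0 < e" for e
    proof -
      obtain p where p: "real_polynomial_function p" "\<And>x. x \<in> cball 0 b \<Longrightarrow> \<bar>f x - p x\<bar> < e"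
        using Stone_Weierstrass_real_polynomial_function[OF compact_cball _ e, of 0 b f]
          continuous_on_subset[OF fc] by blast
      have [measurable]: "p \<in> borel_measurable borel"
        by (rule C1_on_measurable(1)[OF C1_on_real_polynomial_function[OF p(1)]])
      have pb: "\<bar>p x * \<eta> n x\<bar> \<le> B + e" "\<bar>(f x - p x) * \<eta> n x\<bar> \<le> e" if "x \<in> annulus a b" for x
      proof -
        have "x \<in> cball 0 b" using that by (simp add: annulus_def)
        then have "\<bar>f x - p x\<bar> < e" "\<bar>p x\<bar> \<le> B + e" using p(2)[of x] fB[of x] by linarith+
        then show "\<bar>p x * \<eta> n x\<bar> \<le> B + e" "\<bar>(f x - p x) * \<eta> n x\<bar> \<le> e"
          using \<eta>[of n x] mult_mono[of "\<bar>p x\<bar>" "B + e" "\<bar>\<eta> n x\<bar>" 1]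
            mult_mono[of "\<bar>f x - p x\<bar>" e "\<bar>\<eta> n x\<bar>" 1] by (auto simp: abs_mult)
      qed
      have B0: "0 \<le> B" using fB[of 0] by linarith
      have "L (\<lambda>x. (f x - p x) * \<eta> n x + p x * \<eta> n x) = L (\<lambda>x. (f x - p x) * \<eta> n x) + L (\<lambda>x. p x * \<eta> n x)"
      proof (rule add[where B = "B + e"])
        show "\<bar>(f x - p x) * \<eta> n x\<bar> \<le> B + e" if "x \<in> annulus a b" for x
          using pb(2)[OF that] B0 by linarith
      qed (measurable, rule pb(1))
      moreover have "L (\<lambda>x. p x * \<eta> n x) = 0"
        unfolding \<eta>_def by (intro test test_function_annulus_cutoff ab C1_on_real_polynomial_function p)
      ultimately have "L (\<lambda>x. f x * \<eta> n x) = L (\<lambda>x. (f x - p x) * \<eta> n x)"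
        by (simp add: algebra_simps)
      also have "\<bar>\<dots>\<bar> \<le> C * e" by (rule bound, measurable) (rule pb)
      finally show ?thesis .
    qed
    show ?thesis
    proof (rule ccontr)
      define l where "l = \<bar>L (\<lambda>x. f x * \<eta> n x)\<bar>"
      assume "L (\<lambda>x. f x * \<eta> n x) \<noteq> 0"
      then have l: "0 < l" by (simp add: l_def)
      have "0 < C" using small[of 1] l by (simp add: l_def)
      then have "l \<le> l / 2" using small[of "l / (2 * C)"] l by (simp add: l_def[symmetric])
      then show False using l by simp
    qed
  qed
  have "(\<lambda>n. L (\<lambda>x. f x * \<eta> n x)) \<longlonglongrightarrow> L f"
  proof (rule lim)
    show "\<bar>f x * \<eta> n x\<bar> \<le> B" for n x
      using mult_mono[OF fB[of x] \<eta>[of n x]] fB[of x] by (simp add: abs_mult)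
    show "(\<lambda>n. f x * \<eta> n x) \<longlonglongrightarrow> f x" if "x \<in> annulus a b" for x
      using tendsto_mult[OF tendsto_const annulus_cutoff_tendsto_1, of a "norm x" b "f x"] that
      by (simp add: \<eta>_def annulus_def)
  qed measurable
  then show "L f = 0" by (simp add: L\<eta> LIMSEQ_const_iff)
next
  fix F :: "nat \<Rightarrow> real^2 \<Rightarrow> real" and f B
  assume F: "\<And>n. F n \<in> borel_measurable borel" "\<And>n x. \<bar>F n x\<bar> \<le> B" "\<And>x. (\<lambda>n. F n x) \<longlonglongrightarrow> f x"
  show "(\<lambda>n. L (F n)) \<longlonglongrightarrow> L f"
    by (rule lim[OF F]) (rule borel_measurable_LIMSEQ_real[OF F(3,1)])
qed (auto intro: add cmult)

lemma finite_measure_inner_compact: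
  fixes M :: "'a::{second_countable_topology, complete_space} measure"
  assumes "finite_measure M" "sets M = sets borel" "B \<in> sets borel" "0 < e"
  obtains K where "K \<subseteq> B" "compact K" "measure M (B - K) \<le> e"
proof -
  interpret finite_measure M by fact
  have *: "emeasure M B = (SUP K \<in> {K. K \<subseteq> B \<and> compact K}. emeasure M K)"
    using assms by (intro inner_regular) auto
  have "\<exists>K. K \<subseteq> B \<and> compact K \<and> measure M B < measure M K + e"
  proof (cases "measure M B < e")
    case True
    then show ?thesis by (intro exI[of _ "{}"]) auto
  next
    case False
    have "ennreal (measure M B - e) < (SUP K \<in> {K. K \<subseteq> B \<and> compact K}. emeasure M K)"
      unfolding *[symmetric] using assms False by (simp add: emeasure_eq_measure ennreal_less_iff)
    then obtain K where K: "K \<subseteq> B" "compact K" "ennreal (measure M B - e) < emeasure M K"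
      by (auto simp: less_SUP_iff)
    then have "measure M B - e < measure M K" using False by (simp add: emeasure_eq_measure ennreal_less_iff)
    then show ?thesis using K by (intro exI[of _ K]) auto
  qed
  then obtain K where K: "K \<subseteq> B" "compact K" "measure M B < measure M K + e" by blast
  moreover have "measure M (B - K) = measure M B - measure M K"
    using K assms by (intro finite_measure_Diff) (auto simp: compact_imp_closed)
  ultimately show ?thesis by (intro that[of K]) auto
qed

text \<open>The sign of \<open>f\<close> is 1 on a compact set \<open>K\<close> and -1 on a compact set \<open>J\<close> that exhaust
  \<open>f \<noteq> 0\<close> up to small measure. A continuous function with these values is approximated by a
  polynomial. Polynomials are used as the dual functions since their compositions with \<open>x / |x|\<close>
  are smooth.\<close>

theorem L1_norm_le_polynomial_dual:
  fixes M :: "'a::euclidean_space measure" and f :: "'a \<Rightarrow> real"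
  assumes M: "sets M = sets borel" and f: "integrable M f"
    and C: "compact C" "AE x in M. x \<in> C"
    and dual: "\<And>p. real_polynomial_function p \<Longrightarrow> (\<And>x. x \<in> C \<Longrightarrow> \<bar>p x\<bar> \<le> 1)
      \<Longrightarrow> (LINT x|M. p x * f x) \<le> B"
  shows "(LINT x|M. \<bar>f x\<bar>) \<le> B"
proof -
  have [measurable_cong]: "sets M = sets borel" by (rule M)
  have [measurable]: "f \<in> borel_measurable borel"
    using borel_measurable_integrable[OF f] measurable_cong_sets[OF M refl] by blast
  have [measurable]: "C \<in> sets borel" using C(1) by (simp add: compact_imp_closed)
  define N where "N = density M (\<lambda>x. ennreal \<bar>f x\<bar>)"
  have sN [simp]: "sets N = sets borel" using M by (simp add: N_def)
  interpret N: finite_measure N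
  proof (rule finite_measureI)
    have "emeasure N (space N) = (\<integral>\<^sup>+x. ennreal \<bar>f x\<bar> \<partial>M)"
      unfolding N_def by (subst emeasure_density) (auto intro!: nn_integral_cong)
    also have "\<dots> < \<infinity>" using f by (simp add: integrable_iff_bounded)
    finally show "emeasure N (space N) \<noteq> \<infinity>" by simp
  qed
  have intI: "integrable M (\<lambda>x. indicator A x * \<bar>f x\<bar>)" if "A \<in> sets borel" for A
    using integrable_mult_indicator[of A M "\<lambda>x. \<bar>f x\<bar>"] f that M by simp
  have measN: "measure N A = (LINT x|M. indicator A x * \<bar>f x\<bar>)" if [measurable]: "A \<in> sets borel" for A
  proof -
    have "emeasure N A = (\<integral>\<^sup>+x. ennreal (indicator A x * \<bar>f x\<bar>) \<partial>M)"
      unfolding N_def by (subst emeasure_density) (auto intro!: nn_integral_cong simp: indicator_def)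
    also have "\<dots> = ennreal (LINT x|M. indicator A x * \<bar>f x\<bar>)"
      using intI[OF that] by (intro nn_integral_eq_integral) auto
    finally show ?thesis by (simp add: measure_def)
  qed
  define I where "I = (LINT x|M. \<bar>f x\<bar>)"
  have key: "I \<le> B + e * (4 + I + B)" if e: "0 < e" for e
  proof -
    define P where "P = {x \<in> C. 0 < f x}"
    define Q where "Q = {x \<in> C. f x < 0}"
    have [measurable]: "P \<in> sets borel" "Q \<in> sets borel" unfolding P_def Q_def by measurable
    obtain K where K: "K \<subseteq> P" "compact K" "measure N (P - K) \<le> e"
      using finite_measure_inner_compact[OF N.finite_measure_axioms sN _ e, of P] by auto
    obtain J where J: "J \<subseteq> Q" "compact J" "measure N (Q - J) \<le> e"
      using finite_measure_inner_compact[OF N.finite_measure_axioms sN _ e, of Q] by auto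
    have [measurable]: "K \<in> sets borel" "J \<in> sets borel" using K J by (auto simp: compact_imp_closed)
    have "K \<inter> J = {}" using K(1) J(1) unfolding P_def Q_def by fastforce
    then obtain \<psi> :: "'a \<Rightarrow> real" where \<psi>: "continuous_on UNIV \<psi>" "\<And>x. \<psi> x \<in> closed_segment 1 (-1)"
      "\<And>x. x \<in> K \<Longrightarrow> \<psi> x = 1" "\<And>x. x \<in> J \<Longrightarrow> \<psi> x = -1"
      using Urysohn[of K J "1::real" "-1"] K(2) J(2) compact_imp_closed by metis
    have \<psi>b: "\<bar>\<psi> x\<bar> \<le> 1" for x using \<psi>(2)[of x] by (simp add: closed_segment_eq_real_ivl abs_le_iff split: if_splits)
    have [measurable]: "\<psi> \<in> borel_measurable borel" by (rule borel_measurable_continuous_onI[OF \<psi>(1)])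
    obtain p where p: "real_polynomial_function p" "\<And>x. x \<in> C \<Longrightarrow> \<bar>\<psi> x - p x\<bar> < e"
      using Stone_Weierstrass_real_polynomial_function[OF C(1) _ e, of \<psi>]
        continuous_on_subset[OF \<psi>(1)] by blast
    have [measurable]: "p \<in> borel_measurable borel"
      using continuous_on_polymonial_function[of p UNIV] p(1)
      by (intro borel_measurable_continuous_onI) (simp add: real_polynomial_function_eq)
    have pb: "\<bar>p x\<bar> \<le> 1 + e" if "x \<in> C" for x using p(2)[OF that] \<psi>b[of x] by linarith
    define q where "q x = inverse (1 + e) * p x" for x
    have "(LINT x|M. q x * f x) \<le> B"
    proof (rule dual)
      show "real_polynomial_function q" unfolding q_def by (intro real_polynomial_function.intros p)
      show "\<bar>q x\<bar> \<le> 1" if "x \<in> C" for x using pb[OF that] e by (simp add: q_def abs_mult field_simps)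
    qed
    then have pB: "(LINT x|M. p x * f x) \<le> B * (1 + e)"
      using e by (simp add: q_def mult.assoc field_simps)
    have lower: "AE x in M. \<bar>f x\<bar> - (2 * (indicator (P - K) x * \<bar>f x\<bar>) + 2 * (indicator (Q - J) x * \<bar>f x\<bar>) + e * \<bar>f x\<bar>)
        \<le> p x * f x"
      using C(2)
    proof eventually_elim
      case (elim x)
      have "\<bar>(\<psi> x - p x) * f x\<bar> \<le> e * \<bar>f x\<bar>"
        unfolding abs_mult using p(2)[OF elim] by (intro mult_right_mono) auto
      moreover have "\<bar>f x\<bar> - 2 * (indicator (P - K) x * \<bar>f x\<bar>) - 2 * (indicator (Q - J) x * \<bar>f x\<bar>) \<le> \<psi> x * f x"
      proof -
        have ge: "- \<bar>f x\<bar> \<le> \<psi> x * f x"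
          using mult_right_mono[OF \<psi>b[of x], of "\<bar>f x\<bar>"] unfolding abs_mult[symmetric] by simp
        have i1: "0 \<le> indicator (P - K) x * \<bar>f x\<bar>" and i2: "0 \<le> indicator (Q - J) x * \<bar>f x\<bar>" by auto
        consider "x \<in> K" | "x \<in> J" | "x \<in> P - K" | "x \<in> Q - J" | "f x = 0"
          using elim by (cases "f x" "0::real" rule: linorder_cases) (auto simp: P_def Q_def)
        then show ?thesis
        proof cases
          case 1
          then have "x \<in> P" using K(1) by blast
          then have "0 < f x" by (simp add: P_def)
          then have "\<psi> x * f x = \<bar>f x\<bar>" unfolding \<psi>(3)[OF 1] by linarith
          then show ?thesis using i1 i2 by linarith
        next
          case 2
          then have "x \<in> Q" using J(1) by blast
          then have "f x < 0" by (simp add: Q_def)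
          then have "\<psi> x * f x = \<bar>f x\<bar>" unfolding \<psi>(4)[OF 2] by linarith
          then show ?thesis using i1 i2 by linarith
        next
          case 3
          then have "indicator (P - K) x * \<bar>f x\<bar> = \<bar>f x\<bar>" by simp
          then show ?thesis using ge i2 by linarith
        next
          case 4
          then have "indicator (Q - J) x * \<bar>f x\<bar> = \<bar>f x\<bar>" by simp
          then show ?thesis using ge i1 by linarith
        next
          case 5
          show ?thesis unfolding 5 by (simp only: abs_zero mult_zero_right diff_self order_refl)
        qed
      qed
      ultimately show ?case unfolding left_diff_distrib by linarith
    qed
    have int_p: "integrable M (\<lambda>x. p x * f x)"
    proof (rule Bochner_Integration.integrable_bound[of M "\<lambda>x. (1 + e) * f x"])
      show "AE x in M. norm (p x * f x) \<le> norm ((1 + e) * f x)"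
        using C(2)
      proof eventually_elim
        case (elim x)
        then show ?case using pb[OF elim] e by (auto simp: abs_mult intro!: mult_right_mono)
      qed
    qed (use f in auto)
    have "I - (2 * measure N (P - K) + 2 * measure N (Q - J) + e * I)
        = (LINT x|M. \<bar>f x\<bar> - (2 * (indicator (P - K) x * \<bar>f x\<bar>) + 2 * (indicator (Q - J) x * \<bar>f x\<bar>) + e * \<bar>f x\<bar>))"
      using f intI[of "P - K"] intI[of "Q - J"] by (simp add: measN I_def)
    also have "\<dots> \<le> (LINT x|M. p x * f x)"
      using f intI[of "P - K"] intI[of "Q - J"] int_p lower by (intro integral_mono_AE) auto
    finally show ?thesis using K(3) J(3) pB by (simp add: algebra_simps)
  qed
  show ?thesis
    unfolding I_def[symmetric]
  proof (rule field_le_epsilon)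
    fix d :: real assume d: "0 < d"
    define c where "c = \<bar>4 + I + B\<bar> + 1"
    have c: "0 < c" by (simp add: c_def)
    have "I \<le> B + (d / c) * (4 + I + B)" by (rule key) (use d c in simp)
    also have "(d / c) * (4 + I + B) \<le> (d / c) * c"
      using d c by (intro mult_left_mono) (auto simp: c_def)
    also have "\<dots> = d" using c by simp
    finally show "I \<le> B + d" by simp
  qed
qed

corollary AE_zero_polynomial_dual:
  fixes M :: "'a::euclidean_space measure" and f :: "'a \<Rightarrow> real"
  assumes "sets M = sets borel" "integrable M f" "compact C" "AE x in M. x \<in> C"
    and "\<And>p. real_polynomial_function p \<Longrightarrow> (LINT x|M. p x * f x) = 0"
  shows "AE x in M. f x = 0"
proof -
  have "(LINT x|M. \<bar>f x\<bar>) \<le> 0"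
    using assms by (intro L1_norm_le_polynomial_dual[where C = C]) auto
  then have "(LINT x|M. \<bar>f x\<bar>) = 0" by (intro antisym integral_nonneg_AE) auto
  then have "AE x in M. \<bar>f x\<bar> = 0"
    using assms(2) by (subst integral_nonneg_eq_0_iff_AE[symmetric]) auto
  then show ?thesis by simp
qed

section \<open>Gradient measures\<close>

lemma open_annulus: "open (annulus a b)"
  unfolding annulus_def by (intro open_Collect_conj open_Collect_less continuous_intros)

lemma annulus_borel [measurable]: "annulus a b \<in> sets borel"
  by (intro borel_open open_annulus)

lemma annulus_lebesgue [measurable]: "annulus a b \<in> sets lebesgue"
  by (intro sets_completionI_sets) simp

lemma borel_representative:
  fixes f :: "'a::euclidean_space \<Rightarrow> real"
  assumes f: "f absolutely_integrable_on S" and S [measurable]: "S \<in> sets borel"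
  obtains f' where "f' \<in> borel_measurable borel" "integrable lborel f'" "\<And>x. x \<notin> S \<Longrightarrow> f' x = 0"
    "AE x in lebesgue. x \<in> S \<longrightarrow> f x = f' x"
    "\<And>F. F \<in> borel_measurable borel \<Longrightarrow> (LINT x:S|lebesgue. f x * F x) = (LINT x|lborel. f' x * F x)"
proof -
  have int: "integrable lebesgue (\<lambda>x. indicator S x * f x)"
    using f by (simp add: set_integrable_def)
  then have "(\<lambda>x. indicator S x * f x) \<in> borel_measurable lebesgue" by (rule borel_measurable_integrable)
  from completion_ex_borel_measurable_real[OF this] obtain g
    where g [measurable]: "g \<in> borel_measurable borel" and ae: "AE x in lborel. indicator S x * f x = g x"
    by auto
  define f' where "f' x = indicator S x * g x" for x
  have [measurable]: "f' \<in> borel_measurable borel" unfolding f'_def by measurable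
  have ae': "AE x in lebesgue. indicator S x * f x = f' x"
    using AE_completion[OF ae] by eventually_elim (auto simp: f'_def indicator_def split: if_splits)
  have "integrable lebesgue f'"
    by (rule integrable_cong_AE_imp[OF int]) (use ae' in \<open>auto intro: measurable_completion\<close>)
  then have int': "integrable lborel f'"
    by (subst (asm) integrable_completion) auto
  have "(LINT x:S|lebesgue. f x * F x) = (LINT x|lborel. f' x * F x)"
    if F [measurable]: "F \<in> borel_measurable borel" for F
  proof -
    have Fl: "F \<in> borel_measurable lebesgue" "f' \<in> borel_measurable lebesgue"
      using F by (auto intro!: measurable_completion)
    have "(\<lambda>x. (indicator S x * f x) * F x) \<in> borel_measurable lebesgue"
      by (rule borel_measurable_times[OF borel_measurable_integrable[OF int] Fl(1)])
    then have "(\<lambda>x. indicator S x *\<^sub>R (f x * F x)) \<in> borel_measurable lebesgue"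
      by (simp add: mult.assoc)
    then have "(LINT x:S|lebesgue. f x * F x) = (LINT x|lebesgue. f' x * F x)"
      unfolding set_lebesgue_integral_def
    proof (rule integral_cong_AE)
      show "AE x in lebesgue. indicator S x *\<^sub>R (f x * F x) = f' x * F x"
        using ae' by eventually_elim (simp flip: mult.assoc)
    qed (use Fl in \<open>intro borel_measurable_times\<close>)
    also have "\<dots> = (LINT x|lborel. f' x * F x)" by (rule integral_completion) measurable
    finally show ?thesis .
  qed
  moreover have "AE x in lebesgue. x \<in> S \<longrightarrow> f x = f' x" using ae' by eventually_elim auto
  ultimately show ?thesis using that[of f'] int' by (auto simp: f'_def)
qed

text \<open>Integrands on the annulus are Lebesgue measurable and only matter there. A version that is Borel
  measurable and vanishes outside can be integrated against the same functions as the
  Borel measure that encodes the singular part.\<close>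

definition borel_version ::
  "(real^'n::finite) set \<Rightarrow> (real^'n \<Rightarrow> real^'n) \<Rightarrow> (real^'n \<Rightarrow> real^'n) \<Rightarrow> bool" where
  "borel_version S h k \<longleftrightarrow> k \<in> borel_measurable borel \<and> (\<forall>i. integrable lborel (\<lambda>x. k x $ i)) \<and>
     (\<forall>x. x \<notin> S \<longrightarrow> k x = 0) \<and> (AE x in lebesgue. x \<in> S \<longrightarrow> h x = k x) \<and>
     (\<forall>F i. F \<in> borel_measurable borel \<longrightarrow> (LINT x:S|lebesgue. F x * h x $ i) = (LINT x|lborel. F x * k x $ i))"

lemma borel_versionD:
  assumes "borel_version S h k"
  shows "k \<in> borel_measurable borel" "integrable lborel (\<lambda>x. k x $ i)" "x \<notin> S \<Longrightarrow> k x = 0"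
    "AE x in lebesgue. x \<in> S \<longrightarrow> h x = k x"
    "F \<in> borel_measurable borel \<Longrightarrow> (LINT x:S|lebesgue. F x * h x $ i) = (LINT x|lborel. F x * k x $ i)"
  using assms unfolding borel_version_def by blast+

lemma borel_version_exists:
  fixes h :: "real^'n::finite \<Rightarrow> real^'n"
  assumes h: "h absolutely_integrable_on S" and S: "S \<in> sets borel"
  shows "\<exists>k. borel_version S h k"
proof -
  have hi: "(\<lambda>x. h x $ i) absolutely_integrable_on S" for i
    using absolutely_integrable_component[OF h, of "axis i 1"] by (simp add: inner_axis)
  have "\<exists>f'. f' \<in> borel_measurable borel \<and> integrable lborel f' \<and> (\<forall>x. x \<notin> S \<longrightarrow> f' x = 0) \<and>
      (AE x in lebesgue. x \<in> S \<longrightarrow> h x $ i = f' x) \<and>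
      (\<forall>F. F \<in> borel_measurable borel \<longrightarrow> (LINT x:S|lebesgue. h x $ i * F x) = (LINT x|lborel. f' x * F x))" for i
  proof (rule borel_representative[OF hi[of i] S])
    fix f'
    assume "f' \<in> borel_measurable borel" "integrable lborel f'" "\<And>x. x \<notin> S \<Longrightarrow> f' x = 0"
      "AE x in lebesgue. x \<in> S \<longrightarrow> h x $ i = f' x"
      "\<And>F. F \<in> borel_measurable borel \<Longrightarrow> (LINT x:S|lebesgue. h x $ i * F x) = (LINT x|lborel. f' x * F x)"
    then show ?thesis by (intro exI[of _ f'] conjI allI impI)
  qed
  then obtain f' where f': "\<And>i. f' i \<in> borel_measurable borel \<and> integrable lborel (f' i) \<and> (\<forall>x. x \<notin> S \<longrightarrow> f' i x = 0) \<and>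
      (AE x in lebesgue. x \<in> S \<longrightarrow> h x $ i = f' i x) \<and>
      (\<forall>F. F \<in> borel_measurable borel \<longrightarrow> (LINT x:S|lebesgue. h x $ i * F x) = (LINT x|lborel. f' i x * F x))"
    using choice[of "\<lambda>i f'. f' \<in> borel_measurable borel \<and> integrable lborel f' \<and> (\<forall>x. x \<notin> S \<longrightarrow> f' x = 0) \<and>
      (AE x in lebesgue. x \<in> S \<longrightarrow> h x $ i = f' x) \<and>
      (\<forall>F. F \<in> borel_measurable borel \<longrightarrow> (LINT x:S|lebesgue. h x $ i * F x) = (LINT x|lborel. f' x * F x))"] by blast
  define k where "k x = (\<chi> i. f' i x)" for x
  have "k = (\<lambda>x. \<Sum>i\<in>UNIV. f' i x *\<^sub>R axis i 1)"
    by (auto simp: k_def fun_eq_iff vec_eq_iff axis_def if_distrib[where f = "(*) _"] cong: if_cong)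
  moreover have "(\<lambda>x. \<Sum>i\<in>UNIV. f' i x *\<^sub>R (axis i 1 :: real^'n)) \<in> borel_measurable borel"
    using f' by (intro borel_measurable_sum borel_measurable_scaleR) auto
  ultimately have km: "k \<in> borel_measurable borel" by simp
  have "AE x in lebesgue. \<forall>i\<in>UNIV. x \<in> S \<longrightarrow> h x $ i = f' i x"
    using f' by (intro AE_finite_allI) auto
  then have ae: "AE x in lebesgue. x \<in> S \<longrightarrow> h x = k x"
    by eventually_elim (auto simp: vec_eq_iff k_def)
  have nth: "k x $ i = f' i x" for x i by (simp add: k_def)
  have "borel_version S h k"
    unfolding borel_version_def nth
  proof (intro conjI allI impI km ae)
    show "integrable lborel (\<lambda>x. f' i x)" for i using f'[of i] by simp
    show "k x = 0" if "x \<notin> S" for x using f' that by (simp add: k_def vec_eq_iff)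
    show "(LINT x:S|lebesgue. F x * h x $ i) = (LINT x|lborel. F x * f' i x)"
      if "F \<in> borel_measurable borel" for F i
      using f'[of i] that by (simp add: mult.commute)
  qed
  then show ?thesis by blast
qed

text \<open>The \<open>i\<close>-th component of the vector measure with absolutely continuous part \<open>h\<close> and further part
  \<open>\<sigma> \<nu>\<close>, applied to \<open>f\<close>.\<close>

definition grad_pairing ::
  "(real^'n::finite) set \<Rightarrow> (real^'n \<Rightarrow> real^'n) \<Rightarrow> (real^'n) measure \<Rightarrow> (real^'n \<Rightarrow> real^'n) \<Rightarrow>
    'n \<Rightarrow> (real^'n \<Rightarrow> real) \<Rightarrow> real" where
  "grad_pairing \<Omega> h \<nu> \<sigma> i f = (LINT x:\<Omega>|lebesgue. f x * h x $ i) + (LINT x|\<nu>. f x * \<sigma> x $ i)"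

lemma
  fixes M :: "'a::metric_space measure" and g :: "'a \<Rightarrow> real"
  assumes M: "sets M = sets borel" and g: "integrable M g" and \<Omega>: "AE x in M. x \<notin> \<Omega> \<longrightarrow> g x = 0"
  shows integrable_bounded_mult:
      "f \<in> borel_measurable borel \<Longrightarrow> (\<And>x. x \<in> \<Omega> \<Longrightarrow> \<bar>f x\<bar> \<le> B) \<Longrightarrow> integrable M (\<lambda>x. f x * g x)"
    and integral_bounded_mult_le:
      "f \<in> borel_measurable borel \<Longrightarrow> (\<And>x. x \<in> \<Omega> \<Longrightarrow> \<bar>f x\<bar> \<le> B)
        \<Longrightarrow> \<bar>LINT x|M. f x * g x\<bar> \<le> (LINT x|M. \<bar>g x\<bar>) * B"
    and integral_bounded_mult_tendsto:
      "(\<And>n. F n \<in> borel_measurable borel) \<Longrightarrow> (\<And>n x. x \<in> \<Omega> \<Longrightarrow> \<bar>F n x\<bar> \<le> B) \<Longrightarrow>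
        (\<And>x. x \<in> \<Omega> \<Longrightarrow> (\<lambda>n. F n x) \<longlonglongrightarrow> f x) \<Longrightarrow> f \<in> borel_measurable borel \<Longrightarrow>
        (\<lambda>n. LINT x|M. F n x * g x) \<longlonglongrightarrow> (LINT x|M. f x * g x)"
proof -
  have [measurable_cong]: "sets M = sets borel" by (rule M)
  have [measurable]: "g \<in> borel_measurable borel"
    using borel_measurable_integrable[OF g] measurable_cong_sets[OF M refl] by blast
  have le: "AE x in M. norm (f x * g x) \<le> norm (B * \<bar>g x\<bar>)" "AE x in M. norm (f x * g x) \<le> B * \<bar>g x\<bar>"
    if "\<And>x. x \<in> \<Omega> \<Longrightarrow> \<bar>f x\<bar> \<le> B" for f B
  proof -
    show "AE x in M. norm (f x * g x) \<le> norm (B * \<bar>g x\<bar>)"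
      using \<Omega>
    proof eventually_elim
      case (elim x)
      then show ?case
        using that[of x] by (cases "x \<in> \<Omega>") (auto simp: abs_mult intro!: mult_right_mono)
    qed
    show "AE x in M. norm (f x * g x) \<le> B * \<bar>g x\<bar>"
      using \<Omega>
    proof eventually_elim
      case (elim x)
      then show ?case
        using that[of x] by (cases "x \<in> \<Omega>") (auto simp: abs_mult intro!: mult_right_mono)
    qed
  qed
  show int: "integrable M (\<lambda>x. f x * g x)"
    if "f \<in> borel_measurable borel" "\<And>x. x \<in> \<Omega> \<Longrightarrow> \<bar>f x\<bar> \<le> B" for f B
    by (rule Bochner_Integration.integrable_bound[OF _ _ le(1)[OF that(2)]]) (use that(1) g in auto)
  show "\<bar>LINT x|M. f x * g x\<bar> \<le> (LINT x|M. \<bar>g x\<bar>) * B"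
    if "f \<in> borel_measurable borel" "\<And>x. x \<in> \<Omega> \<Longrightarrow> \<bar>f x\<bar> \<le> B" for f B
  proof -
    have "\<bar>LINT x|M. f x * g x\<bar> \<le> (LINT x|M. norm (f x * g x))"
      using integral_norm_bound[of M "\<lambda>x. f x * g x"] by simp
    also have "\<dots> \<le> (LINT x|M. B * \<bar>g x\<bar>)"
      using int[OF that] g le(2)[OF that(2)] by (intro integral_mono_AE) auto
    finally show ?thesis by (simp add: mult.commute)
  qed
  show "(\<lambda>n. LINT x|M. F n x * g x) \<longlonglongrightarrow> (LINT x|M. f x * g x)"
    if [measurable]: "\<And>n. F n \<in> borel_measurable borel" "f \<in> borel_measurable borel"
      and "\<And>n x. x \<in> \<Omega> \<Longrightarrow> \<bar>F n x\<bar> \<le> B" "\<And>x. x \<in> \<Omega> \<Longrightarrow> (\<lambda>n. F n x) \<longlonglongrightarrow> f x" for F f B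
  proof (rule integral_dominated_convergence[where w = "\<lambda>x. B * \<bar>g x\<bar>"])
    show "AE x in M. (\<lambda>n. F n x * g x) \<longlonglongrightarrow> f x * g x"
      using \<Omega>
    proof eventually_elim
      case (elim x)
      then show ?case using that(4)[of x] by (cases "x \<in> \<Omega>") (auto intro!: tendsto_intros)
    qed
    show "AE x in M. norm (F n x * g x) \<le> B * \<bar>g x\<bar>" for n
      by (rule le(2)[OF that(3)])
  qed (use g in auto)
qed

lemma polar_measureD:
  assumes "polar_measure \<Omega> \<nu> \<sigma>" "\<Omega> \<in> sets borel"
  shows "sets \<nu> = sets borel" "finite_measure \<nu>" "AE x in \<nu>. x \<in> \<Omega>" "\<sigma> \<in> borel_measurable borel"
    "AE x in \<nu>. norm (\<sigma> x) = 1" "integrable \<nu> (\<lambda>x. \<sigma> x $ i)" "AE x in \<nu>. x \<notin> \<Omega> \<longrightarrow> \<sigma> x $ i = 0"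
proof -
  show s: "sets \<nu> = sets borel" and f: "finite_measure \<nu>" and \<sigma>: "\<sigma> \<in> borel_measurable borel"
    and n: "AE x in \<nu>. norm (\<sigma> x) = 1"
    using assms(1) by (auto simp: polar_measure_def)
  show ae: "AE x in \<nu>. x \<in> \<Omega>"
    by (rule AE_I[of _ _ "- \<Omega>"]) (use assms s in \<open>auto simp: polar_measure_def\<close>)
  show "AE x in \<nu>. x \<notin> \<Omega> \<longrightarrow> \<sigma> x $ i = 0" using ae by eventually_elim auto
  interpret finite_measure \<nu> by (rule f)
  show "integrable \<nu> (\<lambda>x. \<sigma> x $ i)"
  proof (rule integrable_const_bound[where B = 1])
    show "AE x in \<nu>. norm (\<sigma> x $ i) \<le> 1"
      using n
    proof eventually_elim
      case (elim x)
      then show ?case using component_le_norm_cart[of "\<sigma> x" i] by simp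
    qed
    have "(\<lambda>x. \<sigma> x $ i) \<in> borel_measurable borel"
      using \<sigma> by (intro measurable_compose[OF \<sigma>] borel_measurable_continuous_onI continuous_intros)
    then show "(\<lambda>x. \<sigma> x $ i) \<in> borel_measurable \<nu>" using measurable_cong_sets[OF s refl] by blast
  qed
qed

theorem grad_pairing_unique:
  assumes ab: "0 < a" "a < b"
    and h: "h absolutely_integrable_on annulus a b" "h' absolutely_integrable_on annulus a b"
    and \<nu>: "polar_measure (annulus a b) \<nu> \<sigma>" "polar_measure (annulus a b) \<nu>' \<sigma>'"
    and eq: "\<And>\<phi>. test_function (annulus a b) \<phi> \<Longrightarrow>
      grad_pairing (annulus a b) h \<nu> \<sigma> i \<phi> = grad_pairing (annulus a b) h' \<nu>' \<sigma>' i \<phi>"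
    and f: "f \<in> borel_measurable borel" "\<And>x. \<bar>f x\<bar> \<le> B"
  shows "grad_pairing (annulus a b) h \<nu> \<sigma> i f = grad_pairing (annulus a b) h' \<nu>' \<sigma>' i f"
proof -
  let ?W = "annulus a b"
  obtain k where "borel_version ?W h k"
    using borel_version_exists[OF h(1) annulus_borel] by blast
  note k = borel_versionD[OF this]
  obtain k' where "borel_version ?W h' k'"
    using borel_version_exists[OF h(2) annulus_borel] by blast
  note k' = borel_versionD[OF this]
  note m1 = sets_lborel k(2)[of i]
  note m2 = sets_lborel k'(2)[of i]
  note m3 = polar_measureD(1)[OF \<nu>(1) annulus_borel] polar_measureD(6,7)[OF \<nu>(1) annulus_borel, of i]
  note m4 = polar_measureD(1)[OF \<nu>(2) annulus_borel] polar_measureD(6,7)[OF \<nu>(2) annulus_borel, of i]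
  have a1: "AE x in lborel. x \<notin> ?W \<longrightarrow> k x $ i = 0" and a2: "AE x in lborel. x \<notin> ?W \<longrightarrow> k' x $ i = 0"
    using k(3) k'(3) by auto
  define L where "L f = (LINT x|lborel. f x * k x $ i) + (LINT x|\<nu>. f x * \<sigma> x $ i)
    - ((LINT x|lborel. f x * k' x $ i) + (LINT x|\<nu>'. f x * \<sigma>' x $ i))" for f
  have L: "L f = grad_pairing ?W h \<nu> \<sigma> i f - grad_pairing ?W h' \<nu>' \<sigma>' i f"
    if "f \<in> borel_measurable borel" for f
    unfolding L_def grad_pairing_def k(5)[OF that] k'(5)[OF that] ..
  have ints: "integrable lborel (\<lambda>x. f x * k x $ i)" "integrable lborel (\<lambda>x. f x * k' x $ i)"
    "integrable \<nu> (\<lambda>x. f x * \<sigma> x $ i)" "integrable \<nu>' (\<lambda>x. f x * \<sigma>' x $ i)"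
    if "f \<in> borel_measurable borel" "\<And>x. x \<in> ?W \<Longrightarrow> \<bar>f x\<bar> \<le> B" for f B
    using integrable_bounded_mult[OF m1(1,2) a1 that] integrable_bounded_mult[OF m2(1,2) a2 that]
      integrable_bounded_mult[OF m3 that] integrable_bounded_mult[OF m4 that] by simp_all
  have "L f = 0"
  proof (rule annulus_functional_zero[OF ab, of L, OF _ _ _ _ _ f])
    fix f g :: "real^2 \<Rightarrow> real" and B
    assume f: "f \<in> borel_measurable borel" "\<And>x. x \<in> ?W \<Longrightarrow> \<bar>f x\<bar> \<le> B"
      and g: "g \<in> borel_measurable borel" "\<And>x. x \<in> ?W \<Longrightarrow> \<bar>g x\<bar> \<le> B"
    show "L (\<lambda>x. f x + g x) = L f + L g"
      unfolding L_def distrib_right using ints[OF f] ints[OF g] by simp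
  next
    fix f :: "real^2 \<Rightarrow> real" and B c
    show "L (\<lambda>x. c * f x) = c * L f"
      unfolding L_def mult.assoc by (simp add: algebra_simps)
  next
    fix F :: "nat \<Rightarrow> real^2 \<Rightarrow> real" and f B
    assume F: "\<And>n. F n \<in> borel_measurable borel" "\<And>n x. x \<in> ?W \<Longrightarrow> \<bar>F n x\<bar> \<le> B"
      "\<And>x. x \<in> ?W \<Longrightarrow> (\<lambda>n. F n x) \<longlonglongrightarrow> f x" "f \<in> borel_measurable borel"
    show "(\<lambda>n. L (F n)) \<longlonglongrightarrow> L f"
      unfolding L_def
      by (intro tendsto_intros integral_bounded_mult_tendsto[OF m1(1,2) a1 F]
          integral_bounded_mult_tendsto[OF m2(1,2) a2 F] integral_bounded_mult_tendsto[OF m3 F]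
          integral_bounded_mult_tendsto[OF m4 F])
  next
    fix f :: "real^2 \<Rightarrow> real" and B
    assume f: "f \<in> borel_measurable borel" "\<And>x. x \<in> ?W \<Longrightarrow> \<bar>f x\<bar> \<le> B"
    show "\<bar>L f\<bar> \<le> ((LINT x|lborel. \<bar>k x $ i\<bar>) + (LINT x|lborel. \<bar>k' x $ i\<bar>)
       + (LINT x|\<nu>. \<bar>\<sigma> x $ i\<bar>) + (LINT x|\<nu>'. \<bar>\<sigma>' x $ i\<bar>)) * B"
      using integral_bounded_mult_le[OF m1(1,2) a1 f] integral_bounded_mult_le[OF m2(1,2) a2 f]
        integral_bounded_mult_le[OF m3 f] integral_bounded_mult_le[OF m4 f]
      unfolding L_def distrib_right by linarith
  next
    fix \<phi> assume t: "test_function ?W \<phi>"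
    then have "\<phi> \<in> borel_measurable borel"
      by (auto simp: test_function_def intro!: borel_measurable_continuous_onI C1_onD(3))
    then show "L \<phi> = 0" using eq[OF t] L by simp
  qed
  then show ?thesis using L[OF f(1)] by simp
qed

section \<open>The Lebesgue decomposition of the gradient\<close>

text \<open>The measure \<open>\<nu>\<close> of \<open>A\<close> is the pairing of \<open>\<sigma> \<nu>\<close> with \<open>\<sigma>\<close> on \<open>A\<close>. The pairing of
  \<open>\<sigma>' \<nu>'\<close> with the same function is at most \<open>\<nu>' A\<close> by the Cauchy-Schwarz inequality.\<close>

lemma polar_measure_le:
  fixes \<nu> \<nu>' :: "(real^'n::finite) measure"
  assumes \<nu>: "polar_measure \<Omega> \<nu> \<sigma>" "polar_measure \<Omega> \<nu>' \<sigma>'" and \<Omega>: "\<Omega> \<in> sets borel"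
    and eq: "\<And>f B i. f \<in> borel_measurable borel \<Longrightarrow> (\<And>x. \<bar>f x\<bar> \<le> B) \<Longrightarrow>
      (LINT x|\<nu>. f x * \<sigma> x $ i) = (LINT x|\<nu>'. f x * \<sigma>' x $ i)"
    and A [measurable]: "A \<in> sets borel"
  shows "measure \<nu> A \<le> measure \<nu>' A"
proof -
  note D = polar_measureD[OF \<nu>(1) \<Omega>]
  note D' = polar_measureD[OF \<nu>(2) \<Omega>]
  interpret \<nu>: finite_measure \<nu> by (rule D)
  interpret \<nu>': finite_measure \<nu>' by (rule D')
  have [measurable_cong]: "sets \<nu> = sets borel" "sets \<nu>' = sets borel" by (rule D D')+
  have [measurable]: "\<sigma> \<in> borel_measurable borel" "\<sigma>' \<in> borel_measurable borel" by (rule D D')+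
  \<comment> \<open>\<open>\<sigma>\<close> has norm 1 only almost everywhere, so it is truncated to a bounded function.\<close>
  define s where "s x = \<sigma> x /\<^sub>R max 1 (norm (\<sigma> x))" for x
  have sm [measurable]: "s \<in> borel_measurable borel" unfolding s_def by measurable
  have s1: "norm (s x) \<le> 1" for x by (simp add: s_def divide_inverse[symmetric] field_simps)
  define f where "f i x = indicator A x * s x $ i" for i x
  have fm [measurable]: "f i \<in> borel_measurable borel" for i unfolding f_def by measurable
  have fb: "\<bar>f i x\<bar> \<le> 1" for i x
    using component_le_norm_cart[of "s x" i] s1[of x] by (auto simp: f_def indicator_def)
  have int: "integrable \<nu> (\<lambda>x. f i x * \<sigma> x $ i)" "integrable \<nu>' (\<lambda>x. f i x * \<sigma>' x $ i)" for i
    using integrable_bounded_mult[OF D(1,6,7) fm fb] integrable_bounded_mult[OF D'(1,6,7) fm fb] by simp_all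
  have sum: "(\<Sum>i\<in>UNIV. f i x * v $ i) = indicator A x * (s x \<bullet> v)" for x v
    by (simp add: f_def inner_vec_def sum_distrib_left mult.assoc)
  have "measure \<nu> A = (LINT x|\<nu>. indicator A x)" using D(1) by simp
  also have "\<dots> = (LINT x|\<nu>. (\<Sum>i\<in>UNIV. f i x * \<sigma> x $ i))"
    unfolding sum
  proof (rule integral_cong_AE)
    show "AE x in \<nu>. indicator A x = indicator A x * (s x \<bullet> \<sigma> x)"
      using D(5)
    proof eventually_elim
      case (elim x)
      then have "s x \<bullet> \<sigma> x = 1" by (simp add: s_def dot_square_norm)
      then show ?case by simp
    qed
  qed (use sm in measurable)
  also have "\<dots> = (\<Sum>i\<in>UNIV. (LINT x|\<nu>. f i x * \<sigma> x $ i))" by (intro Bochner_Integration.integral_sum int)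
  also have "\<dots> = (\<Sum>i\<in>UNIV. (LINT x|\<nu>'. f i x * \<sigma>' x $ i))" by (intro sum.cong refl eq[OF fm fb])
  also have "\<dots> = (LINT x|\<nu>'. (\<Sum>i\<in>UNIV. f i x * \<sigma>' x $ i))" by (intro Bochner_Integration.integral_sum[symmetric] int)
  also have "\<dots> \<le> (LINT x|\<nu>'. indicator A x)"
  proof (rule integral_mono_AE)
    show "integrable \<nu>' (\<lambda>x. \<Sum>i\<in>UNIV. f i x * \<sigma>' x $ i)" by (intro Bochner_Integration.integrable_sum int)
    show "integrable \<nu>' (\<lambda>x. indicator A x :: real)"
      using D'(1) by (intro integrable_real_indicator) (auto simp: \<nu>'.emeasure_eq_measure)
    show "AE x in \<nu>'. (\<Sum>i\<in>UNIV. f i x * \<sigma>' x $ i) \<le> indicator A x"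
      using D'(5)
    proof eventually_elim
      case (elim x)
      have "s x \<bullet> \<sigma>' x \<le> norm (s x) * norm (\<sigma>' x)" by (rule norm_cauchy_schwarz)
      also have "\<dots> \<le> 1" using elim s1[of x] by simp
      finally show ?case unfolding sum by (simp add: indicator_def)
    qed
  qed
  also have "\<dots> = measure \<nu>' A" using D'(1) by simp
  finally show ?thesis .
qed

text \<open>Equality extends from test functions to bounded Borel functions. Those that vanish on the null set
  carrying \<open>\<nu>\<close> and \<open>\<nu>'\<close> see the absolutely continuous parts only.\<close>

theorem grad_pairing_singular_unique:
  assumes ab: "0 < a" "a < b"
    and h: "h absolutely_integrable_on annulus a b" "h' absolutely_integrable_on annulus a b"
    and \<nu>: "polar_measure (annulus a b) \<nu> \<sigma>" "polar_measure (annulus a b) \<nu>' \<sigma>'"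
    and N: "N1 \<in> null_sets lborel" "emeasure \<nu> (- N1) = 0" "N2 \<in> null_sets lborel" "emeasure \<nu>' (- N2) = 0"
    and eq: "\<And>\<phi> i. test_function (annulus a b) \<phi> \<Longrightarrow>
      grad_pairing (annulus a b) h \<nu> \<sigma> i \<phi> = grad_pairing (annulus a b) h' \<nu>' \<sigma>' i \<phi>"
  shows "AE x in lebesgue. x \<in> annulus a b \<longrightarrow> h x = h' x" and "\<nu> = \<nu>'"
proof -
  let ?W = "annulus a b"
  note D = polar_measureD[OF \<nu>(1) annulus_borel]
  note D' = polar_measureD[OF \<nu>(2) annulus_borel]
  obtain k where "borel_version ?W h k"
    using borel_version_exists[OF h(1) annulus_borel] by blast
  note k = borel_versionD[OF this]
  note [measurable] = k(1)
  obtain k' where "borel_version ?W h' k'"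
    using borel_version_exists[OF h(2) annulus_borel] by blast
  note k' = borel_versionD[OF this]
  note [measurable] = k'(1)
  have [measurable_cong]: "sets \<nu> = sets borel" "sets \<nu>' = sets borel" by (rule D D')+
  have [measurable]: "\<sigma> \<in> borel_measurable borel" "\<sigma>' \<in> borel_measurable borel" by (rule D D')+
  define N where "N = N1 \<union> N2"
  have Nn: "N \<in> null_sets lborel" unfolding N_def using N by auto
  have [measurable]: "N1 \<in> sets borel" "N2 \<in> sets borel" "N \<in> sets borel" using N Nn by (auto simp: null_sets_def)
  have "AE x in \<nu>. x \<in> N1"
    by (rule AE_I[of _ _ "- N1"]) (use N(2) D(1) in auto)
  moreover have "AE x in \<nu>'. x \<in> N2"
    by (rule AE_I[of _ _ "- N2"]) (use N(4) D'(1) in auto)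
  ultimately have aeN: "AE x in \<nu>. x \<in> N" "AE x in \<nu>'. x \<in> N" by (auto simp: N_def elim: eventually_mono)
  have aeL: "AE x in lborel. x \<notin> N" using Nn by (rule AE_not_in)
  have full: "grad_pairing ?W h \<nu> \<sigma> i f = grad_pairing ?W h' \<nu>' \<sigma>' i f"
    if "f \<in> borel_measurable borel" "\<And>x. \<bar>f x\<bar> \<le> B" for f B i
    by (rule grad_pairing_unique[OF ab h \<nu> eq that])
  have ac: "(LINT x|lborel. f x * k x $ i) = (LINT x|lborel. f x * k' x $ i)"
    if [measurable]: "f \<in> borel_measurable borel" and fB: "\<And>x. \<bar>f x\<bar> \<le> B" for f B i
  proof -
    define g where "g x = f x * indicator (- N) x" for x
    have gm [measurable]: "g \<in> borel_measurable borel" unfolding g_def by measurable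
    have "\<bar>g x\<bar> \<le> B" for x using fB[of x] by (auto simp: g_def indicator_def)
    from full[OF gm this, of i]
    have "(LINT x|lborel. g x * k x $ i) + (LINT x|\<nu>. g x * \<sigma> x $ i)
        = (LINT x|lborel. g x * k' x $ i) + (LINT x|\<nu>'. g x * \<sigma>' x $ i)"
      unfolding grad_pairing_def k(5)[OF gm] k'(5)[OF gm] .
    moreover have "(LINT x|\<nu>. g x * \<sigma> x $ i) = 0" "(LINT x|\<nu>'. g x * \<sigma>' x $ i) = 0"
      using aeN by (auto intro!: integral_eq_zero_AE elim!: eventually_mono simp: g_def)
    moreover have "(LINT x|lborel. g x * k x $ i) = (LINT x|lborel. f x * k x $ i)"
      using aeL by (intro integral_cong_AE) (auto elim!: eventually_mono simp: g_def)
    moreover have "(LINT x|lborel. g x * k' x $ i) = (LINT x|lborel. f x * k' x $ i)"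
      using aeL by (intro integral_cong_AE) (auto elim!: eventually_mono simp: g_def)
    ultimately show ?thesis by simp
  qed
  have "AE x in lborel. k x $ i = k' x $ i" for i
  proof -
    define f where "f x = sgn (k x $ i - k' x $ i)" for x
    have fm [measurable]: "f \<in> borel_measurable borel" unfolding f_def by measurable
    have fb: "\<bar>f x\<bar> \<le> 1" for x by (simp add: f_def sgn_if)
    have "integrable lborel (\<lambda>x. f x * k x $ i)" "integrable lborel (\<lambda>x. f x * k' x $ i)"
      using integrable_bounded_mult[OF sets_lborel k(2)[of i] _ fm fb, of UNIV]
        integrable_bounded_mult[OF sets_lborel k'(2)[of i] _ fm fb, of UNIV] by auto
    then have "(LINT x|lborel. f x * k x $ i - f x * k' x $ i) = 0"
      using ac[OF fm fb, of i] by simp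
    moreover have "f x * k x $ i - f x * k' x $ i = \<bar>k x $ i - k' x $ i\<bar>" for x
      by (simp add: f_def sgn_if algebra_simps)
    ultimately have "(LINT x|lborel. \<bar>k x $ i - k' x $ i\<bar>) = 0" by simp
    then have "AE x in lborel. \<bar>k x $ i - k' x $ i\<bar> = 0"
      using k(2)[of i] k'(2)[of i] by (subst integral_nonneg_eq_0_iff_AE[symmetric]) auto
    then show ?thesis by eventually_elim auto
  qed
  then have "AE x in lborel. \<forall>i\<in>UNIV. k x $ i = k' x $ i" by (intro AE_finite_allI) auto
  then have "AE x in lborel. k x = k' x" by eventually_elim (simp add: vec_eq_iff)
  then have "AE x in lebesgue. k x = k' x" by (rule AE_completion)
  with k(4) k'(4) show "AE x in lebesgue. x \<in> ?W \<longrightarrow> h x = h' x"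
    by eventually_elim auto
  have sing: "(LINT x|\<nu>. f x * \<sigma> x $ i) = (LINT x|\<nu>'. f x * \<sigma>' x $ i)"
    if "f \<in> borel_measurable borel" "\<And>x. \<bar>f x\<bar> \<le> B" for f B i
    using full[OF that, of i] ac[OF that, of i]
    unfolding grad_pairing_def k(5)[OF that(1)] k'(5)[OF that(1)] by simp
  interpret \<nu>: finite_measure \<nu> by (rule D)
  interpret \<nu>': finite_measure \<nu>' by (rule D')
  show "\<nu> = \<nu>'"
  proof (rule measure_eqI)
    fix A assume "A \<in> sets \<nu>"
    then have A: "A \<in> sets borel" using D(1) by simp
    have "measure \<nu> A = measure \<nu>' A"
      by (intro antisym polar_measure_le[OF \<nu> annulus_borel sing A]
          polar_measure_le[OF \<nu>(2,1) annulus_borel sing[symmetric] A])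
    then show "emeasure \<nu> A = emeasure \<nu>' A"
      by (simp add: \<nu>.emeasure_eq_measure \<nu>'.emeasure_eq_measure)
  qed (use D(1) D'(1) in simp)
qed

corollary gradient_decomposition_unique:
  assumes ab: "0 < a" "a < b"
    and "gradient_decomposition (annulus a b) w h \<nu> \<sigma>" "gradient_decomposition (annulus a b) w h' \<nu>' \<sigma>'"
  shows "AE x in lebesgue. x \<in> annulus a b \<longrightarrow> h x = h' x" and "\<nu> = \<nu>'"
proof -
  obtain N1 N2 where N: "N1 \<in> null_sets lborel" "emeasure \<nu> (- N1) = 0" "N2 \<in> null_sets lborel" "emeasure \<nu>' (- N2) = 0"
    using assms(3,4) by (auto simp: gradient_decomposition_def)
  have eq: "grad_pairing (annulus a b) h \<nu> \<sigma> i \<phi> = grad_pairing (annulus a b) h' \<nu>' \<sigma>' i \<phi>"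
    if "test_function (annulus a b) \<phi>" for \<phi> i
  proof -
    have "(LINT x:annulus a b|lebesgue. w x * partial_deriv i \<phi> x) = - grad_pairing (annulus a b) h \<nu> \<sigma> i \<phi>"
      "(LINT x:annulus a b|lebesgue. w x * partial_deriv i \<phi> x) = - grad_pairing (annulus a b) h' \<nu>' \<sigma>' i \<phi>"
      using assms(3,4) that unfolding gradient_decomposition_def grad_pairing_def by blast+
    then show ?thesis by linarith
  qed
  show "AE x in lebesgue. x \<in> annulus a b \<longrightarrow> h x = h' x" "\<nu> = \<nu>'"
    using grad_pairing_singular_unique[OF ab _ _ _ _ N eq] assms(3,4)
    unfolding gradient_decomposition_def by auto
qed

text \<open>A Lebesgue null set of maximal \<open>\<nu>\<close>-measure.\<close>

lemma lebesgue_singular_part: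
  fixes \<nu> :: "'a::euclidean_space measure"
  assumes "finite_measure \<nu>" and sets: "sets \<nu> = sets borel"
  obtains N where "N \<in> null_sets lborel" "\<And>A. A \<in> null_sets lborel \<Longrightarrow> measure \<nu> (A - N) = 0"
proof -
  interpret finite_measure \<nu> by fact
  define S where "S = measure \<nu> ` null_sets lborel"
  have bdd: "bdd_above S" unfolding S_def by (intro bdd_aboveI2[of _ _ "measure \<nu> (space \<nu>)"] bounded_measure)
  have ne: "S \<noteq> {}" unfolding S_def by auto
  have "\<exists>N\<in>null_sets lborel. Sup S - 1 / real (Suc k) < measure \<nu> N" for k
  proof -
    have "Sup S - 1 / real (Suc k) < Sup S" by simp
    then have "\<exists>m\<in>S. Sup S - 1 / real (Suc k) < m" using less_cSup_iff[OF ne bdd] by blast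
    then show ?thesis by (auto simp: S_def)
  qed
  then obtain M where M: "\<And>k. M k \<in> null_sets lborel" "\<And>k. Sup S - 1 / real (Suc k) < measure \<nu> (M k)" by metis
  define N where "N = (\<Union>k. M k)"
  have N: "N \<in> null_sets lborel" unfolding N_def using M(1) by (intro null_sets_UN') auto
  have Nsup: "Sup S \<le> measure \<nu> N"
  proof (rule field_le_epsilon)
    fix e :: real assume "0 < e"
    then obtain k where k: "1 / real (Suc k) < e" using nat_approx_posE by blast
    have "measure \<nu> (M k) \<le> measure \<nu> N"
      using N sets by (intro finite_measure_mono) (auto simp: N_def null_sets_def)
    then show "Sup S \<le> measure \<nu> N + e" using M(2)[of k] k by linarith
  qed
  show ?thesis
  proof (rule that[OF N])
    fix A :: "'a set" assume A: "A \<in> null_sets lborel"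
    have sb: "A \<in> sets \<nu>" "N \<in> sets \<nu>" using A N sets by (auto simp: null_sets_def)
    have "measure \<nu> (N \<union> A) \<le> Sup S"
      by (rule cSup_upper[OF _ bdd]) (use A N in \<open>auto simp: S_def\<close>)
    moreover have "measure \<nu> (N \<union> A) = measure \<nu> N + measure \<nu> (A - N)"
      using finite_measure_Union[of N "A - N"] sb by simp
    ultimately show "measure \<nu> (A - N) = 0" using Nsup measure_nonneg[of \<nu> "A - N"] by linarith
  qed
qed

text \<open>Restriction to a null set \<open>N\<close> of maximal measure is the singular part. The rest has no mass on
  null sets, and its density comes from the Radon-Nikodym theorem.\<close>

theorem gradient_decomposition_exists:
  fixes \<Omega> :: "(real^'n::finite) set"
  assumes \<nu>: "is_gradient_measure \<Omega> w \<nu> \<sigma>" and \<Omega> [measurable]: "\<Omega> \<in> sets borel"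
  shows "\<exists>h \<nu>' \<sigma>'. gradient_decomposition \<Omega> w h \<nu>' \<sigma>'"
proof -
  have p: "polar_measure \<Omega> \<nu> \<sigma>" using \<nu> by (simp add: is_gradient_measure_def)
  note D = polar_measureD[OF p \<Omega>]
  interpret finite_measure \<nu> by (rule D)
  have [measurable_cong]: "sets \<nu> = sets borel" by (rule D)
  have [measurable]: "\<sigma> \<in> borel_measurable borel" by (rule D)
  have sp: "space \<nu> = UNIV" using sets_eq_imp_space_eq[OF D(1)] by simp
  obtain N where N: "N \<in> null_sets lborel" "\<And>A. A \<in> null_sets lborel \<Longrightarrow> measure \<nu> (A - N) = 0"
    using lebesgue_singular_part[OF D(2,1)] by blast
  have [measurable]: "N \<in> sets borel" using N(1) by (auto simp: null_sets_def)
  define \<nu>s where "\<nu>s = density \<nu> (\<lambda>x. ennreal (indicator N x))"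
  define \<nu>a where "\<nu>a = density \<nu> (\<lambda>x. ennreal (indicator (- N) x))"
  have es: "emeasure \<nu>s A = emeasure \<nu> (A \<inter> N)" if [measurable]: "A \<in> sets borel" for A
    unfolding \<nu>s_def by (subst emeasure_density, simp, simp)
      (auto simp: nn_integral_indicator[symmetric] indicator_def intro!: nn_integral_cong simp del: nn_integral_indicator)
  have ea: "emeasure \<nu>a A = emeasure \<nu> (A - N)" if [measurable]: "A \<in> sets borel" for A
    unfolding \<nu>a_def by (subst emeasure_density, simp, simp)
      (auto simp: nn_integral_indicator[symmetric] indicator_def intro!: nn_integral_cong simp del: nn_integral_indicator)
  have "absolutely_continuous lborel \<nu>a"
    unfolding absolutely_continuous_def
  proof
    fix A :: "(real^'n) set" assume A: "A \<in> null_sets lborel"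
    then have "A \<in> sets borel" by (auto simp: null_sets_def)
    then show "A \<in> null_sets \<nu>a"
      using N(2)[OF A] ea[of A] D(1) by (auto simp: null_sets_def emeasure_eq_measure \<nu>a_def)
  qed
  moreover have "sets \<nu>a = sets lborel" using D(1) by (simp add: \<nu>a_def)
  ultimately obtain f where f [measurable]: "f \<in> borel_measurable lborel" and df: "density lborel f = \<nu>a"
    using sigma_finite_measure.Radon_Nikodym[OF sigma_finite_lborel] by blast
  have "(\<integral>\<^sup>+x. f x \<partial>lborel) = emeasure (density lborel f) UNIV"
    by (subst emeasure_density) (auto intro!: nn_integral_cong)
  also have "\<dots> = emeasure \<nu> (UNIV - N)" unfolding df by (subst ea) auto
  finally have fin: "(\<integral>\<^sup>+x. f x \<partial>lborel) < \<infinity>" by (simp add: emeasure_eq_measure)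
  have ftop: "AE x in lborel. f x \<noteq> \<infinity>" by (rule nn_integral_PInf_AE) (use fin in auto)
  define r where "r x = enn2real (f x)" for x
  have [measurable]: "r \<in> borel_measurable borel" unfolding r_def using f by simp
  have fr: "AE x in lborel. f x = ennreal (r x)"
    using ftop by eventually_elim (simp add: r_def less_top)
  have dr: "\<nu>a = density lborel (\<lambda>x. ennreal (r x))"
    unfolding df[symmetric] by (rule density_cong[OF _ _ fr]) auto
  have rint: "integrable lborel r"
  proof (rule integrableI_bounded)
    have "(\<integral>\<^sup>+x. ennreal (norm (r x)) \<partial>lborel) = (\<integral>\<^sup>+x. f x \<partial>lborel)"
      using fr by (intro nn_integral_cong_AE) (auto elim!: eventually_mono simp: r_def)
    then show "(\<integral>\<^sup>+x. ennreal (norm (r x)) \<partial>lborel) < \<infinity>" using fin by simp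
  qed simp
  have ae_a: "AE x in \<nu>a. P x" if "AE x in \<nu>. P x" for P
    using that unfolding \<nu>a_def by (subst AE_density) (auto elim!: eventually_mono)
  have ae_s: "AE x in \<nu>s. P x" if "AE x in \<nu>. P x" for P
    using that unfolding \<nu>s_def by (subst AE_density) (auto elim!: eventually_mono)
  have r\<sigma>: "AE x in lborel. 0 < r x \<longrightarrow> norm (\<sigma> x) = 1"
    using ae_a[OF D(5)] unfolding dr by (subst (asm) AE_density) auto
  have r\<Omega>: "AE x in lborel. 0 < r x \<longrightarrow> x \<in> \<Omega>"
    using ae_a[OF D(3)] unfolding dr by (subst (asm) AE_density) auto
  define h where "h x = r x *\<^sub>R \<sigma> x" for x
  have hm [measurable]: "h \<in> borel_measurable borel" unfolding h_def by measurable
  have hint: "integrable lborel h"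
  proof (rule Bochner_Integration.integrable_bound[OF rint])
    show "AE x in lborel. norm (h x) \<le> norm (r x)"
      using r\<sigma>
    proof eventually_elim
      case (elim x)
      have "0 \<le> r x" by (simp add: r_def)
      then show ?case using elim by (cases "r x = 0") (auto simp: h_def)
    qed
  qed simp
  have habs: "h absolutely_integrable_on \<Omega>"
  proof -
    have "integrable lebesgue h" using hint by (subst integrable_completion) auto
    then show ?thesis unfolding set_integrable_def by (intro integrable_mult_indicator) auto
  qed
  have pol: "polar_measure \<Omega> \<nu>s \<sigma>"
    unfolding polar_measure_def
  proof (intro conjI)
    show "sets \<nu>s = sets borel" using D(1) by (simp add: \<nu>s_def)
    show "finite_measure \<nu>s"
      by (rule finite_measureI) (simp add: \<nu>s_def[THEN arg_cong[where f = space]] sp es emeasure_eq_measure)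
    have "emeasure \<nu> (- \<Omega>) = 0" using p by (simp add: polar_measure_def)
    then show "emeasure \<nu>s (- \<Omega>) = 0"
      using emeasure_mono[of "- \<Omega> \<inter> N" "- \<Omega>" \<nu>] D(1) by (simp add: es)
    show "AE x in \<nu>s. norm (\<sigma> x) = 1" by (rule ae_s[OF D(5)])
  qed (rule D)
  have main: "(LINT x:\<Omega>|lebesgue. w x * partial_deriv i \<phi> x) =
      - ((LINT x:\<Omega>|lebesgue. \<phi> x * h x $ i) + (LINT x|\<nu>s. \<phi> x * \<sigma> x $ i))"
    if t: "test_function \<Omega> \<phi>" for i \<phi>
  proof -
    have c: "C1_on UNIV \<phi>" using t by (simp add: test_function_def)
    have [measurable]: "\<phi> \<in> borel_measurable borel"
      by (intro borel_measurable_continuous_onI C1_onD(3)[OF c])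
    obtain C where C: "compact C" "\<And>x. x \<notin> C \<Longrightarrow> \<phi> x = 0" using t by (auto simp: test_function_def)
    have "bounded (\<phi> ` C)"
      by (intro compact_imp_bounded compact_continuous_image C continuous_on_subset[OF C1_onD(3)[OF c]]) auto
    then obtain B where "\<And>x. x \<in> C \<Longrightarrow> \<bar>\<phi> x\<bar> \<le> B" by (auto simp: bounded_iff)
    then have B: "\<bar>\<phi> x\<bar> \<le> max 0 B" for x using C(2)[of x] by (cases "x \<in> C") (auto intro: max.coboundedI2)
    have int: "integrable \<nu> (\<lambda>x. \<phi> x * \<sigma> x $ i)"
      by (rule integrable_bounded_mult[OF D(1,6,7) _ B]) measurable
    have "(LINT x|\<nu>. \<phi> x * \<sigma> x $ i)
        = (LINT x|\<nu>. indicator N x * (\<phi> x * \<sigma> x $ i) + indicator (- N) x * (\<phi> x * \<sigma> x $ i))"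
      by (intro Bochner_Integration.integral_cong) (auto simp: indicator_def)
    also have "\<dots> = (LINT x|\<nu>. indicator N x * (\<phi> x * \<sigma> x $ i)) + (LINT x|\<nu>. indicator (- N) x * (\<phi> x * \<sigma> x $ i))"
      using integrable_mult_indicator[OF _ int, of N] integrable_mult_indicator[OF _ int, of "- N"] D(1)
      by (intro Bochner_Integration.integral_add) auto
    also have "(LINT x|\<nu>. indicator N x * (\<phi> x * \<sigma> x $ i)) = (LINT x|\<nu>s. \<phi> x * \<sigma> x $ i)"
      unfolding \<nu>s_def by (subst integral_density) auto
    also have "(LINT x|\<nu>. indicator (- N) x * (\<phi> x * \<sigma> x $ i)) = (LINT x|\<nu>a. \<phi> x * \<sigma> x $ i)"
      unfolding \<nu>a_def by (subst integral_density) auto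
    also have "(LINT x|\<nu>a. \<phi> x * \<sigma> x $ i) = (LINT x|lborel. r x * (\<phi> x * \<sigma> x $ i))"
      unfolding dr by (subst integral_density) (auto simp: r_def)
    also have "\<dots> = (LINT x|lborel. indicator \<Omega> x * (\<phi> x * h x $ i))"
    proof (rule integral_cong_AE)
      show "AE x in lborel. r x * (\<phi> x * \<sigma> x $ i) = indicator \<Omega> x * (\<phi> x * h x $ i)"
        using r\<Omega>
      proof eventually_elim
        case (elim x)
        have "0 \<le> r x" by (simp add: r_def)
        then show ?case using elim by (cases "r x = 0") (auto simp: h_def)
      qed
    qed (simp_all add: h_def)
    also have "\<dots> = (LINT x:\<Omega>|lebesgue. \<phi> x * h x $ i)"
      unfolding set_lebesgue_integral_def by (subst integral_completion) (simp_all add: h_def)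
    finally show ?thesis
      using \<nu> t by (simp add: is_gradient_measure_def)
  qed
  have "emeasure \<nu>s (- N) = 0" by (simp add: es)
  then have "gradient_decomposition \<Omega> w h \<nu>s \<sigma>"
    unfolding gradient_decomposition_def using habs pol N(1) main by blast
  then show ?thesis by blast
qed

lemma polar_measure_null: "polar_measure \<Omega> (null_measure borel) (\<lambda>_. 0)"
  unfolding polar_measure_def
  by (auto intro!: finite_measureI AE_I[of _ _ UNIV])

lemma integral_null_measure [simp]: "(LINT x|null_measure M. f x :: real) = 0"
  by (rule integral_eq_zero_AE) (auto intro!: AE_I[of _ _ "space M"])

lemma gradient_decomposition_weak_gradient:
  assumes "has_weak_gradient \<Omega> w G" "G absolutely_integrable_on \<Omega>"
  shows "gradient_decomposition \<Omega> w G (null_measure borel) (\<lambda>_. 0)"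
  unfolding gradient_decomposition_def
  using assms polar_measure_null
  by (auto simp: has_weak_gradient_def weak_partial_def mult.commute intro!: bexI[of _ "{}"])

text \<open>The total variation measure has density \<open>|G|\<close>, and its direction is \<open>G / |G|\<close>.\<close>

lemma is_gradient_measure_weak_gradient:
  fixes \<Omega> :: "(real^'n::finite) set"
  assumes G: "has_weak_gradient \<Omega> w G" "G absolutely_integrable_on \<Omega>" and \<Omega> [measurable]: "\<Omega> \<in> sets borel"
  shows "\<exists>\<nu> \<sigma>. is_gradient_measure \<Omega> w \<nu> \<sigma>"
proof -
  obtain k where "borel_version \<Omega> G k"
    using borel_version_exists[OF G(2) \<Omega>] by blast
  note k = borel_versionD[OF this]
  have [measurable]: "k \<in> borel_measurable borel" by (rule k)
  have [measurable]: "(\<lambda>x. k x $ i) \<in> borel_measurable borel" for i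
    by (intro measurable_compose[OF k(1)] borel_measurable_continuous_onI continuous_intros)
  have kint: "integrable lborel (\<lambda>x. norm (k x))"
  proof (rule Bochner_Integration.integrable_bound)
    show "integrable lborel (\<lambda>x. \<Sum>i\<in>UNIV. \<bar>k x $ i\<bar>)" using k(2) by auto
    show "AE x in lborel. norm (norm (k x)) \<le> norm (\<Sum>i\<in>UNIV. \<bar>k x $ i\<bar>)"
      using norm_le_l1_cart[of "k _"] by (auto simp: sum_nonneg)
  qed simp
  define \<nu> where "\<nu> = density lborel (\<lambda>x. ennreal (norm (k x)))"
  define \<sigma> where "\<sigma> x = sgn (k x)" for x
  have \<sigma>m: "\<sigma> \<in> borel_measurable borel" unfolding \<sigma>_def sgn_div_norm by measurable
  have "polar_measure \<Omega> \<nu> \<sigma>"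
    unfolding polar_measure_def
  proof (intro conjI)
    show "finite_measure \<nu>"
    proof (rule finite_measureI)
      have "emeasure \<nu> (space \<nu>) = (\<integral>\<^sup>+x. ennreal (norm (norm (k x))) \<partial>lborel)"
        unfolding \<nu>_def by (subst emeasure_density) (auto intro!: nn_integral_cong)
      also have "\<dots> < \<infinity>" using kint unfolding integrable_iff_bounded by blast
      finally show "emeasure \<nu> (space \<nu>) \<noteq> \<infinity>" by simp
    qed
    show "emeasure \<nu> (- \<Omega>) = 0"
      unfolding \<nu>_def by (subst emeasure_density) (auto simp: nn_integral_0_iff_AE k(3) indicator_def)
    show "AE x in \<nu>. norm (\<sigma> x) = 1"
      unfolding \<nu>_def by (subst AE_density) (auto simp: \<sigma>_def norm_sgn)
  qed (auto simp: \<nu>_def intro: \<sigma>m)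
  moreover have "(LINT x:\<Omega>|lebesgue. w x * partial_deriv i \<phi> x) = - (LINT x|\<nu>. \<phi> x * \<sigma> x $ i)"
    if t: "test_function \<Omega> \<phi>" for i \<phi>
  proof -
    have [measurable]: "\<phi> \<in> borel_measurable borel"
      using t by (auto simp: test_function_def intro!: borel_measurable_continuous_onI C1_onD(3))
    note [measurable] = \<sigma>m
    have "(LINT x|\<nu>. \<phi> x * \<sigma> x $ i) = (LINT x|lborel. norm (k x) * (\<phi> x * \<sigma> x $ i))"
      unfolding \<nu>_def by (subst integral_density) auto
    also have "\<dots> = (LINT x|lborel. \<phi> x * k x $ i)"
    proof (intro Bochner_Integration.integral_cong refl)
      fix x
      have "norm (k x) * \<sigma> x $ i = k x $ i"
        by (cases "k x = 0") (auto simp: \<sigma>_def sgn_div_norm)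
      then show "norm (k x) * (\<phi> x * \<sigma> x $ i) = \<phi> x * k x $ i"
        by (simp add: mult.left_commute)
    qed
    also have "\<dots> = (LINT x:\<Omega>|lebesgue. G x $ i * \<phi> x)"
      by (subst k(5)[symmetric]) (simp_all add: mult.commute)
    finally show ?thesis using G(1) t by (simp add: has_weak_gradient_def weak_partial_def)
  qed
  ultimately show ?thesis by (auto simp: is_gradient_measure_def)
qed

lemma W11_subset_BV:
  assumes "\<Omega> \<in> sets borel"
  shows "W11 \<Omega> \<subseteq> BV \<Omega>"
  using is_gradient_measure_weak_gradient[OF _ _ assms] by (auto simp: W11_def BV_def)

section \<open>Radial averages\<close>

lemma continuous_on_compact_bound:
  fixes f :: "'a::metric_space \<Rightarrow> real"
  assumes "compact S" "continuous_on S f"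
  shows "\<exists>B. \<forall>x\<in>S. \<bar>f x\<bar> \<le> B"
  using compact_imp_bounded[OF compact_continuous_image[OF assms(2,1)]] by (auto simp: bounded_iff)

lemma C1_on_sgn_polynomial:
  "real_polynomial_function p \<Longrightarrow> C1_on (- {0}) (\<lambda>x :: real^'n::finite. p (sgn x))"
proof (induction rule: real_polynomial_function.induct)
  case (linear f)
  have "C1_on (- {0}) (\<lambda>x. f x * inverse (norm x))"
  proof (rule C1_on_mult)
    show "C1_on (- {0}) f"
      using linear by (intro C1_on_real_polynomial_function real_polynomial_function.intros(1))
    show "C1_on (- {0}) (\<lambda>x :: real^'n. inverse (norm x))"
    proof (rule C1_on_radial[where T = "{0<..}"])
      show "(inverse has_real_derivative - (inverse r)\<^sup>2) (at r)" if "r \<in> {0<..}" for r :: real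
        using DERIV_inverse[of r] that by (simp add: power2_eq_square)
    qed (auto intro!: continuous_intros)
  qed
  moreover have "f x * inverse (norm x) = f (sgn x)" for x
    using linear by (simp add: sgn_div_norm linear_cmul bounded_linear.linear mult.commute)
  ultimately show ?case by simp
qed (auto intro: C1_on_const C1_on_add C1_on_mult)

text \<open>A function that is constant along rays has a tangential gradient.\<close>

lemma inner_gradient_homogeneous:
  fixes f :: "'a::real_inner \<Rightarrow> real"
  assumes D: "GDERIV f x :> d" and hom: "\<And>t. 0 < t \<Longrightarrow> f (t *\<^sub>R x) = f x"
  shows "x \<bullet> d = 0"
proof -
  have "((\<lambda>t. f (t *\<^sub>R x)) has_derivative (\<lambda>h. (h *\<^sub>R x) \<bullet> d)) (at (1::real))"
  proof (rule has_derivative_compose[where g = f, simplified])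
    show "((\<lambda>t. t *\<^sub>R x) has_derivative (\<lambda>h. h *\<^sub>R x)) (at (1::real))"
      by (auto intro!: derivative_eq_intros)
    show "(f has_derivative (\<lambda>h. h \<bullet> d)) (at (1 *\<^sub>R x))" using D by (simp add: gderiv_def)
  qed
  moreover have "((\<lambda>t. f (t *\<^sub>R x)) has_derivative (\<lambda>h. 0)) (at (1::real))"
    by (rule has_derivative_transform_within_open[of "\<lambda>_. f x" _ _ _ "{0<..}"]) (auto simp: hom)
  ultimately have "(\<lambda>h::real. (h *\<^sub>R x) \<bullet> d) = (\<lambda>h. 0)" by (rule has_derivative_unique)
  then show ?thesis by (metis scaleR_one)
qed

text \<open>The field \<open>\<psi>(x / |x|) \<kappa>(|x|) x / |x|\<^sup>2\<close>. Since \<open>x / |x|\<^sup>2\<close> is divergence free in the plane and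
  \<open>\<psi>(x / |x|)\<close> is constant along rays, its divergence is \<open>\<psi>(x / |x|) \<kappa>'(|x|) / |x|\<close>. In
  polar coordinates the factor \<open>1 / |x|\<close> cancels the Jacobian. Testing a gradient with this field
  therefore integrates \<open>\<psi>\<close> against averages along rays with the weight \<open>\<kappa>'\<close>.\<close>

definition angular_field :: "(real^2 \<Rightarrow> real) \<Rightarrow> (real \<Rightarrow> real) \<Rightarrow> 2 \<Rightarrow> real^2 \<Rightarrow> real" where
  "angular_field \<psi> \<kappa> i x = \<psi> (sgn x) * (\<kappa> (norm x) / (norm x)\<^sup>2) * x $ i"

lemma
  assumes \<psi>: "real_polynomial_function \<psi>"
    and \<kappa>: "\<And>r. (\<kappa> has_real_derivative j r) (at r)" "continuous_on UNIV j"
    and a: "0 < a" "\<And>r. r \<le> a \<Longrightarrow> \<kappa> r = 0"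
  shows C1_on_angular_field: "C1_on UNIV (angular_field \<psi> \<kappa> i)"
    and divergence_angular_field: "x \<noteq> 0 \<Longrightarrow>
      (\<Sum>i\<in>UNIV. partial_deriv i (angular_field \<psi> \<kappa> i) x) = \<psi> (sgn x) * j (norm x) / norm x"
proof -
  define F where "F x = \<psi> (sgn x)" for x :: "real^2"
  define Y where "Y r = \<kappa> r / r\<^sup>2" for r
  define Y' where "Y' r = (j r * r\<^sup>2 - \<kappa> r * (2 * r)) / (r\<^sup>2 * r\<^sup>2)" for r
  have Y: "(Y has_real_derivative Y' r) (at r)" if "r \<in> {0<..}" for r
    unfolding Y_def Y'_def using that \<kappa>(1)[of r]
    by (auto intro!: derivative_eq_intros)
  have c\<kappa>: "continuous_on S \<kappa>" for S
    using \<kappa>(1) by (meson DERIV_isCont continuous_at_imp_continuous_on)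
  have Y'c: "continuous_on {0<..} Y'"
    unfolding Y'_def by (intro continuous_intros c\<kappa> continuous_on_subset[OF \<kappa>(2)]) auto
  have CF: "C1_on (- {0}) F" unfolding F_def by (rule C1_on_sgn_polynomial[OF \<psi>])
  have CY: "C1_on (- {0}) (\<lambda>x::real^2. Y (norm x))"
    by (rule C1_on_radial[OF Y Y'c]) auto
  have CG: "C1_on (- {0}) (\<lambda>x. F x * Y (norm x))" by (rule C1_on_mult[OF CF CY])
  have eq: "angular_field \<psi> \<kappa> i = (\<lambda>x. F x * Y (norm x) * x $ i)" for i
    by (auto simp: angular_field_def F_def Y_def fun_eq_iff)
  have C0: "C1_on (- {0}) (angular_field \<psi> \<kappa> i)" for i
    unfolding eq by (intro C1_on_mult CG C1_on_nth)
  have "C1_on (ball 0 a) (angular_field \<psi> \<kappa> i)"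
    by (rule C1_on_zero) (auto simp: angular_field_def a)
  with C0[of i] have "C1_on (- {0} \<union> ball 0 a) (angular_field \<psi> \<kappa> i)" by (intro C1_on_Un) auto
  moreover have "- {0} \<union> ball 0 a = (UNIV :: (real^2) set)" using a by auto
  ultimately show "C1_on UNIV (angular_field \<psi> \<kappa> i)" by simp
  assume x: "x \<noteq> 0"
  define dF where "dF = (\<chi> i. partial_deriv i F x)"
  have GF: "GDERIV F x :> dF" unfolding dF_def by (rule C1_onD(1)[OF CF]) (use x in auto)
  have xF: "x \<bullet> dF = 0"
    by (rule inner_gradient_homogeneous[OF GF]) (simp add: F_def sgn_scaleR)
  have GY: "GDERIV (\<lambda>x. Y (norm x)) x :> Y' (norm x) *\<^sub>R sgn x"
    by (rule GDERIV_radial[OF Y]) (use x in auto)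
  define dG where "dG = F x *\<^sub>R (Y' (norm x) *\<^sub>R sgn x) + Y (norm x) *\<^sub>R dF"
  have GG: "GDERIV (\<lambda>x. F x * Y (norm x)) x :> dG"
    unfolding dG_def by (rule GDERIV_mult[OF GF GY])
  have xs: "x \<bullet> sgn x = norm x" using x by (simp add: sgn_div_norm dot_square_norm power2_eq_square)
  have xG: "x \<bullet> dG = F x * Y' (norm x) * norm x"
    by (simp add: dG_def inner_add_right xF xs)
  have "partial_deriv i (angular_field \<psi> \<kappa> i) x = F x * Y (norm x) + x $ i * dG $ i" for i
    unfolding eq using partial_deriv_eq[OF GDERIV_mult[OF GG GDERIV_nth[of i x]], of i] by simp
  then have "(\<Sum>i\<in>UNIV. partial_deriv i (angular_field \<psi> \<kappa> i) x) = 2 * (F x * Y (norm x)) + x \<bullet> dG"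
    by (simp add: sum_2 inner_vec_def)
  also have "\<dots> = F x * (2 * Y (norm x) + Y' (norm x) * norm x)"
    by (simp add: xG algebra_simps)
  also have "2 * Y (norm x) + Y' (norm x) * norm x = j (norm x) / norm x"
    using x by (simp add: Y_def Y'_def field_simps power2_eq_square)
  finally show "(\<Sum>i\<in>UNIV. partial_deriv i (angular_field \<psi> \<kappa> i) x) = \<psi> (sgn x) * j (norm x) / norm x"
    by (simp add: F_def)
qed

definition radial_average :: "real \<Rightarrow> real \<Rightarrow> (real^2 \<Rightarrow> real) \<Rightarrow> (real \<Rightarrow> real) \<Rightarrow> real^2 \<Rightarrow> real" where
  "radial_average a b w k x = (LINT r|lborel. indicator {a<..<b} r * k r * w (r *\<^sub>R x))"

lemma borel_measurable_sgn_vec [measurable]: "(sgn :: real^2 \<Rightarrow> real^2) \<in> borel_measurable borel"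
  unfolding sgn_div_norm by measurable

lemma
  fixes w :: "real^2 \<Rightarrow> real"
  assumes a: "0 < a" and w: "integrable lborel w" "\<And>x. x \<notin> annulus a b \<Longrightarrow> w x = 0"
    and k: "k \<in> borel_measurable borel" "\<And>r. a < r \<Longrightarrow> r < b \<Longrightarrow> \<bar>k r\<bar> \<le> K"
  shows integrable_radial_average: "integrable circle_measure (radial_average a b w k)"
    and AE_integrable_ray: "AE x in circle_measure. integrable lborel (\<lambda>r. indicator {a<..<b} r * k r * w (r *\<^sub>R x))"
    and radial_average_pairing: "\<psi> \<in> borel_measurable borel \<Longrightarrow> (\<And>x. norm x = 1 \<Longrightarrow> \<bar>\<psi> x\<bar> \<le> C) \<Longrightarrow>
      (LINT x|circle_measure. \<psi> x * radial_average a b w k x)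
        = (LINT x|lborel. \<psi> (sgn x) * k (norm x) / norm x * w x)"
proof -
  have [measurable]: "w \<in> borel_measurable borel" using borel_measurable_integrable[OF w(1)] by simp
  note [measurable] = k(1)
  have W: "annulus a b = {x. a < norm x \<and> norm x < b}" by (simp add: annulus_def)
  have main: "integrable (lborel \<Otimes>\<^sub>M circle_measure) (\<lambda>(r, x). indicator {a<..<b} r * k r * w (r *\<^sub>R x) * \<psi> x) \<and>
      (LINT x|lborel. \<psi> (sgn x) * k (norm x) / norm x * w x)
        = integral\<^sup>L (lborel \<Otimes>\<^sub>M circle_measure) (\<lambda>(r, x). indicator {a<..<b} r * k r * w (r *\<^sub>R x) * \<psi> x)"
    if [measurable]: "\<psi> \<in> borel_measurable borel" and \<psi>: "\<And>x. norm x = 1 \<Longrightarrow> \<bar>\<psi> x\<bar> \<le> C" for \<psi> C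
  proof -
    define f where "f x = \<psi> (sgn x) * k (norm x) / norm x" for x :: "real^2"
    have fm [measurable]: "f \<in> borel_measurable borel" unfolding f_def by measurable
    have fb: "\<bar>f x\<bar> \<le> \<bar>C\<bar> * \<bar>K\<bar> / a" if "x \<in> annulus a b" for x
    proof -
      have x: "a < norm x" "norm x < b" "norm (sgn x) = 1" using that a by (auto simp: annulus_def norm_sgn)
      have "\<bar>f x\<bar> = \<bar>\<psi> (sgn x)\<bar> * \<bar>k (norm x)\<bar> / norm x" by (simp add: f_def abs_mult)
      also have "\<dots> \<le> \<bar>C\<bar> * \<bar>K\<bar> / a"
        using x a \<psi>[OF x(3)] k(2)[OF x(1,2)] by (intro frac_le mult_mono) auto
      finally show ?thesis .
    qed
    have int: "integrable lborel (\<lambda>x. f x * w x)"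
      by (rule integrable_bounded_mult[OF sets_lborel w(1) _ fm fb]) (use w(2) in auto)
    then have "set_integrable lborel (annulus a b) (\<lambda>x. f x * w x)"
      unfolding set_integrable_def by (intro integrable_mult_indicator) auto
    then have pint: "integrable (lborel \<Otimes>\<^sub>M circle_measure) (\<lambda>(r, x). r * indicator {a<..<b} r * (f (r *\<^sub>R x) * w (r *\<^sub>R x)))"
      unfolding W using a by (subst (asm) integrable_annulus_polar) auto
    have ae: "AE p in lborel \<Otimes>\<^sub>M circle_measure. norm (snd p) = 1"
    proof (rule polar.AE_pair_measure)
      show "{p \<in> space (lborel \<Otimes>\<^sub>M circle_measure). norm (snd p) = 1} \<in> sets (lborel \<Otimes>\<^sub>M circle_measure)"
        by measurable
    qed (use AE_circle_measure in auto)
    have eq: "AE p in lborel \<Otimes>\<^sub>M circle_measure.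
        (case p of (r, x) \<Rightarrow> r * indicator {a<..<b} r * (f (r *\<^sub>R x) * w (r *\<^sub>R x)))
        = (case p of (r, x) \<Rightarrow> indicator {a<..<b} r * k r * w (r *\<^sub>R x) * \<psi> x)"
      using ae
    proof eventually_elim
      case (elim p)
      obtain r x where p: "p = (r, x)" by fastforce
      have "sgn (r *\<^sub>R x) = x" "norm (r *\<^sub>R x) = r" if "a < r"
        using elim that a by (auto simp: p sgn_div_norm)
      then show ?case using a by (auto simp: p f_def indicator_def)
    qed
    have m2: "(\<lambda>(r, x). indicator {a<..<b} r * k r * w (r *\<^sub>R x) * \<psi> x) \<in> borel_measurable (lborel \<Otimes>\<^sub>M circle_measure)"
      by measurable
    have 1: "integrable (lborel \<Otimes>\<^sub>M circle_measure) (\<lambda>(r, x). indicator {a<..<b} r * k r * w (r *\<^sub>R x) * \<psi> x)"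
      by (rule integrable_cong_AE_imp[OF pint m2 eq])
    have "(LINT x|lborel. f x * w x) = (LINT x:annulus a b|lborel. f x * w x)"
      unfolding set_lebesgue_integral_def using w(2)
      by (intro Bochner_Integration.integral_cong) (auto simp: indicator_def)
    also have "\<dots> = integral\<^sup>L (lborel \<Otimes>\<^sub>M circle_measure) (\<lambda>(r, x). r * indicator {a<..<b} r * (f (r *\<^sub>R x) * w (r *\<^sub>R x)))"
      unfolding W using a by (intro integral_annulus_polar) auto
    also have "\<dots> = integral\<^sup>L (lborel \<Otimes>\<^sub>M circle_measure) (\<lambda>(r, x). indicator {a<..<b} r * k r * w (r *\<^sub>R x) * \<psi> x)"
      using pint m2 eq by (intro integral_cong_AE) auto
    finally show ?thesis using 1 by (simp add: f_def)
  qed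
  have "integrable (lborel \<Otimes>\<^sub>M circle_measure) (\<lambda>(r, x). indicator {a<..<b} r * k r * w (r *\<^sub>R x))"
    using main[of "\<lambda>_. 1" 1] by simp
  from polar.integrable_snd[OF this] polar.AE_integrable_snd[OF this]
  show "integrable circle_measure (radial_average a b w k)"
    "AE x in circle_measure. integrable lborel (\<lambda>r. indicator {a<..<b} r * k r * w (r *\<^sub>R x))"
    by (simp_all add: radial_average_def[abs_def])
  fix \<psi> :: "real^2 \<Rightarrow> real" and C
  assume \<psi>: "\<psi> \<in> borel_measurable borel" "\<And>x. norm x = 1 \<Longrightarrow> \<bar>\<psi> x\<bar> \<le> C"
  have "(LINT x|circle_measure. \<psi> x * radial_average a b w k x)
      = (LINT x|circle_measure. LINT r|lborel. indicator {a<..<b} r * k r * w (r *\<^sub>R x) * \<psi> x)"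
    by (simp add: radial_average_def mult.commute)
  also have "\<dots> = integral\<^sup>L (lborel \<Otimes>\<^sub>M circle_measure) (\<lambda>(r, x). indicator {a<..<b} r * k r * w (r *\<^sub>R x) * \<psi> x)"
    using main[OF \<psi>] by (intro polar.integral_snd) auto
  finally show "(LINT x|circle_measure. \<psi> x * radial_average a b w k x)
        = (LINT x|lborel. \<psi> (sgn x) * k (norm x) / norm x * w x)"
    using main[OF \<psi>] by simp
qed

lemma radial_average_diff:
  fixes w :: "real^2 \<Rightarrow> real"
  assumes a: "0 < a" and w: "integrable lborel w" "\<And>x. x \<notin> annulus a b \<Longrightarrow> w x = 0"
    and k: "k \<in> borel_measurable borel" "\<And>r. a < r \<Longrightarrow> r < b \<Longrightarrow> \<bar>k r\<bar> \<le> K"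
    and l: "l \<in> borel_measurable borel" "\<And>r. a < r \<Longrightarrow> r < b \<Longrightarrow> \<bar>l r\<bar> \<le> K'"
  shows "AE x in circle_measure. radial_average a b w (\<lambda>r. k r - l r) x
    = radial_average a b w k x - radial_average a b w l x"
proof -
  have "AE x in circle_measure. integrable lborel (\<lambda>r. indicator {a<..<b} r * k r * w (r *\<^sub>R x))"
    by (rule AE_integrable_ray[OF a w k])
  moreover have "AE x in circle_measure. integrable lborel (\<lambda>r. indicator {a<..<b} r * l r * w (r *\<^sub>R x))"
    by (rule AE_integrable_ray[OF a w l])
  ultimately show ?thesis
    by eventually_elim (simp add: radial_average_def left_diff_distrib right_diff_distrib)
qed

text \<open>A function of bounded variation in the form in which it is integrated along rays: Borel
  measurable and zero outside the annulus.\<close>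

definition borel_gradient ::
  "real \<Rightarrow> real \<Rightarrow> (real^2 \<Rightarrow> real) \<Rightarrow> (real^2) measure \<Rightarrow> (real^2 \<Rightarrow> real^2) \<Rightarrow> bool" where
  "borel_gradient a b w \<nu> \<sigma> \<longleftrightarrow> integrable lborel w \<and> (\<forall>x. x \<notin> annulus a b \<longrightarrow> w x = 0) \<and>
     polar_measure (annulus a b) \<nu> \<sigma> \<and>
     (\<forall>i \<phi>. test_function (annulus a b) \<phi> \<longrightarrow>
       (LINT x|lborel. partial_deriv i \<phi> x * w x) = - (LINT x|\<nu>. \<phi> x * \<sigma> x $ i))"

text \<open>By duality the average is tested with a polynomial bounded by 1. The result is an integral of \<open>w\<close>
  times the divergence of an angular field, hence an integral of this field against the
  gradient measure, and the field is at most \<open>1 / a\<close> and lives where \<open>\<kappa> \<noteq> 0\<close>.\<close>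

lemma radial_average_estimate:
  assumes ab: "0 < a" "a < b" and w: "borel_gradient a b w \<nu> \<sigma>"
    and \<kappa>: "\<And>r. (\<kappa> has_real_derivative j r) (at r)" "continuous_on UNIV j"
    and supp: "0 < e" "\<And>r. r \<le> a + e \<or> b - e \<le> r \<Longrightarrow> \<kappa> r = 0"
    and I: "I \<in> sets borel" "\<And>r. \<kappa> r \<noteq> 0 \<Longrightarrow> r \<in> I" and \<kappa>1: "\<And>r. \<bar>\<kappa> r\<bar> \<le> 1"
  shows "(LINT x|circle_measure. \<bar>radial_average a b w j x\<bar>) \<le> measure \<nu> {x. norm x \<in> I} / a"
proof (rule L1_norm_le_polynomial_dual[where C = "sphere 0 1"])
  have wi: "integrable lborel w" and w0: "\<And>x. x \<notin> annulus a b \<Longrightarrow> w x = 0"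
    and pol: "polar_measure (annulus a b) \<nu> \<sigma>"
    and grad: "\<And>i \<phi>. test_function (annulus a b) \<phi> \<Longrightarrow>
       (LINT x|lborel. partial_deriv i \<phi> x * w x) = - (LINT x|\<nu>. \<phi> x * \<sigma> x $ i)"
    using w by (auto simp: borel_gradient_def)
  note D = polar_measureD[OF pol annulus_borel]
  interpret finite_measure \<nu> by (rule D)
  have [measurable_cong]: "sets \<nu> = sets borel" by (rule D)
  note [measurable] = D(4)
  note [measurable] = I(1)
  have jm: "j \<in> borel_measurable borel" by (rule borel_measurable_continuous_onI[OF \<kappa>(2)])
  obtain K where "\<And>r. r \<in> {a..b} \<Longrightarrow> \<bar>j r\<bar> \<le> K"
    using continuous_on_compact_bound[OF compact_Icc continuous_on_subset[OF \<kappa>(2)]] by blast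
  then have K: "\<bar>j r\<bar> \<le> K" if "a < r" "r < b" for r using that by auto
  show "integrable circle_measure (radial_average a b w j)"
    by (rule integrable_radial_average[OF ab(1) wi w0 jm K])
  show "AE x in circle_measure. x \<in> sphere 0 1" using AE_circle_measure by simp
  fix p :: "real^2 \<Rightarrow> real" assume p: "real_polynomial_function p" "\<And>x. x \<in> sphere 0 1 \<Longrightarrow> \<bar>p x\<bar> \<le> 1"
  have p1: "\<bar>p x\<bar> \<le> 1" if "norm x = 1" for x using p(2) that by simp
  have pm: "p \<in> borel_measurable borel"
    by (rule C1_on_measurable(1)[OF C1_on_real_polynomial_function[OF p(1)]])
  have \<kappa>a: "\<kappa> r = 0" if "r \<le> a" for r using supp that by simp
  define \<Phi> where "\<Phi> i = angular_field p \<kappa> i" for i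
  have C1: "C1_on UNIV (\<Phi> i)" for i unfolding \<Phi>_def by (rule C1_on_angular_field[OF p(1) \<kappa> ab(1) \<kappa>a])
  have test: "test_function (annulus a b) (\<Phi> i)" for i
    unfolding test_function_def
  proof (intro conjI C1 exI[of _ "cball 0 (b - e) - ball 0 (a + e)"])
    show "compact (cball 0 (b - e) - ball 0 (a + e) :: (real^2) set)" by (intro compact_diff) auto
    show "cball 0 (b - e) - ball 0 (a + e) \<subseteq> annulus a b" using supp by (auto simp: annulus_def)
    show "\<forall>x. x \<notin> cball 0 (b - e) - ball 0 (a + e) \<longrightarrow> \<Phi> i x = 0"
      using supp(2) by (auto simp: not_le not_less \<Phi>_def angular_field_def)
  qed
  have [measurable]: "\<Phi> i \<in> borel_measurable borel" for i
    by (rule C1_on_measurable(1)[OF C1])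
  have W: "AE x in lborel. x \<notin> annulus a b \<longrightarrow> w x = 0" using w0 by auto
  have dint: "integrable lborel (\<lambda>x. partial_deriv i (\<Phi> i) x * w x)" for i
  proof -
    have c: "continuous_on UNIV (partial_deriv i (\<Phi> i))" by (rule C1_onD(4)[OF C1])
    obtain B where "\<And>x. x \<in> cball 0 b \<Longrightarrow> \<bar>partial_deriv i (\<Phi> i) x\<bar> \<le> B"
      using continuous_on_compact_bound[OF compact_cball continuous_on_subset[OF c]] by blast
    then have "\<And>x. x \<in> annulus a b \<Longrightarrow> \<bar>partial_deriv i (\<Phi> i) x\<bar> \<le> B" by (auto simp: annulus_def)
    from integrable_bounded_mult[OF sets_lborel wi W borel_measurable_continuous_onI[OF c] this] show ?thesis .
  qed
  have \<Phi>\<sigma>: "AE x in \<nu>. (\<Sum>i\<in>UNIV. \<bar>\<Phi> i x * \<sigma> x $ i\<bar>) \<le> 2 / a"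
    "AE x in \<nu>. - (\<Sum>i\<in>UNIV. \<Phi> i x * \<sigma> x $ i) \<le> indicator {x. norm x \<in> I} x / a"
  proof -
    have base: "AE x in \<nu>. x \<in> annulus a b \<and> norm (\<sigma> x) = 1" using D(3,5) by eventually_elim auto
    have bnd: "\<bar>p (sgn x) * (\<kappa> (norm x) / (norm x)\<^sup>2)\<bar> * norm x \<le> indicator {x. norm x \<in> I} x / a"
      if "x \<in> annulus a b" for x
    proof -
      have x: "a < norm x" "norm (sgn x) = 1" using that ab by (auto simp: annulus_def norm_sgn)
      show ?thesis
      proof (cases "\<kappa> (norm x) = 0")
        case False
        have "\<bar>p (sgn x) * (\<kappa> (norm x) / (norm x)\<^sup>2)\<bar> * norm x = \<bar>p (sgn x)\<bar> * \<bar>\<kappa> (norm x)\<bar> / norm x"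
          using x ab by (simp add: abs_mult power2_eq_square)
        also have "\<dots> \<le> 1 * 1 / a" using x ab p1[OF x(2)] \<kappa>1[of "norm x"] by (intro frac_le mult_mono) auto
        finally show ?thesis using I(2)[OF False] by simp
      qed (use ab in auto)
    qed
    show "AE x in \<nu>. - (\<Sum>i\<in>UNIV. \<Phi> i x * \<sigma> x $ i) \<le> indicator {x. norm x \<in> I} x / a"
      using base
    proof eventually_elim
      case (elim x)
      have "(\<Sum>i\<in>UNIV. \<Phi> i x * \<sigma> x $ i) = (p (sgn x) * (\<kappa> (norm x) / (norm x)\<^sup>2)) * (x \<bullet> \<sigma> x)"
        by (simp add: \<Phi>_def angular_field_def inner_vec_def sum_distrib_left mult.assoc)
      then have "\<bar>\<Sum>i\<in>UNIV. \<Phi> i x * \<sigma> x $ i\<bar> = \<bar>p (sgn x) * (\<kappa> (norm x) / (norm x)\<^sup>2)\<bar> * \<bar>x \<bullet> \<sigma> x\<bar>"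
        by (simp add: abs_mult)
      also have "\<dots> \<le> \<bar>p (sgn x) * (\<kappa> (norm x) / (norm x)\<^sup>2)\<bar> * norm x"
        using Cauchy_Schwarz_ineq2[of x "\<sigma> x"] elim by (intro mult_left_mono) auto
      also have "\<dots> \<le> indicator {x. norm x \<in> I} x / a" using bnd elim by blast
      finally show ?case by linarith
    qed
    show "AE x in \<nu>. (\<Sum>i\<in>UNIV. \<bar>\<Phi> i x * \<sigma> x $ i\<bar>) \<le> 2 / a"
      using base
    proof eventually_elim
      case (elim x)
      have "\<bar>\<Phi> i x * \<sigma> x $ i\<bar> \<le> 1 / a" for i
      proof -
        have "\<bar>\<Phi> i x * \<sigma> x $ i\<bar> = \<bar>p (sgn x) * (\<kappa> (norm x) / (norm x)\<^sup>2)\<bar> * \<bar>x $ i\<bar> * \<bar>\<sigma> x $ i\<bar>"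
          by (simp add: \<Phi>_def angular_field_def abs_mult)
        also have "\<dots> \<le> \<bar>p (sgn x) * (\<kappa> (norm x) / (norm x)\<^sup>2)\<bar> * norm x * 1"
          using elim component_le_norm_cart[of x i] component_le_norm_cart[of "\<sigma> x" i]
          by (intro mult_mono) auto
        also have "\<dots> \<le> 1 / a" using bnd[of x] elim ab by (auto simp: indicator_def split: if_splits intro: order_trans)
        finally show ?thesis .
      qed
      from this[of 1] this[of 2] show ?case by (simp add: sum_2)
    qed
  qed
  have \<Phi>int: "integrable \<nu> (\<lambda>x. \<Phi> i x * \<sigma> x $ i)" for i
  proof (rule integrable_const_bound[where B = "2 / a"])
    show "AE x in \<nu>. norm (\<Phi> i x * \<sigma> x $ i) \<le> 2 / a"
      using \<Phi>\<sigma>(1)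
    proof eventually_elim
      case (elim x)
      then show ?case using exhaust_2[of i] by (auto simp: sum_2)
    qed
  qed measurable
  have "(LINT x|circle_measure. p x * radial_average a b w j x)
      = (LINT x|lborel. p (sgn x) * j (norm x) / norm x * w x)"
    by (rule radial_average_pairing[OF ab(1) wi w0 jm K pm p1])
  also have "\<dots> = (LINT x|lborel. (\<Sum>i\<in>UNIV. partial_deriv i (\<Phi> i) x * w x))"
  proof (intro Bochner_Integration.integral_cong refl)
    fix x
    show "p (sgn x) * j (norm x) / norm x * w x = (\<Sum>i\<in>UNIV. partial_deriv i (\<Phi> i) x * w x)"
    proof (cases "x = 0")
      case True
      then have "w x = 0" using w0[of x] ab by (simp add: annulus_def)
      then show ?thesis by simp
    next
      case False
      have "(\<Sum>i\<in>UNIV. partial_deriv i (\<Phi> i) x) = p (sgn x) * j (norm x) / norm x"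
        unfolding \<Phi>_def by (rule divergence_angular_field[OF p(1) \<kappa> ab(1) \<kappa>a False])
      then show ?thesis unfolding sum_distrib_right[symmetric] by simp
    qed
  qed
  also have "\<dots> = (\<Sum>i\<in>UNIV. (LINT x|lborel. partial_deriv i (\<Phi> i) x * w x))"
    by (intro Bochner_Integration.integral_sum dint)
  also have "\<dots> = (\<Sum>i\<in>UNIV. - (LINT x|\<nu>. \<Phi> i x * \<sigma> x $ i))"
    by (intro sum.cong refl grad test)
  also have "\<dots> = (LINT x|\<nu>. - (\<Sum>i\<in>UNIV. \<Phi> i x * \<sigma> x $ i))"
    using \<Phi>int by (simp add: sum_negf)
  also have "\<dots> \<le> (LINT x|\<nu>. indicator {x. norm x \<in> I} x / a)"
  proof (rule integral_mono_AE)
    show "integrable \<nu> (\<lambda>x. indicator {x. norm x \<in> I} x / a)"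
      by (intro integrable_divide integrable_real_indicator) (auto simp: emeasure_eq_measure)
  qed (use \<Phi>int \<Phi>\<sigma>(2) in auto)
  also have "\<dots> = measure \<nu> {x. norm x \<in> I} / a"
    using sets_eq_imp_space_eq[OF D(1)] by simp
  finally show "(LINT x|circle_measure. p x * radial_average a b w j x) \<le> measure \<nu> {x. norm x \<in> I} / a" .
qed auto

text \<open>Completeness of \<open>L\<^sup>1\<close>: the limit is that of a subsequence converging almost everywhere, and Fatou's
  lemma turns the Cauchy property into convergence.\<close>

lemma L1_Cauchy_limit:
  fixes s :: "nat \<Rightarrow> 'a \<Rightarrow> real"
  assumes s: "\<And>n. integrable M (s n)"
    and cauchy: "\<And>e. 0 < e \<Longrightarrow> \<exists>N. \<forall>i\<ge>N. \<forall>j\<ge>N. (LINT x|M. \<bar>s i x - s j x\<bar>) < e"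
  obtains T where "integrable M T" "(\<lambda>n. LINT x|M. \<bar>s n x - T x\<bar>) \<longlonglongrightarrow> 0"
proof -
  have [measurable]: "s n \<in> borel_measurable M" for n using s by auto
  obtain r where r: "strict_mono r" "AE x in M. Cauchy (\<lambda>i. s (r i) x)"
    using cauchy_L1_AE_cauchy_subseq[of M s] s cauchy by (auto simp: real_norm_def)
  define T where "T x = lim (\<lambda>i. s (r i) x)" for x
  have [measurable]: "T \<in> borel_measurable M" unfolding T_def by measurable
  have conv: "AE x in M. (\<lambda>i. s (r i) x) \<longlonglongrightarrow> T x"
    using r(2) by eventually_elim (simp add: T_def Cauchy_convergent convergent_LIMSEQ_iff[symmetric])
  have bound: "\<exists>N. \<forall>n\<ge>N. (\<integral>\<^sup>+x. ennreal \<bar>s n x - T x\<bar> \<partial>M) \<le> ennreal e" if e: "0 < e" for e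
  proof -
    obtain N where N: "\<And>i j. N \<le> i \<Longrightarrow> N \<le> j \<Longrightarrow> (LINT x|M. \<bar>s i x - s j x\<bar>) < e"
      using cauchy[OF e] by blast
    have "(\<integral>\<^sup>+x. ennreal \<bar>s n x - T x\<bar> \<partial>M) \<le> ennreal e" if n: "N \<le> n" for n
    proof -
      have "(\<integral>\<^sup>+x. ennreal \<bar>s n x - T x\<bar> \<partial>M) = (\<integral>\<^sup>+x. liminf (\<lambda>i. ennreal \<bar>s n x - s (r i) x\<bar>) \<partial>M)"
      proof (rule nn_integral_cong_AE)
        show "AE x in M. ennreal \<bar>s n x - T x\<bar> = liminf (\<lambda>i. ennreal \<bar>s n x - s (r i) x\<bar>)"
          using conv
        proof eventually_elim
          case (elim x)
          have "(\<lambda>i. ennreal \<bar>s n x - s (r i) x\<bar>) \<longlonglongrightarrow> ennreal \<bar>s n x - T x\<bar>"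
            by (intro tendsto_intros tendsto_ennrealI elim)
          then show ?case by (intro lim_imp_Liminf[symmetric]) auto
        qed
      qed
      also have "\<dots> \<le> liminf (\<lambda>i. \<integral>\<^sup>+x. ennreal \<bar>s n x - s (r i) x\<bar> \<partial>M)"
        by (rule nn_integral_liminf) measurable
      also have "\<dots> \<le> liminf (\<lambda>i. ennreal e)"
      proof (rule Liminf_mono, unfold eventually_sequentially, intro exI allI impI)
        fix i assume "N \<le> i"
        then have "N \<le> r i" using seq_suble[OF r(1), of i] by linarith
        then have "(LINT x|M. \<bar>s n x - s (r i) x\<bar>) \<le> e" using N[OF n] by fastforce
        moreover have "(\<integral>\<^sup>+x. ennreal \<bar>s n x - s (r i) x\<bar> \<partial>M) = ennreal (LINT x|M. \<bar>s n x - s (r i) x\<bar>)"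
          using s by (intro nn_integral_eq_integral) auto
        ultimately show "(\<integral>\<^sup>+x. ennreal \<bar>s n x - s (r i) x\<bar> \<partial>M) \<le> ennreal e" by (simp add: ennreal_leI)
      qed
      finally show ?thesis by (simp add: Liminf_const)
    qed
    then show ?thesis by blast
  qed
  obtain n where n: "(\<integral>\<^sup>+x. ennreal \<bar>s n x - T x\<bar> \<partial>M) \<le> ennreal 1" using bound[of 1] by auto
  have diff: "integrable M (\<lambda>x. s n x - T x)"
    by (rule integrableI_bounded) (use n in \<open>auto simp: le_less_trans\<close>)
  have T: "integrable M T" using Bochner_Integration.integrable_diff[OF s[of n] diff] by simp
  show ?thesis
  proof (rule that[OF T], rule LIMSEQ_I)
    fix e :: real assume e: "0 < e"
    obtain N where N: "\<And>n. N \<le> n \<Longrightarrow> (\<integral>\<^sup>+x. ennreal \<bar>s n x - T x\<bar> \<partial>M) \<le> ennreal (e / 2)"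
      using bound[of "e / 2"] e by auto
    have "norm ((LINT x|M. \<bar>s n x - T x\<bar>) - 0) < e" if "N \<le> n" for n
    proof -
      have "ennreal (LINT x|M. \<bar>s n x - T x\<bar>) = (\<integral>\<^sup>+x. ennreal \<bar>s n x - T x\<bar> \<partial>M)"
        using s T by (intro nn_integral_eq_integral[symmetric]) auto
      then have "ennreal (LINT x|M. \<bar>s n x - T x\<bar>) \<le> ennreal (e / 2)" using N[OF that] by simp
      then have "(LINT x|M. \<bar>s n x - T x\<bar>) \<le> e / 2" using e by (subst (asm) ennreal_le_iff) auto
      moreover have "0 \<le> (LINT x|M. \<bar>s n x - T x\<bar>)" by (intro integral_nonneg_AE) auto
      ultimately show ?thesis using e by simp
    qed
    then show "\<exists>N. \<forall>n\<ge>N. norm ((LINT x|M. \<bar>s n x - T x\<bar>) - 0) < e" by blast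
  qed
qed

section \<open>Boundary traces\<close>

lemma borel_gradient_exists:
  assumes "w absolutely_integrable_on annulus a b" "is_gradient_measure (annulus a b) w \<nu> \<sigma>"
  shows "\<exists>w'. borel_gradient a b w' \<nu> \<sigma> \<and> (AE x in lebesgue. x \<in> annulus a b \<longrightarrow> w x = w' x) \<and>
    (\<forall>F. F \<in> borel_measurable borel \<longrightarrow> (LINT x:annulus a b|lebesgue. w x * F x) = (LINT x|lborel. F x * w' x))"
proof (rule borel_representative[OF assms(1) annulus_borel])
  fix w'
  assume w': "integrable lborel w'" "\<And>x. x \<notin> annulus a b \<Longrightarrow> w' x = 0"
    "AE x in lebesgue. x \<in> annulus a b \<longrightarrow> w x = w' x"
    and F: "\<And>F. F \<in> borel_measurable borel \<Longrightarrow> (LINT x:annulus a b|lebesgue. w x * F x) = (LINT x|lborel. w' x * F x)"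
  have "borel_gradient a b w' \<nu> \<sigma>"
    unfolding borel_gradient_def
  proof (intro conjI allI impI)
    fix i \<phi> assume t: "test_function (annulus a b) \<phi>"
    then have c: "continuous_on UNIV (partial_deriv i \<phi>)" by (auto simp: test_function_def intro: C1_onD(4))
    have "(LINT x|lborel. partial_deriv i \<phi> x * w' x) = (LINT x:annulus a b|lebesgue. w x * partial_deriv i \<phi> x)"
      by (subst F) (simp_all add: borel_measurable_continuous_onI[OF c] mult.commute)
    then show "(LINT x|lborel. partial_deriv i \<phi> x * w' x) = - (LINT x|\<nu>. \<phi> x * \<sigma> x $ i)"
      using assms(2) t by (simp add: is_gradient_measure_def)
  qed (use w' assms(2) in \<open>auto simp: is_gradient_measure_def\<close>)
  then show ?thesis
    using w'(3) F by (intro exI[of _ w'] conjI allI impI) (simp_all add: mult.commute)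
qed

text \<open>The estimate is applied to the differences of the cutoffs. They live in layers
  that shrink to the empty set, so their gradient measure tends to zero.\<close>

lemma radial_average_limit:
  assumes ab: "0 < a" "a < b" and w: "borel_gradient a b w \<nu> \<sigma>"
    and \<eta>: "\<And>n r. (\<eta> n has_real_derivative j n r) (at r)" "\<And>n. continuous_on UNIV (j n)"
      "\<And>n r. 0 \<le> \<eta> n r" "\<And>n r. \<eta> n r \<le> 1"
    and supp: "\<And>n m. \<exists>e>0. \<forall>r. r \<le> a + e \<or> b - e \<le> r \<longrightarrow> \<eta> n r = \<eta> m r"
    and I: "\<And>N n m r. N \<le> n \<Longrightarrow> N \<le> m \<Longrightarrow> \<eta> n r \<noteq> \<eta> m r \<Longrightarrow> r \<in> I N"
      "\<And>N. I N \<in> sets borel" "decseq I" "(\<Inter>N. I N) = {}"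
  obtains T where "integrable circle_measure T"
    "(\<lambda>n. LINT x|circle_measure. \<bar>radial_average a b w (j n) x - T x\<bar>) \<longlonglongrightarrow> 0"
proof -
  have wi: "integrable lborel w" and w0: "\<And>x. x \<notin> annulus a b \<Longrightarrow> w x = 0"
    and pol: "polar_measure (annulus a b) \<nu> \<sigma>"
    using w by (auto simp: borel_gradient_def)
  note D = polar_measureD[OF pol annulus_borel]
  interpret finite_measure \<nu> by (rule D)
  have jm: "j n \<in> borel_measurable borel" for n by (rule borel_measurable_continuous_onI[OF \<eta>(2)])
  have "\<exists>K. \<forall>r\<in>{a..b}. \<bar>j n r\<bar> \<le> K" for n
    using continuous_on_compact_bound[OF compact_Icc continuous_on_subset[OF \<eta>(2)]] by blast
  then obtain K where "\<And>n. \<forall>r\<in>{a..b}. \<bar>j n r\<bar> \<le> K n" by metis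
  then have K: "\<bar>j n r\<bar> \<le> K n" if "a < r" "r < b" for n r using that by auto
  have jint: "integrable circle_measure (radial_average a b w (j n))" for n
    by (rule integrable_radial_average[OF ab(1) wi w0 jm K])
  have S: "{x::real^2. norm x \<in> I N} \<in> sets borel" for N
    using I(2)[of N] by measurable
  have "(\<lambda>N. measure \<nu> {x. norm x \<in> I N}) \<longlonglongrightarrow> measure \<nu> (\<Inter>N. {x. norm x \<in> I N})"
  proof (rule finite_Lim_measure_decseq)
    show "decseq (\<lambda>N. {x::real^2. norm x \<in> I N})"
      using I(3) unfolding decseq_def by blast
  qed (use S D(1) in auto)
  moreover have "(\<Inter>N. {x::real^2. norm x \<in> I N}) = {}" using I(4) by auto
  ultimately have small: "(\<lambda>N. measure \<nu> {x. norm x \<in> I N}) \<longlonglongrightarrow> 0" by simp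
  have est: "(LINT x|circle_measure. \<bar>radial_average a b w (j n) x - radial_average a b w (j m) x\<bar>)
      \<le> measure \<nu> {x. norm x \<in> I N} / a" if nm: "N \<le> n" "N \<le> m" for N n m
  proof -
    obtain e where e: "0 < e" "\<And>r. r \<le> a + e \<or> b - e \<le> r \<Longrightarrow> \<eta> n r = \<eta> m r" using supp[of n m] by blast
    have "(LINT x|circle_measure. \<bar>radial_average a b w (j n) x - radial_average a b w (j m) x\<bar>)
        = (LINT x|circle_measure. \<bar>radial_average a b w (\<lambda>r. j n r - j m r) x\<bar>)"
    proof (rule integral_cong_AE)
      have jd: "integrable circle_measure (radial_average a b w (\<lambda>r. j n r - j m r))"
      proof (rule integrable_radial_average[OF ab(1) wi w0])
        show "(\<lambda>r. j n r - j m r) \<in> borel_measurable borel" using jm by (intro borel_measurable_diff)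
        show "\<bar>j n r - j m r\<bar> \<le> K n + K m" if "a < r" "r < b" for r
          using K[OF that, of n] K[OF that, of m] by linarith
      qed
      show "(\<lambda>x. \<bar>radial_average a b w (\<lambda>r. j n r - j m r) x\<bar>) \<in> borel_measurable circle_measure"
        using borel_measurable_integrable[OF jd] by (intro borel_measurable_abs)
      show "(\<lambda>x. \<bar>radial_average a b w (j n) x - radial_average a b w (j m) x\<bar>) \<in> borel_measurable circle_measure"
        using borel_measurable_integrable[OF jint[of n]] borel_measurable_integrable[OF jint[of m]]
        by (intro borel_measurable_abs borel_measurable_diff)
      have "AE x in circle_measure. radial_average a b w (\<lambda>r. j n r - j m r) x
          = radial_average a b w (j n) x - radial_average a b w (j m) x"
        by (rule radial_average_diff[OF ab(1) wi w0 jm K jm K])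
      then show "AE x in circle_measure. \<bar>radial_average a b w (j n) x - radial_average a b w (j m) x\<bar>
          = \<bar>radial_average a b w (\<lambda>r. j n r - j m r) x\<bar>"
        by eventually_elim simp
    qed
    also have "\<dots> \<le> measure \<nu> {x. norm x \<in> I N} / a"
    proof (rule radial_average_estimate[OF ab w _ _ e(1) _ I(2)])
      show "((\<lambda>r. \<eta> n r - \<eta> m r) has_real_derivative j n r - j m r) (at r)" for r
        by (intro DERIV_diff \<eta>(1))
      show "continuous_on UNIV (\<lambda>r. j n r - j m r)" by (intro continuous_intros \<eta>(2))
      show "\<eta> n r - \<eta> m r = 0" if "r \<le> a + e \<or> b - e \<le> r" for r using e(2)[OF that] by simp
      show "r \<in> I N" if "\<eta> n r - \<eta> m r \<noteq> 0" for r using I(1)[OF nm] that by simp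
      show "\<bar>\<eta> n r - \<eta> m r\<bar> \<le> 1" for r
        using \<eta>(3)[of n r] \<eta>(4)[of n r] \<eta>(3)[of m r] \<eta>(4)[of m r] by linarith
    qed
    finally show ?thesis .
  qed
  show ?thesis
  proof (rule L1_Cauchy_limit[of circle_measure "\<lambda>n. radial_average a b w (j n)"])
    fix e :: real assume e: "0 < e"
    then have "0 < e * a" using ab by simp
    then have "\<forall>\<^sub>F N in sequentially. measure \<nu> {x. norm x \<in> I N} < e * a"
      using small by (rule order_tendstoD(2)[rotated])
    then obtain N where N: "measure \<nu> {x. norm x \<in> I N} < e * a" by (auto simp: eventually_sequentially)
    then have "measure \<nu> {x. norm x \<in> I N} / a < e" using ab by (simp add: divide_less_eq)
    then show "\<exists>N. \<forall>i\<ge>N. \<forall>k\<ge>N. (LINT x|circle_measure.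
        \<bar>radial_average a b w (j i) x - radial_average a b w (j k) x\<bar>) < e"
      using est by (intro exI[of _ N] allI impI) (rule le_less_trans)
  qed (use jint that in auto)
qed

lemma outer_cutoff_reflect:
  "outer_cutoff a b n r = inner_cutoff a b n (a + b - r)"
  by (simp add: outer_cutoff_def inner_cutoff_def)

lemma
  assumes ab: "a < b"
  shows inner_cutoff_eventually_const:
      "\<exists>e>0. \<forall>r. r \<le> a + e \<or> b - e \<le> r \<longrightarrow> inner_cutoff a b n r = inner_cutoff a b m r"
    and inner_cutoff_differ: "N \<le> n \<Longrightarrow> N \<le> m \<Longrightarrow> inner_cutoff a b n r \<noteq> inner_cutoff a b m r \<Longrightarrow>
      r \<in> {a<..<a + 2 / cutoff_scale a b N}"
    and decseq_inner_layer: "decseq (\<lambda>N. {a<..<a + 2 / cutoff_scale a b N})"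
    and Inter_inner_layer: "(\<Inter>N. {a<..<a + 2 / cutoff_scale a b N}) = {}"
proof -
  have mono: "1 / cutoff_scale a b n \<le> 1 / cutoff_scale a b m" if "m \<le> n" for m n
    using ab that by (intro divide_left_mono) (auto simp: cutoff_scale_def divide_right_mono)
  note pos = cutoff_scale_pos[OF ab]
  show "\<exists>e>0. \<forall>r. r \<le> a + e \<or> b - e \<le> r \<longrightarrow> inner_cutoff a b n r = inner_cutoff a b m r"
  proof (intro exI[of _ "min (1 / cutoff_scale a b (max n m)) ((b - a) / 2)"] conjI allI impI)
    fix r assume r: "r \<le> a + min (1 / cutoff_scale a b (max n m)) ((b - a) / 2) \<or>
      b - min (1 / cutoff_scale a b (max n m)) ((b - a) / 2) \<le> r"
    show "inner_cutoff a b n r = inner_cutoff a b m r"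
    proof (cases "r \<le> a + min (1 / cutoff_scale a b (max n m)) ((b - a) / 2)")
      case True
      have "r \<le> a + 1 / cutoff_scale a b k" if "k \<le> max n m" for k
        using True mono[OF that] by linarith
      then show ?thesis by (simp add: inner_cutoff_eq_0[OF ab])
    next
      case False
      have "a + 2 / cutoff_scale a b k \<le> r" for k
        using False r cutoff_scale_ge[OF ab, of k]
          min.cobounded2[of "1 / cutoff_scale a b (max n m)" "(b - a) / 2"] by argo
      then show ?thesis by (simp add: inner_cutoff_eq_1[OF ab])
    qed
  qed (use pos ab in auto)
  show "r \<in> {a<..<a + 2 / cutoff_scale a b N}"
    if nm: "N \<le> n" "N \<le> m" "inner_cutoff a b n r \<noteq> inner_cutoff a b m r"
  proof -
    have "a < r"
    proof (rule ccontr)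
      assume "\<not> a < r"
      then have "r \<le> a + 1 / cutoff_scale a b k" for k using pos[of k] by (simp add: add_increasing2)
      then show False using nm(3) inner_cutoff_eq_0[OF ab] by metis
    qed
    moreover have "r < a + 2 / cutoff_scale a b N"
    proof (rule ccontr)
      assume "\<not> ?thesis"
      then have "a + 2 / cutoff_scale a b k \<le> r" if "N \<le> k" for k using mono[OF that] by simp
      then show False using nm inner_cutoff_eq_1[OF ab] by metis
    qed
    ultimately show ?thesis by simp
  qed
  show "decseq (\<lambda>N. {a<..<a + 2 / cutoff_scale a b N})"
    unfolding decseq_def
  proof (intro allI impI subsetI)
    fix m n x assume "m \<le> n" "x \<in> {a<..<a + 2 / cutoff_scale a b n}"
    then show "x \<in> {a<..<a + 2 / cutoff_scale a b m}" using mono[of m n] by auto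
  qed
  show "(\<Inter>N. {a<..<a + 2 / cutoff_scale a b N}) = {}"
  proof (rule ccontr)
    assume "\<not> ?thesis"
    then obtain r where "r \<in> (\<Inter>N. {a<..<a + 2 / cutoff_scale a b N})" by blast
    then have r: "a < r \<and> r < a + 2 / cutoff_scale a b N" for N by auto
    have "\<forall>\<^sub>F N in sequentially. 2 / cutoff_scale a b N < r - a"
      by (rule order_tendstoD(2)[OF cutoff_scale_at_top[OF ab]]) (use r in simp)
    then obtain N where "2 / cutoff_scale a b N < r - a" by (auto simp: eventually_sequentially)
    then show False using r[of N] by linarith
  qed
qed

lemma inner_trace_exists:
  assumes ab: "0 < a" "a < b" and w: "borel_gradient a b w \<nu> \<sigma>"
  obtains T where "integrable circle_measure T"
    "(\<lambda>n. LINT x|circle_measure. \<bar>radial_average a b w (inner_kernel a b n) x - T x\<bar>) \<longlonglongrightarrow> 0"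
  by (rule radial_average_limit[OF ab w, where \<eta> = "inner_cutoff a b" and j = "inner_kernel a b",
        OF _ _ _ _ inner_cutoff_eventually_const[OF ab(2)] inner_cutoff_differ[OF ab(2)] _
          decseq_inner_layer[OF ab(2)] Inter_inner_layer[OF ab(2)]])
    (use that in \<open>auto simp: cutoff_bounds DERIV_inner_cutoff intro!: continuous_intros\<close>)

lemma outer_trace_exists:
  assumes ab: "0 < a" "a < b" and w: "borel_gradient a b w \<nu> \<sigma>"
  obtains T where "integrable circle_measure T"
    "(\<lambda>n. LINT x|circle_measure. \<bar>radial_average a b w (outer_kernel a b n) x - T x\<bar>) \<longlonglongrightarrow> 0"
proof (rule radial_average_limit[OF ab w, where \<eta> = "outer_cutoff a b" and j = "\<lambda>n r. - outer_kernel a b n r"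
      and I = "\<lambda>N. {r. a + b - r \<in> {a<..<a + 2 / cutoff_scale a b N}}"])
  fix n m
  obtain e where e: "0 < e" "\<And>r. r \<le> a + e \<or> b - e \<le> r \<Longrightarrow> inner_cutoff a b n r = inner_cutoff a b m r"
    using inner_cutoff_eventually_const[OF ab(2), of n m] by blast
  show "\<exists>e>0. \<forall>r. r \<le> a + e \<or> b - e \<le> r \<longrightarrow> outer_cutoff a b n r = outer_cutoff a b m r"
    unfolding outer_cutoff_reflect by (intro exI[of _ e] conjI allI impI e) linarith
next
  show "r \<in> {r. a + b - r \<in> {a<..<a + 2 / cutoff_scale a b N}}"
    if "N \<le> n" "N \<le> m" "outer_cutoff a b n r \<noteq> outer_cutoff a b m r" for N n m r
    using inner_cutoff_differ[OF ab(2) that(1,2)] that(3) unfolding outer_cutoff_reflect by blast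
  show "decseq (\<lambda>N. {r. a + b - r \<in> {a<..<a + 2 / cutoff_scale a b N}})"
    using decseq_inner_layer[OF ab(2)] unfolding decseq_def by blast
  show "(\<Inter>N. {r. a + b - r \<in> {a<..<a + 2 / cutoff_scale a b N}}) = {}"
    using Inter_inner_layer[OF ab(2)] by blast
  show "{r. a + b - r \<in> {a<..<a + 2 / cutoff_scale a b N}} \<in> sets borel" for N by measurable
next
  fix T assume T: "integrable circle_measure T"
    "(\<lambda>n. LINT x|circle_measure. \<bar>radial_average a b w (\<lambda>r. - outer_kernel a b n r) x - T x\<bar>) \<longlonglongrightarrow> 0"
  show thesis
  proof (rule that[of "\<lambda>x. - T x"])
    have "radial_average a b w (\<lambda>r. - outer_kernel a b n r) x = - radial_average a b w (outer_kernel a b n) x" for n x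
      by (simp add: radial_average_def)
    moreover have "\<bar>- s - t\<bar> = \<bar>s - - t\<bar>" for s t :: real by simp
    ultimately show "(\<lambda>n. LINT x|circle_measure. \<bar>radial_average a b w (outer_kernel a b n) x - - T x\<bar>) \<longlonglongrightarrow> 0"
      using T(2) by simp
  qed (use T in simp)
qed (auto simp: cutoff_bounds DERIV_outer_cutoff intro!: continuous_intros)

lemma C1_on_Lipschitz_cball:
  fixes \<phi> :: "real^'n::finite \<Rightarrow> real"
  assumes "C1_on UNIV \<phi>"
  obtains L where "0 \<le> L" "\<And>x y. x \<in> cball 0 b \<Longrightarrow> y \<in> cball 0 b \<Longrightarrow> \<bar>\<phi> x - \<phi> y\<bar> \<le> L * norm (x - y)"
proof -
  define D where "D x = (\<chi> i. partial_deriv i \<phi> x)" for x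
  have c: "continuous_on (cball 0 b) (\<lambda>x. norm (D x))"
    unfolding D_def by (intro continuous_intros continuous_on_subset[OF C1_onD(2)[OF assms]]) auto
  obtain L where L: "\<And>x. x \<in> cball 0 b \<Longrightarrow> \<bar>norm (D x)\<bar> \<le> L"
    using continuous_on_compact_bound[OF compact_cball c] by blast
  have "norm (\<phi> x - \<phi> y) \<le> max 0 L * norm (x - y)" if "x \<in> cball 0 b" "y \<in> cball 0 b" for x y
  proof (rule differentiable_bound[OF convex_cball _ _ that])
    fix z :: "real^'n" assume z: "z \<in> cball 0 b"
    show "(\<phi> has_derivative (\<lambda>h. h \<bullet> D z)) (at z within cball 0 b)"
      using C1_onD(1)[OF assms, of z] unfolding D_def gderiv_def by (auto intro: has_derivative_at_withinI)
    have "onorm (\<lambda>h. h \<bullet> D z) \<le> norm (D z)"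
      by (rule onorm_le) (simp add: Cauchy_Schwarz_ineq2 mult.commute)
    then show "onorm (\<lambda>h. h \<bullet> D z) \<le> max 0 L" using L[OF z] by simp
  qed
  then show ?thesis using that[of "max 0 L"] by simp
qed

text \<open>On each ray \<open>\<phi>\<close> is replaced by its value at the boundary point. The error is of the order of the
  width of the layer, while the kernel is of the order of the reciprocal width. So the
  integrand stays bounded, its support shrinks to the boundary, and the error vanishes
  by dominated convergence. What is left is an average along rays.\<close>

lemma radial_average_kernel_tendsto:
  fixes \<phi> :: "real^2 \<Rightarrow> real"
  assumes a: "0 < a" and w: "integrable lborel w" "\<And>x. x \<notin> annulus a b \<Longrightarrow> w x = 0"
    and k: "\<And>n. k n \<in> borel_measurable borel" "\<And>n r. 0 \<le> k n r" "\<And>n r. k n r \<le> 2 * s n"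
      "\<And>n r. k n r \<noteq> 0 \<Longrightarrow> \<bar>r - R\<bar> \<le> 2 / s n"
    and s: "\<And>n. 0 < s n" "(\<lambda>n. 2 / s n) \<longlonglongrightarrow> 0" and R: "R = a \<or> R = b" "a < b"
    and T: "integrable circle_measure T" "(\<lambda>n. LINT x|circle_measure. \<bar>radial_average a b w (k n) x - T x\<bar>) \<longlonglongrightarrow> 0"
    and \<phi>: "C1_on UNIV \<phi>"
  shows "(\<lambda>n. LINT x|lborel. \<phi> x * (k n (norm x) * (x $ i / norm x)) * w x)
    \<longlonglongrightarrow> R * (LINT x|circle_measure. \<phi> (R *\<^sub>R x) * T x * x $ i)"
proof -
  have R0: "0 < R" "R \<le> b" using R a by auto
  have W: "AE x in lborel. x \<notin> annulus a b \<longrightarrow> w x = 0" using w(2) by auto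
  note [measurable] = k(1)
  have [measurable]: "\<phi> \<in> borel_measurable borel"
    by (rule C1_on_measurable(1)[OF \<phi>])
  obtain L where L: "0 \<le> L" "\<And>x y. x \<in> cball 0 b \<Longrightarrow> y \<in> cball 0 b \<Longrightarrow> \<bar>\<phi> x - \<phi> y\<bar> \<le> L * norm (x - y)"
    using C1_on_Lipschitz_cball[OF \<phi>] by metis
  obtain M where "\<And>x. x \<in> cball 0 b \<Longrightarrow> \<bar>\<phi> x\<bar> \<le> M"
    using continuous_on_compact_bound[OF compact_cball C1_onD(3)[OF C1_on_subset[OF \<phi>]]] by blast
  then have M: "\<bar>\<phi> x\<bar> \<le> \<bar>M\<bar>" if "x \<in> cball 0 b" for x using that by force
  define \<psi> where "\<psi> x = R * \<phi> (R *\<^sub>R x) * x $ i" for x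
  have \<psi>m [measurable]: "\<psi> \<in> borel_measurable borel" unfolding \<psi>_def by measurable
  have \<psi>b: "\<bar>\<psi> x\<bar> \<le> R * \<bar>M\<bar>" if "norm x = 1" for x
  proof -
    have "\<bar>\<psi> x\<bar> = R * \<bar>\<phi> (R *\<^sub>R x)\<bar> * \<bar>x $ i\<bar>" using R0 by (simp add: \<psi>_def abs_mult)
    also have "\<dots> \<le> R * \<bar>M\<bar> * 1"
      using R0 that component_le_norm_cart[of x i] by (intro mult_mono M) auto
    finally show ?thesis by simp
  qed
  have kb: "\<bar>k n r\<bar> \<le> 2 * s n" for n r using k(2,3)[of n r] by simp
  define X where "X n = (LINT x|lborel. \<phi> x * (k n (norm x) * (x $ i / norm x)) * w x)" for n
  define Y where "Y n = (LINT x|lborel. \<psi> (sgn x) * k n (norm x) / norm x * w x)" for n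
  have Yeq: "Y n = (LINT x|circle_measure. \<psi> x * radial_average a b w (k n) x)" for n
    unfolding Y_def by (rule radial_average_pairing[OF a w k(1) kb \<psi>m \<psi>b, symmetric])
  have Aint: "integrable circle_measure (radial_average a b w (k n))" for n
    by (rule integrable_radial_average[OF a w k(1) kb])
  have sph: "AE x in circle_measure. x \<notin> sphere 0 1 \<longrightarrow> f x = 0" for f :: "real^2 \<Rightarrow> real"
    using AE_circle_measure by eventually_elim auto
  have \<psi>int: "integrable circle_measure (\<lambda>x. \<psi> x * f x)" if "integrable circle_measure f" for f
    by (rule integrable_bounded_mult[OF sets_circle_measure that sph \<psi>m]) (use \<psi>b in auto)
  have Ylim: "Y \<longlonglongrightarrow> (LINT x|circle_measure. \<psi> x * T x)"
  proof (rule Lim_transform2[OF tendsto_const], rule Lim_null_comparison)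
    show "(\<lambda>n. (LINT x|circle_measure. \<bar>radial_average a b w (k n) x - T x\<bar>) * (R * \<bar>M\<bar>)) \<longlonglongrightarrow> 0"
      using tendsto_mult_left_zero[OF T(2)] .
    show "\<forall>\<^sub>F n in sequentially. norm ((LINT x|circle_measure. \<psi> x * T x) - Y n)
      \<le> (LINT x|circle_measure. \<bar>radial_average a b w (k n) x - T x\<bar>) * (R * \<bar>M\<bar>)"
    proof (intro always_eventually allI)
      fix n
      have "(LINT x|circle_measure. \<psi> x * T x) - Y n = - (LINT x|circle_measure. \<psi> x * (radial_average a b w (k n) x - T x))"
        unfolding Yeq right_diff_distrib using \<psi>int[OF Aint[of n]] \<psi>int[OF T(1)] by simp
      then show "norm ((LINT x|circle_measure. \<psi> x * T x) - Y n)
        \<le> (LINT x|circle_measure. \<bar>radial_average a b w (k n) x - T x\<bar>) * (R * \<bar>M\<bar>)"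
        using integral_bounded_mult_le[OF sets_circle_measure _ sph \<psi>m, of "\<lambda>x. radial_average a b w (k n) x - T x" "R * \<bar>M\<bar>"]
          Aint[of n] T(1) \<psi>b by simp
    qed
  qed
  define g where "g n x = \<phi> x * (k n (norm x) * (x $ i / norm x)) - \<psi> (sgn x) * k n (norm x) / norm x" for n x
  have gm [measurable]: "g n \<in> borel_measurable borel" for n unfolding g_def by measurable
  have gb: "\<bar>g n x\<bar> \<le> 4 * (L + \<bar>M\<bar> / a)" if x: "x \<in> annulus a b" for n x
  proof (cases "k n (norm x) = 0")
    case True
    then show ?thesis using L(1) a by (simp add: g_def)
  next
    case False
    have n: "a < norm x" "norm x < b" "norm (sgn x) = 1" "0 < norm x" "x \<noteq> 0"
      using x a by (auto simp: annulus_def norm_sgn)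
    have "g n x = k n (norm x) * (x $ i / norm x) * (\<phi> x - R / norm x * \<phi> (R *\<^sub>R sgn x))"
    proof -
      have "sgn x $ i = x $ i / norm x" by (simp add: sgn_div_norm divide_inverse mult.commute)
      then show ?thesis unfolding g_def \<psi>_def by (simp add: divide_inverse algebra_simps)
    qed
    then have "\<bar>g n x\<bar> = k n (norm x) * (\<bar>x $ i\<bar> / norm x) * \<bar>\<phi> x - R / norm x * \<phi> (R *\<^sub>R sgn x)\<bar>"
      using k(2)[of n "norm x"] by (simp add: abs_mult)
    also have "\<dots> \<le> (2 * s n) * 1 * ((L + \<bar>M\<bar> / a) * (2 / s n))"
    proof (intro mult_mono)
      show "\<bar>x $ i\<bar> / norm x \<le> 1" using n component_le_norm_cart[of x i] by simp
      have d: "\<bar>norm x - R\<bar> \<le> 2 / s n" by (rule k(4)[OF False])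
      have Rs: "R *\<^sub>R sgn x \<in> cball 0 b" using R0 n by simp
      have "x - R *\<^sub>R sgn x = (norm x - R) *\<^sub>R sgn x" using n by (simp add: sgn_div_norm algebra_simps)
      then have "norm (x - R *\<^sub>R sgn x) = \<bar>norm x - R\<bar>" using n by simp
      then have 1: "\<bar>\<phi> x - \<phi> (R *\<^sub>R sgn x)\<bar> \<le> L * \<bar>norm x - R\<bar>" using L(2)[of x "R *\<^sub>R sgn x"] Rs n by simp
      have "\<bar>1 - R / norm x\<bar> = \<bar>norm x - R\<bar> / norm x"
        using n(4) by (simp add: abs_divide[symmetric] diff_divide_distrib[symmetric] field_simps)
      also have "\<dots> \<le> \<bar>norm x - R\<bar> / a" using n a by (intro divide_left_mono) auto
      finally have 2: "\<bar>(1 - R / norm x) * \<phi> (R *\<^sub>R sgn x)\<bar> \<le> \<bar>norm x - R\<bar> / a * \<bar>M\<bar>"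
        unfolding abs_mult using a by (intro mult_mono M Rs) auto
      have "\<phi> x - R / norm x * \<phi> (R *\<^sub>R sgn x) = (\<phi> x - \<phi> (R *\<^sub>R sgn x)) + (1 - R / norm x) * \<phi> (R *\<^sub>R sgn x)"
        by (simp add: algebra_simps)
      then have "\<bar>\<phi> x - R / norm x * \<phi> (R *\<^sub>R sgn x)\<bar> \<le> L * \<bar>norm x - R\<bar> + \<bar>norm x - R\<bar> / a * \<bar>M\<bar>"
        using 1 2 by linarith
      also have "\<dots> = (L + \<bar>M\<bar> / a) * \<bar>norm x - R\<bar>" by (simp add: algebra_simps)
      also have "\<dots> \<le> (L + \<bar>M\<bar> / a) * (2 / s n)" using d L(1) a by (intro mult_left_mono) auto
      finally show "\<bar>\<phi> x - R / norm x * \<phi> (R *\<^sub>R sgn x)\<bar> \<le> (L + \<bar>M\<bar> / a) * (2 / s n)" .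
    qed (use k s n in \<open>auto simp: less_imp_le\<close>)
    also have "\<dots> = 4 * (L + \<bar>M\<bar> / a)" using s(1)[of n] by simp
    finally show ?thesis .
  qed
  have glim: "(\<lambda>n. g n x) \<longlonglongrightarrow> 0" if x: "x \<in> annulus a b" for x
  proof -
    have "0 < \<bar>norm x - R\<bar>" using x R by (auto simp: annulus_def)
    then have "\<forall>\<^sub>F n in sequentially. 2 / s n < \<bar>norm x - R\<bar>" by (rule order_tendstoD(2)[OF s(2)])
    then have "\<forall>\<^sub>F n in sequentially. g n x = 0"
    proof eventually_elim
      case (elim n)
      then have "k n (norm x) = 0" using k(4)[of n "norm x"] by force
      then show ?case by (simp add: g_def)
    qed
    then show ?thesis by (rule tendsto_eventually)
  qed
  have "(\<lambda>n. LINT x|lborel. g n x * w x) \<longlonglongrightarrow> (LINT x|lborel. 0 * w x)"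
    by (rule integral_bounded_mult_tendsto[OF sets_lborel w(1) W gm gb glim]) auto
  then have diff0: "(\<lambda>n. LINT x|lborel. g n x * w x) \<longlonglongrightarrow> 0" by simp
  have bnd: "\<bar>x $ i / norm x\<bar> \<le> 1" for x :: "real^2"
    using component_le_norm_cart[of x i] by (cases "x = 0") auto
  have Xint: "integrable lborel (\<lambda>x. \<phi> x * (k n (norm x) * (x $ i / norm x)) * w x)" for n
  proof (rule integrable_bounded_mult[OF sets_lborel w(1) W])
    fix x assume "x \<in> annulus a b"
    then have "x \<in> cball 0 b" by (simp add: annulus_def)
    then show "\<bar>\<phi> x * (k n (norm x) * (x $ i / norm x))\<bar> \<le> \<bar>M\<bar> * (2 * s n * 1)"
      unfolding abs_mult using bnd[of x] s(1)[of n] by (intro mult_mono M kb) (auto simp: abs_mult)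
  qed measurable
  have Yint: "integrable lborel (\<lambda>x. \<psi> (sgn x) * k n (norm x) / norm x * w x)" for n
  proof (rule integrable_bounded_mult[OF sets_lborel w(1) W])
    fix x assume "x \<in> annulus a b"
    then have n: "a < norm x" "norm (sgn x) = 1" using a by (auto simp: annulus_def norm_sgn)
    have "\<bar>\<psi> (sgn x) * k n (norm x) / norm x\<bar> = \<bar>\<psi> (sgn x)\<bar> * \<bar>k n (norm x)\<bar> / norm x" by (simp add: abs_mult)
    also have "\<dots> \<le> (R * \<bar>M\<bar>) * (2 * s n) / a"
      using \<psi>b[OF n(2)] kb[of n "norm x"] n a R0 s(1)[of n] by (intro frac_le mult_mono) auto
    finally show "\<bar>\<psi> (sgn x) * k n (norm x) / norm x\<bar> \<le> (R * \<bar>M\<bar>) * (2 * s n) / a" .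
  qed measurable
  have "X n = Y n + (LINT x|lborel. g n x * w x)" for n
    unfolding X_def Y_def g_def left_diff_distrib using Xint[of n] Yint[of n] by simp
  then have "X \<longlonglongrightarrow> (LINT x|circle_measure. \<psi> x * T x) + 0"
    using tendsto_add[OF Ylim diff0] by presburger
  moreover have "(LINT x|circle_measure. \<psi> x * T x) = R * (LINT x|circle_measure. \<phi> (R *\<^sub>R x) * T x * x $ i)"
    by (subst integral_mult_right_zero[symmetric]) (simp add: \<psi>_def mult_ac)
  ultimately show ?thesis by (simp add: X_def[abs_def])
qed

text \<open>The test function is \<open>\<phi>\<close> times a cutoff. The gradient of the cutoff produces the averages with
  the two kernels, which converge to the boundary terms.\<close>

theorem Gauss_Green_annulus:
  fixes \<phi> :: "real^2 \<Rightarrow> real"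
  assumes ab: "0 < a" "a < b" and w: "borel_gradient a b w \<nu> \<sigma>"
    and T1: "integrable circle_measure T1"
      "(\<lambda>n. LINT x|circle_measure. \<bar>radial_average a b w (inner_kernel a b n) x - T1 x\<bar>) \<longlonglongrightarrow> 0"
    and T2: "integrable circle_measure T2"
      "(\<lambda>n. LINT x|circle_measure. \<bar>radial_average a b w (outer_kernel a b n) x - T2 x\<bar>) \<longlonglongrightarrow> 0"
    and \<phi>: "C1_on UNIV \<phi>"
  shows "(LINT x|lborel. partial_deriv i \<phi> x * w x) = - (LINT x|\<nu>. \<phi> x * \<sigma> x $ i)
    + (b * (LINT x|circle_measure. \<phi> (b *\<^sub>R x) * T2 x * x $ i)
     - a * (LINT x|circle_measure. \<phi> (a *\<^sub>R x) * T1 x * x $ i))"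
proof -
  have wi: "integrable lborel w" and w0: "\<And>x. x \<notin> annulus a b \<Longrightarrow> w x = 0"
    and pol: "polar_measure (annulus a b) \<nu> \<sigma>"
    and grad: "\<And>i \<phi>. test_function (annulus a b) \<phi> \<Longrightarrow>
       (LINT x|lborel. partial_deriv i \<phi> x * w x) = - (LINT x|\<nu>. \<phi> x * \<sigma> x $ i)"
    using w by (auto simp: borel_gradient_def)
  note D = polar_measureD[OF pol annulus_borel]
  have W: "AE x in lborel. x \<notin> annulus a b \<longrightarrow> w x = 0" using w0 by auto
  have \<phi>m [measurable]: "\<phi> \<in> borel_measurable borel"
    by (rule C1_on_measurable(1)[OF \<phi>])
  have dm [measurable]: "partial_deriv i \<phi> \<in> borel_measurable borel"
    by (rule C1_on_measurable(2)[OF \<phi>])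
  have ball: "x \<in> cball 0 b" if "x \<in> annulus a b" for x using that by (simp add: annulus_def)
  obtain M where M0: "\<And>x. x \<in> cball 0 b \<Longrightarrow> \<bar>\<phi> x\<bar> \<le> M"
    using continuous_on_compact_bound[OF compact_cball C1_onD(3)[OF C1_on_subset[OF \<phi>]]] by blast
  then have M: "\<bar>\<phi> x\<bar> \<le> \<bar>M\<bar>" if "x \<in> annulus a b" for x using M0[OF ball[OF that]] by linarith
  obtain M' where M0': "\<And>x. x \<in> cball 0 b \<Longrightarrow> \<bar>partial_deriv i \<phi> x\<bar> \<le> M'"
    using continuous_on_compact_bound[OF compact_cball C1_onD(4)[OF C1_on_subset[OF \<phi>]]] by blast
  then have M': "\<bar>partial_deriv i \<phi> x\<bar> \<le> \<bar>M'\<bar>" if "x \<in> annulus a b" for x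
    using M0'[OF ball[OF that]] by linarith
  define \<eta> where "\<eta> n x = annulus_cutoff a b n (norm x)" for n and x :: "real^2"
  have \<eta>m [measurable]: "\<eta> n \<in> borel_measurable borel" for n unfolding \<eta>_def by measurable
  have \<eta>1: "\<bar>\<eta> n x\<bar> \<le> 1" for n x using annulus_cutoff_bounds by (simp add: \<eta>_def)
  have \<eta>lim: "(\<lambda>n. \<eta> n x) \<longlonglongrightarrow> 1" if "x \<in> annulus a b" for x
    using that annulus_cutoff_tendsto_1 by (simp add: \<eta>_def annulus_def)
  define A where "A n = (LINT x|lborel. \<phi> x * (inner_kernel a b n (norm x) * (x $ i / norm x)) * w x)" for n
  define B where "B n = (LINT x|lborel. \<phi> x * (outer_kernel a b n (norm x) * (x $ i / norm x)) * w x)" for n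
  have bnd: "\<bar>x $ i / norm x\<bar> \<le> 1" for x :: "real^2"
    using component_le_norm_cart[of x i] by (cases "x = 0") auto
  have kint: "integrable lborel (\<lambda>x. \<phi> x * (k (norm x) * (x $ i / norm x)) * w x)"
    if [measurable]: "k \<in> borel_measurable borel" and "\<And>r. 0 \<le> k r" "\<And>r. k r \<le> K" for k K
  proof (rule integrable_bounded_mult[OF sets_lborel wi W])
    fix x assume "x \<in> annulus a b"
    then show "\<bar>\<phi> x * (k (norm x) * (x $ i / norm x))\<bar> \<le> \<bar>M\<bar> * (K * 1)"
      unfolding abs_mult using bnd[of x] that(2,3)[of "norm x"] by (intro mult_mono M) (auto simp: abs_mult)
  qed measurable
  have eq: "A n - B n + (LINT x|lborel. (\<eta> n x * partial_deriv i \<phi> x) * w x)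
      = - (LINT x|\<nu>. (\<phi> x * \<eta> n x) * \<sigma> x $ i)" for n
  proof -
    have i1: "integrable lborel (\<lambda>x. \<phi> x * (inner_kernel a b n (norm x) * (x $ i / norm x)) * w x)"
      by (rule kint[OF _ kernel_bounds(1,2)[OF ab(2)]]) simp
    have i2: "integrable lborel (\<lambda>x. \<phi> x * (outer_kernel a b n (norm x) * (x $ i / norm x)) * w x)"
      by (rule kint[OF _ kernel_bounds(3,4)[OF ab(2)]]) simp
    have i3: "integrable lborel (\<lambda>x. (\<eta> n x * partial_deriv i \<phi> x) * w x)"
    proof (rule integrable_bounded_mult[OF sets_lborel wi W])
      show "\<bar>\<eta> n x * partial_deriv i \<phi> x\<bar> \<le> 1 * \<bar>M'\<bar>" if "x \<in> annulus a b" for x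
        unfolding abs_mult by (intro mult_mono \<eta>1 M' that) auto
    qed measurable
    have "(LINT x|lborel. partial_deriv i (\<lambda>x. \<phi> x * \<eta> n x) x * w x)
        = (LINT x|lborel. \<phi> x * (inner_kernel a b n (norm x) * (x $ i / norm x)) * w x
            - \<phi> x * (outer_kernel a b n (norm x) * (x $ i / norm x)) * w x
            + (\<eta> n x * partial_deriv i \<phi> x) * w x)"
    proof (intro Bochner_Integration.integral_cong refl)
      fix x
      show "partial_deriv i (\<lambda>x. \<phi> x * \<eta> n x) x * w x = \<phi> x * (inner_kernel a b n (norm x) * (x $ i / norm x)) * w x
            - \<phi> x * (outer_kernel a b n (norm x) * (x $ i / norm x)) * w x
            + (\<eta> n x * partial_deriv i \<phi> x) * w x"
      proof (cases "x = 0")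
        case True
        then have "w x = 0" using w0[of x] ab by (simp add: annulus_def)
        then show ?thesis by simp
      next
        case False
        show ?thesis
          unfolding \<eta>_def partial_deriv_radial_mult[OF \<phi> DERIV_annulus_cutoff[OF ab(2)] False]
          by (simp add: algebra_simps)
      qed
    qed
    also have "\<dots> = A n - B n + (LINT x|lborel. (\<eta> n x * partial_deriv i \<phi> x) * w x)"
      unfolding A_def B_def using i1 i2 i3 by simp
    finally show ?thesis
      using grad[OF test_function_annulus_cutoff[OF ab \<phi>, of n], of i] by (simp add: \<eta>_def)
  qed
  have "A \<longlonglongrightarrow> a * (LINT x|circle_measure. \<phi> (a *\<^sub>R x) * T1 x * x $ i)"
    unfolding A_def[abs_def]
  proof (rule radial_average_kernel_tendsto[OF ab(1) wi w0 _ kernel_bounds(1,2)[OF ab(2)] _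
        cutoff_scale_pos[OF ab(2)] cutoff_scale_at_top[OF ab(2)] _ ab(2) T1 \<phi>])
    show "\<bar>r - a\<bar> \<le> 2 / cutoff_scale a b n" if "inner_kernel a b n r \<noteq> 0" for n r
      using inner_kernel_eq_0[OF ab(2), of r n] that cutoff_scale_pos[OF ab(2), of n]
      by (smt (verit) divide_pos_pos)
  qed auto
  moreover have "B \<longlonglongrightarrow> b * (LINT x|circle_measure. \<phi> (b *\<^sub>R x) * T2 x * x $ i)"
    unfolding B_def[abs_def]
  proof (rule radial_average_kernel_tendsto[OF ab(1) wi w0 _ kernel_bounds(3,4)[OF ab(2)] _
        cutoff_scale_pos[OF ab(2)] cutoff_scale_at_top[OF ab(2)] _ ab(2) T2 \<phi>])
    show "\<bar>r - b\<bar> \<le> 2 / cutoff_scale a b n" if "outer_kernel a b n r \<noteq> 0" for n r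
      using outer_kernel_eq_0[OF ab(2), of n r] that cutoff_scale_pos[OF ab(2), of n]
      by (smt (verit) divide_pos_pos)
  qed auto
  moreover have "(\<lambda>n. LINT x|lborel. (\<eta> n x * partial_deriv i \<phi> x) * w x) \<longlonglongrightarrow> (LINT x|lborel. partial_deriv i \<phi> x * w x)"
  proof (rule integral_bounded_mult_tendsto[OF sets_lborel wi W])
    show "\<bar>\<eta> n x * partial_deriv i \<phi> x\<bar> \<le> 1 * \<bar>M'\<bar>" if "x \<in> annulus a b" for n x
      unfolding abs_mult by (intro mult_mono \<eta>1 M' that) auto
    show "(\<lambda>n. \<eta> n x * partial_deriv i \<phi> x) \<longlonglongrightarrow> partial_deriv i \<phi> x" if "x \<in> annulus a b" for x
      using tendsto_mult[OF \<eta>lim[OF that] tendsto_const] by simp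
  qed measurable
  moreover have "(\<lambda>n. LINT x|\<nu>. (\<phi> x * \<eta> n x) * \<sigma> x $ i) \<longlonglongrightarrow> (LINT x|\<nu>. \<phi> x * \<sigma> x $ i)"
  proof (rule integral_bounded_mult_tendsto[OF D(1,6,7)])
    show "\<bar>\<phi> x * \<eta> n x\<bar> \<le> \<bar>M\<bar> * 1" if "x \<in> annulus a b" for n x
      unfolding abs_mult by (intro mult_mono \<eta>1 M that) auto
    show "(\<lambda>n. \<phi> x * \<eta> n x) \<longlonglongrightarrow> \<phi> x" if "x \<in> annulus a b" for x
      using tendsto_mult[OF tendsto_const \<eta>lim[OF that], of "\<phi> x"] by simp
  qed measurable
  ultimately have "a * (LINT x|circle_measure. \<phi> (a *\<^sub>R x) * T1 x * x $ i) - b * (LINT x|circle_measure. \<phi> (b *\<^sub>R x) * T2 x * x $ i)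
      + (LINT x|lborel. partial_deriv i \<phi> x * w x) = - (LINT x|\<nu>. \<phi> x * \<sigma> x $ i)"
    by (intro LIMSEQ_unique[OF tendsto_add[OF tendsto_diff]]) (auto simp: eq intro!: tendsto_intros)
  then show ?thesis by simp
qed

section \<open>The Gauss-Green formula on the annulus\<close>

lemma closure_annulus:
  assumes ab: "0 < a" "a < b"
  shows "closure (annulus a b) = {x. a \<le> norm x \<and> norm x \<le> b}"
proof
  have "closed {x :: real^2. a \<le> norm x \<and> norm x \<le> b}"
    by (intro closed_Collect_conj closed_Collect_le continuous_intros)
  then show "closure (annulus a b) \<subseteq> {x. a \<le> norm x \<and> norm x \<le> b}"
    by (intro closure_minimal) (auto simp: annulus_def)
  show "{x. a \<le> norm x \<and> norm x \<le> b} \<subseteq> closure (annulus a b)"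
  proof clarify
    fix x :: "real^2" assume x: "a \<le> norm x" "norm x \<le> b"
    have "(\<lambda>t. t *\<^sub>R sgn x) ` closure {a<..<b} \<subseteq> closure (annulus a b)"
    proof (rule image_closure_subset)
      show "(\<lambda>t. t *\<^sub>R sgn x) ` {a<..<b} \<subseteq> closure (annulus a b)"
        using x ab by (intro order_trans[OF _ closure_subset]) (auto simp: annulus_def norm_sgn)
    qed (auto intro!: continuous_intros)
    moreover have "norm x \<in> closure {a<..<b}" using x ab by simp
    moreover have "norm x *\<^sub>R sgn x = x" by (cases "x = 0") (simp_all add: sgn_div_norm)
    ultimately show "x \<in> closure (annulus a b)" by (metis image_subset_iff)
  qed
qed

lemma frontier_annulus:
  assumes ab: "0 < a" "a < b"
  shows "frontier (annulus a b) = sphere 0 a \<union> sphere 0 b"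
  unfolding frontier_def closure_annulus[OF ab] interior_open[OF open_annulus]
  using ab by (auto simp: annulus_def)

lemma sphere_borel [measurable]: "sphere (0::real^2) r \<in> sets borel"
  by (intro borel_closed closed_sphere)

lemma
  fixes f :: "real^2 \<Rightarrow> real"
  assumes ab: "0 < a" "a < b" and f [measurable]: "f \<in> borel_measurable borel"
  shows set_integrable_frontier_annulus: "set_integrable hausdorff1 (frontier (annulus a b)) f \<longleftrightarrow>
      integrable circle_measure (\<lambda>x. f (a *\<^sub>R x)) \<and> integrable circle_measure (\<lambda>x. f (b *\<^sub>R x))"
    and set_integral_frontier_annulus: "set_integrable hausdorff1 (frontier (annulus a b)) f \<Longrightarrow>
      (LINT x:frontier (annulus a b)|hausdorff1. f x)
        = a * (LINT x|circle_measure. f (a *\<^sub>R x)) + b * (LINT x|circle_measure. f (b *\<^sub>R x))"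
proof -
  have b: "0 < b" using ab by simp
  have sphere: "sphere (0::real^2) r \<in> sets hausdorff1" for r using sphere_borel by simp
  have iff: "set_integrable hausdorff1 (frontier (annulus a b)) f \<longleftrightarrow>
      set_integrable hausdorff1 (sphere 0 a) f \<and> set_integrable hausdorff1 (sphere 0 b) f"
    unfolding frontier_annulus[OF ab]
    using set_integrable_Un[OF _ _ sphere sphere] set_integrable_subset[of hausdorff1 "sphere 0 a \<union> sphere 0 b" f] sphere
    by blast
  then show "set_integrable hausdorff1 (frontier (annulus a b)) f \<longleftrightarrow>
      integrable circle_measure (\<lambda>x. f (a *\<^sub>R x)) \<and> integrable circle_measure (\<lambda>x. f (b *\<^sub>R x))"
    unfolding set_integrable_hausdorff1_sphere[OF ab(1) f] set_integrable_hausdorff1_sphere[OF b f] .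
  assume int: "set_integrable hausdorff1 (frontier (annulus a b)) f"
  have "(LINT x:frontier (annulus a b)|hausdorff1. f x)
      = (LINT x:sphere 0 a|hausdorff1. f x) + (LINT x:sphere 0 b|hausdorff1. f x)"
    unfolding frontier_annulus[OF ab]
    using int iff ab by (intro set_integral_Un) auto
  then show "(LINT x:frontier (annulus a b)|hausdorff1. f x)
        = a * (LINT x|circle_measure. f (a *\<^sub>R x)) + b * (LINT x|circle_measure. f (b *\<^sub>R x))"
    unfolding set_integral_hausdorff1_sphere[OF ab(1) f] set_integral_hausdorff1_sphere[OF b f] .
qed

lemma annulus_normal_measurable [measurable]: "(\<lambda>x. annulus_normal a b x $ i) \<in> borel_measurable borel"
proof -
  have "(\<lambda>x::real^2. if norm x = b then (x /\<^sub>R b) $ i else (- (x /\<^sub>R a)) $ i) \<in> borel_measurable borel"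
  proof (rule measurable_If)
    show "{x \<in> space borel. norm (x::real^2) = b} \<in> sets borel" by measurable
  qed (intro borel_measurable_continuous_onI continuous_intros)+
  then show ?thesis by (simp only: annulus_normal_def if_distrib[of "\<lambda>v. v $ i"])
qed

lemma abs_annulus_normal_le:
  assumes ab: "0 < a" "a < b" and x: "x \<in> frontier (annulus a b)"
  shows "\<bar>annulus_normal a b x $ i\<bar> \<le> 1"
proof -
  have "norm x = a \<or> norm x = b" using x unfolding frontier_annulus[OF ab] by auto
  then have "norm (annulus_normal a b x) = 1" using ab by (auto simp: annulus_normal_def)
  then show ?thesis using component_le_norm_cart[of "annulus_normal a b x" i] by simp
qed

definition glue_trace :: "real \<Rightarrow> real \<Rightarrow> (real^2 \<Rightarrow> real) \<Rightarrow> (real^2 \<Rightarrow> real) \<Rightarrow> real^2 \<Rightarrow> real" where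
  "glue_trace a b T1 T2 x = (if norm x = b then T2 (x /\<^sub>R b) else T1 (x /\<^sub>R a))"

text \<open>The radial limits on the two circles, glued together, satisfy the definition of a trace because
  Hausdorff measure on a circle is the radius times the angle.\<close>

theorem is_trace_radial_limits:
  assumes ab: "0 < a" "a < b"
    and w: "is_gradient_measure (annulus a b) w \<nu> \<sigma>"
    and w': "borel_gradient a b w' \<nu> \<sigma>"
      "\<And>F. F \<in> borel_measurable borel \<Longrightarrow> (LINT x:annulus a b|lebesgue. w x * F x) = (LINT x|lborel. F x * w' x)"
    and T1: "integrable circle_measure T1"
      "(\<lambda>n. LINT x|circle_measure. \<bar>radial_average a b w' (inner_kernel a b n) x - T1 x\<bar>) \<longlonglongrightarrow> 0"
    and T2: "integrable circle_measure T2"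
      "(\<lambda>n. LINT x|circle_measure. \<bar>radial_average a b w' (outer_kernel a b n) x - T2 x\<bar>) \<longlonglongrightarrow> 0"
  shows "is_trace (annulus a b) (annulus_normal a b) w (glue_trace a b T1 T2)"
proof -
  have b: "0 < b" using ab by simp
  have [measurable]: "T1 \<in> borel_measurable borel" "T2 \<in> borel_measurable borel"
    using borel_measurable_integrable[OF T1(1)] borel_measurable_integrable[OF T2(1)]
      measurable_cong_sets[OF sets_circle_measure refl] by blast+
  let ?T = "glue_trace a b T1 T2"
  have Tm [measurable]: "?T \<in> borel_measurable borel"
    unfolding glue_trace_def[abs_def] by measurable
  have Ta: "AE x in circle_measure. ?T (a *\<^sub>R x) = T1 x" and Tb: "AE x in circle_measure. ?T (b *\<^sub>R x) = T2 x"
    using AE_circle_measure by (eventually_elim, use ab in \<open>simp add: glue_trace_def\<close>)+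
  have "integrable circle_measure (\<lambda>x. ?T (a *\<^sub>R x))"
    by (rule integrable_cong_AE_imp[OF T1(1)]) (use Ta in \<open>auto elim: eventually_mono\<close>)
  moreover have "integrable circle_measure (\<lambda>x. ?T (b *\<^sub>R x))"
    by (rule integrable_cong_AE_imp[OF T2(1)]) (use Tb in \<open>auto elim: eventually_mono\<close>)
  ultimately have Tint: "set_integrable hausdorff1 (frontier (annulus a b)) ?T"
    by (simp add: set_integrable_frontier_annulus[OF ab])
  have gg: "(LINT x:annulus a b|lebesgue. w x * partial_deriv i \<phi> x) =
             - (LINT x|\<nu>. \<phi> x * \<sigma> x $ i)
             + (LINT x:frontier (annulus a b)|hausdorff1. \<phi> x * ?T x * annulus_normal a b x $ i)"
    if \<phi>: "C1_on UNIV \<phi>" for i \<phi>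
  proof -
    have [measurable]: "\<phi> \<in> borel_measurable borel"
      by (rule C1_on_measurable(1)[OF \<phi>])
    have [measurable]: "partial_deriv i \<phi> \<in> borel_measurable borel"
      by (rule C1_on_measurable(2)[OF \<phi>])
    define f where "f x = \<phi> x * ?T x * annulus_normal a b x $ i" for x
    have fm [measurable]: "f \<in> borel_measurable borel" unfolding f_def by measurable
    obtain M where M: "\<And>x. x \<in> cball 0 b \<Longrightarrow> \<bar>\<phi> x\<bar> \<le> M"
      using continuous_on_compact_bound[OF compact_cball C1_onD(3)[OF C1_on_subset[OF \<phi>]]] by blast
    have aea: "AE x in circle_measure. f (a *\<^sub>R x) = - (\<phi> (a *\<^sub>R x) * T1 x * x $ i)"
      using Ta AE_circle_measure
      by eventually_elim (use ab in \<open>simp add: f_def annulus_normal_def\<close>)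
    have aeb: "AE x in circle_measure. f (b *\<^sub>R x) = \<phi> (b *\<^sub>R x) * T2 x * x $ i"
      using Tb AE_circle_measure
      by eventually_elim (use ab in \<open>simp add: f_def annulus_normal_def\<close>)
    have ib: "integrable circle_measure (\<lambda>x. \<phi> (R *\<^sub>R x) * T x * x $ i)"
      if "integrable circle_measure T" and R: "0 \<le> R" "R \<le> b" for R T
    proof -
      have [measurable]: "T \<in> borel_measurable borel"
        using borel_measurable_integrable[OF that(1)] measurable_cong_sets[OF sets_circle_measure refl] by blast
      have "integrable circle_measure (\<lambda>x. (\<phi> (R *\<^sub>R x) * x $ i) * T x)"
      proof (rule integrable_bounded_mult[OF sets_circle_measure that(1), of "sphere 0 1" _ "\<bar>M\<bar> * 1"])
        show "AE x in circle_measure. x \<notin> sphere 0 1 \<longrightarrow> T x = 0"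
          using AE_circle_measure by eventually_elim simp
        fix x :: "real^2" assume "x \<in> sphere 0 1"
        then have x: "norm x = 1" by simp
        have "\<bar>\<phi> (R *\<^sub>R x)\<bar> \<le> M" by (rule M) (use x R in simp)
        then show "\<bar>\<phi> (R *\<^sub>R x) * x $ i\<bar> \<le> \<bar>M\<bar> * 1"
          unfolding abs_mult using component_le_norm_cart[of x i] x by (intro mult_mono) auto
      qed measurable
      then show ?thesis by (simp add: mult_ac)
    qed
    have ia: "integrable circle_measure (\<lambda>x. f (a *\<^sub>R x))"
    proof (rule integrable_cong_AE_imp)
      show "integrable circle_measure (\<lambda>x. - (\<phi> (a *\<^sub>R x) * T1 x * x $ i))"
        using ib[OF T1(1), of a] ab by simp
    qed (use aea in \<open>auto elim: eventually_mono\<close>)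
    have ib': "integrable circle_measure (\<lambda>x. f (b *\<^sub>R x))"
    proof (rule integrable_cong_AE_imp)
      show "integrable circle_measure (\<lambda>x. \<phi> (b *\<^sub>R x) * T2 x * x $ i)"
        using ib[OF T2(1), of b] ab by simp
    qed (use aeb in \<open>auto elim: eventually_mono\<close>)
    have "(LINT x:frontier (annulus a b)|hausdorff1. f x)
        = a * (LINT x|circle_measure. f (a *\<^sub>R x)) + b * (LINT x|circle_measure. f (b *\<^sub>R x))"
      by (rule set_integral_frontier_annulus[OF ab fm]) (simp add: set_integrable_frontier_annulus[OF ab fm] ia ib')
    also have "(LINT x|circle_measure. f (a *\<^sub>R x)) = (LINT x|circle_measure. - (\<phi> (a *\<^sub>R x) * T1 x * x $ i))"
      by (rule integral_cong_AE) (use aea in auto)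
    also have "(LINT x|circle_measure. f (b *\<^sub>R x)) = (LINT x|circle_measure. \<phi> (b *\<^sub>R x) * T2 x * x $ i)"
      by (rule integral_cong_AE) (use aeb in auto)
    finally have fr: "(LINT x:frontier (annulus a b)|hausdorff1. f x)
      = b * (LINT x|circle_measure. \<phi> (b *\<^sub>R x) * T2 x * x $ i) - a * (LINT x|circle_measure. \<phi> (a *\<^sub>R x) * T1 x * x $ i)"
      by simp
    have "(LINT x:annulus a b|lebesgue. w x * partial_deriv i \<phi> x) = (LINT x|lborel. partial_deriv i \<phi> x * w' x)"
      by (rule w'(2)) simp
    also have "\<dots> = - (LINT x|\<nu>. \<phi> x * \<sigma> x $ i) + (LINT x:frontier (annulus a b)|hausdorff1. f x)"
      unfolding fr by (rule Gauss_Green_annulus[OF ab w'(1) T1 T2 \<phi>])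
    finally show ?thesis by (simp add: f_def)
  qed
  show ?thesis
    unfolding is_trace_def using Tint w gg by blast
qed

theorem trace_exists:
  assumes ab: "0 < a" "a < b" and w: "w \<in> BV (annulus a b)"
  shows "\<exists>T. is_trace (annulus a b) (annulus_normal a b) w T"
proof -
  obtain \<nu> \<sigma> where wi: "w absolutely_integrable_on annulus a b" and g: "is_gradient_measure (annulus a b) w \<nu> \<sigma>"
    using w by (auto simp: BV_def)
  obtain w' where w': "borel_gradient a b w' \<nu> \<sigma>"
      "\<forall>F. F \<in> borel_measurable borel \<longrightarrow> (LINT x:annulus a b|lebesgue. w x * F x) = (LINT x|lborel. F x * w' x)"
    using borel_gradient_exists[OF wi g] by blast
  obtain T1 where "integrable circle_measure T1"
    "(\<lambda>n. LINT x|circle_measure. \<bar>radial_average a b w' (inner_kernel a b n) x - T1 x\<bar>) \<longlonglongrightarrow> 0"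
    by (rule inner_trace_exists[OF ab w'(1)])
  moreover obtain T2 where "integrable circle_measure T2"
    "(\<lambda>n. LINT x|circle_measure. \<bar>radial_average a b w' (outer_kernel a b n) x - T2 x\<bar>) \<longlonglongrightarrow> 0"
    by (rule outer_trace_exists[OF ab w'(1)])
  ultimately show ?thesis using is_trace_radial_limits[OF ab g w'(1)] w'(2) by blast
qed

lemma is_trace_trace_on:
  assumes "0 < a" "a < b" "w \<in> BV (annulus a b)"
  shows "is_trace (annulus a b) (annulus_normal a b) w (annulus_trace a b w)"
  unfolding trace_on_def using trace_exists[OF assms] by (rule someI_ex)

text \<open>A continuous function is bounded on the annulus only, so it is first cut off sharply.\<close>

lemma annulus_test_continuous_unique:
  assumes ab: "0 < a" "a < b"
    and h: "h absolutely_integrable_on annulus a b" "h' absolutely_integrable_on annulus a b"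
    and \<nu>: "polar_measure (annulus a b) \<nu> \<sigma>" "polar_measure (annulus a b) \<nu>' \<sigma>'"
    and eq: "\<And>\<phi>. test_function (annulus a b) \<phi> \<Longrightarrow>
      grad_pairing (annulus a b) h \<nu> \<sigma> i \<phi> = grad_pairing (annulus a b) h' \<nu>' \<sigma>' i \<phi>"
    and f: "continuous_on UNIV f"
  shows "grad_pairing (annulus a b) h \<nu> \<sigma> i f = grad_pairing (annulus a b) h' \<nu>' \<sigma>' i f"
proof -
  let ?W = "annulus a b"
  have fm [measurable]: "f \<in> borel_measurable borel" by (rule borel_measurable_continuous_onI[OF f])
  obtain B where B0: "\<And>x. x \<in> cball 0 b \<Longrightarrow> \<bar>f x\<bar> \<le> B"
    using continuous_on_compact_bound[OF compact_cball continuous_on_subset[OF f]] by blast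
  define g where "g x = f x * indicator ?W x" for x
  have gm: "g \<in> borel_measurable borel" unfolding g_def by measurable
  have gB: "\<bar>g x\<bar> \<le> \<bar>B\<bar>" for x
    using B0[of x] by (auto simp: g_def indicator_def annulus_def)
  have same: "grad_pairing ?W k \<mu> s i f = grad_pairing ?W k \<mu> s i g" if pol: "polar_measure ?W \<mu> s" for k \<mu> s
  proof -
    note D = polar_measureD[OF pol annulus_borel]
    have "(LINT x:?W|lebesgue. f x * k x $ i) = (LINT x:?W|lebesgue. g x * k x $ i)"
      by (rule set_lebesgue_integral_cong) (auto simp: g_def)
    moreover have "(LINT x|\<mu>. f x * s x $ i) = (LINT x|\<mu>. g x * s x $ i)"
    proof (rule integral_cong_AE)
      have [measurable_cong]: "sets \<mu> = sets borel" by (rule D)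
      have [measurable]: "(\<lambda>x. s x $ i) \<in> borel_measurable borel"
        by (intro measurable_compose[OF D(4)] borel_measurable_continuous_onI continuous_intros)
      show "(\<lambda>x. f x * s x $ i) \<in> borel_measurable \<mu>" "(\<lambda>x. g x * s x $ i) \<in> borel_measurable \<mu>"
        using gm by measurable
      show "AE x in \<mu>. f x * s x $ i = g x * s x $ i"
        using D(3) by eventually_elim (simp add: g_def)
    qed
    ultimately show ?thesis by (simp add: grad_pairing_def)
  qed
  show ?thesis
    unfolding same[OF \<nu>(1)] same[OF \<nu>(2)] by (rule grad_pairing_unique[OF ab h \<nu> eq gm gB])
qed

lemma absolutely_integrable_zero_vec: "(\<lambda>x. 0 :: real^2) absolutely_integrable_on S"
  by (simp add: set_integrable_def)

text \<open>The definition of a trace provides the formula for one particular gradient measure. The formula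
  holds for every other representation of the gradient since they agree on continuous functions.\<close>

lemma trace_Gauss_Green:
  assumes ab: "0 < a" "a < b" and T: "is_trace (annulus a b) (annulus_normal a b) w T"
    and d: "h absolutely_integrable_on annulus a b" "polar_measure (annulus a b) \<nu> \<sigma>"
      "\<And>i \<phi>. test_function (annulus a b) \<phi> \<Longrightarrow>
        (LINT x:annulus a b|lebesgue. w x * partial_deriv i \<phi> x) = - grad_pairing (annulus a b) h \<nu> \<sigma> i \<phi>"
    and \<phi>: "C1_on UNIV \<phi>"
  shows "(LINT x:annulus a b|lebesgue. w x * partial_deriv i \<phi> x) = - grad_pairing (annulus a b) h \<nu> \<sigma> i \<phi>
    + (LINT x:frontier (annulus a b)|hausdorff1. \<phi> x * T x * annulus_normal a b x $ i)"
proof -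
  obtain \<nu>' \<sigma>' where g: "is_gradient_measure (annulus a b) w \<nu>' \<sigma>'"
    and gg: "(LINT x:annulus a b|lebesgue. w x * partial_deriv i \<phi> x) =
             - (LINT x|\<nu>'. \<phi> x * \<sigma>' x $ i)
             + (LINT x:frontier (annulus a b)|hausdorff1. \<phi> x * T x * annulus_normal a b x $ i)"
    using T \<phi> unfolding is_trace_def by blast
  have pol: "polar_measure (annulus a b) \<nu>' \<sigma>'" using g by (simp add: is_gradient_measure_def)
  have "grad_pairing (annulus a b) (\<lambda>_. 0) \<nu>' \<sigma>' i \<phi> = grad_pairing (annulus a b) h \<nu> \<sigma> i \<phi>"
  proof (rule annulus_test_continuous_unique[OF ab absolutely_integrable_zero_vec d(1) pol d(2) _ C1_onD(3)[OF \<phi>]])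
    fix \<psi> assume t: "test_function (annulus a b) \<psi>"
    have "(LINT x:annulus a b|lebesgue. w x * partial_deriv i \<psi> x) = - grad_pairing (annulus a b) (\<lambda>_. 0) \<nu>' \<sigma>' i \<psi>"
      using g t by (simp add: is_gradient_measure_def grad_pairing_def set_lebesgue_integral_def)
    then show "grad_pairing (annulus a b) (\<lambda>_. 0) \<nu>' \<sigma>' i \<psi> = grad_pairing (annulus a b) h \<nu> \<sigma> i \<psi>"
      using d(3)[OF t, of i] by linarith
  qed
  then show ?thesis using gg by (simp add: grad_pairing_def set_lebesgue_integral_def)
qed

lemma AE_density_indicator:
  assumes "A \<in> sets M"
  shows "(AE x in density M (indicator A). P x) \<longleftrightarrow> (AE x in M. x \<in> A \<longrightarrow> P x)"
  using assms by (subst AE_density) (auto simp: indicator_def split: if_splits)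

text \<open>Testing with \<open>p x * x $ i\<close> and summing over \<open>i\<close> gives the integral of \<open>p T\<close> with the weight
  \<open>x \<bullet> n\<close>, which is \<open>b\<close> or \<open>- a\<close> on the two circles. So all polynomials have the same integral
  against \<open>T\<close> and \<open>T'\<close> with a weight that does not vanish.\<close>

theorem trace_unique:
  assumes ab: "0 < a" "a < b"
    and T: "is_trace (annulus a b) (annulus_normal a b) w T" "is_trace (annulus a b) (annulus_normal a b) w T'"
  shows "AE x in hausdorff1. x \<in> frontier (annulus a b) \<longrightarrow> T x = T' x"
proof -
  let ?F = "frontier (annulus a b)"
  obtain \<nu> \<sigma> where g: "is_gradient_measure (annulus a b) w \<nu> \<sigma>" using T(1) by (auto simp: is_trace_def)
  have Fb [measurable]: "?F \<in> sets borel" by (intro borel_closed frontier_closed)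
  have Ti: "set_integrable hausdorff1 ?F T" "set_integrable hausdorff1 ?F T'" using T by (auto simp: is_trace_def)
  define d where "d x = indicator ?F x * T x - indicator ?F x * T' x" for x
  have di: "integrable hausdorff1 d"
    unfolding d_def using Ti by (auto simp: set_integrable_def)
  have [measurable]: "d \<in> borel_measurable borel"
    using borel_measurable_integrable[OF di] measurable_cong_sets[OF sets_hausdorff1 refl] by blast
  have d0: "AE x in hausdorff1. x \<notin> ?F \<longrightarrow> d x = 0" by (simp add: d_def)
  have xn: "x \<bullet> annulus_normal a b x = (if norm x = b then b else - a)" if "x \<in> ?F" for x
    using that ab unfolding frontier_annulus[OF ab]
    by (auto simp: annulus_normal_def dot_square_norm power2_eq_square)
  have [measurable]: "(\<lambda>x. x \<bullet> annulus_normal a b x) \<in> borel_measurable borel"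
    unfolding inner_vec_def by measurable
  define f where "f x = (x \<bullet> annulus_normal a b x) * d x" for x
  have fi: "integrable hausdorff1 f"
    unfolding f_def by (rule integrable_bounded_mult[OF sets_hausdorff1 di d0, where B = b]) (use xn ab in auto)
  define M where "M = density hausdorff1 (indicator ?F)"
  have e: "(indicator ?F :: _ \<Rightarrow> ennreal) = (\<lambda>x. ennreal (indicator ?F x))" by (auto simp: indicator_def fun_eq_iff)
  have ind: "indicator ?F x * f x = f x" "indicator ?F x * (r * f x) = r * f x" for r x
    by (auto simp: f_def d_def indicator_def)
  have bdd: "compact ?F" unfolding frontier_annulus[OF ab] by (intro compact_Un compact_sphere)
  have "AE x in M. f x = 0"
  proof (rule AE_zero_polynomial_dual[OF _ _ bdd])
    show "sets M = sets borel" by (simp add: M_def)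
    show "integrable M f" unfolding M_def e
      by (subst integrable_density) (use borel_measurable_integrable[OF fi] in \<open>simp_all add: ind fi\<close>)
    show "AE x in M. x \<in> ?F" unfolding M_def by (subst AE_density_indicator) auto
    fix p :: "real^2 \<Rightarrow> real" assume p: "real_polynomial_function p"
    have pc: "C1_on UNIV (\<lambda>x. p x * x $ i)" for i
      by (intro C1_on_mult C1_on_nth C1_on_real_polynomial_function[OF p])
    note [measurable] = C1_on_measurable(1)[OF C1_on_real_polynomial_function[OF p]]
    have gd: "test_function (annulus a b) \<phi> \<Longrightarrow>
        (LINT x:annulus a b|lebesgue. w x * partial_deriv i \<phi> x) = - grad_pairing (annulus a b) (\<lambda>_. 0) \<nu> \<sigma> i \<phi>" for i \<phi>
      using g by (simp add: is_gradient_measure_def grad_pairing_def set_lebesgue_integral_def)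
    have pol: "polar_measure (annulus a b) \<nu> \<sigma>" using g by (simp add: is_gradient_measure_def)
    define c where "c i x = (p x * x $ i) * annulus_normal a b x $ i" for i x
    have cm [measurable]: "c i \<in> borel_measurable borel" for i unfolding c_def by measurable
    have "\<exists>B. \<forall>x\<in>?F. \<bar>c i x\<bar> \<le> B" for i
    proof -
      obtain B where B: "\<forall>x\<in>?F. \<bar>p x * x $ i\<bar> \<le> B"
        using continuous_on_compact_bound[OF bdd C1_onD(3)[OF C1_on_subset[OF pc[of i] subset_UNIV]]] by blast
      have "\<bar>c i x\<bar> \<le> B * 1" if "x \<in> ?F" for x
        unfolding c_def abs_mult[of "p x * x $ i"] using B that abs_annulus_normal_le[OF ab that]
        by (intro mult_mono) (auto intro: order_trans[OF abs_ge_zero])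
      then show ?thesis by blast
    qed
    then obtain B where B: "\<And>i x. x \<in> ?F \<Longrightarrow> \<bar>c i x\<bar> \<le> B i" by metis
    have ci: "integrable hausdorff1 (\<lambda>x. c i x * (indicator ?F x * S x))" if S: "set_integrable hausdorff1 ?F S" for i S
      by (rule integrable_bounded_mult[OF sets_hausdorff1 _ _ cm B]) (use S in \<open>auto simp: set_integrable_def\<close>)
    have "(LINT x:?F|hausdorff1. c i x * T x) = (LINT x:?F|hausdorff1. c i x * T' x)" for i
      using trace_Gauss_Green[OF ab T(1) absolutely_integrable_zero_vec pol gd pc, of i i]
        trace_Gauss_Green[OF ab T(2) absolutely_integrable_zero_vec pol gd pc, of i i]
      by (simp add: c_def mult_ac)
    then have zero: "integrable hausdorff1 (\<lambda>x. c i x * d x)" "(LINT x|hausdorff1. c i x * d x) = 0" for i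
      unfolding d_def right_diff_distrib using ci[OF Ti(1), of i] ci[OF Ti(2), of i]
      by (simp_all add: set_lebesgue_integral_def mult_ac)
    have "(LINT x|M. p x * f x) = (LINT x|hausdorff1. p x * f x)"
      unfolding M_def e by (subst integral_density) (use borel_measurable_integrable[OF fi] in \<open>simp_all add: ind\<close>)
    also have "\<dots> = (LINT x|hausdorff1. c 1 x * d x + c 2 x * d x)"
      by (simp add: f_def c_def inner_vec_def sum_2 algebra_simps)
    also have "\<dots> = 0" using zero by simp
    finally show "(LINT x|M. p x * f x) = 0" .
  qed
  then have "AE x in hausdorff1. x \<in> ?F \<longrightarrow> f x = 0"
    unfolding M_def by (subst (asm) AE_density_indicator) auto
  then show ?thesis
  proof eventually_elim
    case (elim x)
    then show ?case using xn[of x] ab by (auto simp: f_def d_def split: if_splits)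
  qed
qed

section \<open>Weak derivatives of smooth functions\<close>

lemma DERIV_along:
  assumes "GDERIV f (g t) :> D" "(g has_vector_derivative v) (at t)"
  shows "((\<lambda>t. f (g t)) has_real_derivative v \<bullet> D) (at t)"
proof -
  have "((\<lambda>t. f (g t)) has_derivative (\<lambda>h. (h *\<^sub>R v) \<bullet> D)) (at t)"
    using assms unfolding gderiv_def has_vector_derivative_def by (rule has_derivative_compose[rotated])
  then show ?thesis by (simp add: has_field_derivative_def mult_commute_abs mult.commute)
qed

text \<open>The integral of \<open>\<psi> (x + t e)\<close> over the whole space does not depend on \<open>t\<close>, and its derivative
  with respect to \<open>t\<close> is the integral of the directional derivative.\<close>

lemma integral_partial_deriv_compact_support:
  fixes \<psi> :: "real^'n::finite \<Rightarrow> real"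
  assumes \<psi>: "C1_on UNIV \<psi>" and C: "compact C" "\<And>x. x \<notin> C \<Longrightarrow> \<psi> x = 0"
  shows "(LINT x|lborel. partial_deriv i \<psi> x) = 0"
proof -
  have d0: "partial_deriv i \<psi> x = 0" if "x \<notin> C" for x
    by (rule partial_deriv_zero[of "- C"]) (use that C in \<open>auto simp: compact_imp_closed open_Compl\<close>)
  note cont = C1_onD(3)[OF \<psi>] C1_onD(4)[OF \<psi>]
  define e :: "real^'n" where "e = axis i 1"
  obtain r where r: "0 < r" "C \<subseteq> cball 0 r"
    using compact_imp_bounded[OF C(1)] unfolding bounded_pos by (auto simp: subset_iff)
  obtain v where v: "cball 0 (r + 1) \<subseteq> cbox (- v) (v :: real^'n)"
    using bounded_subset_cbox_symmetric[OF bounded_cball] by blast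
  have off: "x + s *\<^sub>R e \<notin> C" if "x \<notin> cbox (- v) v" "\<bar>s\<bar> \<le> 1" for x s
  proof -
    have "r + 1 < norm x" using v that(1) by (force simp: not_le)
    moreover have "norm x \<le> norm (x + s *\<^sub>R e) + norm (s *\<^sub>R e)"
      using norm_triangle_ineq4[of "x + s *\<^sub>R e" "s *\<^sub>R e"] by simp
    ultimately show ?thesis using that(2) r(2) by (auto simp: e_def)
  qed
  have conv: "integral (cbox (- v) v) F = (LINT x|lborel. F x)"
    if F: "continuous_on UNIV F" "\<And>x. x \<notin> cbox (- v) v \<Longrightarrow> F x = 0" for F :: "real^'n \<Rightarrow> real"
  proof -
    have ind: "(\<lambda>x. indicator (cbox (- v) v) x *\<^sub>R F x) = F" by (rule ext) (use F(2) in \<open>auto simp: indicator_def\<close>)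
    have "set_integrable lborel (cbox (- v) v) F"
      unfolding set_integrable_def by (rule borel_integrable_compact[OF compact_cbox continuous_on_subset[OF F(1)]]) simp
    from set_borel_integral_eq_integral(2)[OF this] show ?thesis by (simp only: set_lebesgue_integral_def ind)
  qed
  have shift: "integral (cbox (- v) v) (\<lambda>x. \<psi> (x + s *\<^sub>R e)) = (LINT x|lborel. \<psi> x)" if "\<bar>s\<bar> \<le> 1" for s
  proof -
    have "integral (cbox (- v) v) (\<lambda>x. \<psi> (x + s *\<^sub>R e)) = (LINT x|lborel. \<psi> (s *\<^sub>R e + x))"
      using off[OF _ that] C(2) by (subst conv) (auto intro!: continuous_intros continuous_on_compose2[OF cont(1)] simp: add.commute)
    also have "\<dots> = (LINT x|distr lborel borel ((+) (s *\<^sub>R e)). \<psi> x)"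
      by (subst integral_distr) (auto simp: C1_on_measurable(1)[OF \<psi>])
    finally show ?thesis by (simp add: lborel_distr_plus)
  qed
  let ?I = "\<lambda>s. integral (cbox (- v) v) (\<lambda>x. \<psi> (x + s *\<^sub>R e))"
  have "(?I has_field_derivative integral (cbox (- v) v) (\<lambda>x. partial_deriv i \<psi> (x + 0 *\<^sub>R e))) (at 0 within {-1..1})"
  proof (rule leibniz_rule_field_derivative)
    show "((\<lambda>s. \<psi> (x + s *\<^sub>R e)) has_field_derivative partial_deriv i \<psi> (x + s *\<^sub>R e)) (at s within {-1..1})" for s x
    proof -
      have "((\<lambda>s. x + s *\<^sub>R e) has_vector_derivative e) (at s)"
        by (auto intro!: derivative_eq_intros simp: has_vector_derivative_def)
      from DERIV_along[OF C1_onD(1)[OF \<psi> UNIV_I] this]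
      have "((\<lambda>s. \<psi> (x + s *\<^sub>R e)) has_real_derivative partial_deriv i \<psi> (x + s *\<^sub>R e)) (at s)"
        by (simp add: e_def inner_axis')
      then show ?thesis by (rule DERIV_subset) simp
    qed
    show "(\<lambda>x. \<psi> (x + s *\<^sub>R e)) integrable_on cbox (- v) v" for s
      by (intro integrable_continuous continuous_on_compose2[OF cont(1)] continuous_intros) auto
    show "continuous_on ({-1..1} \<times> cbox (- v) v) (\<lambda>(s, x). partial_deriv i \<psi> (x + s *\<^sub>R e))"
      unfolding case_prod_unfold by (intro continuous_on_compose2[OF cont(2)] continuous_intros) auto
  qed auto
  moreover have "(?I has_field_derivative 0) (at 0 within {-1..1})"
    by (rule has_field_derivative_transform_within[where d = 1 and f = "\<lambda>_. LINT x|lborel. \<psi> x"])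
      (auto simp: shift abs_le_iff)
  moreover have "at (0::real) within {-1..1} = at 0" by (intro at_within_interior) auto
  ultimately have "integral (cbox (- v) v) (\<lambda>x. partial_deriv i \<psi> (x + 0 *\<^sub>R e)) = 0"
    using DERIV_unique by fastforce
  then show ?thesis using conv[OF cont(2)[of i]] off[of _ 0] d0 by simp
qed

lemma L1_loc_continuous:
  assumes "continuous_on \<Omega> f"
  shows "L1_loc \<Omega> (f :: real^'n::finite \<Rightarrow> real)"
  unfolding L1_loc_def
proof (intro allI impI)
  fix C assume C: "compact C \<and> C \<subseteq> \<Omega>"
  then have "integrable lborel (\<lambda>x. indicator C x *\<^sub>R f x)"
    using continuous_on_subset[OF assms] by (intro borel_integrable_compact) auto
  then show "f absolutely_integrable_on C"
    unfolding set_integrable_def by (intro integrable_completion[THEN iffD2]) auto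
qed

lemma L2_loc_continuous:
  assumes "open \<Omega>" "continuous_on \<Omega> f"
  shows "L2_loc \<Omega> (f :: real^'n::finite \<Rightarrow> real)"
  unfolding L2_loc_def
proof
  show "f \<in> borel_measurable (lebesgue_on \<Omega>)"
    using assms by (intro continuous_imp_measurable_on_sets_lebesgue sets_completionI_sets) auto
  have "continuous_on \<Omega> (\<lambda>x. (f x)\<^sup>2)" by (intro continuous_intros assms)
  from L1_loc_continuous[OF this]
  show "\<forall>C. compact C \<and> C \<subseteq> \<Omega> \<longrightarrow> (\<lambda>x. (f x)\<^sup>2) absolutely_integrable_on C" by (simp add: L1_loc_def)
qed

text \<open>The product of \<open>f\<close> with a test function, extended by zero, is continuously
  differentiable, and the integral of its derivative vanishes.\<close>

theorem weak_partial_C1: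
  fixes f :: "real^'n::finite \<Rightarrow> real"
  assumes \<Omega>: "open \<Omega>" and f: "C1_on \<Omega> f"
  shows "weak_partial \<Omega> i f (partial_deriv i f)"
  unfolding weak_partial_def
proof (intro conjI allI impI L1_loc_continuous C1_onD[OF f])
  fix \<phi> assume "test_function \<Omega> \<phi>"
  then obtain C where \<phi>: "C1_on UNIV \<phi>" and C: "compact C" "C \<subseteq> \<Omega>" "\<And>x. x \<notin> C \<Longrightarrow> \<phi> x = 0"
    by (auto simp: test_function_def)
  have oC: "open (- C)" using C(1) by (simp add: compact_imp_closed open_Compl)
  have d\<phi>: "partial_deriv i \<phi> x = 0" if "x \<notin> C" for x
    by (rule partial_deriv_zero[OF oC]) (use that C in auto)
  define \<psi> where "\<psi> x = (if x \<in> \<Omega> then f x * \<phi> x else 0)" for x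
  have prod: "C1_on \<Omega> (\<lambda>x. f x * \<phi> x)" by (intro C1_on_mult f C1_on_subset[OF \<phi>]) auto
  have "C1_on \<Omega> \<psi>" by (rule C1_on_cong[OF \<Omega> prod]) (simp add: \<psi>_def)
  moreover have "C1_on (- C) \<psi>" by (rule C1_on_zero[OF oC]) (auto simp: \<psi>_def C)
  ultimately have "C1_on (\<Omega> \<union> - C) \<psi>" by (intro C1_on_Un \<Omega> oC)
  moreover have "\<Omega> \<union> - C = UNIV" using C(2) by auto
  ultimately have \<psi>: "C1_on UNIV \<psi>" by simp
  have int0: "(LINT x|lborel. partial_deriv i \<psi> x) = 0"
    by (rule integral_partial_deriv_compact_support[OF \<psi> C(1)]) (auto simp: \<psi>_def C)
  have intC: "integrable lborel (\<lambda>x. indicator C x *\<^sub>R (f x * partial_deriv i \<phi> x))"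
    "integrable lborel (\<lambda>x. indicator C x *\<^sub>R (partial_deriv i f x * \<phi> x))"
  proof -
    have cc: "continuous_on C (\<lambda>x. f x * partial_deriv i \<phi> x)" "continuous_on C (\<lambda>x. partial_deriv i f x * \<phi> x)"
      using C1_onD(3,4)[OF C1_on_subset[OF f C(2)]] C1_onD(3,4)[OF C1_on_subset[OF \<phi> subset_UNIV]]
      by (intro continuous_on_mult; blast)+
    show "integrable lborel (\<lambda>x. indicator C x *\<^sub>R (f x * partial_deriv i \<phi> x))"
      "integrable lborel (\<lambda>x. indicator C x *\<^sub>R (partial_deriv i f x * \<phi> x))"
      using borel_integrable_compact[OF C(1) cc(1)] borel_integrable_compact[OF C(1) cc(2)] .
  qed
  have conv: "(LINT x:\<Omega>|lebesgue. g x) = (LINT x|lborel. indicator C x *\<^sub>R g x)"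
    if "integrable lborel (\<lambda>x. indicator C x *\<^sub>R g x)" "\<And>x. x \<notin> C \<Longrightarrow> g x = 0" for g :: "real^'n \<Rightarrow> real"
  proof -
    have "(\<lambda>x. indicator \<Omega> x *\<^sub>R g x) = (\<lambda>x. indicator C x *\<^sub>R g x)"
      using that(2) C(2) by (auto simp: fun_eq_iff indicator_def)
    then show ?thesis
      unfolding set_lebesgue_integral_def
      using borel_measurable_integrable[OF that(1)] by (simp add: integral_completion)
  qed
  have "partial_deriv i \<psi> x = indicator C x *\<^sub>R (f x * partial_deriv i \<phi> x) + indicator C x *\<^sub>R (partial_deriv i f x * \<phi> x)" for x
  proof (cases "x \<in> C")
    case True
    then have x: "x \<in> \<Omega>" using C by auto
    have "partial_deriv i \<psi> x = partial_deriv i (\<lambda>x. f x * \<phi> x) x"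
      by (rule partial_deriv_cong[OF C1_onD(1)[OF prod x] \<Omega> x]) (simp add: \<psi>_def)
    also have "\<dots> = f x * partial_deriv i \<phi> x + \<phi> x * partial_deriv i f x"
      by (rule partial_deriv_mult[OF f C1_on_subset[OF \<phi>] x]) auto
    finally show ?thesis using True by (simp add: mult.commute)
  next
    case False
    then have "partial_deriv i \<psi> x = 0"
      by (intro partial_deriv_zero[OF oC]) (auto simp: \<psi>_def C)
    then show ?thesis using False by simp
  qed
  then have "(LINT x|lborel. indicator C x *\<^sub>R (f x * partial_deriv i \<phi> x))
      + (LINT x|lborel. indicator C x *\<^sub>R (partial_deriv i f x * \<phi> x)) = 0"
    using int0 intC by simp
  then show "(LINT x:\<Omega>|lebesgue. f x * partial_deriv i \<phi> x) = - (LINT x:\<Omega>|lebesgue. partial_deriv i f x * \<phi> x)"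
    using conv[OF intC(1)] conv[OF intC(2)] d\<phi> C(3) by simp
qed

lemma W22_loc_C2:
  fixes u :: "real^'n::finite \<Rightarrow> real"
  assumes \<Omega>: "open \<Omega>" and u: "C1_on \<Omega> u" "\<And>i. C1_on \<Omega> (partial_deriv i u)"
  shows "u \<in> W22_loc \<Omega>"
  unfolding W22_loc_def
proof (intro CollectI conjI exI allI)
  show "L2_loc \<Omega> u" by (intro L2_loc_continuous \<Omega> C1_onD[OF u(1)])
  show "L2_loc \<Omega> (partial_deriv i u)" for i by (intro L2_loc_continuous \<Omega> C1_onD[OF u(1)])
  show "weak_partial \<Omega> i u (partial_deriv i u)" for i by (rule weak_partial_C1[OF \<Omega> u(1)])
  show "L2_loc \<Omega> (partial_deriv j (partial_deriv i u))" for i j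
    by (intro L2_loc_continuous \<Omega> C1_onD[OF u(2)])
  show "weak_partial \<Omega> j (partial_deriv i u) (partial_deriv j (partial_deriv i u))" for i j
    by (rule weak_partial_C1[OF \<Omega> u(2)])
qed

section \<open>Rigidity\<close>

lemma antiderivative_vanishing:
  fixes j :: "real \<Rightarrow> real"
  assumes j: "continuous_on UNIV j" "\<And>r. r \<le> a \<Longrightarrow> j r = 0"
  shows "\<exists>\<kappa>. (\<forall>r. (\<kappa> has_real_derivative j r) (at r)) \<and> (\<forall>r\<le>a. \<kappa> r = 0)"
proof (intro exI conjI allI impI)
  let ?\<kappa> = "\<lambda>r. integral {a - 1..r} j"
  show zero: "?\<kappa> r = 0" if "r \<le> a" for r
    using that j(2) integral_cong[of "{a - 1..r}" j "\<lambda>_. 0"] by simp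
  fix r
  show "(?\<kappa> has_real_derivative j r) (at r)"
  proof (cases "r < a")
    case True
    show ?thesis
      by (rule has_field_derivative_transform_within_open[where f = "\<lambda>_. 0" and S = "{..<a}"])
        (use True j(2) zero in auto)
  next
    case False
    have "(?\<kappa> has_real_derivative j r) (at r within {a - 1..r + 1})"
      by (rule integral_has_real_derivative[OF continuous_on_subset[OF j(1)]]) (use False in auto)
    moreover have "at r within {a - 1..r + 1} = at r" using False by (intro at_within_interior) auto
    ultimately show ?thesis by simp
  qed
qed

text \<open>The test functions vanish near the inner circle but are arbitrary on the outer one, so that the
  hypothesis includes a vanishing trace there. The angular field with \<open>\<kappa>\<close> an antiderivative of
  \<open>r * k r\<close>, starting at the inner circle, shows that \<open>z\<close> is orthogonal to all functions
  \<open>\<psi>(x / |x|) k(|x|)\<close>. A linear factor \<open>h x = |x| h(x / |x|)\<close> can be absorbed into \<open>\<psi>\<close>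
  and \<open>k\<close>, so \<open>z\<close> is orthogonal to \<open>p(x) k(|x|)\<close> for every polynomial \<open>p\<close>.\<close>

theorem AE_zero_of_zero_gradient:
  fixes z :: "real^2 \<Rightarrow> real"
  assumes ab: "0 < a" "a < b" and z: "integrable lborel z" "\<And>x. x \<notin> annulus a b \<Longrightarrow> z x = 0"
    and grad: "\<And>\<psi> i e. C1_on UNIV \<psi> \<Longrightarrow> 0 < e \<Longrightarrow> (\<And>x. norm x \<le> a + e \<Longrightarrow> \<psi> x = 0)
      \<Longrightarrow> (LINT x|lborel. partial_deriv i \<psi> x * z x) = 0"
  shows "AE x in lebesgue. z x = 0"
proof -
  let ?W = "annulus a b"
  have z0: "AE x in lborel. x \<notin> ?W \<longrightarrow> z x = 0" using z(2) by auto
  have bint: "integrable lborel (\<lambda>x. f x * z x)" if "f \<in> borel_measurable borel" "\<And>x. x \<in> ?W \<Longrightarrow> \<bar>f x\<bar> \<le> B" for f B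
    by (rule integrable_bounded_mult[OF sets_lborel z(1) z0 that])
  have cbound: "\<exists>B. \<forall>x\<in>?W. \<bar>f x\<bar> \<le> B" if "continuous_on UNIV f" for f :: "real^2 \<Rightarrow> real"
  proof -
    note c = that
    obtain B where "\<forall>x\<in>cball 0 b. \<bar>f x\<bar> \<le> B"
      using continuous_on_compact_bound[OF compact_cball continuous_on_subset[OF c subset_UNIV]] by blast
    then show ?thesis by (intro exI[of _ B]) (simp add: annulus_def)
  qed
  \<comment> \<open>weights that vanish near the inner circle\<close>
  define ok where "ok k \<longleftrightarrow> continuous_on UNIV k \<and> (\<exists>e>0. \<forall>r\<le>a + e. k r = 0)" for k :: "real \<Rightarrow> real"
  have base: "(LINT x|lborel. \<psi> (sgn x) * k (norm x) * z x) = 0" if \<psi>: "real_polynomial_function \<psi>" and k: "ok k" for \<psi> k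
  proof -
    obtain e where e: "0 < e" "\<And>r. r \<le> a + e \<Longrightarrow> k r = 0" and kc: "continuous_on UNIV k"
      using k by (auto simp: ok_def)
    have jc: "continuous_on UNIV (\<lambda>r. r * k r)" by (intro continuous_intros kc)
    obtain \<kappa> where \<kappa>: "\<And>r. (\<kappa> has_real_derivative r * k r) (at r)" "\<And>r. r \<le> a + e \<Longrightarrow> \<kappa> r = 0"
      using antiderivative_vanishing[OF jc, of "a + e"] e(2) by auto
    have ae: "0 < a + e" using ab e by simp
    define \<Phi> where "\<Phi> i = angular_field \<psi> \<kappa> i" for i
    have C1: "C1_on UNIV (\<Phi> i)" for i
      unfolding \<Phi>_def by (rule C1_on_angular_field[OF \<psi> \<kappa>(1) jc ae \<kappa>(2)])
    have dint: "integrable lborel (\<lambda>x. partial_deriv i (\<Phi> i) x * z x)" for i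
      using cbound[OF C1_onD(4)[OF C1[of i], of i]] bint[OF C1_on_measurable(2)[OF C1[of i], of i]]
      by blast
    have "\<psi> (sgn x) * k (norm x) * z x = (\<Sum>i\<in>UNIV. partial_deriv i (\<Phi> i) x * z x)" for x
    proof (cases "x = 0")
      case True
      then show ?thesis using z(2)[of x] ab by (simp add: annulus_def)
    next
      case False
      have "(\<Sum>i\<in>UNIV. partial_deriv i (\<Phi> i) x) = \<psi> (sgn x) * (norm x * k (norm x)) / norm x"
        unfolding \<Phi>_def by (rule divergence_angular_field[OF \<psi> \<kappa>(1) jc ae \<kappa>(2) False])
      then show ?thesis unfolding sum_distrib_right[symmetric] using False by simp
    qed
    then have "(LINT x|lborel. \<psi> (sgn x) * k (norm x) * z x) = (LINT x|lborel. (\<Sum>i\<in>UNIV. partial_deriv i (\<Phi> i) x * z x))"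
      by simp
    also have "\<dots> = (\<Sum>i\<in>UNIV. (LINT x|lborel. partial_deriv i (\<Phi> i) x * z x))"
      by (intro Bochner_Integration.integral_sum dint)
    also have "\<dots> = 0"
      by (intro sum.neutral ballI grad[OF C1 e(1)]) (simp add: \<Phi>_def angular_field_def \<kappa>(2))
    finally show ?thesis .
  qed
  have int: "integrable lborel (\<lambda>x. f x * (\<psi> (sgn x) * k (norm x)) * z x)"
    if f: "continuous_on UNIV f" and \<psi>: "real_polynomial_function \<psi>" and k: "continuous_on UNIV k" for f \<psi> k
  proof -
    have \<psi>c: "continuous_on (- {0}) (\<lambda>x. \<psi> (sgn x))" by (rule C1_onD(3)[OF C1_on_sgn_polynomial[OF \<psi>]])
    have c: "continuous_on (- {0}) (\<lambda>x. f x * (\<psi> (sgn x) * k (norm x)))"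
      by (intro continuous_intros continuous_on_subset[OF f] \<psi>c continuous_on_compose2[OF k]) auto
    have "compact (cball 0 b - ball (0::real^2) a)" by (intro compact_diff) auto
    moreover have "cball 0 b - ball (0::real^2) a \<subseteq> - {0}" using ab by auto
    ultimately obtain B where B: "\<forall>x\<in>cball 0 b - ball 0 a. \<bar>f x * (\<psi> (sgn x) * k (norm x))\<bar> \<le> B"
      using continuous_on_compact_bound[OF _ continuous_on_subset[OF c]] by blast
    have m: "\<psi> \<in> borel_measurable borel" "f \<in> borel_measurable borel" "k \<in> borel_measurable borel"
      by (intro borel_measurable_continuous_onI C1_onD(3)[OF C1_on_real_polynomial_function[OF \<psi>]] f k)+
    show ?thesis
      by (rule bint[where B = B]) (use m B in \<open>auto simp: annulus_def not_less\<close>)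
  qed
  \<comment> \<open>The factors that preserve orthogonality of \<open>z\<close> to all functions \<open>\<psi>(x / |x|) k(|x|)\<close>. They are closed under multiplication with polynomials.\<close>
  define Q where "Q f \<longleftrightarrow> continuous_on UNIV f \<and> (\<forall>\<psi> k. real_polynomial_function \<psi> \<longrightarrow> ok k \<longrightarrow>
    (LINT x|lborel. f x * (\<psi> (sgn x) * k (norm x)) * z x) = 0)" for f
  have Q1: "Q (\<lambda>_. 1)" using base by (simp add: Q_def)
  have mult: "Q (\<lambda>x. p x * f x)" if "real_polynomial_function p" "Q f" for p f
    using that
  proof (induction arbitrary: f rule: real_polynomial_function.induct)
    case (linear h)
    have h: "h x = h (sgn x) * norm x" for x
      using linear(1) by (cases "x = 0")
        (simp_all add: sgn_div_norm linear_cmul bounded_linear.linear linear_0 mult.commute)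
    show ?case
      unfolding Q_def
    proof (intro conjI allI impI)
      show "continuous_on UNIV (\<lambda>x. h x * f x)"
        using linear(2) by (intro continuous_on_mult linear_continuous_on[OF linear(1)]) (simp add: Q_def)
      fix \<psi> :: "real^2 \<Rightarrow> real" and k
      assume \<psi>: "real_polynomial_function \<psi>" and k: "ok k"
      have "real_polynomial_function (\<lambda>x. h x * \<psi> x)" using linear(1) \<psi>
        by (intro real_polynomial_function.intros(4)) (auto intro: real_polynomial_function.intros(1))
      moreover have "ok (\<lambda>r. r * k r)" using k by (auto simp: ok_def intro!: continuous_intros)
      ultimately have "(LINT x|lborel. f x * ((h (sgn x) * \<psi> (sgn x)) * (norm x * k (norm x))) * z x) = 0"
        using linear(2) unfolding Q_def by blast
      moreover have "f x * ((h (sgn x) * \<psi> (sgn x)) * (norm x * k (norm x))) * z x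
          = h x * f x * (\<psi> (sgn x) * k (norm x)) * z x" for x
        unfolding h[of x] by (simp add: mult_ac)
      ultimately show "(LINT x|lborel. h x * f x * (\<psi> (sgn x) * k (norm x)) * z x) = 0" by simp
    qed
  next
    case (const c)
    then show ?case by (auto simp: Q_def mult.assoc intro!: continuous_intros)
  next
    case (add p q)
    have "Q (\<lambda>x. p x * f x)" "Q (\<lambda>x. q x * f x)" using add.IH add.prems by blast+
    then have c: "continuous_on UNIV (\<lambda>x. p x * f x)" "continuous_on UNIV (\<lambda>x. q x * f x)"
      and 0: "\<And>\<psi> k. real_polynomial_function \<psi> \<Longrightarrow> ok k \<Longrightarrow>
        (LINT x|lborel. p x * f x * (\<psi> (sgn x) * k (norm x)) * z x) = 0 \<and>
        (LINT x|lborel. q x * f x * (\<psi> (sgn x) * k (norm x)) * z x) = 0"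
      unfolding Q_def by blast+
    show ?case
      unfolding Q_def distrib_right
    proof (intro conjI allI impI continuous_on_add c)
      fix \<psi> :: "real^2 \<Rightarrow> real" and k
      assume \<psi>: "real_polynomial_function \<psi>" and k: "ok k"
      then have "continuous_on UNIV k" by (simp add: ok_def)
      from int[OF c(1) \<psi> this] int[OF c(2) \<psi> this] 0[OF \<psi> k]
      show "(LINT x|lborel. p x * f x * (\<psi> (sgn x) * k (norm x)) * z x
          + q x * f x * (\<psi> (sgn x) * k (norm x)) * z x) = 0" by simp
    qed
  next
    case (mult p q)
    then show ?case using mult.IH(1)[OF mult.IH(2)[OF mult.prems]] by (simp add: mult.assoc)
  qed
  have zm [measurable]: "z \<in> borel_measurable borel" using borel_measurable_integrable[OF z(1)] by simp
  let ?M = "density lborel (indicator ?W)"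
  have ind: "ennreal (indicator ?W x) = indicator ?W x" "indicator ?W x * z x = z x" for x
    using z(2)[of x] by (auto simp: indicator_def)
  have "AE x in ?M. z x = 0"
  proof (rule AE_zero_polynomial_dual[where C = "cball 0 b"])
    show "integrable ?M z" unfolding ind(1)[symmetric] by (subst integrable_density) (auto simp: ind z(1))
    show "AE x in ?M. x \<in> cball 0 b" by (subst AE_density_indicator) (auto simp: annulus_def)
    fix p :: "real^2 \<Rightarrow> real" assume p: "real_polynomial_function p"
    have pc: "continuous_on UNIV p" by (rule C1_onD(3)[OF C1_on_real_polynomial_function[OF p]])
    have [measurable]: "p \<in> borel_measurable borel" by (rule borel_measurable_continuous_onI[OF pc])
    obtain B where B: "\<And>x. x \<in> ?W \<Longrightarrow> \<bar>p x\<bar> \<le> B" using cbound[OF pc] by blast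
    have zero: "(LINT x|lborel. (p x * inner_cutoff a b n (norm x)) * z x) = 0" for n
    proof -
      have "ok (inner_cutoff a b n)"
        using inner_cutoff_eq_0[OF ab(2), of _ n] cutoff_scale_pos[OF ab(2), of n]
        by (auto simp: ok_def intro!: continuous_intros exI[of _ "1 / cutoff_scale a b n"])
      from mult[OF p Q1, unfolded Q_def, THEN conjunct2, rule_format, OF real_polynomial_function.intros(2)[of 1] this]
      show ?thesis by simp
    qed
    have "(\<lambda>n. LINT x|lborel. (p x * inner_cutoff a b n (norm x)) * z x) \<longlonglongrightarrow> (LINT x|lborel. p x * z x)"
    proof (rule integral_bounded_mult_tendsto[OF sets_lborel z(1) z0])
      show "\<bar>p x * inner_cutoff a b n (norm x)\<bar> \<le> B" if "x \<in> ?W" for n x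
        using mult_mono[OF B[OF that] cutoff_bounds(2)[of a b n "norm x"]] cutoff_bounds(1)[of a b n "norm x"] B[OF that]
        by (simp add: abs_mult)
      show "(\<lambda>n. p x * inner_cutoff a b n (norm x)) \<longlonglongrightarrow> p x" if "x \<in> ?W" for x
        using tendsto_mult[OF tendsto_const cutoff_tendsto_1(1), of a "norm x" b "p x"] that by (simp add: annulus_def)
    qed measurable
    then have "(LINT x|lborel. p x * z x) = 0" by (simp add: zero LIMSEQ_const_iff)
    then show "(LINT x|?M. p x * z x) = 0"
      unfolding ind(1)[symmetric] by (subst integral_density) (auto simp: mult.left_commute[of _ "p _"] ind)
  qed auto
  then have "AE x in lborel. x \<in> ?W \<longrightarrow> z x = 0" by (subst (asm) AE_density_indicator) auto
  then have "AE x in lborel. z x = 0" using z0 by eventually_elim blast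
  then show ?thesis by (rule AE_completion)
qed

section \<open>Traces of radial functions\<close>

lemma integral_kernel:
  assumes ab: "a < b"
  shows "integrable lborel (\<lambda>r. indicator {a<..<b} r * inner_kernel a b n r)"
    "(LINT r|lborel. indicator {a<..<b} r * inner_kernel a b n r) = 1"
    "integrable lborel (\<lambda>r. indicator {a<..<b} r * outer_kernel a b n r)"
    "(LINT r|lborel. indicator {a<..<b} r * outer_kernel a b n r) = 1"
proof -
  have s: "0 < cutoff_scale a b n" "2 / cutoff_scale a b n \<le> (b - a) / 2"
    using cutoff_scale_pos[OF ab] cutoff_scale_ge[OF ab] by auto
  have p: "0 < 1 / cutoff_scale a b n" using s by simp
  have op: "indicator {a<..<b} r * k r = indicator {a..b} r *\<^sub>R k r" if "k a = 0" "k b = 0" for k :: "real \<Rightarrow> real" and r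
    using that by (auto simp: indicator_def less_le)
  have z: "inner_kernel a b n a = 0" "inner_kernel a b n b = 0" "outer_kernel a b n a = 0" "outer_kernel a b n b = 0"
    using s p ab by (auto intro!: inner_kernel_eq_0 outer_kernel_eq_0) (argo+)?
  have v: "inner_cutoff a b n a = 0" "inner_cutoff a b n b = 1" "outer_cutoff a b n a = 1" "outer_cutoff a b n b = 0"
    using s p ab by (auto intro!: inner_cutoff_eq_0 outer_cutoff_eq_0 inner_cutoff_eq_1 outer_cutoff_eq_1) (argo+)?
  have "has_bochner_integral lborel (\<lambda>r. indicator {a..b} r *\<^sub>R inner_kernel a b n r) (inner_cutoff a b n b - inner_cutoff a b n a)"
    by (rule has_bochner_integral_FTC_Icc)
      (use ab in \<open>auto intro!: continuous_intros DERIV_inner_cutoff[THEN DERIV_subset, THEN has_real_derivative_iff_has_vector_derivative[THEN iffD1]]\<close>)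
  then show "integrable lborel (\<lambda>r. indicator {a<..<b} r * inner_kernel a b n r)"
    "(LINT r|lborel. indicator {a<..<b} r * inner_kernel a b n r) = 1"
    unfolding op[OF z(1,2)] v by (auto simp: has_bochner_integral_iff)
  have "((\<lambda>r. - outer_cutoff a b n r) has_real_derivative outer_kernel a b n r) (at r)" for r
    using DERIV_minus[OF DERIV_outer_cutoff] by simp
  then have "has_bochner_integral lborel (\<lambda>r. indicator {a..b} r *\<^sub>R outer_kernel a b n r) (- outer_cutoff a b n b - - outer_cutoff a b n a)"
    by (intro has_bochner_integral_FTC_Icc)
      (use ab in \<open>auto intro!: continuous_intros DERIV_subset[THEN has_real_derivative_iff_has_vector_derivative[THEN iffD1]]\<close>)
  then show "integrable lborel (\<lambda>r. indicator {a<..<b} r * outer_kernel a b n r)"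
    "(LINT r|lborel. indicator {a<..<b} r * outer_kernel a b n r) = 1"
    unfolding op[OF z(3,4)] v by (auto simp: has_bochner_integral_iff)
qed

text \<open>For a radial function the average along every ray is the mean value of \<open>U\<close> with respect to the
  kernel, which concentrates at \<open>R\<close>.\<close>

lemma radial_average_radial_limit:
  fixes U :: "real \<Rightarrow> real"
  assumes ab: "0 < a" "a < b" and U: "continuous_on {a..b} U"
    and k: "\<And>n. k n \<in> borel_measurable borel" "\<And>n r. 0 \<le> k n r"
      "\<And>n. integrable lborel (\<lambda>r. indicator {a<..<b} r * k n r)" "\<And>n. (LINT r|lborel. indicator {a<..<b} r * k n r) = 1"
      "\<And>n r. k n r \<noteq> 0 \<Longrightarrow> \<bar>r - R\<bar> \<le> s n"
    and s: "s \<longlonglongrightarrow> 0" and R: "R \<in> {a..b}"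
  shows "(\<lambda>n. LINT x|circle_measure. \<bar>radial_average a b (\<lambda>x. indicator (annulus a b) x * U (norm x)) (k n) x - U R\<bar>) \<longlonglongrightarrow> 0"
proof -
  define V where "V r = indicator {a..b} r * U r" for r
  define g where "g n r = indicator {a<..<b} r * k n r" for n r
  define c where "c n = (LINT r|lborel. V r * g n r)" for n
  have Vm [measurable]: "V \<in> borel_measurable borel"
    using borel_measurable_continuous_on_indicator[OF _ U] by (simp add: V_def[abs_def])
  note [measurable] = k(1)
  have g: "integrable lborel (g n)" "(LINT r|lborel. g n r) = 1" "(LINT r|lborel. \<bar>g n r\<bar>) = 1" for n
    using k(2-4)[of n] by (simp_all add: g_def[abs_def] abs_mult)
  obtain M where M: "\<And>r. r \<in> {a..b} \<Longrightarrow> \<bar>U r\<bar> \<le> M"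
    using continuous_on_compact_bound[OF compact_Icc U] by blast
  have Vg: "integrable lborel (\<lambda>r. V r * g n r)" for n
    by (rule integrable_bounded_mult[OF sets_lborel g(1) _ Vm, of "{a..b}" _ M]) (use M in \<open>auto simp: V_def g_def\<close>)
  have avg: "AE x in circle_measure. radial_average a b (\<lambda>x. indicator (annulus a b) x * U (norm x)) (k n) x = c n" for n
    using AE_circle_measure
  proof eventually_elim
    case (elim x)
    show ?case
      unfolding radial_average_def c_def
      by (intro Bochner_Integration.integral_cong) (use elim ab in \<open>auto simp: V_def g_def annulus_def indicator_def\<close>)
  qed
  have "c \<longlonglongrightarrow> U R"
  proof (rule LIMSEQ_I)
    fix e :: real assume e: "0 < e"
    have "\<exists>d>0. \<forall>r\<in>{a..b}. dist r R < d \<longrightarrow> dist (U r) (U R) < e / 2"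
      using U R e unfolding continuous_on_iff by (meson half_gt_zero)
    then obtain d where d: "0 < d" "\<And>r. r \<in> {a..b} \<Longrightarrow> dist r R < d \<Longrightarrow> dist (U r) (U R) < e / 2" by blast
    have "\<forall>\<^sub>F n in sequentially. s n < d" by (rule order_tendstoD(2)[OF s d(1)])
    then obtain N where N: "\<And>n. N \<le> n \<Longrightarrow> s n < d" by (auto simp: eventually_sequentially)
    have "norm (c n - U R) < e" if "N \<le> n" for n
    proof -
      have "c n - U R = (LINT r|lborel. (V r - U R) * g n r)"
        using Vg[of n] g[of n] by (simp add: c_def left_diff_distrib)
      also have "\<bar>\<dots>\<bar> \<le> (LINT r|lborel. \<bar>g n r\<bar>) * (e / 2)"
      proof (rule integral_bounded_mult_le[OF sets_lborel g(1), of "{r. g n r \<noteq> 0}"])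
        fix r assume "r \<in> {r. g n r \<noteq> 0}"
        then have r: "r \<in> {a<..<b}" "k n r \<noteq> 0" by (auto simp: g_def indicator_def split: if_splits)
        then have "dist r R < d" using k(5)[of n r] N[OF that] by (simp add: dist_real_def)
        then show "\<bar>V r - U R\<bar> \<le> e / 2" using d(2)[of r] r(1) by (simp add: V_def dist_real_def)
      qed auto
      finally show ?thesis using g(3)[of n] e by simp
    qed
    then show "\<exists>N. \<forall>n\<ge>N. norm (c n - U R) < e" by blast
  qed
  then have "(\<lambda>n. \<bar>c n - U R\<bar>) \<longlonglongrightarrow> \<bar>U R - U R\<bar>" by (intro tendsto_intros)
  then have "(\<lambda>n. measure circle_measure UNIV * \<bar>c n - U R\<bar>) \<longlonglongrightarrow> measure circle_measure UNIV * 0"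
    by (intro tendsto_intros) simp
  moreover have "(LINT x|circle_measure. \<bar>radial_average a b (\<lambda>x. indicator (annulus a b) x * U (norm x)) (k n) x - U R\<bar>)
      = measure circle_measure UNIV * \<bar>c n - U R\<bar>" for n
  proof -
    have "(LINT x|circle_measure. \<bar>radial_average a b (\<lambda>x. indicator (annulus a b) x * U (norm x)) (k n) x - U R\<bar>)
        = (LINT x|circle_measure. \<bar>c n - U R\<bar>)"
    proof (rule integral_cong_AE)
      have eqv: "(\<lambda>x. indicator (annulus a b) x * U (norm x)) = (\<lambda>x. indicator (annulus a b) x * V (norm x))"
        by (auto simp: V_def indicator_def annulus_def fun_eq_iff)
      show "(\<lambda>x. \<bar>radial_average a b (\<lambda>x. indicator (annulus a b) x * U (norm x)) (k n) x - U R\<bar>) \<in> borel_measurable circle_measure"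
        unfolding eqv radial_average_def by measurable
      show "AE x in circle_measure. \<bar>radial_average a b (\<lambda>x. indicator (annulus a b) x * U (norm x)) (k n) x - U R\<bar> = \<bar>c n - U R\<bar>"
        using avg[of n] by eventually_elim simp
    qed simp
    also have "\<dots> = measure circle_measure UNIV * \<bar>c n - U R\<bar>" by simp
    finally show ?thesis .
  qed
  ultimately show ?thesis by simp
qed

section \<open>The one-dimensional problem\<close>

text \<open>The extension of \<open>f\<close> to the line that is even for \<open>c = 1\<close> and odd for \<open>c = - 1\<close>. The
  hypotheses on \<open>c\<close> make the one-sided values and derivatives at 0 fit.\<close>

lemma DERIV_reflection:
  fixes f f' :: "real \<Rightarrow> real"
  assumes f: "\<And>t. 0 \<le> t \<Longrightarrow> (f has_real_derivative f' t) (at t within {0..})"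
    and c: "c * f 0 = f 0" "- c * f' 0 = f' 0"
  shows "((\<lambda>t. if 0 \<le> t then f t else c * f (- t)) has_real_derivative
    (if 0 \<le> t then f' t else - c * f' (- t))) (at t)"
proof -
  let ?F = "\<lambda>t. if 0 \<le> t then f t else c * f (- t)"
  have pos: "(?F has_real_derivative f' t) (at t within {0..})" if "0 \<le> t" for t
    by (rule has_field_derivative_transform_within[where d = 1]) (use f[OF that] that in auto)
  have neg: "(?F has_real_derivative - c * f' (- t)) (at t within {..0})" if "t \<le> 0" for t
  proof -
    have "((\<lambda>t. f (- t)) has_real_derivative f' (- t) * (- 1)) (at t within {..0})"
    proof -
      have "(f has_real_derivative f' (- t)) (at (- t) within uminus ` {..0})" using f[of "- t"] that by simp
      moreover have "(uminus has_real_derivative - 1) (at t within {..0})" by (auto intro!: derivative_eq_intros)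
      ultimately have "(f \<circ> uminus has_real_derivative f' (- t) * (- 1)) (at t within {..0})"
        by (rule DERIV_image_chain)
      then show ?thesis by (simp add: o_def)
    qed
    then have "((\<lambda>t. c * f (- t)) has_real_derivative - c * f' (- t)) (at t within {..0})"
      using DERIV_cmult[of "\<lambda>t. f (- t)" "f' (- t) * (- 1)" t "{..0}" c] by simp
    then show ?thesis
      by (rule has_field_derivative_transform_within[where d = 1]) (use that c in auto)
  qed
  consider "0 < t" | "t < 0" | "t = 0" by linarith
  then show ?thesis
  proof cases
    case 1
    then have "(at t within {0..}) = at t" by (intro at_within_interior) auto
    then show ?thesis using pos[of t] 1 by simp
  next
    case 2
    then have "(at t within {..0}) = at t" by (intro at_within_interior) auto
    then show ?thesis using neg[of t] 2 by simp
  next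
    case 3
    have "(?F has_real_derivative f' 0) (at 0 within {0..})" "(?F has_real_derivative f' 0) (at 0 within {..0})"
      using pos[of 0] neg[of 0] c(2) by auto
    then have "(?F has_real_derivative f' 0) (at 0)"
      unfolding has_field_derivative_iff by (rule Lim_Un_univ) auto
    then show ?thesis using 3 by simp
  qed
qed

lemma integrable_iff_spike:
  fixes f g :: "real \<Rightarrow> real"
  assumes "negligible S" "\<And>x. x \<in> T - S \<Longrightarrow> g x = f x"
  shows "g integrable_on T \<longleftrightarrow> f integrable_on T"
  using integrable_spike[of f T S g] integrable_spike[of g T S f] assms by auto

locale linear_growth =
  fixes g g' g'' :: "real \<Rightarrow> real"
  assumes g_nonneg: "\<And>t. 0 \<le> t \<Longrightarrow> 0 \<le> g t"
    and g_deriv: "\<And>t. 0 \<le> t \<Longrightarrow> (g has_real_derivative g' t) (at t within {0..})"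
      "\<And>t. 0 \<le> t \<Longrightarrow> (g' has_real_derivative g'' t) (at t within {0..})"
    and g''_cont: "continuous_on {0..} g''"
    and growth: "\<exists>A B. \<forall>t\<ge>0. g t \<le> A * t + B"
    and g_0: "g 0 = 0" "g' 0 = 0"
    and g''_pos: "\<And>t. 0 \<le> t \<Longrightarrow> 0 < g'' t"
begin

text \<open>The odd extension of \<open>g'\<close>, which is the derivative of \<open>g |t|\<close>. It treats slopes of both signs at
  once.\<close>

definition G :: "real \<Rightarrow> real" where
  "G t = (if 0 \<le> t then g' t else - 1 * g' (- t))"

lemma DERIV_G: "(G has_real_derivative g'' \<bar>t\<bar>) (at t)"
proof -
  have "(G has_real_derivative (if 0 \<le> t then g'' t else - (- 1) * g'' (- t))) (at t)"
    unfolding G_def[abs_def] by (rule DERIV_reflection[OF g_deriv(2)]) (simp_all add: g_0)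
  then show ?thesis by (auto simp: abs_if split: if_splits)
qed

lemma DERIV_g_abs: "((\<lambda>t. g \<bar>t\<bar>) has_real_derivative G t) (at t)"
proof -
  have "((\<lambda>t. if 0 \<le> t then g t else 1 * g (- t)) has_real_derivative
      (if 0 \<le> t then g' t else - 1 * g' (- t))) (at t)"
    by (rule DERIV_reflection[OF g_deriv(1)]) (simp_all add: g_0)
  moreover have "(\<lambda>t. if 0 \<le> t then g t else 1 * g (- t)) = (\<lambda>t. g \<bar>t\<bar>)" by (auto simp: fun_eq_iff)
  ultimately show ?thesis by (simp add: G_def)
qed

lemma G_strict_mono: "s < t \<Longrightarrow> G s < G t"
  by (rule DERIV_pos_imp_increasing[of s t]) (use DERIV_G g''_pos in \<open>auto intro!: exI\<close>)

lemma G_less_iff [simp]: "G s < G t \<longleftrightarrow> s < t"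
  using G_strict_mono[of s t] G_strict_mono[of t s] by (cases s t rule: linorder_cases) auto

lemma G_le_iff [simp]: "G s \<le> G t \<longleftrightarrow> s \<le> t"
  using G_less_iff[of t s] by linarith

lemma G_eq_iff [simp]: "G s = G t \<longleftrightarrow> s = t"
  using G_le_iff[of s t] G_le_iff[of t s] by linarith

lemma G_0 [simp]: "G 0 = 0" by (simp add: G_def g_0)

lemma G_minus [simp]: "G (- t) = - G t" by (auto simp: G_def g_0)

lemma isCont_G: "isCont G t" by (rule DERIV_isCont[OF DERIV_G])

lemma g_abs_tangent_strict:
  assumes "p \<noteq> t"
  shows "g \<bar>t\<bar> + G t * (p - t) < g \<bar>p\<bar>"
proof (cases "t < p")
  case True
  obtain z where z: "t < z" "z < p" "g \<bar>p\<bar> - g \<bar>t\<bar> = (p - t) * G z"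
    using MVT2[OF True, of "\<lambda>t. g \<bar>t\<bar>" G] DERIV_g_abs by blast
  have "(p - t) * G t < (p - t) * G z" using z True by (intro mult_strict_left_mono) auto
  then show ?thesis using z(3) unfolding mult.commute[of "G t"] by linarith
next
  case False
  then have lt: "p < t" using assms by simp
  obtain z where z: "p < z" "z < t" "g \<bar>t\<bar> - g \<bar>p\<bar> = (t - p) * G z"
    using MVT2[OF lt, of "\<lambda>t. g \<bar>t\<bar>" G] DERIV_g_abs by blast
  have "(t - p) * G z < (t - p) * G t" using z lt by (intro mult_strict_left_mono) auto
  then show ?thesis using z(3) unfolding mult.commute[of "G t"] left_diff_distrib by linarith
qed

lemma g_abs_tangent: "g \<bar>t\<bar> + G t * (p - t) \<le> g \<bar>p\<bar>"
  using g_abs_tangent_strict[of p t] by (cases "p = t") auto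

lemma G_nonneg: "0 \<le> t \<Longrightarrow> 0 \<le> G t"
  using G_le_iff[of 0 t] by simp

lemma g_strict_mono:
  assumes "0 \<le> s" "s < t"
  shows "g s < g t"
proof -
  have "0 \<le> G s * (t - s)" using assms by (intro mult_nonneg_nonneg G_nonneg) auto
  moreover have "g s + G s * (t - s) < g t" using g_abs_tangent_strict[of t s] assms by simp
  ultimately show ?thesis by linarith
qed

text \<open>The tangents of \<open>g\<close> stay below its linear upper bound.\<close>

lemma G_bdd: "bdd_above (range G)"
proof -
  obtain A B where AB: "\<And>t. 0 \<le> t \<Longrightarrow> g t \<le> A * t + B" using growth by blast
  have "G s \<le> A" for s
  proof (rule ccontr)
    assume "\<not> ?thesis"
    then have gt: "0 < G s - A" by simp
    define t where "t = max 0 ((B - g \<bar>s\<bar> + G s * s) / (G s - A) + 1)"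
    have "g \<bar>s\<bar> + G s * (t - s) \<le> A * t + B"
      using g_abs_tangent[of s t] AB[of t] by (simp add: t_def)
    then have "(G s - A) * t \<le> B - g \<bar>s\<bar> + G s * s" by (simp add: algebra_simps)
    moreover have "B - g \<bar>s\<bar> + G s * s < (G s - A) * ((B - g \<bar>s\<bar> + G s * s) / (G s - A) + 1)"
    proof -
      define d X where "d = G s - A" and "X = B - g \<bar>s\<bar> + G s * s"
      have "d * (X / d + 1) = X + d" using gt by (simp add: d_def[symmetric] distrib_left)
      then have "X < d * (X / d + 1)" using gt by (simp add: d_def)
      then show ?thesis by (simp add: d_def X_def)
    qed
    moreover have "(G s - A) * ((B - g \<bar>s\<bar> + G s * s) / (G s - A) + 1) \<le> (G s - A) * t"
      using gt by (intro mult_left_mono) (auto simp: t_def)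
    ultimately show False by linarith
  qed
  then show ?thesis by (intro bdd_aboveI[of _ A]) auto
qed

definition ginf :: real where "ginf = (SUP t. G t)"

lemma G_less_ginf: "G t < ginf"
proof -
  have "G t < G (t + 1)" by simp
  also have "\<dots> \<le> ginf" unfolding ginf_def by (rule cSUP_upper[OF UNIV_I G_bdd])
  finally show ?thesis .
qed

lemma abs_G_less_ginf: "\<bar>G t\<bar> < ginf"
  using G_less_ginf[of t] G_less_ginf[of "- t"] by (simp add: abs_less_iff)

lemma ginf_pos: "0 < ginf" using G_less_ginf[of 0] by simp

lemma G_approx:
  assumes "s < ginf"
  obtains t where "0 < t" "s < G t"
proof -
  obtain t where "s < G t" using assms unfolding ginf_def less_cSUP_iff[OF UNIV_not_empty G_bdd] by auto
  moreover have "G t \<le> G (\<bar>t\<bar> + 1)" by simp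
  ultimately show ?thesis using that[of "\<bar>t\<bar> + 1"] by linarith
qed

lemma g_le_ginf: "0 \<le> t \<Longrightarrow> g t \<le> ginf * t"
  using g_abs_tangent[of t 0] G_less_ginf[of t] mult_right_mono[of "G t" ginf t] g_0 by (simp add: algebra_simps)

lemma recession_slope_eq: "recession_slope g = ginf"
proof -
  have "((\<lambda>t. g t / t) \<longlongrightarrow> ginf) at_top"
  proof (rule order_tendstoI)
    fix l assume "l < ginf"
    then obtain s where s: "0 < s" "l < G s" by (rule G_approx)
    have "((\<lambda>t. (g s - G s * s) / t + G s) \<longlongrightarrow> 0 + G s) at_top"
      by (intro tendsto_intros tendsto_divide_0[OF tendsto_const] filterlim_at_top_imp_at_infinity filterlim_ident)
    then have "\<forall>\<^sub>F t in at_top. l < (g s - G s * s) / t + G s"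
      using s(2) by (intro order_tendstoD(1)) auto
    moreover have "\<forall>\<^sub>F t in at_top. 0 < (t::real)" by (rule eventually_gt_at_top)
    ultimately show "\<forall>\<^sub>F t in at_top. l < g t / t"
    proof eventually_elim
      case (elim t)
      have "((g s - G s * s) / t + G s) * t \<le> g t"
      proof -
        have "((g s - G s * s) / t + G s) * t = g s - G s * s + G s * t"
          using elim by (simp add: distrib_right)
        moreover have "g s + G s * (t - s) \<le> g t" using g_abs_tangent[of s t] s elim by simp
        ultimately show ?thesis by (simp add: right_diff_distrib)
      qed
      then have "(g s - G s * s) / t + G s \<le> g t / t" using elim by (simp add: pos_le_divide_eq)
      then show ?case using elim by linarith
    qed
  next
    fix u assume u: "ginf < u"
    have "\<forall>\<^sub>F t in at_top. 0 < (t::real)" by (rule eventually_gt_at_top)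
    then show "\<forall>\<^sub>F t in at_top. g t / t < u"
    proof eventually_elim
      case (elim t)
      then have "g t / t \<le> ginf" using g_le_ginf[of t] by (simp add: pos_divide_le_eq)
      then show ?case using u by linarith
    qed
  qed
  then show ?thesis unfolding recession_slope_def by (intro tendsto_Lim) auto
qed

text \<open>The inverse function of \<open>G\<close>. The value 0 outside the range of \<open>G\<close> keeps \<open>H\<close> odd.\<close>

definition H :: "real \<Rightarrow> real" where
  "H s = (if \<bar>s\<bar> < ginf then inv G s else 0)"

lemma H_G [simp]: "H (G t) = t"
proof -
  have "inj G" by (auto intro: injI)
  then show ?thesis using abs_G_less_ginf[of t] by (simp add: H_def)
qed

lemma G_surj:
  assumes "\<bar>s\<bar> < ginf"
  shows "\<exists>t. G t = s"
proof -
  have main: "\<exists>t. G t = s" if s: "0 \<le> s" "s < ginf" for s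
  proof -
    obtain t where t: "0 < t" "s < G t" using G_approx[OF s(2)] .
    have "\<exists>x\<ge>0. x \<le> t \<and> G x = s"
      by (rule IVT') (use s t isCont_G in \<open>auto intro!: continuous_at_imp_continuous_on\<close>)
    then show ?thesis by blast
  qed
  show ?thesis
  proof (cases "0 \<le> s")
    case False
    then obtain t where "G t = - s" using main[of "- s"] assms by auto
    then have "G (- t) = s" by simp
    then show ?thesis by blast
  qed (use main assms in auto)
qed

lemma G_H: "\<bar>s\<bar> < ginf \<Longrightarrow> G (H s) = s"
  using G_surj[of s] H_G by metis

lemma H_minus: "H (- s) = - H s"
proof (cases "\<bar>s\<bar> < ginf")
  case True
  then have "G (H (- s)) = G (- H s)" by (simp add: G_H)
  then show ?thesis by (simp only: G_eq_iff)
qed (simp add: H_def)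

lemma H_mono: "\<bar>s\<bar> < ginf \<Longrightarrow> \<bar>t\<bar> < ginf \<Longrightarrow> s \<le> t \<Longrightarrow> H s \<le> H t"
  by (subst G_le_iff[symmetric]) (simp add: G_H del: G_le_iff)

lemma H_0 [simp]: "H 0 = 0" using H_G[of 0] by simp

lemma isCont_H: "\<bar>s\<bar> < ginf \<Longrightarrow> isCont H s"
  using isCont_inverse_function2[of "H s - 1" "H s" "H s + 1" H G] isCont_G by (simp add: G_H)

lemma DERIV_H:
  assumes "\<bar>s\<bar> < ginf"
  shows "(H has_real_derivative inverse (g'' \<bar>H s\<bar>)) (at s)"
proof (rule DERIV_inverse_function[of G, where a = "- ginf" and b = ginf])
  show "g'' \<bar>H s\<bar> \<noteq> 0" using g''_pos[of "\<bar>H s\<bar>"] by simp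
  show "G (H y) = y" if "- ginf < y" "y < ginf" for y by (rule G_H) (use that in auto)
qed (use assms DERIV_G isCont_H in auto)

lemma continuous_on_H: "continuous_on {- ginf<..<ginf} H"
  by (intro continuous_at_imp_continuous_on ballI isCont_H) auto

lemma continuous_on_H': "continuous_on {- ginf<..<ginf} (\<lambda>s. inverse (g'' \<bar>H s\<bar>))"
proof (rule continuous_on_inverse)
  show "continuous_on {- ginf<..<ginf} (\<lambda>s. g'' \<bar>H s\<bar>)"
    by (rule continuous_on_compose2[OF g''_cont]) (auto intro!: continuous_intros continuous_on_H)
  show "\<forall>s\<in>{- ginf<..<ginf}. g'' \<bar>H s\<bar> \<noteq> 0" using g''_pos[of "\<bar>H _\<bar>"] by (metis abs_ge_zero less_irrefl)
qed

text \<open>The derivative of the radial profile with flux \<open>c x / |x|\<^sup>2\<close>. If \<open>\<bar>c\<bar> = ginf * a\<close>, then it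
  is unbounded near \<open>a\<close>, and its value at \<open>a\<close> is the default value 0 of \<open>H\<close>.\<close>

definition V :: "real \<Rightarrow> real \<Rightarrow> real" where
  "V c r = H (c / r)"

lemma abs_div_less_ginf:
  assumes "0 < a" "\<bar>c\<bar> \<le> ginf * a" "a < r"
  shows "\<bar>c / r\<bar> < ginf"
proof -
  have "ginf * a < ginf * r" using assms ginf_pos by simp
  then have "\<bar>c\<bar> < ginf * r" using assms by linarith
  then show ?thesis using assms by (simp add: abs_divide divide_less_eq)
qed

lemma div_image_ginf:
  assumes "0 < a" "\<bar>c\<bar> \<le> ginf * a"
  shows "(\<lambda>r. c / r) ` {a<..} \<subseteq> {- ginf<..<ginf}"
proof (rule image_subsetI)
  fix r assume "r \<in> {a<..}"
  then have "\<bar>c / r\<bar> < ginf" by (intro abs_div_less_ginf[OF assms]) simp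
  then have "c / r < ginf" "- (c / r) < ginf" unfolding abs_less_iff by blast+
  then have "- ginf < c / r" by linarith
  then show "c / r \<in> {- ginf<..<ginf}" using \<open>c / r < ginf\<close> by simp
qed

lemma continuous_on_V:
  assumes "0 < a" "\<bar>c\<bar> \<le> ginf * a"
  shows "continuous_on {a<..} (V c)"
  unfolding V_def
  by (rule continuous_on_compose2[OF continuous_on_H _ div_image_ginf[OF assms]])
    (use assms in \<open>auto intro!: continuous_intros\<close>)

lemma continuous_on_V_closed:
  assumes "0 < a" "\<bar>c\<bar> < ginf * a"
  shows "continuous_on {a..} (V c)"
proof (rule continuous_on_subset)
  define a' where "a' = (\<bar>c\<bar> / ginf + a) / 2"
  have lt: "\<bar>c\<bar> / ginf < a" using assms ginf_pos by (simp add: divide_less_eq mult.commute)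
  have a': "0 < a'" "a' < a" "\<bar>c\<bar> / ginf \<le> a'"
  proof -
    define q where "q = \<bar>c\<bar> / ginf"
    have "0 \<le> q" using ginf_pos by (simp add: q_def)
    then show "0 < a'" "a' < a" "\<bar>c\<bar> / ginf \<le> a'"
      using lt assms(1) unfolding a'_def q_def[symmetric] by auto
  qed
  then have "\<bar>c\<bar> \<le> ginf * a'" using ginf_pos by (simp add: divide_le_eq mult.commute)
  then show "continuous_on {a'<..} (V c)" using a' by (intro continuous_on_V)
  show "{a..} \<subseteq> {a'<..}" using a' by auto
qed

lemma V_mono:
  assumes "0 < a" "\<bar>c\<bar> \<le> ginf * a" "\<bar>d\<bar> \<le> ginf * a" "c \<le> d" "a < r"
  shows "V c r \<le> V d r"
  unfolding V_def using assms abs_div_less_ginf[OF assms(1,2,5)] abs_div_less_ginf[OF assms(1,3,5)]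
  by (intro H_mono) (auto simp: divide_right_mono)

lemma V_minus: "V (- c) r = - V c r"
  using H_minus[of "c / r"] by (simp add: V_def)

lemma V_0 [simp]: "V 0 r = 0" by (simp add: V_def)

text \<open>The total increase depends continuously on \<open>c\<close> as long as \<open>c < ginf * a\<close>, so either some \<open>c\<close>
  works by the intermediate value theorem, or all of them yield less than \<open>D\<close>. In the second case monotone convergence
  shows that the extreme slope is integrable with increase at most \<open>D\<close>.\<close>

lemma exists_slope_nonneg:
  assumes ab: "0 < a" "a < b" and D: "0 \<le> D"
  shows "\<exists>c. 0 \<le> c \<and> c \<le> ginf * a \<and> V c integrable_on {a..b} \<and>
    (integral {a..b} (V c) = D \<or> c = ginf * a \<and> integral {a..b} (V c) \<le> D)"
proof -
  define m where "m = ginf * a"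
  have m: "0 < m" using ab ginf_pos by (simp add: m_def)
  have cont: "continuous_on {a..b} (V c)" if "0 \<le> c" "c < m" for c
    by (rule continuous_on_subset[OF continuous_on_V_closed[OF ab(1)]]) (use that in \<open>auto simp: m_def\<close>)
  have int: "V c integrable_on {a..b}" if "0 \<le> c" "c < m" for c
    by (rule integrable_continuous_real[OF cont[OF that]])
  show ?thesis
  proof (cases "\<exists>c1. 0 \<le> c1 \<and> c1 < m \<and> D \<le> integral {a..b} (V c1)")
    case True
    then obtain c1 where c1: "0 \<le> c1" "c1 < m" "D \<le> integral {a..b} (V c1)" by blast
    have "continuous_on ({0..c1} \<times> cbox a b) (\<lambda>(c, r). V c r)"
      unfolding V_def case_prod_unfold
    proof (rule continuous_on_compose2[OF continuous_on_H])
      show "continuous_on ({0..c1} \<times> cbox a b) (\<lambda>p. fst p / snd p)"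
        using ab by (intro continuous_intros) auto
      have "fst p / snd p \<in> {- ginf<..<ginf}" if "p \<in> {0..c1} \<times> cbox a b" for p
      proof -
        have p: "0 \<le> fst p" "fst p \<le> c1" "a \<le> snd p" using that by auto
        have "ginf * a \<le> ginf * snd p" using p ginf_pos by (intro mult_left_mono) auto
        then have "fst p < ginf * snd p" using p c1 unfolding m_def by linarith
        then have "fst p / snd p < ginf" using p ab by (simp add: divide_less_eq)
        moreover have "0 \<le> fst p / snd p" using p ab by simp
        ultimately show ?thesis using ginf_pos by simp
      qed
      then show "(\<lambda>p. fst p / snd p) ` ({0..c1} \<times> cbox a b) \<subseteq> {- ginf<..<ginf}" by blast
    qed
    then have "continuous_on {0..c1} (\<lambda>c. integral {a..b} (V c))"
      using integral_continuous_on_param[of "{0..c1}" a b V] by simp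
    moreover have "integral {a..b} (V 0) \<le> D"
    proof -
      have "V 0 = (\<lambda>r. 0)" by (simp add: fun_eq_iff)
      then show ?thesis using D by simp
    qed
    ultimately obtain c where "0 \<le> c" "c \<le> c1" "integral {a..b} (V c) = D"
      using IVT'[of "\<lambda>c. integral {a..b} (V c)" 0 D c1] c1 by blast
    then show ?thesis using int[of c] c1 by (intro exI[of _ c]) (auto simp: m_def)
  next
    case False
    then have small: "integral {a..b} (V c) < D" if "0 \<le> c" "c < m" for c using that by force
    \<comment> \<open>an increasing sequence of slopes with limit \<open>m\<close>\<close>
    define c where "c k = m * (1 - 1 / (real k + 1))" for k :: nat
    have c: "0 \<le> c k" "c k < m" "c k \<le> c (Suc k)" for k
      using m by (auto simp: c_def field_simps)
    have clim: "c \<longlonglongrightarrow> m"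
    proof -
      have "(\<lambda>k. 1 / (real k + 1)) \<longlonglongrightarrow> 0" by real_asymp
      then have "(\<lambda>k. m * (1 - 1 / (real k + 1))) \<longlonglongrightarrow> m * (1 - 0)" by (intro tendsto_intros)
      then show ?thesis by (simp add: c_def[abs_def])
    qed
    \<comment> \<open>The value at \<open>a\<close> is changed since \<open>V c a\<close> does not converge to \<open>V m a\<close>.\<close>
    define W where "W c r = (if r = a then 0 else V c r)" for c r
    have WV: "(W c integrable_on {a..b}) = (V c integrable_on {a..b})" "integral {a..b} (W c) = integral {a..b} (V c)" for c
      by (rule integrable_iff_spike[of "{a}"] integral_spike[of "{a}"]; simp add: W_def)+
    have abs: "\<bar>c k\<bar> \<le> ginf * a" for k using c[of k] by (simp add: m_def)
    have "W m integrable_on {a..b} \<and> ((\<lambda>k. integral {a..b} (W (c k))) \<longlonglongrightarrow> integral {a..b} (W m))"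
    proof (rule monotone_convergence_increasing)
      show "W (c k) integrable_on {a..b}" for k using int c WV by simp
      show "W (c k) r \<le> W (c (Suc k)) r" if "r \<in> {a..b}" for k r
        using V_mono[OF ab(1) abs abs c(3), of r] that by (simp add: W_def)
      show "(\<lambda>k. W (c k) r) \<longlonglongrightarrow> W m r" if r: "r \<in> {a..b}" for r
      proof (cases "r = a")
        case False
        then have cont: "isCont H (m / r)"
          using r m by (intro isCont_H abs_div_less_ginf[OF ab(1)]) (auto simp: m_def)
        have "(\<lambda>k. c k / r) \<longlonglongrightarrow> m / r" using False r ab by (intro tendsto_intros clim) auto
        from isCont_tendsto_compose[OF cont this] show ?thesis using False by (simp add: W_def V_def)
      qed (simp add: W_def)
      show "bounded (range (\<lambda>k. integral {a..b} (W (c k))))"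
        unfolding bounded_iff
      proof (intro exI[of _ D] ballI)
        fix y assume "y \<in> range (\<lambda>k. integral {a..b} (W (c k)))"
        then obtain k where y: "y = integral {a..b} (V (c k))" using WV by auto
        have "0 \<le> integral {a..b} (W (c k))"
        proof (rule integral_nonneg)
          show "0 \<le> W (c k) r" if "r \<in> {a..b}" for r
            using V_mono[OF ab(1) _ abs, of 0 k r] c[of k] ab ginf_pos that by (simp add: W_def)
        qed (use int c WV in simp)
        then show "norm y \<le> D" using small[OF c(1,2), of k] WV y by simp
      qed
    qed
    then have "V m integrable_on {a..b}" and lim: "(\<lambda>k. integral {a..b} (V (c k))) \<longlonglongrightarrow> integral {a..b} (V m)"
      using WV by auto
    moreover have "integral {a..b} (V m) \<le> D"
      by (rule LIMSEQ_le_const2[OF lim]) (use small[OF c(1,2)] in \<open>auto intro: less_imp_le\<close>)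
    ultimately show ?thesis using m by (intro exI[of _ m]) (auto simp: m_def)
  qed
qed

lemma exists_slope:
  assumes ab: "0 < a" "a < b"
  obtains c where "\<bar>c\<bar> \<le> ginf * a" "V c integrable_on {a..b}"
    "integral {a..b} (V c) = D \<or> (c = ginf * a \<and> integral {a..b} (V c) \<le> D) \<or>
      (c = - (ginf * a) \<and> D \<le> integral {a..b} (V c))" "0 \<le> D \<Longrightarrow> 0 \<le> c"
proof (cases "0 \<le> D")
  case True
  then show ?thesis using exists_slope_nonneg[OF ab, of D] that by auto
next
  case False
  then obtain c where c: "0 \<le> c" "c \<le> ginf * a" "V c integrable_on {a..b}"
    "integral {a..b} (V c) = - D \<or> c = ginf * a \<and> integral {a..b} (V c) \<le> - D"
    using exists_slope_nonneg[OF ab, of "- D"] by auto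
  have V: "V (- c) = (\<lambda>r. - V c r)" by (simp add: V_minus fun_eq_iff)
  have "V (- c) integrable_on {a..b}" "integral {a..b} (V (- c)) = - integral {a..b} (V c)"
    unfolding V using c(3) by (auto intro: integrable_neg)
  then show ?thesis using c False by (intro that[of "- c"]) auto
qed

text \<open>The normalization at \<open>b\<close> reflects that the outer datum is always attained.\<close>

definition profile :: "real \<Rightarrow> real \<Rightarrow> real \<Rightarrow> real \<Rightarrow> real" where
  "profile b m c r = m - integral {r..b} (V c)"

lemma profile_at_b [simp]: "profile b m c b = m"
  by (simp add: profile_def)

lemma continuous_on_profile:
  assumes "V c integrable_on {a..b}"
  shows "continuous_on {a..b} (profile b m c)"
  unfolding profile_def by (intro continuous_intros indefinite_integral_continuous_1' assms)

lemma DERIV_profile: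
  assumes ab: "0 < a" and c: "\<bar>c\<bar> \<le> ginf * a" and r: "a < r" "r < b"
  shows "(profile b m c has_real_derivative V c r) (at r)"
proof -
  define r0 where "r0 = (a + r) / 2"
  have r0: "a < r0" "r0 < r" using r by (auto simp: r0_def)
  have cont: "continuous_on {r0..b} (V c)"
    by (rule continuous_on_subset[OF continuous_on_V[OF ab c]]) (use r0 in auto)
  have "((\<lambda>x. integral {r0..x} (V c)) has_real_derivative V c r) (at r within {r0..b})"
    by (rule integral_has_real_derivative[OF cont]) (use r0 r in auto)
  moreover have "at r within {r0..b} = at r" using r0 r by (intro at_within_interior) auto
  ultimately have "((\<lambda>x. integral {r0..x} (V c)) has_real_derivative V c r) (at r)" by simp
  then have "((\<lambda>x. m - integral {r0..b} (V c) + integral {r0..x} (V c)) has_real_derivative 0 + V c r) (at r)"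
    by (intro DERIV_add DERIV_const)
  then have "((\<lambda>x. m - integral {r0..b} (V c) + integral {r0..x} (V c)) has_real_derivative V c r) (at r)" by simp
  then show ?thesis
  proof (rule has_field_derivative_transform_within_open[of _ _ _ "{r0<..<b}"])
    fix x assume x: "x \<in> {r0<..<b}"
    have "integral {r0..x} (V c) + integral {x..b} (V c) = integral {r0..b} (V c)"
      by (rule Henstock_Kurzweil_Integration.integral_combine) (use x cont in \<open>auto intro: integrable_continuous_real\<close>)
    then show "m - integral {r0..b} (V c) + integral {r0..x} (V c) = profile b m c x"
      by (simp add: profile_def)
  qed (use r0 r in auto)
qed

definition V' :: "real \<Rightarrow> real \<Rightarrow> real" where
  "V' c r = inverse (g'' \<bar>H (c / r)\<bar>) * (- c / r\<^sup>2)"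

lemma DERIV_V:
  assumes ab: "0 < a" and c: "\<bar>c\<bar> \<le> ginf * a" and r: "a < r"
  shows "(V c has_real_derivative V' c r) (at r)"
proof -
  have "((\<lambda>r. c / r) has_real_derivative - c / r\<^sup>2) (at r)"
    using ab r by (auto intro!: derivative_eq_intros simp: power2_eq_square)
  from DERIV_chain2[OF DERIV_H[OF abs_div_less_ginf[OF ab c r]] this]
  show ?thesis by (simp add: V_def[abs_def] V'_def)
qed

lemma continuous_on_V':
  assumes "0 < a" "\<bar>c\<bar> \<le> ginf * a"
  shows "continuous_on {a<..} (V' c)"
  unfolding V'_def
proof (intro continuous_on_mult)
  show "continuous_on {a<..} (\<lambda>r. inverse (g'' \<bar>H (c / r)\<bar>))"
    by (rule continuous_on_compose2[OF continuous_on_H' _ div_image_ginf[OF assms]])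
      (use assms in \<open>auto intro!: continuous_intros\<close>)
  show "continuous_on {a<..} (\<lambda>r. - c / r\<^sup>2)" using assms by (intro continuous_intros) auto
qed

lemma integral_V_mono:
  assumes ab: "0 < a" "a < b" and c: "\<bar>c\<bar> \<le> ginf * a" "V c integrable_on {a..b}"
    and d: "\<bar>d\<bar> \<le> ginf * a" "V d integrable_on {a..b}" and cd: "c \<le> d" and r: "a \<le> r"
  shows "integral {r..b} (V c) \<le> integral {r..b} (V d)"
proof -
  define W where "W c s = (if s = a then 0 else V c s)" for c s
  have WV: "(W c integrable_on {r..b}) = (V c integrable_on {r..b})" "integral {r..b} (W c) = integral {r..b} (V c)" for c
    by (rule integrable_iff_spike[of "{a}"] integral_spike[of "{a}"]; simp add: W_def)+
  have "V c integrable_on {r..b}" "V d integrable_on {r..b}"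
    using c(2) d(2) r by (auto intro: integrable_subinterval_real)
  then have "integral {r..b} (W c) \<le> integral {r..b} (W d)"
    by (intro integral_le) (use WV V_mono[OF ab(1) c(1) d(1) cd] r in \<open>auto simp: W_def\<close>)
  then show ?thesis by (simp add: WV)
qed

end

section \<open>Uniqueness of weak gradients\<close>

lemma test_function_mono:
  assumes "test_function S \<phi>" "S \<subseteq> T"
  shows "test_function T \<phi>"
  using assms unfolding test_function_def by blast

lemma AE_annulus_exhaustion:
  assumes "\<And>e. 0 < e \<Longrightarrow> AE x in lebesgue. x \<in> annulus (a + e) (b - e) \<longrightarrow> P x"
  shows "AE x in lebesgue. x \<in> annulus a b \<longrightarrow> P x"
proof -
  have "AE x in lebesgue. \<forall>n. x \<in> annulus (a + inverse (real (Suc n))) (b - inverse (real (Suc n))) \<longrightarrow> P x"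
    unfolding AE_all_countable using assms by simp
  then show ?thesis
  proof eventually_elim
    case (elim x)
    show ?case
    proof
      assume x: "x \<in> annulus a b"
      then have "0 < min (norm x - a) (b - norm x)" by (simp add: annulus_def)
      from reals_Archimedean[OF this] obtain n
        where "inverse (real (Suc n)) < min (norm x - a) (b - norm x)" ..
      then have "x \<in> annulus (a + inverse (real (Suc n))) (b - inverse (real (Suc n)))"
        by (simp only: annulus_def mem_Collect_eq min_less_iff_conj) linarith
      then show "P x" using elim by blast
    qed
  qed
qed

text \<open>A weak gradient is only locally integrable. On smaller annuli it is integrable, and uniqueness of
  the gradient measure applies.\<close>

theorem weak_gradient_AE_unique:
  assumes ab: "0 < a" "a < b"
    and G: "has_weak_gradient (annulus a b) w G" "has_weak_gradient (annulus a b) w G'"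
  shows "AE x in lebesgue. x \<in> annulus a b \<longrightarrow> G x = G' x"
proof (rule AE_annulus_exhaustion)
  fix e :: real assume e: "0 < e"
  let ?S = "annulus (a + e) (b - e)" and ?W = "annulus a b"
  show "AE x in lebesgue. x \<in> ?S \<longrightarrow> G x = G' x"
  proof (cases "a + e < b - e")
    case False
    then have "?S = {}" by (auto simp: annulus_def)
    then show ?thesis by simp
  next
    case True
    have ab': "0 < a + e" "a + e < b - e" using ab e True by auto
    have sub: "?S \<subseteq> closure ?S" "closure ?S \<subseteq> ?W" "?S \<subseteq> ?W"
      unfolding closure_annulus[OF ab'] unfolding annulus_def using e by auto
    have comp: "compact (closure ?S)"
      using bounded_subset[of "cball 0 (b - e)" ?S] by (auto simp: annulus_def subset_iff)
    have int: "H absolutely_integrable_on ?S" if "has_weak_gradient ?W w H" for H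
    proof (subst absolutely_integrable_componentwise_iff, intro ballI)
      fix v :: "real^2" assume "v \<in> Basis"
      then obtain i where v: "v = axis i 1" by (auto simp: Basis_vec_def)
      have "(\<lambda>x. H x $ i) absolutely_integrable_on closure ?S"
        using that comp sub(2) unfolding has_weak_gradient_def weak_partial_def L1_loc_def by blast
      then show "(\<lambda>x. H x \<bullet> v) absolutely_integrable_on ?S"
        unfolding v inner_axis using sub(1) by (auto intro: set_integrable_subset)
    qed
    have restr: "(LINT x:?W|lebesgue. w x * partial_deriv i \<phi> x)
        = - grad_pairing ?S H (null_measure borel) (\<lambda>_. 0) i \<phi>"
      if H: "has_weak_gradient ?W w H" and \<phi>: "test_function ?S \<phi>" for H i \<phi>
    proof -
      have "\<phi> x = 0" if "x \<notin> ?S" for x using \<phi> that unfolding test_function_def by blast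
      then have "(LINT x:?W|lebesgue. H x $ i * \<phi> x) = (LINT x:?S|lebesgue. \<phi> x * H x $ i)"
        unfolding set_lebesgue_integral_def using sub(3)
        by (intro Bochner_Integration.integral_cong) (auto simp: indicator_def)
      then show ?thesis
        using H test_function_mono[OF \<phi> sub(3)]
        unfolding has_weak_gradient_def weak_partial_def grad_pairing_def by simp
    qed
    have null: "{} \<in> null_sets lborel" "emeasure (null_measure borel :: (real^2) measure) (- {}) = 0" by auto
    have eq: "grad_pairing ?S G (null_measure borel) (\<lambda>_. 0) i \<phi>
        = grad_pairing ?S G' (null_measure borel) (\<lambda>_. 0) i \<phi>" if "test_function ?S \<phi>" for i \<phi>
      using restr[OF G(1) that, of i] restr[OF G(2) that, of i] by linarith
    show ?thesis
      by (rule grad_pairing_singular_unique(1)[OF ab' int[OF G(1)] int[OF G(2)]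
            polar_measure_null polar_measure_null null null eq])
  qed
qed

section \<open>The calibrating field\<close>

text \<open>The field \<open>c x / |x|\<^sup>2\<close>, cut off near the origin to become a test field on the whole plane.
  On the annulus the cutoff is 1.\<close>

definition calibration :: "real \<Rightarrow> real \<Rightarrow> 2 \<Rightarrow> real^2 \<Rightarrow> real" where
  "calibration a c = angular_field (\<lambda>_. 1) (\<lambda>r. c * inner_cutoff (a / 2) a 0 r)"

lemma
  assumes a: "0 < a"
  shows calibration_eq: "a \<le> norm x \<Longrightarrow> calibration a c i x = c * x $ i / (norm x)\<^sup>2"
    and C1_on_calibration: "C1_on UNIV (calibration a c i)"
    and div_calibration: "a \<le> norm x \<Longrightarrow>
      partial_deriv 1 (calibration a c 1) x + partial_deriv 2 (calibration a c 2) x = 0"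
proof -
  have lt: "a / 2 < a" using a by simp
  have s: "0 < 1 / cutoff_scale (a / 2) a 0" "a / 2 + 2 / cutoff_scale (a / 2) a 0 \<le> a"
    using cutoff_scale_pos[OF lt] cutoff_scale_ge[OF lt, of 0] a by auto
  have \<kappa>: "((\<lambda>r. c * inner_cutoff (a / 2) a 0 r) has_real_derivative c * inner_kernel (a / 2) a 0 r) (at r)" for r
    by (rule DERIV_cmult[OF DERIV_inner_cutoff])
  have j: "continuous_on UNIV (\<lambda>r. c * inner_kernel (a / 2) a 0 r)" by (intro continuous_intros)
  have z: "0 < a / 2" "r \<le> a / 2 \<Longrightarrow> c * inner_cutoff (a / 2) a 0 r = 0" for r
    using inner_cutoff_eq_0[OF lt, of r 0] s a by simp_all
  show "C1_on UNIV (calibration a c i)"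
    unfolding calibration_def by (rule C1_on_angular_field[OF real_polynomial_function.intros(2) \<kappa> j z])
  assume x: "a \<le> norm x"
  show "calibration a c i x = c * x $ i / (norm x)\<^sup>2"
    using inner_cutoff_eq_1[OF lt, of 0 "norm x"] s x by (simp add: calibration_def angular_field_def)
  have "x \<noteq> 0" using x a by auto
  from divergence_angular_field[OF real_polynomial_function.intros(2) \<kappa> j z this, of 1]
  show "partial_deriv 1 (calibration a c 1) x + partial_deriv 2 (calibration a c 2) x = 0"
    using inner_kernel_eq_0[OF lt, of "norm x" 0] s x by (simp add: sum_2 calibration_def)
qed

section \<open>The radial solution\<close>

locale radial_solution = linear_growth +
  fixes a b c m :: real
  assumes ab: "0 < a" "a < b" and c: "\<bar>c\<bar> \<le> ginf * a" "V c integrable_on {a..b}"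
begin

abbreviation U :: "real \<Rightarrow> real" where "U \<equiv> profile b m c"

definition u :: "real^2 \<Rightarrow> real" where "u x = U (norm x)"

text \<open>The gradient of \<open>u\<close> on the annulus, set to zero outside so that it is its own Borel version.\<close>

definition Du :: "real^2 \<Rightarrow> real^2" where
  "Du x = indicator (annulus a b) x *\<^sub>R (V c (norm x) *\<^sub>R sgn x)"

lemma GDERIV_u:
  assumes "x \<in> annulus a b"
  shows "GDERIV u x :> Du x"
proof -
  have "GDERIV (\<lambda>x. U (norm x)) x :> V c (norm x) *\<^sub>R sgn x"
    by (rule GDERIV_radial, rule DERIV_profile[OF ab(1) c(1)]) (use assms ab in \<open>auto simp: annulus_def\<close>)
  then show ?thesis using assms by (simp add: u_def[abs_def] Du_def)
qed

lemma C1_u: "C1_on (annulus a b) u"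
  unfolding u_def[abs_def]
proof (rule C1_on_radial[where T = "{a<..<b}"])
  show "(U has_real_derivative V c r) (at r)" if "r \<in> {a<..<b}" for r
    by (rule DERIV_profile[OF ab(1) c(1)]) (use that in auto)
  show "continuous_on {a<..<b} (V c)"
    by (rule continuous_on_subset[OF continuous_on_V[OF ab(1) c(1)]]) auto
qed (use ab in \<open>auto simp: annulus_def\<close>)

lemma C1_partial_u: "C1_on (annulus a b) (partial_deriv i u)"
proof (rule C1_on_cong[OF open_annulus])
  show "partial_deriv i u x = (V c (norm x) * (1 / norm x)) * x $ i" if "x \<in> annulus a b" for x
    using partial_deriv_eq[OF GDERIV_u[OF that]] that by (simp add: Du_def sgn_div_norm divide_inverse)
  have "C1_on (annulus a b) (\<lambda>x. V c (norm x))"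
    by (rule C1_on_radial[where T = "{a<..}"], rule DERIV_V[OF ab(1) c(1)])
      (use ab continuous_on_V'[OF ab(1) c(1)] in \<open>auto simp: annulus_def\<close>)
  moreover have "C1_on (annulus a b) (\<lambda>x. 1 / norm x)"
  proof (rule C1_on_radial[where T = "{a<..}" and Y' = "\<lambda>r. - 1 / r\<^sup>2"])
    show "((\<lambda>r. 1 / r) has_real_derivative - 1 / r\<^sup>2) (at r)" if "r \<in> {a<..}" for r
      using that ab by (auto intro!: derivative_eq_intros simp: power2_eq_square)
    show "continuous_on {a<..} (\<lambda>r. - 1 / r\<^sup>2)" using ab by (intro continuous_intros) auto
  qed (use ab in \<open>auto simp: annulus_def\<close>)
  ultimately show "C1_on (annulus a b) (\<lambda>x. (V c (norm x) * (1 / norm x)) * x $ i)"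
    by (intro C1_on_mult C1_on_nth)
qed

lemma u_W22_loc: "u \<in> W22_loc (annulus a b)"
  by (rule W22_loc_C2[OF open_annulus C1_u C1_partial_u])

lemma continuous_on_u: "continuous_on (closure (annulus a b)) u"
  unfolding u_def[abs_def] closure_annulus[OF ab]
  by (rule continuous_on_compose2[OF continuous_on_profile[OF c(2)]]) (auto intro!: continuous_intros)

lemma V_measurable [measurable]: "(\<lambda>r. indicator {a<..<b} r * V c r) \<in> borel_measurable borel"
proof -
  have "continuous_on {a<..<b} (V c)"
    by (rule continuous_on_subset[OF continuous_on_V[OF ab(1) c(1)]]) auto
  from borel_measurable_continuous_on_indicator[OF _ this] show ?thesis by simp
qed

text \<open>\<open>V c\<close> has the sign of \<open>c\<close>, so its Henstock-Kurzweil integral converges absolutely.\<close>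

lemma V_integrable: "integrable lborel (\<lambda>r. indicator {a<..<b} r * V c r)"
proof -
  have "V c absolutely_integrable_on {a<..<b}"
  proof (cases "0 \<le> c")
    case True
    have "0 \<le> V c r" if "r \<in> {a<..<b}" for r
      using V_mono[OF ab(1) _ c(1) True, of r] that ab ginf_pos by simp
    then show ?thesis
      using c(2) by (intro nonnegative_absolutely_integrable_1) (auto simp: integrable_on_Icc_iff_Ioo)
  next
    case False
    have "0 \<le> - V c r" if "r \<in> {a<..<b}" for r
      using V_mono[OF ab(1) c(1) _ _, of 0 r] that ab ginf_pos False by simp
    then have "(\<lambda>r. - V c r) absolutely_integrable_on {a<..<b}"
      using c(2) by (intro nonnegative_absolutely_integrable_1) (auto simp: integrable_on_Icc_iff_Ioo intro: integrable_neg)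
    then show ?thesis by (simp add: set_integrable_def)
  qed
  then have "integrable lebesgue (\<lambda>r. indicator {a<..<b} r * V c r)" by (simp add: set_integrable_def)
  then show ?thesis by (subst (asm) integrable_completion) simp_all
qed

lemma Du_measurable [measurable]: "Du \<in> borel_measurable borel"
proof -
  have "(\<lambda>x::real^2. (indicator {a<..<b} (norm x) * V c (norm x)) *\<^sub>R sgn x) \<in> borel_measurable borel"
    using measurable_compose[of norm borel borel, OF _ V_measurable] by measurable
  moreover have "(indicator {a<..<b} (norm x) * V c (norm x)) *\<^sub>R sgn x = Du x" for x :: "real^2"
    by (simp add: Du_def annulus_def indicator_def)
  ultimately show ?thesis by simp
qed

lemma norm_Du: "norm (Du y) \<le> \<bar>V c (norm y)\<bar>"
  by (simp add: Du_def norm_sgn indicator_def)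

lemma Du_integrable: "integrable lborel (\<lambda>x. Du x $ i)"
proof -
  let ?P = "lborel \<Otimes>\<^sub>M circle_measure"
  let ?W = "\<lambda>r. indicator {a<..<b} r * V c r"
  have "integrable ?P (\<lambda>(r, x). ?W r)"
  proof (rule polar.Fubini_integrable)
    show "integrable lborel (\<lambda>r. LINT x|circle_measure. norm (case (r, x) of (r, x) \<Rightarrow> ?W r))"
      using V_integrable by (simp add: integrable_abs del: abs_mult)
  qed simp_all
  then have "integrable ?P (\<lambda>p. b * (case p of (r, x) \<Rightarrow> ?W r))" by simp
  then have bnd: "integrable ?P (\<lambda>(r, x). b * ?W r)" by (simp add: case_prod_unfold)
  have ae: "AE p in ?P. norm (snd p) = 1"
  proof (rule polar.AE_pair_measure)
    show "{p \<in> space ?P. norm (snd p) = 1} \<in> sets ?P" by measurable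
  qed (use AE_circle_measure in simp)
  have "integrable ?P (\<lambda>(r, x). r * indicator {a<..<b} r * Du (r *\<^sub>R x) $ i)"
  proof (rule Bochner_Integration.integrable_bound[OF bnd])
    show "AE p in ?P. norm (case p of (r, x) \<Rightarrow> r * indicator {a<..<b} r * Du (r *\<^sub>R x) $ i)
        \<le> norm (case p of (r, x) \<Rightarrow> b * ?W r)"
      using ae
    proof eventually_elim
      case (elim p)
      obtain r x where p: "p = (r, x)" by (cases p)
      show ?case
      proof (cases "r \<in> {a<..<b}")
        case True
        have n: "norm (r *\<^sub>R x) = r" using elim True ab by (simp add: p)
        have "\<bar>Du (r *\<^sub>R x) $ i\<bar> \<le> norm (Du (r *\<^sub>R x))" by (rule component_le_norm_cart)
        also have "\<dots> \<le> \<bar>V c r\<bar>" using norm_Du[of "r *\<^sub>R x"] unfolding n .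
        finally have "r * \<bar>Du (r *\<^sub>R x) $ i\<bar> \<le> b * \<bar>V c r\<bar>" using True ab by (intro mult_mono) auto
        then show ?thesis using True ab by (simp add: p abs_mult)
      qed (simp add: p)
    qed
  qed measurable
  then have "set_integrable lborel {x. a < norm x \<and> norm x < b} (\<lambda>x. Du x $ i)"
    using ab by (subst integrable_annulus_polar) auto
  moreover have "indicator {x. a < norm x \<and> norm x < b} x *\<^sub>R Du x $ i = Du x $ i" for x
    by (simp add: Du_def annulus_def indicator_def)
  ultimately show ?thesis by (simp only: set_integrable_def)
qed

lemma Du_absolutely_integrable: "Du absolutely_integrable_on annulus a b"
proof (subst absolutely_integrable_componentwise_iff, intro ballI)
  fix v :: "real^2" assume "v \<in> Basis"
  then obtain i where v: "v = axis i 1" by (auto simp: Basis_vec_def)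
  have "integrable lebesgue (\<lambda>x. Du x $ i)" using Du_integrable by (subst integrable_completion) auto
  moreover have "(\<lambda>x. indicator (annulus a b) x *\<^sub>R Du x $ i) = (\<lambda>x. Du x $ i)"
    by (auto simp: Du_def indicator_def)
  ultimately show "(\<lambda>x. Du x \<bullet> v) absolutely_integrable_on annulus a b"
    unfolding v inner_axis by (simp only: set_integrable_def real_inner_1_right)
qed

lemma borel_version_Du: "borel_version (annulus a b) Du Du"
  unfolding borel_version_def
proof (intro conjI allI impI)
  fix F :: "real^2 \<Rightarrow> real" and i assume [measurable]: "F \<in> borel_measurable borel"
  have "(\<lambda>x. indicator (annulus a b) x *\<^sub>R (F x * Du x $ i)) = (\<lambda>x. F x * Du x $ i)"
    by (auto simp: Du_def indicator_def)
  then show "(LINT x:annulus a b|lebesgue. F x * Du x $ i) = (LINT x|lborel. F x * Du x $ i)"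
    by (simp only: set_lebesgue_integral_def) (rule integral_completion, measurable)
next
  show "Du x = 0" if "x \<notin> annulus a b" for x using that by (simp add: Du_def)
qed (simp_all add: Du_integrable)

lemma has_weak_gradient_u: "has_weak_gradient (annulus a b) u Du"
  unfolding has_weak_gradient_def
proof
  fix i
  have w: "weak_partial (annulus a b) i u (partial_deriv i u)"
    by (rule weak_partial_C1[OF open_annulus C1_u])
  have eq: "x \<in> annulus a b \<Longrightarrow> partial_deriv i u x = Du x $ i" for x
    by (rule partial_deriv_eq[OF GDERIV_u])
  have "L1_loc (annulus a b) (\<lambda>x. Du x $ i)"
    unfolding L1_loc_def
  proof (intro allI impI)
    fix C assume C: "compact C \<and> C \<subseteq> annulus a b"
    then have "partial_deriv i u absolutely_integrable_on C" using w by (auto simp: weak_partial_def L1_loc_def)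
    then show "(\<lambda>x. Du x $ i) absolutely_integrable_on C"
      using eq C by (subst set_integrable_cong[OF refl refl, of _ _ "partial_deriv i u"]) auto
  qed
  moreover have "(LINT x:annulus a b|lebesgue. partial_deriv i u x * \<phi> x)
      = (LINT x:annulus a b|lebesgue. Du x $ i * \<phi> x)" for \<phi>
    by (rule set_lebesgue_integral_cong) (auto simp: eq)
  ultimately show "weak_partial (annulus a b) i u (\<lambda>x. Du x $ i)"
    using w by (simp add: weak_partial_def)
qed

lemma u_absolutely_integrable: "u absolutely_integrable_on annulus a b"
proof -
  have "compact (closure (annulus a b))"
    using bounded_subset[of "cball 0 b" "annulus a b"] by (auto simp: annulus_def subset_iff)
  then have "u absolutely_integrable_on closure (annulus a b)"
    using L1_loc_continuous[OF continuous_on_u] by (auto simp: L1_loc_def)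
  then show ?thesis by (rule set_integrable_subset) (auto simp: closure_subset)
qed

lemma u_W11: "u \<in> W11 (annulus a b)"
  using u_absolutely_integrable has_weak_gradient_u Du_absolutely_integrable by (auto simp: W11_def)

lemma gradient_decomposition_u: "gradient_decomposition (annulus a b) u Du (null_measure borel) (\<lambda>_. 0)"
  by (rule gradient_decomposition_weak_gradient[OF has_weak_gradient_u Du_absolutely_integrable])

lemma is_trace_u: "is_trace (annulus a b) (annulus_normal a b) u (glue_trace a b (\<lambda>_. U a) (\<lambda>_. U b))"
proof -
  define u' where "u' x = indicator (annulus a b) x * U (norm x)" for x :: "real^2"
  have cont: "continuous_on {a..b} U" by (rule continuous_on_profile[OF c(2)])
  have [measurable]: "u' \<in> borel_measurable borel"
  proof -
    have "continuous_on (annulus a b) (\<lambda>x. U (norm x))"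
      by (rule continuous_on_compose2[OF cont]) (auto simp: annulus_def intro!: continuous_intros)
    from borel_measurable_continuous_on_indicator[OF _ this] show ?thesis by (simp add: u'_def[abs_def])
  qed
  have int: "(LINT x:annulus a b|lebesgue. u x * F x) = (LINT x|lborel. F x * u' x)"
    if [measurable]: "F \<in> borel_measurable borel" for F
  proof -
    have "(LINT x:annulus a b|lebesgue. u x * F x) = (LINT x|lebesgue. F x * u' x)"
      unfolding set_lebesgue_integral_def
      by (intro Bochner_Integration.integral_cong) (auto simp: u_def u'_def indicator_def)
    then show ?thesis by (simp add: integral_completion)
  qed
  obtain \<nu> \<sigma> where g: "is_gradient_measure (annulus a b) u \<nu> \<sigma>"
    using is_gradient_measure_weak_gradient[OF has_weak_gradient_u Du_absolutely_integrable] by auto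
  have bg: "borel_gradient a b u' \<nu> \<sigma>"
    unfolding borel_gradient_def
  proof (intro conjI allI impI)
    have "integrable lebesgue u'"
      using u_absolutely_integrable by (simp add: set_integrable_def u_def u'_def[abs_def])
    then show "integrable lborel u'" by (subst (asm) integrable_completion) simp_all
    show "polar_measure (annulus a b) \<nu> \<sigma>" using g by (simp add: is_gradient_measure_def)
    fix i \<phi> assume \<phi>: "test_function (annulus a b) \<phi>"
    then have "continuous_on UNIV (partial_deriv i \<phi>)" by (auto simp: test_function_def C1_on_def)
    then have "partial_deriv i \<phi> \<in> borel_measurable borel" by (rule borel_measurable_continuous_onI)
    from int[OF this] show "(LINT x|lborel. partial_deriv i \<phi> x * u' x) = - (LINT x|\<nu>. \<phi> x * \<sigma> x $ i)"
      using g \<phi> by (simp add: is_gradient_measure_def)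
  qed (simp add: u'_def)
  have supp: "inner_kernel a b n r \<noteq> 0 \<Longrightarrow> \<bar>r - a\<bar> \<le> 2 / cutoff_scale a b n"
    "outer_kernel a b n r \<noteq> 0 \<Longrightarrow> \<bar>r - b\<bar> \<le> 2 / cutoff_scale a b n" for n r
    using inner_kernel_eq_0[OF ab(2), of r n] outer_kernel_eq_0[OF ab(2), of n r] cutoff_scale_pos[OF ab(2), of n]
    by (fastforce simp: abs_le_iff)+
  note lim = radial_average_radial_limit[OF ab cont _ _ _ _ _ cutoff_scale_at_top[OF ab(2), of 2], folded u'_def]
  show ?thesis
  proof (rule is_trace_radial_limits[OF ab g bg int])
    show "(\<lambda>n. LINT x|circle_measure. \<bar>radial_average a b u' (inner_kernel a b n) x - U a\<bar>) \<longlonglongrightarrow> 0"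
      by (rule lim) (use ab integral_kernel[OF ab(2)] kernel_bounds[OF ab(2)] supp in auto)
    show "(\<lambda>n. LINT x|circle_measure. \<bar>radial_average a b u' (outer_kernel a b n) x - U b\<bar>) \<longlonglongrightarrow> 0"
      by (rule lim) (use ab integral_kernel[OF ab(2)] kernel_bounds[OF ab(2)] supp in auto)
  qed auto
qed

end

section \<open>The energy of a function of bounded variation\<close>

lemma absolutely_integrable_borel_version:
  fixes k :: "real^'n::finite \<Rightarrow> 'b::euclidean_space"
  assumes f: "integrable lborel f" "\<And>x. x \<notin> S \<Longrightarrow> f x = (0::real)"
    and S: "AE x in lebesgue. x \<in> S \<longrightarrow> f' x = f x"
  shows "(LINT x:S|lebesgue. f' x) = (LINT x|lborel. f x)"
proof -
  have [measurable]: "f \<in> borel_measurable borel" using borel_measurable_integrable[OF f(1)] by simp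
  have ind: "(\<lambda>x. indicator S x *\<^sub>R f x) = f"
    by (rule ext) (use f(2) in \<open>auto simp: indicator_def\<close>)
  have "integrable lebesgue f" using f(1) by (subst integrable_completion) simp_all
  then have si: "f absolutely_integrable_on S" unfolding set_integrable_def ind .
  obtain N where N: "N \<in> null_sets lebesgue" "{x. \<not> (x \<in> S \<longrightarrow> f' x = f x)} \<subseteq> N"
    using S unfolding eventually_ae_filter by auto
  then have neg: "negligible N" by (simp add: negligible_iff_null_sets)
  have eq: "f' x = f x" if "x \<in> S - N" for x using N(2) that by blast
  have si': "f' absolutely_integrable_on S" by (rule absolutely_integrable_spike[OF si neg eq])
  have "(LINT x:S|lebesgue. f' x) = (LINT x:S|lebesgue. f x)"
    unfolding set_lebesgue_integral_eq_integral(2)[OF si] set_lebesgue_integral_eq_integral(2)[OF si']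
    by (rule integral_spike[OF neg]) (rule eq[symmetric])
  also have "\<dots> = (LINT x|lebesgue. f x)" unfolding set_lebesgue_integral_def ind ..
  also have "\<dots> = (LINT x|lborel. f x)" by (rule integral_completion) simp
  finally show ?thesis .
qed

lemma frontier_bounded_mult:
  assumes T: "set_integrable hausdorff1 F T"
    and f: "f \<in> borel_measurable borel" "\<And>x. x \<in> F \<Longrightarrow> \<bar>f x\<bar> \<le> B"
  shows "set_integrable hausdorff1 F (\<lambda>x. f x * T (x::real^2) :: real)"
proof -
  have "integrable hausdorff1 (\<lambda>x. f x * (indicator F x *\<^sub>R T x))"
    by (rule integrable_bounded_mult[OF _ T[unfolded set_integrable_def] _ f]) (auto simp: sets_hausdorff1)
  then show ?thesis by (simp add: set_integrable_def mult.left_commute)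
qed

lemma set_integrable_frontier_const:
  assumes ab: "0 < a" "a < b"
  shows "set_integrable hausdorff1 (frontier (annulus a b)) (\<lambda>_. r :: real)"
  by (subst set_integrable_frontier_annulus[OF ab]) auto

lemma mem_frontier_annulus:
  assumes ab: "0 < a" "a < b"
  shows "x \<in> frontier (annulus a b) \<longleftrightarrow> norm x = a \<or> norm x = b"
  unfolding frontier_annulus[OF ab] by simp

lemma boundary_data_integrable:
  assumes ab: "0 < a" "a < b" and w: "w \<in> BV (annulus a b)"
  shows "set_integrable hausdorff1 (frontier (annulus a b)) (\<lambda>x. \<bar>(if norm x = b then m else m') - annulus_trace a b w x\<bar>)"
proof (intro set_integrable_abs set_integral_diff)
  show "set_integrable hausdorff1 (frontier (annulus a b)) (annulus_trace a b w)"
    using is_trace_trace_on[OF ab w] by (simp add: is_trace_def)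
  have "set_integrable hausdorff1 (frontier (annulus a b)) (\<lambda>x. (if norm x = b then m else m') * 1)"
    by (rule frontier_bounded_mult[OF set_integrable_frontier_const[OF ab], of _ "max \<bar>m\<bar> \<bar>m'\<bar>"]) auto
  then show "set_integrable hausdorff1 (frontier (annulus a b)) (\<lambda>x. if norm x = b then m else m')" by simp
qed

text \<open>The three components of the gradient of \<open>w\<close> that enter the energy: \<open>k\<close> is a Borel version of
  \<open>\<nabla>\<^sup>a w\<close>, and \<open>\<nabla>\<^sup>s w = \<sigma> \<nu>\<close>.\<close>

definition gradient_data :: "real \<Rightarrow> real \<Rightarrow> (real^2 \<Rightarrow> real) \<Rightarrow> (real^2 \<Rightarrow> real^2) \<Rightarrow>
    (real^2) measure \<Rightarrow> (real^2 \<Rightarrow> real^2) \<Rightarrow> bool" where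
  "gradient_data a b w k \<nu> \<sigma> \<longleftrightarrow> w \<in> BV (annulus a b) \<and>
    (\<exists>h. gradient_decomposition (annulus a b) w h \<nu> \<sigma> \<and> borel_version (annulus a b) h k)"

lemma gradient_data_exists:
  assumes "w \<in> BV (annulus a b)"
  obtains k \<nu> \<sigma> where "gradient_data a b w k \<nu> \<sigma>"
proof -
  obtain \<nu> \<sigma> where "is_gradient_measure (annulus a b) w \<nu> \<sigma>" using assms by (auto simp: BV_def)
  from gradient_decomposition_exists[OF this annulus_borel] obtain h \<nu>' \<sigma>'
    where d: "gradient_decomposition (annulus a b) w h \<nu>' \<sigma>'" by blast
  then have "h absolutely_integrable_on annulus a b" by (simp add: gradient_decomposition_def)
  from borel_version_exists[OF this annulus_borel] obtain k where "borel_version (annulus a b) h k" ..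
  then show ?thesis using that assms d unfolding gradient_data_def by blast
qed

lemma gradient_dataD:
  assumes "gradient_data a b w k \<nu> \<sigma>"
  shows "k \<in> borel_measurable borel" "integrable lborel (\<lambda>x. k x $ i)" "x \<notin> annulus a b \<Longrightarrow> k x = 0"
    "polar_measure (annulus a b) \<nu> \<sigma>" "w \<in> BV (annulus a b)"
  using assms borel_versionD[of "annulus a b" _ k]
  unfolding gradient_data_def gradient_decomposition_def by blast+

lemma gradient_data_Gauss_Green:
  assumes ab: "0 < a" "a < b" and d: "gradient_data a b w k \<nu> \<sigma>" and \<phi>: "C1_on UNIV \<phi>"
  shows "(LINT x:annulus a b|lebesgue. w x * partial_deriv i \<phi> x)
      = - ((LINT x|lborel. \<phi> x * k x $ i) + (LINT x|\<nu>. \<phi> x * \<sigma> x $ i))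
        + (LINT x:frontier (annulus a b)|hausdorff1. \<phi> x * annulus_trace a b w x * annulus_normal a b x $ i)"
proof -
  obtain h where h: "gradient_decomposition (annulus a b) w h \<nu> \<sigma>" "borel_version (annulus a b) h k"
    and w: "w \<in> BV (annulus a b)"
    using d unfolding gradient_data_def by blast
  have hi: "h absolutely_integrable_on annulus a b" and pol: "polar_measure (annulus a b) \<nu> \<sigma>"
    and test: "\<And>i \<phi>. test_function (annulus a b) \<phi> \<Longrightarrow>
      (LINT x:annulus a b|lebesgue. w x * partial_deriv i \<phi> x) = - grad_pairing (annulus a b) h \<nu> \<sigma> i \<phi>"
    using h(1) unfolding gradient_decomposition_def grad_pairing_def by blast+
  have m: "\<phi> \<in> borel_measurable borel" by (rule C1_on_measurable(1)[OF \<phi>])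
  show ?thesis
    using trace_Gauss_Green[OF ab is_trace_trace_on[OF ab w] hi pol test \<phi>, of i]
    by (simp add: grad_pairing_def borel_versionD(5)[OF h(2) m])
qed

context linear_growth
begin

lemma g_norm_measurable:
  assumes "k \<in> borel_measurable borel"
  shows "(\<lambda>x. g (norm (k x :: real^2))) \<in> borel_measurable borel"
proof -
  have "continuous_on UNIV (\<lambda>t. g \<bar>t\<bar>)"
    by (intro continuous_at_imp_continuous_on ballI DERIV_isCont[OF DERIV_g_abs])
  then have "(\<lambda>t. g \<bar>t\<bar>) \<in> borel_measurable borel" by (rule borel_measurable_continuous_onI)
  from measurable_compose[OF measurable_compose[OF assms borel_measurable_norm] this] show ?thesis by simp
qed

lemma g_norm_integrable:
  assumes k: "k \<in> borel_measurable borel" "\<And>i. integrable lborel (\<lambda>x. k x $ i)"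
  shows "integrable lborel (\<lambda>x. g (norm (k x :: real^2)))"
proof (rule Bochner_Integration.integrable_bound)
  show "integrable lborel (\<lambda>x. ginf * (\<bar>k x $ 1\<bar> + \<bar>k x $ 2\<bar>))" using k(2) by simp
  show "AE x in lborel. norm (g (norm (k x))) \<le> norm (ginf * (\<bar>k x $ 1\<bar> + \<bar>k x $ 2\<bar>))"
  proof (rule AE_I2)
    fix x
    have "norm (k x) \<le> \<bar>k x $ 1\<bar> + \<bar>k x $ 2\<bar>" using norm_le_l1_cart[of "k x"] by (simp add: sum_2)
    then have le: "ginf * norm (k x) \<le> ginf * (\<bar>k x $ 1\<bar> + \<bar>k x $ 2\<bar>)"
      using ginf_pos by (intro mult_left_mono) auto
    then show "norm (g (norm (k x))) \<le> norm (ginf * (\<bar>k x $ 1\<bar> + \<bar>k x $ 2\<bar>))"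
      using order_trans[OF g_le_ginf le] g_nonneg[of "norm (k x)"] by simp
  qed
qed (use g_norm_measurable[OF k(1)] in simp)

text \<open>The relaxed functional in terms of a representation of the gradient and of the trace \<open>T\<close>, for
  boundary data that are constant on each circle.\<close>

definition energy :: "real \<Rightarrow> real \<Rightarrow> real \<Rightarrow> real \<Rightarrow> (real^2 \<Rightarrow> real^2) \<Rightarrow> (real^2) measure \<Rightarrow> (real^2 \<Rightarrow> real) \<Rightarrow> real" where
  "energy a b m\<^sub>1 m\<^sub>2 k \<nu> T = (LINT x|lborel. g (norm (k x))) + ginf * measure \<nu> (annulus a b)
    + ginf * (LINT x:frontier (annulus a b)|hausdorff1. \<bar>(if norm x = b then m\<^sub>2 else m\<^sub>1) - T x\<bar>)"

lemma integral_g_norm: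
  assumes k: "borel_version S h k" and h': "AE x in lebesgue. x \<in> S \<longrightarrow> h' x = h x"
  shows "(LINT x:S|lebesgue. g (norm (h' x))) = (LINT x|lborel. g (norm (k x :: real^2)))"
proof (rule absolutely_integrable_borel_version)
  show "integrable lborel (\<lambda>x. g (norm (k x)))"
    by (rule g_norm_integrable) (use borel_versionD[OF k] in auto)
  show "AE x in lebesgue. x \<in> S \<longrightarrow> g (norm (h' x)) = g (norm (k x))"
    using h' borel_versionD(4)[OF k] by eventually_elim simp
qed (simp add: borel_versionD(3)[OF k] g_0)

text \<open>The functional is defined by choices of a decomposition and of a trace. The decomposition is unique
  almost everywhere, so the choice does not change the integrals.\<close>

lemma relaxed_functional_eq:
  assumes ab: "0 < a" "a < b" and w: "gradient_data a b w k \<nu> \<sigma>"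
    and u0: "\<And>x. norm x = a \<Longrightarrow> u0 x = m\<^sub>1" "\<And>x. norm x = b \<Longrightarrow> u0 x = m\<^sub>2"
  shows "relaxed_functional a b g u0 w = energy a b m\<^sub>1 m\<^sub>2 k \<nu> (annulus_trace a b w)"
proof -
  let ?W = "annulus a b"
  obtain h where h: "gradient_decomposition ?W w h \<nu> \<sigma>" "borel_version ?W h k"
    using w unfolding gradient_data_def by blast
  have "\<exists>h \<nu> \<sigma>. gradient_decomposition ?W w h \<nu> \<sigma>" using h(1) by blast
  then have "\<exists>\<nu> \<sigma>. gradient_decomposition ?W w (grad_ac ?W w) \<nu> \<sigma>"
    unfolding grad_ac_def by (rule someI_ex)
  then obtain \<nu>1 \<sigma>1 where 1: "gradient_decomposition ?W w (grad_ac ?W w) \<nu>1 \<sigma>1" by blast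
  have "\<exists>\<nu> h \<sigma>. gradient_decomposition ?W w h \<nu> \<sigma>" using h(1) by blast
  then have "\<exists>h \<sigma>. gradient_decomposition ?W w h (grad_sing_variation ?W w) \<sigma>"
    unfolding grad_sing_variation_def by (rule someI_ex)
  then obtain h2 \<sigma>2 where 2: "gradient_decomposition ?W w h2 (grad_sing_variation ?W w) \<sigma>2" by blast
  have ac: "(LINT x:?W|lebesgue. g (norm (grad_ac ?W w x))) = (LINT x|lborel. g (norm (k x)))"
    by (rule integral_g_norm[OF h(2) gradient_decomposition_unique(1)[OF ab 1 h(1)]])
  have sing: "grad_sing_variation ?W w = \<nu>" by (rule gradient_decomposition_unique(2)[OF ab 2 h(1)])
  have bd: "(LINT x:frontier ?W|hausdorff1. \<bar>u0 x - annulus_trace a b w x\<bar>)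
      = (LINT x:frontier ?W|hausdorff1. \<bar>(if norm x = b then m\<^sub>2 else m\<^sub>1) - annulus_trace a b w x\<bar>)"
    by (rule set_lebesgue_integral_cong) (use ab u0 in \<open>auto simp: mem_frontier_annulus sets_hausdorff1\<close>)
  show ?thesis
    unfolding relaxed_functional_def Let_def energy_def recession_slope_eq ac sing bd ..
qed

text \<open>A Sobolev function has no singular part, and the boundary term on the outer circle vanishes by
  admissibility.\<close>

lemma inner_relaxed_functional_eq:
  assumes ab: "0 < a" "a < b" and w: "w \<in> outer_admissible a b m\<^sub>2"
    and D: "has_weak_gradient (annulus a b) w D" and k: "borel_version (annulus a b) D k"
  shows "inner_relaxed_functional a b g m\<^sub>1 w = energy a b m\<^sub>1 m\<^sub>2 k (null_measure borel) (annulus_trace a b w)"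
proof -
  let ?W = "annulus a b" and ?T = "annulus_trace a b w"
  have wW: "w \<in> W11 ?W" and T: "AE x in hausdorff1. norm x = b \<longrightarrow> ?T x = m\<^sub>2"
    using w by (auto simp: outer_admissible_def)
  have "has_weak_gradient ?W w (weak_gradient ?W w)"
    unfolding weak_gradient_def by (rule someI[of "has_weak_gradient ?W w", OF D])
  then have ac: "(LINT x:?W|lebesgue. g (norm (weak_gradient ?W w x))) = (LINT x|lborel. g (norm (k x)))"
    by (intro integral_g_norm[OF k] weak_gradient_AE_unique[OF ab]) (use D in auto)
  have "w \<in> BV ?W" using wW W11_subset_BV[OF annulus_borel] by blast
  from boundary_data_integrable[OF ab this, of m\<^sub>2 m\<^sub>1]
  have m3: "(\<lambda>x. indicator (frontier ?W) x *\<^sub>R \<bar>(if norm x = b then m\<^sub>2 else m\<^sub>1) - ?T x\<bar>) \<in> borel_measurable hausdorff1"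
    unfolding set_integrable_def by (rule borel_measurable_integrable)
  have "(\<lambda>x. indicator (sphere 0 a) x *\<^sub>R (indicator (frontier ?W) x *\<^sub>R
      \<bar>(if norm x = b then m\<^sub>2 else m\<^sub>1) - ?T x\<bar>)) \<in> borel_measurable hausdorff1"
    by (rule borel_measurable_scaleR[OF borel_measurable_indicator m3]) (simp add: sets_hausdorff1)
  moreover have "(\<lambda>x. indicator (sphere 0 a) x *\<^sub>R (indicator (frontier ?W) x *\<^sub>R
      \<bar>(if norm x = b then m\<^sub>2 else m\<^sub>1) - ?T x\<bar>)) = (\<lambda>x. indicator {x. norm x = a} x *\<^sub>R \<bar>?T x - m\<^sub>1\<bar>)"
    using mem_frontier_annulus[OF ab] ab by (auto simp: indicator_def fun_eq_iff)
  ultimately have m2: "(\<lambda>x. indicator {x. norm x = a} x *\<^sub>R \<bar>?T x - m\<^sub>1\<bar>) \<in> borel_measurable hausdorff1" by simp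
  have bd: "(LINT x:{x. norm x = a}|hausdorff1. \<bar>?T x - m\<^sub>1\<bar>)
      = (LINT x:frontier ?W|hausdorff1. \<bar>(if norm x = b then m\<^sub>2 else m\<^sub>1) - ?T x\<bar>)"
    unfolding set_lebesgue_integral_def
  proof (rule integral_cong_AE[OF m2 m3])
    show "AE x in hausdorff1. indicator {x. norm x = a} x *\<^sub>R \<bar>?T x - m\<^sub>1\<bar>
      = indicator (frontier ?W) x *\<^sub>R \<bar>(if norm x = b then m\<^sub>2 else m\<^sub>1) - ?T x\<bar>"
      using T by eventually_elim (use mem_frontier_annulus[OF ab] ab in \<open>auto simp: indicator_def\<close>)
  qed
  show ?thesis
    unfolding inner_relaxed_functional_def energy_def recession_slope_eq ac bd by simp
qed

end

section \<open>Calibration\<close>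

locale optimal_radial_solution = radial_solution +
  fixes m\<^sub>1 :: real
  assumes optimal: "U a = m\<^sub>1 \<or> c = ginf * a \<and> m\<^sub>1 \<le> U a \<or> c = - (ginf * a) \<and> U a \<le> m\<^sub>1"
begin

definition Z :: "real^2 \<Rightarrow> real^2" where "Z x = (\<chi> i. calibration a c i x)"

lemma Z_inner: "Z x \<bullet> p = calibration a c 1 x * p $ 1 + calibration a c 2 x * p $ 2"
  by (simp add: Z_def inner_vec_def sum_2)

lemma Z_eq: "a \<le> norm x \<Longrightarrow> Z x = (c / (norm x)\<^sup>2) *\<^sub>R x"
  using calibration_eq[OF ab(1)] by (simp add: Z_def vec_eq_iff)

lemma norm_Z:
  assumes "a \<le> norm x"
  shows "norm (Z x) = \<bar>c\<bar> / norm x"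
proof -
  have "0 < norm x" using assms ab by linarith
  then show ?thesis unfolding Z_eq[OF assms] by (simp add: power2_eq_square abs_div abs_mult)
qed

lemma norm_Z_less: "a < norm x \<Longrightarrow> norm (Z x) < ginf"
  using abs_div_less_ginf[OF ab(1) c(1), of "norm x"] norm_Z[of x] by (simp add: abs_divide)

lemma Z_normal:
  assumes "x \<in> frontier (annulus a b)"
  shows "Z x \<bullet> annulus_normal a b x = (if norm x = b then c / b else - (c / a))"
proof -
  have x: "norm x = a \<or> norm x = b" using assms mem_frontier_annulus[OF ab] by blast
  then have n: "norm x \<noteq> 0" "a \<le> norm x" using ab by auto
  have "Z x \<bullet> x = c / (norm x)\<^sup>2 * (norm x)\<^sup>2"
    unfolding Z_eq[OF n(2)] inner_scaleR_left power2_norm_eq_inner ..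
  then have "Z x \<bullet> x = c" using n by simp
  then show ?thesis using x ab by (auto simp: annulus_normal_def divide_inverse mult.commute)
qed

text \<open>Let \<open>t\<close> be the component of \<open>p\<close> in the direction \<open>x / |x|\<close>. Then \<open>g |p| \<ge> g |t|\<close> since \<open>g\<close>
  increases, and \<open>g |t|\<close> lies above its tangent at \<open>V c |x|\<close>, whose slope is
  \<open>c / |x|\<close>. One of the two inequalities is strict unless \<open>p\<close> is the gradient of \<open>u\<close>.\<close>

lemma integrand_le:
  assumes x: "x \<in> annulus a b"
  shows "g (norm (Du x)) - Z x \<bullet> Du x \<le> g (norm p) - Z x \<bullet> p"
    and "g (norm p) - Z x \<bullet> p \<le> g (norm (Du x)) - Z x \<bullet> Du x \<Longrightarrow> p = Du x"
proof -
  define r e t v where "r = norm x" and "e = sgn x" and "t = sgn x \<bullet> p" and "v = V c r"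
  have r: "a < r" "0 < r" using x ab by (auto simp: annulus_def r_def)
  have e: "norm e = 1" "e \<bullet> e = 1" using r by (auto simp: e_def norm_sgn r_def power2_norm_eq_inner[symmetric])
  have Z: "Z x = (c / r) *\<^sub>R e"
    using r Z_eq[of x] by (simp add: r_def e_def sgn_div_norm power2_eq_square divide_inverse)
  have D: "Du x = v *\<^sub>R e" using x by (simp add: Du_def v_def e_def r_def)
  have G: "G v = c / r" unfolding v_def V_def by (rule G_H[OF abs_div_less_ginf[OF ab(1) c(1) r(1)]])
  have nD: "norm (Du x) = \<bar>v\<bar>" by (simp add: D e)
  have ZD: "Z x \<bullet> Du x = G v * v" by (simp add: Z D e G)
  have Zp: "Z x \<bullet> p = G v * t" by (simp add: Z G t_def e_def)
  have tp: "\<bar>t\<bar> \<le> norm p" using Cauchy_Schwarz_ineq2[of e p] e by (simp add: t_def e_def)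
  have gt: "g \<bar>t\<bar> \<le> g (norm p)" using g_strict_mono[of "\<bar>t\<bar>" "norm p"] tp by (cases "\<bar>t\<bar> = norm p") auto
  have tan: "g \<bar>v\<bar> + G v * (t - v) \<le> g \<bar>t\<bar>" by (rule g_abs_tangent)
  show "g (norm (Du x)) - Z x \<bullet> Du x \<le> g (norm p) - Z x \<bullet> p"
    unfolding nD ZD Zp using gt tan by (simp add: algebra_simps)
  assume "g (norm p) - Z x \<bullet> p \<le> g (norm (Du x)) - Z x \<bullet> Du x"
  then have le: "g (norm p) \<le> g \<bar>v\<bar> + G v * (t - v)" unfolding nD ZD Zp by (simp add: algebra_simps)
  have tv: "t = v" using g_abs_tangent_strict[of t v] le gt by fastforce
  have "norm p = \<bar>t\<bar>" using g_strict_mono[of "\<bar>t\<bar>" "norm p"] tp le tv by force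
  then have "(norm p)\<^sup>2 = t\<^sup>2" by simp
  then have pp: "p \<bullet> p = t * t" by (simp only: power2_norm_eq_inner) (simp add: power2_eq_square)
  have ep: "e \<bullet> p = t" "p \<bullet> e = t" by (simp_all add: t_def e_def inner_commute)
  have "(p - t *\<^sub>R e) \<bullet> (p - t *\<^sub>R e) = 0"
    by (simp add: inner_diff_left inner_diff_right pp ep e)
  then show "p = Du x" by (simp add: D tv)
qed

text \<open>Both inequalities say that \<open>s\<close> has at most the slope \<open>ginf\<close> of the penalty. On the inner circle the left side is
  the minimum also for \<open>t \<noteq> d\<close> since then \<open>\<bar>s\<bar> = ginf\<close> and the two terms
  compensate each other. On the outer circle \<open>\<bar>s\<bar> < ginf\<close>.\<close>

lemma boundary_le:
  assumes x: "x \<in> frontier (annulus a b)"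
  defines "d \<equiv> (if norm x = b then m else m\<^sub>1)" and "s \<equiv> (if norm x = b then c / b else - (c / a))"
    and "t \<equiv> (if norm x = b then m else U a)"
  shows "ginf * \<bar>d - t\<bar> + s * t \<le> ginf * \<bar>d - T\<bar> + s * T"
    and "norm x = b \<Longrightarrow> ginf * \<bar>d - T\<bar> + s * T \<le> ginf * \<bar>d - t\<bar> + s * t \<Longrightarrow> T = m"
proof -
  have abs: "\<bar>s' * (d - T)\<bar> \<le> ginf * \<bar>d - T\<bar>" if "\<bar>s'\<bar> \<le> ginf" for s' d T :: real
    unfolding abs_mult using that by (intro mult_right_mono) auto
  have outer: "\<bar>c / b\<bar> < ginf" by (rule abs_div_less_ginf[OF ab(1) c(1) ab(2)])
  have inner: "\<bar>c / a\<bar> \<le> ginf" using c(1) ab by (simp add: abs_divide divide_le_eq)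
  show "ginf * \<bar>d - t\<bar> + s * t \<le> ginf * \<bar>d - T\<bar> + s * T"
  proof (cases "norm x = b")
    case True
    then have "d = m" "t = m" "s = c / b" by (simp_all add: d_def t_def s_def)
    moreover have "c / b * (m - T) \<le> ginf * \<bar>m - T\<bar>" using abs[of "c / b" m T] outer by linarith
    ultimately show ?thesis by (simp only: right_diff_distrib) simp
  next
    case False
    then have dts: "d = m\<^sub>1" "t = U a" "s = - (c / a)" by (simp_all add: d_def t_def s_def)
    have le: "- (c / a) * (m\<^sub>1 - T) \<le> ginf * \<bar>m\<^sub>1 - T\<bar>" using abs[of "c / a" m\<^sub>1 T] inner by linarith
    have eq: "ginf * \<bar>m\<^sub>1 - U a\<bar> = - (c / a) * (m\<^sub>1 - U a)"
      using optimal
    proof (elim disjE conjE)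
      assume "c = ginf * a" "m\<^sub>1 \<le> U a"
      then have "c / a = ginf" "\<bar>m\<^sub>1 - U a\<bar> = U a - m\<^sub>1" using ab by auto
      then show ?thesis by (simp add: algebra_simps)
    next
      assume "c = - (ginf * a)" "U a \<le> m\<^sub>1"
      then have "c / a = - ginf" "\<bar>m\<^sub>1 - U a\<bar> = m\<^sub>1 - U a" using ab by auto
      then show ?thesis by simp
    qed simp
    have "ginf * \<bar>m\<^sub>1 - U a\<bar> + - (c / a) * U a = - (c / a) * m\<^sub>1" unfolding eq by (simp only: right_diff_distrib)
    moreover have "- (c / a) * m\<^sub>1 \<le> ginf * \<bar>m\<^sub>1 - T\<bar> + - (c / a) * T"
      using le by (simp only: right_diff_distrib)
    ultimately show ?thesis unfolding dts by linarith
  qed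
  assume n: "norm x = b" and le: "ginf * \<bar>d - T\<bar> + s * T \<le> ginf * \<bar>d - t\<bar> + s * t"
  show "T = m"
  proof (rule ccontr)
    assume "T \<noteq> m"
    then have "\<bar>c / b\<bar> * \<bar>m - T\<bar> < ginf * \<bar>m - T\<bar>" using outer by (intro mult_strict_right_mono) auto
    then have "c / b * (m - T) < ginf * \<bar>m - T\<bar>" unfolding abs_mult[symmetric] by linarith
    moreover have "ginf * \<bar>m - T\<bar> + c / b * T \<le> c / b * m" using le n by (simp add: d_def t_def s_def)
    ultimately show False by (simp only: right_diff_distrib)
  qed
qed

lemma calibration_bounded: "\<exists>B. \<forall>x. norm x \<le> b \<longrightarrow> \<bar>calibration a c i x\<bar> \<le> B"
proof -
  have "continuous_on (cball 0 b) (calibration a c i)"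
    by (rule continuous_on_subset[OF C1_onD(3)[OF C1_on_calibration[OF ab(1)]]]) simp
  then have "\<exists>B. \<forall>x\<in>cball 0 b. \<bar>calibration a c i x\<bar> \<le> B" by (intro continuous_on_compact_bound) auto
  then show ?thesis by (simp add: Ball_def)
qed

lemma calibration_measurable [measurable]: "calibration a c i \<in> borel_measurable borel"
  by (rule C1_on_measurable(1)[OF C1_on_calibration[OF ab(1)]])

text \<open>The integrals of \<open>Z\<close> against the gradient and of the trace against \<open>Z \<bullet> n\<close> add up to zero, since
  \<open>Z\<close> is divergence free.\<close>

theorem energy_calibrated:
  assumes w: "gradient_data a b w k \<nu> \<sigma>"
  defines "T \<equiv> annulus_trace a b w"
  shows "integrable lborel (\<lambda>x. g (norm (k x)) - Z x \<bullet> k x)"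
    and "integrable \<nu> (\<lambda>x. ginf - Z x \<bullet> \<sigma> x)"
    and "set_integrable hausdorff1 (frontier (annulus a b))
      (\<lambda>x. ginf * \<bar>(if norm x = b then m else m\<^sub>1) - T x\<bar> + (if norm x = b then c / b else - (c / a)) * T x)"
    and "energy a b m\<^sub>1 m k \<nu> T = (LINT x|lborel. g (norm (k x)) - Z x \<bullet> k x) + (LINT x|\<nu>. ginf - Z x \<bullet> \<sigma> x)
      + (LINT x:frontier (annulus a b)|hausdorff1.
          ginf * \<bar>(if norm x = b then m else m\<^sub>1) - T x\<bar> + (if norm x = b then c / b else - (c / a)) * T x)"
proof -
  let ?W = "annulus a b" and ?d = "\<lambda>x::real^2. if norm x = b then m else m\<^sub>1"
    and ?s = "\<lambda>x::real^2. if norm x = b then c / b else - (c / a)"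
    and ?z = "calibration a c"
  let ?F = "frontier ?W"
  have F: "norm x = a \<or> norm x = b" if "x \<in> ?F" for x using that mem_frontier_annulus[OF ab] by blast
  have k: "k \<in> borel_measurable borel" "integrable lborel (\<lambda>x. k x $ i)" for i
    using gradient_dataD[OF w] by auto
  have pol: "polar_measure ?W \<nu> \<sigma>" by (rule gradient_dataD(4)[OF w])
  note \<nu> = polar_measureD[OF pol annulus_borel]
  interpret \<nu>: finite_measure \<nu> by (rule \<nu>(2))
  have tr: "is_trace ?W (annulus_normal a b) w T"
    unfolding T_def by (rule is_trace_trace_on[OF ab gradient_dataD(5)[OF w]])
  have Ti: "set_integrable hausdorff1 ?F T" using tr by (simp add: is_trace_def)
  have zk: "integrable lborel (\<lambda>x. ?z i x * k x $ i)" for i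
  proof -
    obtain B where B: "\<And>x. norm x \<le> b \<Longrightarrow> \<bar>?z i x\<bar> \<le> B" using calibration_bounded[of i] by blast
    show ?thesis
      by (rule integrable_bounded_mult[where \<Omega> = ?W and B = B])
        (use k gradient_dataD(3)[OF w] B in \<open>auto simp: annulus_def\<close>)
  qed
  have z\<sigma>: "integrable \<nu> (\<lambda>x. ?z i x * \<sigma> x $ i)" for i
  proof -
    obtain B where B: "\<And>x. norm x \<le> b \<Longrightarrow> \<bar>?z i x\<bar> \<le> B" using calibration_bounded[of i] by blast
    show ?thesis
      by (rule integrable_bounded_mult[where \<Omega> = ?W and B = B, OF \<nu>(1,6,7)]) (use B in \<open>auto simp: annulus_def\<close>)
  qed
  have zT: "set_integrable hausdorff1 ?F (\<lambda>x. ?z i x * T x * annulus_normal a b x $ i)" for i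
  proof -
    obtain B where B: "\<And>x. norm x \<le> b \<Longrightarrow> \<bar>?z i x\<bar> \<le> B" using calibration_bounded[of i] by blast
    have "\<bar>?z i x * annulus_normal a b x $ i\<bar> \<le> B * 1" if "x \<in> ?F" for x
      unfolding abs_mult using F[OF that] B[of x] ab abs_annulus_normal_le[OF ab that, of i]
      by (intro mult_mono) auto
    from frontier_bounded_mult[OF Ti, of "\<lambda>x. ?z i x * annulus_normal a b x $ i", OF _ this]
    show ?thesis by (simp add: mult_ac)
  qed
  have sT: "set_integrable hausdorff1 ?F (\<lambda>x. ?s x * T x)"
    by (rule frontier_bounded_mult[OF Ti, of _ "max \<bar>c / b\<bar> \<bar>c / a\<bar>"]) (use ab in auto)
  have dT: "set_integrable hausdorff1 ?F (\<lambda>x. \<bar>?d x - T x\<bar>)"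
    unfolding T_def by (rule boundary_data_integrable[OF ab gradient_dataD(5)[OF w]])
  have gg: "(LINT x:?W|lebesgue. w x * partial_deriv i (?z i) x)
      = - ((LINT x|lborel. ?z i x * k x $ i) + (LINT x|\<nu>. ?z i x * \<sigma> x $ i))
        + (LINT x:?F|hausdorff1. ?z i x * T x * annulus_normal a b x $ i)" for i
    unfolding T_def by (rule gradient_data_Gauss_Green[OF ab w C1_on_calibration[OF ab(1)]])
  have wi: "w absolutely_integrable_on ?W" using gradient_dataD(5)[OF w] by (simp add: BV_def)
  have "(LINT x:?W|lebesgue. w x * partial_deriv 2 (?z 2) x)
      = (LINT x:?W|lebesgue. - (w x * partial_deriv 1 (?z 1) x))"
  proof (rule set_lebesgue_integral_cong)
    show "\<forall>x. x \<in> ?W \<longrightarrow> w x * partial_deriv 2 (?z 2) x = - (w x * partial_deriv 1 (?z 1) x)"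
    proof (intro allI impI)
      fix x assume "x \<in> ?W"
      then have "partial_deriv 2 (?z 2) x = - partial_deriv 1 (?z 1) x"
        using div_calibration[OF ab(1), of x c] by (simp add: annulus_def)
      then show "w x * partial_deriv 2 (?z 2) x = - (w x * partial_deriv 1 (?z 1) x)" by simp
    qed
  qed simp
  also have "\<dots> = - (LINT x:?W|lebesgue. w x * partial_deriv 1 (?z 1) x)" by (simp add: set_lebesgue_integral_def)
  finally have sum0: "(LINT x:?W|lebesgue. w x * partial_deriv 1 (?z 1) x)
      + (LINT x:?W|lebesgue. w x * partial_deriv 2 (?z 2) x) = 0" by simp
  have Zk: "integrable lborel (\<lambda>x. Z x \<bullet> k x)"
    "(LINT x|lborel. Z x \<bullet> k x) = (LINT x|lborel. ?z 1 x * k x $ 1) + (LINT x|lborel. ?z 2 x * k x $ 2)"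
    unfolding Z_inner using zk by simp_all
  have Z\<sigma>: "integrable \<nu> (\<lambda>x. Z x \<bullet> \<sigma> x)"
    "(LINT x|\<nu>. Z x \<bullet> \<sigma> x) = (LINT x|\<nu>. ?z 1 x * \<sigma> x $ 1) + (LINT x|\<nu>. ?z 2 x * \<sigma> x $ 2)"
    unfolding Z_inner using z\<sigma> by simp_all
  have "(LINT x:?F|hausdorff1. ?s x * T x)
      = (LINT x:?F|hausdorff1. ?z 1 x * T x * annulus_normal a b x $ 1 + ?z 2 x * T x * annulus_normal a b x $ 2)"
    by (rule set_lebesgue_integral_cong) (auto simp: sets_hausdorff1 Z_normal[symmetric] Z_inner algebra_simps)
  also have "\<dots> = (LINT x:?F|hausdorff1. ?z 1 x * T x * annulus_normal a b x $ 1)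
      + (LINT x:?F|hausdorff1. ?z 2 x * T x * annulus_normal a b x $ 2)"
    by (rule set_integral_add(2)[OF zT zT])
  finally have id: "(LINT x|lborel. Z x \<bullet> k x) + (LINT x|\<nu>. Z x \<bullet> \<sigma> x) = (LINT x:?F|hausdorff1. ?s x * T x)"
    using sum0 gg[of 1] gg[of 2] Zk(2) Z\<sigma>(2) by linarith
  have gk: "integrable lborel (\<lambda>x. g (norm (k x)))" by (rule g_norm_integrable[OF k])
  show "integrable lborel (\<lambda>x. g (norm (k x)) - Z x \<bullet> k x)" "integrable \<nu> (\<lambda>x. ginf - Z x \<bullet> \<sigma> x)"
    using gk Zk(1) Z\<sigma>(1) by auto
  have gd: "set_integrable hausdorff1 ?F (\<lambda>x. ginf * \<bar>?d x - T x\<bar>)" using dT by simp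
  show "set_integrable hausdorff1 ?F (\<lambda>x. ginf * \<bar>?d x - T x\<bar> + ?s x * T x)"
    by (rule set_integral_add(1)[OF gd sT])
  have "measure \<nu> ?W = measure \<nu> (space \<nu>)"
    by (rule \<nu>.finite_measure_eq_AE) (use \<nu>(1,3) in auto)
  then have 2: "(LINT x|\<nu>. ginf - Z x \<bullet> \<sigma> x) = ginf * measure \<nu> ?W - (LINT x|\<nu>. Z x \<bullet> \<sigma> x)"
    using Z\<sigma>(1) by (simp add: mult.commute)
  have 3: "(LINT x:?F|hausdorff1. ginf * \<bar>?d x - T x\<bar> + ?s x * T x)
      = ginf * (LINT x:?F|hausdorff1. \<bar>?d x - T x\<bar>) + (LINT x:?F|hausdorff1. ?s x * T x)"
    by (subst set_integral_add(2)[OF gd sT]) simp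
  have 1: "(LINT x|lborel. g (norm (k x)) - Z x \<bullet> k x) = (LINT x|lborel. g (norm (k x))) - (LINT x|lborel. Z x \<bullet> k x)"
    by (rule Bochner_Integration.integral_diff[OF gk Zk(1)])
  show "energy a b m\<^sub>1 m k \<nu> T = (LINT x|lborel. g (norm (k x)) - Z x \<bullet> k x) + (LINT x|\<nu>. ginf - Z x \<bullet> \<sigma> x)
      + (LINT x:?F|hausdorff1. ginf * \<bar>?d x - T x\<bar> + ?s x * T x)"
    unfolding 1 2 3 energy_def using id by linarith
qed

lemma gradient_data_u: "gradient_data a b u Du (null_measure borel) (\<lambda>_. 0)"
  using gradient_decomposition_u borel_version_Du u_W11 W11_subset_BV[OF annulus_borel]
  unfolding gradient_data_def by blast

lemma trace_u: "AE x in hausdorff1. x \<in> frontier (annulus a b) \<longrightarrow>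
    annulus_trace a b u x = (if norm x = b then m else U a)"
  using trace_unique[OF ab is_trace_trace_on[OF ab gradient_dataD(5)[OF gradient_data_u]] is_trace_u]
  by eventually_elim (auto simp: glue_trace_def)

theorem
  assumes w: "gradient_data a b w k \<nu> \<sigma>"
  shows energy_minimal: "energy a b m\<^sub>1 m Du (null_measure borel) (annulus_trace a b u)
      \<le> energy a b m\<^sub>1 m k \<nu> (annulus_trace a b w)"
    and energy_equality: "energy a b m\<^sub>1 m k \<nu> (annulus_trace a b w)
        \<le> energy a b m\<^sub>1 m Du (null_measure borel) (annulus_trace a b u) \<Longrightarrow>
      (AE x in lborel. k x = Du x) \<and> (AE x in \<nu>. False) \<and>
      (AE x in hausdorff1. norm x = b \<longrightarrow> annulus_trace a b w x = m)"
proof -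
  let ?W = "annulus a b" and ?d = "\<lambda>x::real^2. if norm x = b then m else m\<^sub>1"
    and ?s = "\<lambda>x::real^2. if norm x = b then c / b else - (c / a)"
  let ?F = "frontier ?W"
  define T where "T = annulus_trace a b w"
  define S where "S = annulus_trace a b u"
  note w4 = energy_calibrated[OF w, folded T_def]
  note u4 = energy_calibrated[OF gradient_data_u, folded S_def]
  note \<nu> = polar_measureD[OF gradient_dataD(4)[OF w] annulus_borel]
  define f where "f x = (g (norm (k x)) - Z x \<bullet> k x) - (g (norm (Du x)) - Z x \<bullet> Du x)" for x
  define p where "p x = ginf - Z x \<bullet> \<sigma> x" for x
  define q where "q x = indicator ?F x *\<^sub>R (ginf * \<bar>?d x - T x\<bar> + ?s x * T x)
    - indicator ?F x *\<^sub>R (ginf * \<bar>?d x - S x\<bar> + ?s x * S x)" for x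
  have fi: "integrable lborel f" unfolding f_def[abs_def] using w4(1) u4(1) by simp
  have pi: "integrable \<nu> p" unfolding p_def[abs_def] by (rule w4(2))
  have qi: "integrable hausdorff1 q"
    unfolding q_def[abs_def] using w4(3) u4(3) unfolding set_integrable_def by (rule Bochner_Integration.integrable_diff)
  have diff: "energy a b m\<^sub>1 m k \<nu> T - energy a b m\<^sub>1 m Du (null_measure borel) S
      = (LINT x|lborel. f x) + (LINT x|\<nu>. p x) + (LINT x|hausdorff1. q x)"
  proof -
    have "(LINT x|lborel. f x) = (LINT x|lborel. g (norm (k x)) - Z x \<bullet> k x) - (LINT x|lborel. g (norm (Du x)) - Z x \<bullet> Du x)"
      unfolding f_def by (rule Bochner_Integration.integral_diff[OF w4(1) u4(1)])
    moreover have "(LINT x|hausdorff1. q x) = (LINT x:?F|hausdorff1. ginf * \<bar>?d x - T x\<bar> + ?s x * T x)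
      - (LINT x:?F|hausdorff1. ginf * \<bar>?d x - S x\<bar> + ?s x * S x)"
      unfolding q_def set_lebesgue_integral_def
      by (rule Bochner_Integration.integral_diff[OF w4(3)[unfolded set_integrable_def] u4(3)[unfolded set_integrable_def]])
    ultimately show ?thesis unfolding w4(4) u4(4) p_def by simp
  qed
  have f0: "0 \<le> f x" for x
    using integrand_le(1)[of x "k x"] gradient_dataD(3)[OF w, of x]
    by (cases "x \<in> ?W") (auto simp: f_def Du_def)
  have p0: "AE x in \<nu>. 0 < p x"
    using \<nu>(3,5)
  proof eventually_elim
    case (elim x)
    have "Z x \<bullet> \<sigma> x \<le> norm (Z x) * norm (\<sigma> x)" by (rule norm_cauchy_schwarz)
    then show ?case using elim norm_Z_less[of x] by (simp add: p_def annulus_def)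
  qed
  have q0: "AE x in hausdorff1. 0 \<le> q x \<and> (q x = 0 \<longrightarrow> norm x = b \<longrightarrow> T x = m)"
    using trace_u[folded S_def]
  proof eventually_elim
    case (elim x)
    show ?case
    proof (cases "x \<in> ?F")
      case False
      then have "norm x \<noteq> b" using mem_frontier_annulus[OF ab, of x] by blast
      then show ?thesis using False by (simp add: q_def)
    next
      case True
      have "S x = (if norm x = b then m else U a)" using elim True by blast
      then have q: "q x = (ginf * \<bar>?d x - T x\<bar> + ?s x * T x)
          - (ginf * \<bar>?d x - (if norm x = b then m else U a)\<bar> + ?s x * (if norm x = b then m else U a))"
        using True by (simp only: q_def indicator_simps scaleR_one)
      show ?thesis using boundary_le[OF True, of "T x"] unfolding q by argo
    qed
  qed
  have F0: "0 \<le> (LINT x|lborel. f x)" by (rule integral_nonneg_AE) (simp add: f0)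
  have P0: "0 \<le> (LINT x|\<nu>. p x)" by (rule integral_nonneg_AE) (use p0 in eventually_elim, simp)
  have Q0: "0 \<le> (LINT x|hausdorff1. q x)" by (rule integral_nonneg_AE) (use q0 in eventually_elim, simp)
  show "energy a b m\<^sub>1 m Du (null_measure borel) (annulus_trace a b u) \<le> energy a b m\<^sub>1 m k \<nu> (annulus_trace a b w)"
    unfolding T_def[symmetric] S_def[symmetric] using diff F0 P0 Q0 by linarith
  assume "energy a b m\<^sub>1 m k \<nu> (annulus_trace a b w) \<le> energy a b m\<^sub>1 m Du (null_measure borel) (annulus_trace a b u)"
  then have z: "(LINT x|lborel. f x) = 0" "(LINT x|\<nu>. p x) = 0" "(LINT x|hausdorff1. q x) = 0"
    using diff F0 P0 Q0 unfolding T_def[symmetric] S_def[symmetric] by linarith+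
  have "AE x in lborel. f x = 0" using z(1) integral_nonneg_eq_0_iff_AE[OF fi] f0 by simp
  then have 1: "AE x in lborel. k x = Du x"
  proof eventually_elim
    case (elim x)
    show ?case
    proof (cases "x \<in> ?W")
      case True
      show ?thesis by (rule integrand_le(2)[OF True]) (use elim in \<open>simp add: f_def\<close>)
    qed (simp add: gradient_dataD(3)[OF w] Du_def)
  qed
  have p0': "AE x in \<nu>. 0 \<le> p x" using p0 by eventually_elim simp
  have "AE x in \<nu>. p x = 0" using z(2) integral_nonneg_eq_0_iff_AE[OF pi p0'] by blast
  then have 2: "AE x in \<nu>. False" using p0 by eventually_elim simp
  have q0': "AE x in hausdorff1. 0 \<le> q x" using q0 by eventually_elim simp
  have "AE x in hausdorff1. q x = 0" using z(3) integral_nonneg_eq_0_iff_AE[OF qi q0'] by blast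
  then have 3: "AE x in hausdorff1. norm x = b \<longrightarrow> T x = m" using q0 by eventually_elim blast
  show "(AE x in lborel. k x = Du x) \<and> (AE x in \<nu>. False) \<and>
      (AE x in hausdorff1. norm x = b \<longrightarrow> annulus_trace a b w x = m)"
    using 1 2 3 unfolding T_def by blast
qed

text \<open>By the equality case, \<open>w\<close> and \<open>u\<close> have the same gradient and the same trace on the outer circle,
  so the Gauss-Green formula shows that their difference satisfies the hypothesis of
  \<open>AE_zero_of_zero_gradient\<close>.\<close>

theorem energy_unique:
  assumes w: "gradient_data a b w k \<nu> \<sigma>"
    and le: "energy a b m\<^sub>1 m k \<nu> (annulus_trace a b w)
      \<le> energy a b m\<^sub>1 m Du (null_measure borel) (annulus_trace a b u)"
  shows "AE x in lebesgue. x \<in> annulus a b \<longrightarrow> w x = u x"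
proof -
  let ?W = "annulus a b" and ?n = "\<lambda>i x. annulus_normal a b x $ i"
  let ?F = "frontier ?W"
  have k: "AE x in lborel. k x = Du x" and \<nu>0: "AE x in \<nu>. False"
    and T: "AE x in hausdorff1. norm x = b \<longrightarrow> annulus_trace a b w x = m"
    using energy_equality[OF w le] by blast+
  have wBV: "w \<in> BV ?W" by (rule gradient_dataD(5)[OF w])
  then have wi: "w absolutely_integrable_on ?W" by (simp add: BV_def)
  show ?thesis
  proof (rule borel_representative[OF wi annulus_borel], rule borel_representative[OF u_absolutely_integrable annulus_borel])
    fix w' u' assume w': "w' \<in> borel_measurable borel" "integrable lborel w'" "\<And>x. x \<notin> ?W \<Longrightarrow> w' x = 0"
    "AE x in lebesgue. x \<in> ?W \<longrightarrow> w x = w' x"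
    "\<And>F. F \<in> borel_measurable borel \<Longrightarrow> (LINT x:?W|lebesgue. w x * F x) = (LINT x|lborel. w' x * F x)"
    and u': "u' \<in> borel_measurable borel" "integrable lborel u'" "\<And>x. x \<notin> ?W \<Longrightarrow> u' x = 0"
    "AE x in lebesgue. x \<in> ?W \<longrightarrow> u x = u' x"
    "\<And>F. F \<in> borel_measurable borel \<Longrightarrow> (LINT x:?W|lebesgue. u x * F x) = (LINT x|lborel. u' x * F x)"
  have "AE x in lebesgue. w' x - u' x = 0"
  proof (rule AE_zero_of_zero_gradient[OF ab])
    show "integrable lborel (\<lambda>x. w' x - u' x)" using w' u' by simp
    show "w' x - u' x = 0" if "x \<notin> ?W" for x using w'(3) u'(3) that by simp
    fix \<psi> :: "real^2 \<Rightarrow> real" and i e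
    assume \<psi>: "C1_on UNIV \<psi>" and e: "0 < e" "\<And>x. norm x \<le> a + e \<Longrightarrow> \<psi> x = 0"
    let ?D = "partial_deriv i \<psi>"
    have dc: "continuous_on UNIV ?D" by (rule C1_onD(4)[OF \<psi>])
    have dm: "?D \<in> borel_measurable borel" by (rule borel_measurable_continuous_onI[OF dc])
    have [measurable]: "\<psi> \<in> borel_measurable borel" by (rule C1_on_measurable(1)[OF \<psi>])
    have "\<exists>B. \<forall>x\<in>cball 0 b. \<bar>?D x\<bar> \<le> B"
      by (rule continuous_on_compact_bound[OF _ continuous_on_subset[OF dc]]) auto
    then obtain B where "\<forall>x\<in>cball 0 b. \<bar>?D x\<bar> \<le> B" by blast
    then have B: "\<bar>?D x\<bar> \<le> B" if "x \<in> ?W" for x using that by (simp add: annulus_def)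
    have int: "integrable lborel (\<lambda>x. ?D x * w' x)" "integrable lborel (\<lambda>x. ?D x * u' x)"
      by (rule integrable_bounded_mult[where \<Omega> = ?W, OF _ _ _ dm B]; use w' u' in simp)+
    have [measurable]: "k \<in> borel_measurable borel" by (rule gradient_dataD(1)[OF w])
    have vol: "(LINT x|lborel. \<psi> x * k x $ i) = (LINT x|lborel. \<psi> x * Du x $ i)"
    proof (rule integral_cong_AE)
      have "(\<lambda>x. k x $ i) \<in> borel_measurable borel"
        using borel_measurable_integrable[OF gradient_dataD(2)[OF w, of i]] by simp
      then show "(\<lambda>x. \<psi> x * k x $ i) \<in> borel_measurable lborel" by measurable
      show "AE x in lborel. \<psi> x * k x $ i = \<psi> x * Du x $ i" using k by eventually_elim simp
    qed measurable
    have sing: "(LINT x|\<nu>. \<psi> x * \<sigma> x $ i) = 0"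
      by (rule integral_eq_zero_AE) (use \<nu>0 in eventually_elim, simp)
    have [measurable_cong]: "sets (hausdorff1 :: (real^2) measure) = sets borel" by (rule sets_hausdorff1)
    have bm: "(\<lambda>x. indicator ?F x *\<^sub>R (\<psi> x * annulus_trace a b v x * ?n i x)) \<in> borel_measurable hausdorff1"
      if "v \<in> BV ?W" for v
    proof -
      have [measurable]: "(\<lambda>x. indicator ?F x *\<^sub>R annulus_trace a b v x) \<in> borel_measurable hausdorff1"
        using is_trace_trace_on[OF ab that] unfolding is_trace_def set_integrable_def
        by (blast intro: borel_measurable_integrable)
      have "(\<lambda>x. \<psi> x * ?n i x * (indicator ?F x *\<^sub>R annulus_trace a b v x)) \<in> borel_measurable hausdorff1"
        by measurable
      then show ?thesis by (simp add: mult_ac)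
    qed
    have bd: "(LINT x:?F|hausdorff1. \<psi> x * annulus_trace a b w x * ?n i x)
      = (LINT x:?F|hausdorff1. \<psi> x * annulus_trace a b u x * ?n i x)"
      unfolding set_lebesgue_integral_def
    proof (rule integral_cong_AE[OF bm[OF wBV] bm[OF gradient_dataD(5)[OF gradient_data_u]]])
      show "AE x in hausdorff1. indicator ?F x *\<^sub>R (\<psi> x * annulus_trace a b w x * ?n i x)
        = indicator ?F x *\<^sub>R (\<psi> x * annulus_trace a b u x * ?n i x)"
        using T trace_u
      proof eventually_elim
        case (elim x)
        show ?case
        proof (cases "x \<in> ?F")
          case True
          then consider "norm x = a" | "norm x = b" using mem_frontier_annulus[OF ab] by blast
          then show ?thesis by cases (use elim True e in auto)
        qed simp
      qed
    qed
    have "(LINT x:?W|lebesgue. w x * ?D x) = (LINT x:?W|lebesgue. u x * ?D x)"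
      unfolding gradient_data_Gauss_Green[OF ab w \<psi>] gradient_data_Gauss_Green[OF ab gradient_data_u \<psi>]
        vol sing bd by simp
    then have "(LINT x|lborel. ?D x * w' x) = (LINT x|lborel. ?D x * u' x)"
      unfolding w'(5)[OF dm] u'(5)[OF dm] by (simp add: mult.commute)
    then show "(LINT x|lborel. ?D x * (w' x - u' x)) = 0"
      using int by (simp add: right_diff_distrib)
  qed
  then show "AE x in lebesgue. x \<in> ?W \<longrightarrow> w x = u x" using w'(4) u'(4) by eventually_elim simp
  qed
qed

theorem u_unique_minimizer:
  assumes u0: "\<And>x. norm x = a \<Longrightarrow> u0 x = m\<^sub>1" "\<And>x. norm x = b \<Longrightarrow> u0 x = m"
  shows "is_unique_minimizer (annulus a b) (relaxed_functional a b g u0) (BV (annulus a b)) u"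
proof -
  let ?K = "relaxed_functional a b g u0" and ?E = "energy a b m\<^sub>1 m"
  have K: "?K w = ?E k \<nu> (annulus_trace a b w)" if "gradient_data a b w k \<nu> \<sigma>" for w k \<nu> \<sigma>
    by (rule relaxed_functional_eq[OF ab that u0])
  note uK = K[OF gradient_data_u]
  have uBV: "u \<in> BV (annulus a b)" by (rule gradient_dataD(5)[OF gradient_data_u])
  have min: "?K u \<le> ?K w" if "w \<in> BV (annulus a b)" for w
  proof (rule gradient_data_exists[OF that])
    fix k \<nu> \<sigma> assume w: "gradient_data a b w k \<nu> \<sigma>"
    show ?thesis unfolding uK K[OF w] by (rule energy_minimal[OF w])
  qed
  show ?thesis
    unfolding is_unique_minimizer_def is_minimizer_def
  proof (intro conjI ballI allI impI uBV min)
    fix v assume v: "v \<in> BV (annulus a b) \<and> (\<forall>w\<in>BV (annulus a b). ?K v \<le> ?K w)"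
    then obtain k \<nu> \<sigma> where d: "gradient_data a b v k \<nu> \<sigma>" using gradient_data_exists by blast
    have "?K v \<le> ?K u" using v uBV by blast
    then show "AE x in lebesgue. x \<in> annulus a b \<longrightarrow> v x = u x"
      unfolding uK K[OF d] by (rule energy_unique[OF d])
  qed
qed

lemma trace_u_outer: "AE x in hausdorff1. norm x = b \<longrightarrow> annulus_trace a b u x = m"
  using trace_u by eventually_elim (simp add: mem_frontier_annulus[OF ab])

theorem u_unique_inner_minimizer:
  "is_unique_minimizer (annulus a b) (inner_relaxed_functional a b g m\<^sub>1) (outer_admissible a b m) u"
proof -
  let ?K = "inner_relaxed_functional a b g m\<^sub>1" and ?E = "energy a b m\<^sub>1 m" and ?X = "outer_admissible a b m"
  have uX: "u \<in> ?X" using u_W11 trace_u_outer by (simp add: outer_admissible_def)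
  have uK: "?K u = ?E Du (null_measure borel) (annulus_trace a b u)"
    by (rule inner_relaxed_functional_eq[OF ab uX has_weak_gradient_u borel_version_Du])
  have data: "\<exists>k. gradient_data a b w k (null_measure borel) (\<lambda>_. 0) \<and>
      ?K w = ?E k (null_measure borel) (annulus_trace a b w)" if w: "w \<in> ?X" for w
  proof -
    have wW: "w \<in> W11 (annulus a b)" using w by (simp add: outer_admissible_def)
    then obtain D where D: "has_weak_gradient (annulus a b) w D" "D absolutely_integrable_on annulus a b"
      by (auto simp: W11_def)
    obtain k where k: "borel_version (annulus a b) D k" using borel_version_exists[OF D(2) annulus_borel] ..
    have "gradient_data a b w k (null_measure borel) (\<lambda>_. 0)"
      unfolding gradient_data_def
      using wW W11_subset_BV[OF annulus_borel] gradient_decomposition_weak_gradient[OF D] k by blast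
    then show ?thesis using inner_relaxed_functional_eq[OF ab w D(1) k] by blast
  qed
  have min: "?K u \<le> ?K w" if "w \<in> ?X" for w
  proof -
    obtain k where k: "gradient_data a b w k (null_measure borel) (\<lambda>_. 0)"
      "?K w = ?E k (null_measure borel) (annulus_trace a b w)" using data[OF \<open>w \<in> ?X\<close>] by blast
    show ?thesis unfolding uK k(2) by (rule energy_minimal[OF k(1)])
  qed
  show ?thesis
    unfolding is_unique_minimizer_def is_minimizer_def
  proof (intro conjI ballI allI impI uX min)
    fix v assume v: "v \<in> ?X \<and> (\<forall>w\<in>?X. ?K v \<le> ?K w)"
    then obtain k where k: "gradient_data a b v k (null_measure borel) (\<lambda>_. 0)"
      "?K v = ?E k (null_measure borel) (annulus_trace a b v)" using data[of v] by blast
    have "?K v \<le> ?K u" using v uX by blast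
    then show "AE x in lebesgue. x \<in> annulus a b \<longrightarrow> v x = u x"
      unfolding uK k(2) by (rule energy_unique[OF k(1)])
  qed
qed

end

context linear_growth
begin

lemma optimal_slope_exists:
  assumes ab: "0 < a" "a < b"
  shows "\<exists>c. optimal_radial_solution g g' g'' a b c m\<^sub>2 m\<^sub>1 \<and> (m\<^sub>1 \<le> m\<^sub>2 \<longrightarrow> 0 \<le> c)"
proof (rule exists_slope[OF ab, of "m\<^sub>2 - m\<^sub>1"])
  fix c assume c: "\<bar>c\<bar> \<le> ginf * a" "V c integrable_on {a..b}"
    and opt: "integral {a..b} (V c) = m\<^sub>2 - m\<^sub>1 \<or> (c = ginf * a \<and> integral {a..b} (V c) \<le> m\<^sub>2 - m\<^sub>1) \<or>
      (c = - (ginf * a) \<and> m\<^sub>2 - m\<^sub>1 \<le> integral {a..b} (V c))"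
    and nonneg: "0 \<le> m\<^sub>2 - m\<^sub>1 \<Longrightarrow> 0 \<le> c"
  have "profile b m\<^sub>2 c a = m\<^sub>1 \<or> c = ginf * a \<and> m\<^sub>1 \<le> profile b m\<^sub>2 c a
      \<or> c = - (ginf * a) \<and> profile b m\<^sub>2 c a \<le> m\<^sub>1"
    using opt unfolding profile_def by argo
  then have "optimal_radial_solution g g' g'' a b c m\<^sub>2 m\<^sub>1"
    using ab c by unfold_locales
  then show ?thesis using nonneg by auto
qed

section \<open>Dependence on the inner datum\<close>

text \<open>For \<open>c \<ge> 0\<close> the derivative \<open>V c\<close> is nonnegative.\<close>

lemma profile_monotone:
  assumes "optimal_radial_solution g g' g'' a b c m\<^sub>2 m\<^sub>1" "0 \<le> c" "r \<in> {a..b}"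
  shows "profile b m\<^sub>2 c a \<le> profile b m\<^sub>2 c r"
proof -
  interpret optimal_radial_solution g g' g'' a b c m\<^sub>2 m\<^sub>1 by (rule assms)
  show ?thesis
  proof (rule DERIV_nonneg_imp_increasing_open[of a r "profile b m\<^sub>2 c"])
    show "a \<le> r" using assms by simp
  next
    fix s assume s: "a < s" "s < r"
    have "V 0 s \<le> V c s" by (rule V_mono[OF ab(1) _ c(1) assms(2) s(1)]) (use ab ginf_pos in simp)
    moreover have "(profile b m\<^sub>2 c has_real_derivative V c s) (at s)"
      by (rule DERIV_profile[OF ab(1) c(1)]) (use s assms in auto)
    ultimately show "\<exists>y. (profile b m\<^sub>2 c has_real_derivative y) (at s) \<and> 0 \<le> y" by auto
  next
    show "continuous_on {a..r} (profile b m\<^sub>2 c)"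
      by (rule continuous_on_subset[OF continuous_on_profile[OF c(2)]]) (use assms in auto)
  qed
qed

lemma inner_value_ge:
  assumes "optimal_radial_solution g g' g'' a b c m\<^sub>2 m\<^sub>1" "0 \<le> c"
  shows "m\<^sub>1 \<le> profile b m\<^sub>2 c a" and "profile b m\<^sub>2 c a = m\<^sub>1 \<or> c = ginf * a"
proof -
  interpret optimal_radial_solution g g' g'' a b c m\<^sub>2 m\<^sub>1 by (rule assms)
  have "0 < ginf * a" using ab ginf_pos by simp
  then show "m\<^sub>1 \<le> profile b m\<^sub>2 c a" "profile b m\<^sub>2 c a = m\<^sub>1 \<or> c = ginf * a"
    using optimal assms(2) by auto
qed

text \<open>If the smaller datum is attained, then its profile starts below the other one, which starts
  at least at its own datum. Otherwise its slope \<open>c\<close> is the largest possible one, and a larger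
  slope means a larger increase up to the common value at \<open>b\<close>.\<close>

lemma inner_value_mono:
  assumes 1: "optimal_radial_solution g g' g'' a b c m\<^sub>2 \<zeta>\<^sub>1" "0 \<le> c"
    and 2: "optimal_radial_solution g g' g'' a b d m\<^sub>2 \<zeta>\<^sub>2" "0 \<le> d" and le: "\<zeta>\<^sub>1 \<le> \<zeta>\<^sub>2"
  shows "profile b m\<^sub>2 c a \<le> profile b m\<^sub>2 d a"
  using inner_value_ge(2)[OF 1]
proof
  assume "profile b m\<^sub>2 c a = \<zeta>\<^sub>1"
  then show ?thesis using inner_value_ge(1)[OF 2] le by simp
next
  assume c: "c = ginf * a"
  interpret p: optimal_radial_solution g g' g'' a b c m\<^sub>2 \<zeta>\<^sub>1 by (rule 1)
  interpret q: optimal_radial_solution g g' g'' a b d m\<^sub>2 \<zeta>\<^sub>2 by (rule 2)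
  have "d \<le> c" using q.c(1) c by linarith
  from integral_V_mono[OF p.ab q.c p.c this, of a] show ?thesis by (simp add: profile_def)
qed

end

theorem theorem1p2:
  fixes \<rho>\<^sub>1 \<rho>\<^sub>2 m\<^sub>1 m\<^sub>2 \<mu> \<mu>' :: real
    and u0hat g g' g'' :: "real \<Rightarrow> real"
  assumes radii: "0 < \<rho>\<^sub>1" "\<rho>\<^sub>1 < \<rho>\<^sub>2"
    and data: "m\<^sub>1 = u0hat \<rho>\<^sub>1" "m\<^sub>2 = u0hat \<rho>\<^sub>2"
    and mu: "1 < \<mu>"
    and g_nonneg: "\<And>t. 0 \<le> t \<Longrightarrow> 0 \<le> g t"
    and g_C2: "\<And>t. 0 \<le> t \<Longrightarrow> (g has_real_derivative g' t) (at t within {0..})"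
      "\<And>t. 0 \<le> t \<Longrightarrow> (g' has_real_derivative g'' t) (at t within {0..})"
      "continuous_on {0..} g''"
    and linear_growth:
      "\<exists>a A b B. 0 < a \<and> 0 < A \<and> (\<forall>t\<ge>0. a * t - b \<le> g t \<and> g t \<le> A * t + B)"
    and g_zero: "g 0 = 0" "g' 0 = 0"
    and mu': "1 \<le> \<mu>'" "\<mu>' \<le> \<mu>"
    and ellipticity:
      "\<exists>\<nu>\<^sub>1 \<nu>\<^sub>2. 0 < \<nu>\<^sub>1 \<and> 0 < \<nu>\<^sub>2 \<and>
         (\<forall>t\<ge>0. \<nu>\<^sub>1 * (1 + t) powr (- \<mu>) \<le> g'' t \<and> g'' t \<le> \<nu>\<^sub>2 * (1 + t) powr (- \<mu>'))"
    and gap: "\<mu> - \<mu>' < 2"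
  shows
    "(\<exists>u uhat.
        is_unique_minimizer (annulus \<rho>\<^sub>1 \<rho>\<^sub>2)
          (relaxed_functional \<rho>\<^sub>1 \<rho>\<^sub>2 g (\<lambda>x. u0hat (norm x))) (BV (annulus \<rho>\<^sub>1 \<rho>\<^sub>2)) u
      \<and> u \<in> W11 (annulus \<rho>\<^sub>1 \<rho>\<^sub>2)
      \<and> continuous_on (closure (annulus \<rho>\<^sub>1 \<rho>\<^sub>2)) u
      \<and> C1_on (annulus \<rho>\<^sub>1 \<rho>\<^sub>2) u
      \<and> u \<in> W22_loc (annulus \<rho>\<^sub>1 \<rho>\<^sub>2)
      \<and> (\<forall>x \<in> closure (annulus \<rho>\<^sub>1 \<rho>\<^sub>2). u x = uhat (norm x))
      \<and> (\<forall>x. norm x = \<rho>\<^sub>2 \<longrightarrow> u x = m\<^sub>2)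
      \<and> is_unique_minimizer (annulus \<rho>\<^sub>1 \<rho>\<^sub>2)
          (inner_relaxed_functional \<rho>\<^sub>1 \<rho>\<^sub>2 g m\<^sub>1) (outer_admissible \<rho>\<^sub>1 \<rho>\<^sub>2 m\<^sub>2) u)
   \<and> (\<exists>uhat :: real \<Rightarrow> real \<Rightarrow> real.
        (\<forall>m<m\<^sub>2. continuous_on {\<rho>\<^sub>1..\<rho>\<^sub>2} (uhat m) \<and>
           is_unique_minimizer (annulus \<rho>\<^sub>1 \<rho>\<^sub>2)
             (inner_relaxed_functional \<rho>\<^sub>1 \<rho>\<^sub>2 g m) (outer_admissible \<rho>\<^sub>1 \<rho>\<^sub>2 m\<^sub>2)
             (\<lambda>x. uhat m (norm x)))
      \<and> (\<forall>m<m\<^sub>2. \<forall>\<rho>\<in>{\<rho>\<^sub>1<..<\<rho>\<^sub>2}. m \<le> uhat m \<rho>)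
      \<and> (\<forall>\<zeta>\<^sub>1 \<zeta>\<^sub>2. \<zeta>\<^sub>1 < m\<^sub>2 \<and> \<zeta>\<^sub>2 < m\<^sub>2 \<and> \<zeta>\<^sub>1 < \<zeta>\<^sub>2 \<longrightarrow> uhat \<zeta>\<^sub>1 \<rho>\<^sub>1 \<le> uhat \<zeta>\<^sub>2 \<rho>\<^sub>1))"
proof -
  let ?a = \<rho>\<^sub>1 and ?b = \<rho>\<^sub>2
  obtain \<nu>\<^sub>1 \<nu>\<^sub>2 where \<nu>: "0 < \<nu>\<^sub>1" "\<And>t. 0 \<le> t \<Longrightarrow> \<nu>\<^sub>1 * (1 + t) powr (- \<mu>) \<le> g'' t"
    using ellipticity by blast
  have g''_pos: "0 < g'' t" if "0 \<le> t" for t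
  proof -
    have "0 < \<nu>\<^sub>1 * (1 + t) powr (- \<mu>)" using \<nu>(1) that by simp
    then show ?thesis using \<nu>(2)[OF that] by linarith
  qed
  have growth: "\<exists>A B. \<forall>t\<ge>0. g t \<le> A * t + B" using linear_growth by blast
  interpret linear_growth g g' g''
    by (rule linear_growth.intro) (use g_nonneg g_C2 growth g_zero g''_pos in auto)
  obtain c where "optimal_radial_solution g g' g'' ?a ?b c m\<^sub>2 m\<^sub>1"
    using optimal_slope_exists[OF radii] by blast
  then interpret u: optimal_radial_solution g g' g'' ?a ?b c m\<^sub>2 m\<^sub>1 .
  have "\<forall>m. \<exists>c. optimal_radial_solution g g' g'' ?a ?b c m\<^sub>2 m \<and> (m \<le> m\<^sub>2 \<longrightarrow> 0 \<le> c)"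
    using optimal_slope_exists[OF radii] by blast
  then obtain C where C: "\<And>m. optimal_radial_solution g g' g'' ?a ?b (C m) m\<^sub>2 m" "\<And>m. m < m\<^sub>2 \<Longrightarrow> 0 \<le> C m"
    by (metis less_imp_le)
  show ?thesis
  proof (rule conjI, goal_cases)
    case 1
    show ?case
    proof (intro exI conjI)
      show "is_unique_minimizer (annulus ?a ?b) (relaxed_functional ?a ?b g (\<lambda>x. u0hat (norm x))) (BV (annulus ?a ?b)) u.u"
        by (rule u.u_unique_minimizer) (use data in auto)
      show "\<forall>x \<in> closure (annulus ?a ?b). u.u x = profile ?b m\<^sub>2 c (norm x)" by (simp add: u.u_def)
      show "\<forall>x. norm x = ?b \<longrightarrow> u.u x = m\<^sub>2" by (simp add: u.u_def)
    qed (rule u.u_W11 u.continuous_on_u u.C1_u u.u_W22_loc u.u_unique_inner_minimizer)+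
  next
    case 2
    show ?case
    proof (intro exI[of _ "\<lambda>m. profile ?b m\<^sub>2 (C m)"] conjI allI impI ballI)
      fix m assume "m < m\<^sub>2"
      interpret v: optimal_radial_solution g g' g'' ?a ?b "C m" m\<^sub>2 m by (rule C)
      show "continuous_on {?a..?b} (profile ?b m\<^sub>2 (C m))" by (rule continuous_on_profile[OF v.c(2)])
      show "is_unique_minimizer (annulus ?a ?b) (inner_relaxed_functional ?a ?b g m) (outer_admissible ?a ?b m\<^sub>2)
          (\<lambda>x. profile ?b m\<^sub>2 (C m) (norm x))"
        using v.u_unique_inner_minimizer unfolding v.u_def[abs_def] .
    next
      fix m \<rho> assume m: "m < m\<^sub>2" and \<rho>: "\<rho> \<in> {?a<..<?b}"
      show "m \<le> profile ?b m\<^sub>2 (C m) \<rho>"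
        using inner_value_ge(1)[OF C(1) C(2)[OF m]] profile_monotone[OF C(1) C(2)[OF m], of \<rho>] \<rho> by simp
    next
      fix \<zeta>\<^sub>1 \<zeta>\<^sub>2 assume "\<zeta>\<^sub>1 < m\<^sub>2 \<and> \<zeta>\<^sub>2 < m\<^sub>2 \<and> \<zeta>\<^sub>1 < \<zeta>\<^sub>2"
      then show "profile ?b m\<^sub>2 (C \<zeta>\<^sub>1) ?a \<le> profile ?b m\<^sub>2 (C \<zeta>\<^sub>2) ?a"
        by (intro inner_value_mono[OF C(1) C(2) C(1) C(2)]) auto
    qed
  qed
qed

end
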